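(* Let $d\ge 2$, let $\mathscr T$ be a hierarchical T-mesh under cross subdivision in which all subdivided cells are interior cells, and let $\mathscr C$ be the CVR graph of $\mathscr T$. Suppose that $\mathscr T$ is obtained by subdividing a collection of $(d-1)\times(d-1)$ tensor product submeshes in each level, where the submeshes may overlap. Then $$\dim \bar S_d(\mathscr T)=\dim \bar S_{d-2}(\mathscr C).$$
   Context: A T-mesh is a finite set of axis-aligned rectangles (cells) such that two distinct ones meet at most in boundary points; here they fill a rectangle $\Omega$. Vertices are the corners of cells; edges are segments joining consecutive vertices on cell boundaries. A vertex or edge is a boundary one if it lies on $\partial\Omega$, otherwise interior; a cell having a boundary edge is a boundary cell, otherwise an interior cell. An interior vertex where exactly 3 edges meet is a T-node; one where 4 edges meet is a cross-vertex. Hierarchical T-mesh: start with a tensor product mesh (level $0$); given level $k$, some cells of level $k$ are subdivided, and the new cells, edges and vertices are of level $k+1$. Cross subdivision: a cell is divided equally into $2\times 2$ subcells. Here, at each level $k$, the set of subdivided level-$k$ cells is a union of $(d-1)\times(d-1)$ tensor product submeshes, i.e. of grid blocks of $(d-1)\times(d-1)$ level-$k$ cells, which may partially overlap. CVR (cross-vertex relationship) graph $\mathscr C$ of $\mathscr T$: the graph obtained by retaining the cross-vertices of $\mathscr T$ and the line segments along the mesh lines of $\mathscr T$ whose two endpoints are cross-vertices, and removing all other vertices (boundary vertices and T-nodes) and edges. When all subdivided cells are interior, $\mathscr C$ is treated as a regular T-mesh possibly with some $L$-nodes (interior vertices where exactly two perpendicular edges meet), occupying a rectangle; its cells are the faces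 into which the graph divides that rectangle (some may be non-rectangular because of $L$-nodes). For a mesh $\mathscr M$ occupying a region $\Omega_{\mathscr M}$ and an integer $e\ge 0$, $\bar S_e(\mathscr M)$ is the spline space with homogeneous boundary conditions: the functions $f$ on $\mathbb R^2$ that are $C^{e-1}$ in each of $x$ and $y$ on all of $\mathbb R^2$, are polynomials of bi-degree $(e,e)$ on each cell of $\mathscr M$, and vanish identically on $\mathbb R^2\setminus\Omega_{\mathscr M}$. (For $e=0$ no continuity is required: functions constant on each cell.) *)

theory Defs
  imports "HOL-Analysis.Analysis" "HOL-Library.Function_Algebras"
begin

section \<open>Meshes\<close>

text \<open>A mesh is given by its set of cells, each a closed rectangle
  \<open>cbox (a, c) (b, d) = {a..b} \<times> {c..d}\<close> in the plane.
  The region occupied by a mesh \<open>M\<close> is \<open>\<Union>M\<close>.\<close>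

type_synonym mesh = "(real \<times> real) set set"

definition mesh_vertices :: "mesh \<Rightarrow> (real \<times> real) set" where
  "mesh_vertices M =
     {v. \<exists>a b c d. a < b \<and> c < d \<and> cbox (a, c) (b, d) \<in> M \<and> v \<in> {a, b} \<times> {c, d}}"

definition mesh_edges :: "mesh \<Rightarrow> (real \<times> real) set set" where
  "mesh_edges M =
     {closed_segment p q | p q.
        p \<in> mesh_vertices M \<and> q \<in> mesh_vertices M \<and> p \<noteq> q \<and>
        open_segment p q \<inter> mesh_vertices M = {} \<and>
        (\<exists>K\<in>M. closed_segment p q \<subseteq> frontier K)}"

definition boundary_cell :: "mesh \<Rightarrow> (real \<times> real) set \<Rightarrow> bool" where
  "boundary_cell M K \<longleftrightarrow>
     K \<in> M \<and> (\<exists>e\<in>mesh_edges M. e \<subseteq> frontier K \<and> e \<subseteq> frontier (\<Union>M))"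

definition interior_cell :: "mesh \<Rightarrow> (real \<times> real) set \<Rightarrow> bool" where
  "interior_cell M K \<longleftrightarrow> K \<in> M \<and> \<not> boundary_cell M K"

definition cross_vertices :: "mesh \<Rightarrow> (real \<times> real) set" where
  "cross_vertices M =
     {v \<in> mesh_vertices M. v \<notin> frontier (\<Union>M) \<and> card {e \<in> mesh_edges M. v \<in> e} = 4}"


section \<open>Hierarchical T-meshes under cross subdivision\<close>

definition tensor_grid :: "nat \<Rightarrow> nat \<Rightarrow> mesh \<Rightarrow> bool" where
  "tensor_grid m n M \<longleftrightarrow>
     (\<exists>x y :: nat \<Rightarrow> real. strict_mono_on {0..m} x \<and> strict_mono_on {0..n} y \<and>
        M = {cbox (x i, y j) (x (Suc i), y (Suc j)) | i j. i < m \<and> j < n})"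

definition tensor_product_mesh :: "mesh \<Rightarrow> bool" where
  "tensor_product_mesh M \<longleftrightarrow> (\<exists>m n. m \<ge> 1 \<and> n \<ge> 1 \<and> tensor_grid m n M)"

definition cross_subdivision :: "(real \<times> real) set \<Rightarrow> mesh" where
  "cross_subdivision K =
     {Q. \<exists>a b c d. a < b \<and> c < d \<and> K = cbox (a, c) (b, d) \<and>
         Q \<in> {cbox (a, c) ((a + b) / 2, (c + d) / 2),
              cbox ((a + b) / 2, c) (b, (c + d) / 2),
              cbox (a, (c + d) / 2) ((a + b) / 2, d),
              cbox ((a + b) / 2, (c + d) / 2) (b, d)}}"

text \<open>\<open>S k\<close> is the set of level-\<open>k\<close> cells that are subdivided when passing to level \<open>k + 1\<close>.\<close>

primrec level_cells :: "mesh \<Rightarrow> (nat \<Rightarrow> mesh) \<Rightarrow> nat \<Rightarrow> mesh" where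
  "level_cells M0 S 0 = M0"
| "level_cells M0 S (Suc k) = (\<Union>K\<in>S k. cross_subdivision K)"

text \<open>The mesh after \<open>N\<close> refinement steps; only \<open>S 0, \<dots>, S (N - 1)\<close> matter.\<close>

definition hierarchical_mesh :: "mesh \<Rightarrow> (nat \<Rightarrow> mesh) \<Rightarrow> nat \<Rightarrow> mesh" where
  "hierarchical_mesh M0 S N =
     (\<Union>k<N. level_cells M0 S k - S k) \<union> level_cells M0 S N"

text \<open>A union of possibly overlapping \<open>r \<times> r\<close> tensor product submeshes of \<open>L\<close>.\<close>

definition union_of_blocks :: "nat \<Rightarrow> mesh \<Rightarrow> mesh \<Rightarrow> bool" where
  "union_of_blocks r L A \<longleftrightarrow>
     (\<exists>\<B>. (\<forall>B\<in>\<B>. B \<subseteq> L \<and> tensor_grid r r B) \<and> A = \<Union>\<B>)"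


section \<open>The CVR graph\<close>

text \<open>The graph as a point set. A retained segment may pass through T-nodes, which are then
  no longer vertices; a cross-vertex on no retained segment stays as an isolated point.\<close>

definition cvr_graph :: "mesh \<Rightarrow> (real \<times> real) set" where
  "cvr_graph M = cross_vertices M \<union>
     \<Union>{closed_segment p q | p q. p \<in> cross_vertices M \<and> q \<in> cross_vertices M \<and>
                                closed_segment p q \<subseteq> \<Union>(mesh_edges M)}"

text \<open>If only interior cells have been subdivided, the convex hull is the rectangle
  occupied by the CVR graph, and its boundary belongs to the graph.\<close>

definition cvr_region :: "mesh \<Rightarrow> (real \<times> real) set" where
  "cvr_region M = convex hull (cross_vertices M)"

text \<open>The faces, as open sets without their boundary.\<close>

definition cvr_faces :: "mesh \<Rightarrow> (real \<times> real) set set" where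
  "cvr_faces M = components (cvr_region M - cvr_graph M)"


section \<open>Spline spaces with homogeneous boundary conditions\<close>

text \<open>\<open>f\<close> has continuous partial derivatives of all orders \<open>i < e\<close> (that is, up to \<open>e - 1\<close>)
  with respect to \<open>x\<close>, respectively \<open>y\<close>. There is no condition if \<open>e = 0\<close>.\<close>

definition smooth_in_x :: "nat \<Rightarrow> (real \<times> real \<Rightarrow> real) \<Rightarrow> bool" where
  "smooth_in_x e f \<longleftrightarrow>
     (\<exists>g :: nat \<Rightarrow> real \<times> real \<Rightarrow> real. g 0 = f \<and> (\<forall>i<e. continuous_on UNIV (g i)) \<and>
        (\<forall>i. Suc i < e \<longrightarrow>
           (\<forall>x y. ((\<lambda>t. g i (t, y)) has_real_derivative g (Suc i) (x, y)) (at x))))"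

definition smooth_in_y :: "nat \<Rightarrow> (real \<times> real \<Rightarrow> real) \<Rightarrow> bool" where
  "smooth_in_y e f \<longleftrightarrow>
     (\<exists>g :: nat \<Rightarrow> real \<times> real \<Rightarrow> real. g 0 = f \<and> (\<forall>i<e. continuous_on UNIV (g i)) \<and>
        (\<forall>i. Suc i < e \<longrightarrow>
           (\<forall>x y. ((\<lambda>t. g i (x, t)) has_real_derivative g (Suc i) (x, y)) (at y))))"

definition bidegree_poly_on :: "nat \<Rightarrow> (real \<times> real) set \<Rightarrow> (real \<times> real \<Rightarrow> real) \<Rightarrow> bool" where
  "bidegree_poly_on e K f \<longleftrightarrow>
     (\<exists>a :: nat \<Rightarrow> nat \<Rightarrow> real. \<forall>x y. (x, y) \<in> K \<longrightarrow> f (x, y) = (\<Sum>i\<le>e. \<Sum>j\<le>e. a i j * x ^ i * y ^ j))"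

text \<open>Here \<open>\<Omega>\<close> is the region and \<open>F\<close> the set of open cells of the mesh. For \<open>e = 0\<close> the values
  on the mesh lines are immaterial; the last condition normalises them to \<open>0\<close>, so that each
  piecewise constant function is represented once. For \<open>e \<ge> 1\<close> they are determined by
  continuity.\<close>

definition homogeneous_splines ::
    "nat \<Rightarrow> (real \<times> real) set \<Rightarrow> (real \<times> real) set set \<Rightarrow> (real \<times> real \<Rightarrow> real) set" where
  "homogeneous_splines e \<Omega> F =
     {f. smooth_in_x e f \<and> smooth_in_y e f \<and>
         (\<forall>K\<in>F. bidegree_poly_on e K f) \<and>
         (\<forall>p. p \<notin> \<Omega> \<longrightarrow> f p = 0) \<and>
         (e = 0 \<longrightarrow> (\<forall>p. p \<notin> \<Union>F \<longrightarrow> f p = 0))}"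

definition mesh_splines :: "nat \<Rightarrow> mesh \<Rightarrow> (real \<times> real \<Rightarrow> real) set" where
  "mesh_splines e M = homogeneous_splines e (\<Union>M) (interior ` M)"

definition cvr_splines :: "nat \<Rightarrow> mesh \<Rightarrow> (real \<times> real \<Rightarrow> real) set" where
  "cvr_splines e M = homogeneous_splines e (cvr_region M) (cvr_faces M)"

text \<open>The dimension of subspaces of the vector space of real functions under pointwise operations.\<close>

global_interpretation fun_space: vector_space "\<lambda>(c::real) (f::'a \<Rightarrow> real) p. c * f p"
  by unfold_locales (auto simp: fun_eq_iff algebra_simps)

end

theory Submission
  imports Defs "HOL-Computational_Algebra.Polynomial"
begin

text \<open>
  Expand a spline with homogeneous boundary conditions in products
  \<open>(x - X a)\<^sub>+\<^sup>e (y - Y b)\<^sub>+\<^sup>e\<close> of truncated powers on the finest grid. The functions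
  that arise are those whose coefficients \<open>c (a, b)\<close> satisfy moment conditions of order at most \<open>e\<close>
  along every grid line, one for each segment of the line that is missing in the mesh. For the CVR
  graph the same conditions, of order \<open>d - 2\<close>, hold together with \<open>c (a, b) = 0\<close> off the cross-vertices.

  The two dimensions agree on a tensor product mesh, and a refinement increases them by the same
  amount. To see the latter, restrict the coefficients to the new nodes. By the Fredholm alternative
  the new coefficients can be prescribed subject only to their own conditions, provided every element
  of the dual space is, on the subdivided cells, given by polynomials of bidegree \<open>(d, d)\<close>
  or \<open>(d - 2, d - 2)\<close> that agree on adjacent cells. This property passes to the next level: a bubble
  of degree \<open>d\<close> vanishes on the \<open>d\<close> lines of a \<open>(d - 1) \<times> (d - 1)\<close> block, one of degree \<open>d - 2\<close> on the
  \<open>d - 2\<close> inner ones, so either is determined by its value at one further point. Finally, the new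
  coefficients for degree \<open>d\<close> and for degree \<open>d - 2\<close> are compared through quadratic weights that
  vanish at both ends of a run of cells (at edge midpoints) or of a block (at cell centres).
\<close>

text \<open>No dimension is ever computed. Only increments are compared, and these come down to
  transporting coefficients between the degrees \<open>d\<close> and \<open>d - 2\<close>. A factor
  that is quadratic along a line changes the order of the moment conditions by two; its zeros sit
  where a node of the T-mesh is not a cross-vertex. At edge midpoints this is all, since a midpoint
  lies on a single new line. At a cell centre a horizontal and a vertical condition meet, and one
  number has to serve both: the weight is a quadratic in \<open>x\<close> times a quadratic in
  \<open>y\<close>, and each factor is a constant for the other direction as long as the block does
  not change. The obstacle is overlap. A cell may lie in several blocks, so weights and bubbles of
  adjacent cells need not come from the same block. It disappears because a bubble that is nonzero
  on two adjacent cells forces them to lie in exactly the same blocks: a block ending at their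
  common side would give the bubble one root more than its degree allows. Hence any choice of block
  that depends only on the blocks around a cell is consistent wherever it matters.\<close>

section \<open>Linear algebra in spaces of real functions: dimension, rank and nullity,
  annihilators\<close>

abbreviation fun_linear :: "(('a \<Rightarrow> real) \<Rightarrow> ('b \<Rightarrow> real)) \<Rightarrow> bool" where
  "fun_linear \<equiv> Vector_Spaces.linear (\<lambda>(c::real) f p. c * f p) (\<lambda>(c::real) f p. c * f p)"

lemma fun_linearI:
  assumes "\<And>c d. f (c + d) = f c + f d" "\<And>k c. f (\<lambda>p. k * c p) = (\<lambda>p. k * f c p)"
  shows "fun_linear f"
  using assms by unfold_locales (auto simp: fun_eq_iff algebra_simps)

interpretation fun_pair: vector_space_pair
  "\<lambda>(c::real) (f::'a \<Rightarrow> real) p. c * f p" "\<lambda>(c::real) (f::'b \<Rightarrow> real) p. c * f p"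
  by unfold_locales

lemma fun_subspaceI:
  assumes "(\<lambda>_. 0) \<in> S" "\<And>c d. c \<in> S \<Longrightarrow> d \<in> S \<Longrightarrow> (\<lambda>p. c p + d p) \<in> S"
    "\<And>k c. c \<in> S \<Longrightarrow> (\<lambda>p. k * c p) \<in> S"
  shows "fun_space.subspace S"
  unfolding fun_space.subspace_def using assms by (auto simp: plus_fun_def zero_fun_def)

lemma fun_dim_image:
  assumes "fun_linear f" "fun_space.subspace S" "inj_on f S"
  shows "fun_space.dim (f ` S) = fun_space.dim S"
proof -
  obtain B where B: "B \<subseteq> S" "fun_space.independent B" "S \<subseteq> fun_space.span B"
      "card B = fun_space.dim S"
    using fun_space.basis_exists by blast
  have sp: "fun_space.span B = S"
    using B assms(2) fun_space.span_minimal by blast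
  have "fun_space.independent (f ` B)"
    using fun_pair.linear_independent_injective_image[OF assms(1) B(2)] assms(3) sp by simp
  moreover have "f ` S \<subseteq> fun_space.span (f ` B)"
    using sp fun_pair.linear_span_image[OF assms(1), of B] by simp
  moreover have "card (f ` B) = card B"
    using card_image inj_on_subset[OF assms(3) B(1)] by blast
  ultimately show ?thesis
    using fun_space.dim_unique[of "f ` B" "f ` S"] B by (metis image_mono)
qed

lemma fun_dim_bij:
  assumes "fun_linear f" "fun_space.subspace S" "\<And>c. c \<in> S \<Longrightarrow> f c \<in> T"
    "\<And>c. c \<in> S \<Longrightarrow> f c = (\<lambda>_. 0) \<Longrightarrow> c = (\<lambda>_. 0)" "\<And>c. c \<in> T \<Longrightarrow> \<exists>b\<in>S. f b = c"
  shows "fun_space.dim S = fun_space.dim T"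
proof -
  have "inj_on f S"
  proof (rule inj_onI)
    fix c b assume *: "c \<in> S" "b \<in> S" "f c = f b"
    then have "f (c - b) = (\<lambda>_. 0)"
      using fun_pair.linear_diff[OF assms(1)] by (auto simp: zero_fun_def fun_eq_iff)
    then have "c - b = (\<lambda>_. 0)"
      using * assms(2,4) fun_space.subspace_diff by blast
    then show "c = b" by (auto simp: fun_eq_iff)
  qed
  moreover have "f ` S = T" using assms(3,5) by auto
  ultimately show ?thesis using fun_dim_image[OF assms(1,2)] by metis
qed

lemma fun_sum_apply: "(\<Sum>i\<in>A. f i) p = (\<Sum>i\<in>A. f i p :: real)"
  by (induction A rule: infinite_finite_induct) auto

text \<open>The space of all real functions is in general infinite-dimensional. A finite common
  support puts \<open>B\<close> into the span of finitely many unit vectors, which bounds its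
  size.\<close>

lemma finite_independent_finite_support:
  fixes B :: "('a \<Rightarrow> real) set"
  assumes "finite V" "fun_space.independent B" "\<And>c v. c \<in> B \<Longrightarrow> v \<notin> V \<Longrightarrow> c v = 0"
  shows "finite B"
proof -
  define e where "e v = (\<lambda>p::'a. if p = v then 1 else 0 :: real)" for v
  have "c \<in> fun_space.span (e ` V)" if "c \<in> B" for c
  proof -
    have "(\<Sum>v\<in>V. (\<lambda>p. c v * e v p)) \<in> fun_space.span (e ` V)"
      by (intro fun_space.span_sum fun_space.span_scale fun_space.span_base) auto
    moreover have "(\<Sum>v\<in>V. (\<lambda>p. c v * e v p)) = c"
    proof
      fix p
      have "(\<Sum>v\<in>V. (\<lambda>p. c v * e v p)) p = (\<Sum>v\<in>V. if v = p then c v else 0)"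
        by (auto simp: e_def fun_sum_apply intro!: sum.cong)
      then show "(\<Sum>v\<in>V. (\<lambda>p. c v * e v p)) p = c p"
        using assms(1,3) that by auto
    qed
    ultimately show ?thesis by simp
  qed
  then show ?thesis
    using fun_space.independent_span_bound[of "e ` V" B] assms by auto
qed

text \<open>Rank and nullity. A basis of the kernel is extended to a basis of \<open>S\<close>, and
  \<open>f\<close> maps the span of the added vectors isomorphically onto the image. The finite
  support makes the basis finite, so that cardinalities can be added.\<close>

lemma fun_dim_kernel_image:
  assumes "fun_linear f" "fun_space.subspace S" "finite V" "\<And>c v. c \<in> S \<Longrightarrow> v \<notin> V \<Longrightarrow> c v = 0"
  shows "fun_space.dim S = fun_space.dim {c \<in> S. f c = (\<lambda>_. 0)} + fun_space.dim (f ` S)"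
proof -
  let ?K = "{c \<in> S. f c = (\<lambda>_. 0)}"
  obtain B1 where B1: "B1 \<subseteq> ?K" "fun_space.independent B1" "?K \<subseteq> fun_space.span B1"
      "card B1 = fun_space.dim ?K"
    using fun_space.basis_exists by blast
  obtain B where B: "B1 \<subseteq> B" "B \<subseteq> S" "fun_space.independent B" "S \<subseteq> fun_space.span B"
    using fun_space.maximal_independent_subset_extend[of B1 S] B1 by auto
  have fin: "finite B"
    using finite_independent_finite_support[OF assms(3) B(3)] assms(4) B(2) by blast
  have spB: "fun_space.span B = S"
    using B assms(2) fun_space.span_minimal by blast
  let ?C = "fun_space.span (B - B1)"
  have CS: "?C \<subseteq> S" using spB fun_space.span_mono[of "B - B1" B] by auto
  \<comment> \<open>Such a \<open>w\<close> lies in the spans of two disjoint parts of the basis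
    \<open>B\<close>, so all its coordinates vanish.\<close>
  have triv: "w = (\<lambda>_. 0)" if "w \<in> ?C" "f w = (\<lambda>_. 0)" for w
  proof -
    have "w \<in> fun_space.span B1" using that CS B1(3) by auto
    then have 1: "fun_space.representation B w = fun_space.representation B1 w"
      using fun_space.representation_extend[of B w B1] B by auto
    have 2: "fun_space.representation B w = fun_space.representation (B - B1) w"
      using fun_space.representation_extend[of B w "B - B1"] B that by auto
    have "fun_space.representation B w b = 0" for b
      using 1 2 fun_space.representation_ne_zero[of B1 w b]
        fun_space.representation_ne_zero[of "B - B1" w b] by auto
    moreover have "(\<Sum>b | fun_space.representation B w b \<noteq> 0. (\<lambda>p. fun_space.representation B w b * b p)) = w"
      using fun_space.sum_nonzero_representation_eq[OF B(3), of w] that CS B(4) by auto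
    ultimately show ?thesis by (auto simp: zero_fun_def)
  qed
  have "fun_space.dim ?C = fun_space.dim (f ` S)"
  proof (rule fun_dim_bij[OF assms(1)])
    show "fun_space.subspace ?C" by simp
    show "f c \<in> f ` S" if "c \<in> ?C" for c using that CS by auto
    show "c = (\<lambda>_. 0)" if "c \<in> ?C" "f c = (\<lambda>_. 0)" for c using triv that by auto
    show "\<exists>b\<in>?C. f b = g" if g: "g \<in> f ` S" for g
    proof -
      obtain c where c: "c \<in> S" "g = f c" using g by auto
      have "c \<in> fun_space.span (B1 \<union> (B - B1))" using c(1) B(1,4) by (auto simp: Un_absorb1)
      then obtain u v where uv: "u \<in> fun_space.span B1" "v \<in> ?C" "c = u + v"
        unfolding fun_space.span_Un by auto
      have "f u \<in> fun_space.span (f ` B1)"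
        using uv(1) fun_pair.linear_span_image[OF assms(1), of B1] by auto
      moreover have "f ` B1 \<subseteq> {0}" using B1(1) by (auto simp: zero_fun_def)
      ultimately have "f u = 0"
        using fun_space.span_mono[of "f ` B1" "{0}"] by auto
      then have "f v = g" using uv c fun_pair.linear_add[OF assms(1)] by auto
      then show ?thesis using uv by auto
    qed
  qed
  moreover have "fun_space.dim ?C = card (B - B1)"
    using fun_space.independent_mono[OF B(3)] by (intro fun_space.dim_span_eq_card_independent) auto
  moreover have "fun_space.dim S = card B"
    using B fun_space.basis_card_eq_dim by metis
  moreover have "card B = card B1 + card (B - B1)"
    using fin B(1) by (metis card_Diff_subset card_mono finite_subset le_add_diff_inverse)
  ultimately show ?thesis using B1(4) by simp
qed

text \<open>Fredholm alternative: annihilating the part of \<open>\<Phi>\<close> that vanishes on \<open>V0\<close> suffices to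
  correct \<open>c\<close> on \<open>V0\<close> into an annihilator of \<open>\<Phi>\<close>.\<close>

lemma annihilator_extend:
  fixes c :: "'a \<Rightarrow> real"
  assumes "finite V" "V0 \<subseteq> V"
    and "\<And>\<phi> \<psi>. \<phi> \<in> \<Phi> \<Longrightarrow> \<psi> \<in> \<Phi> \<Longrightarrow> (\<lambda>v. \<phi> v + \<psi> v) \<in> \<Phi>" "\<And>k \<phi>. \<phi> \<in> \<Phi> \<Longrightarrow> (\<lambda>v. k * \<phi> v) \<in> \<Phi>"
    and "\<And>\<phi>. \<phi> \<in> \<Phi> \<Longrightarrow> \<forall>v\<in>V0. \<phi> v = 0 \<Longrightarrow> (\<Sum>v\<in>V. c v * \<phi> v) = 0"
  shows "\<exists>c'. (\<forall>v. v \<notin> V0 \<longrightarrow> c' v = c v) \<and> (\<forall>\<phi>\<in>\<Phi>. (\<Sum>v\<in>V. c' v * \<phi> v) = 0)"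
proof -
  have "finite V0" using assms(1,2) finite_subset by blast
  then show ?thesis using assms(2,5)
  proof (induction V0 arbitrary: c rule: finite_induct)
    case empty then show ?case by auto
  next
    case (insert u V0)
    show ?case
    proof (cases "\<exists>\<psi>\<in>\<Phi>. (\<forall>v\<in>V0. \<psi> v = 0) \<and> \<psi> u \<noteq> 0")
      case False
      then have "\<exists>c'. (\<forall>v. v \<notin> V0 \<longrightarrow> c' v = c v) \<and> (\<forall>\<phi>\<in>\<Phi>. (\<Sum>v\<in>V. c' v * \<phi> v) = 0)"
        using insert.prems by (intro insert.IH) auto
      then show ?thesis by auto
    next
      case True
      then obtain \<psi> where \<psi>: "\<psi> \<in> \<Phi>" "\<forall>v\<in>V0. \<psi> v = 0" "\<psi> u \<noteq> 0" by auto
      \<comment> \<open>The value at \<open>u\<close> is changed so that \<open>c1\<close> pairs to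
        zero with \<open>\<psi>\<close>; this is possible because \<open>\<psi> u\<close> is
        nonzero.\<close>
      define c1 where "c1 = c(u := c u - (\<Sum>v\<in>V. c v * \<psi> v) / \<psi> u)"
      have uV: "u \<in> V" using insert.prems by auto
      have c1: "(\<Sum>v\<in>V. c1 v * \<phi> v) = (\<Sum>v\<in>V. c v * \<phi> v) - (\<Sum>v\<in>V. c v * \<psi> v) / \<psi> u * \<phi> u" for \<phi>
        using assms(1) uV by (simp add: c1_def sum.remove[OF assms(1) uV] algebra_simps)
      have "(\<Sum>v\<in>V. c1 v * \<phi> v) = 0" if \<phi>: "\<phi> \<in> \<Phi>" "\<forall>v\<in>V0. \<phi> v = 0" for \<phi>
      proof -
        \<comment> \<open>Subtracting the multiple of \<open>\<psi>\<close> that matches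
          \<open>\<phi>\<close> at \<open>u\<close> gives an element of \<open>\<Phi>\<close>
          vanishing on all of \<open>insert u V0\<close>, to which the hypothesis on
          \<open>c\<close> applies. Its relation says that the correction at \<open>u\<close> is
          right for \<open>\<phi>\<close> too.\<close>
        define \<eta> where "\<eta> v = \<phi> v + (- (\<phi> u / \<psi> u)) * \<psi> v" for v
        have "\<eta> \<in> \<Phi>" unfolding \<eta>_def by (intro assms(3,4) \<phi> \<psi>)
        moreover have "\<forall>v\<in>insert u V0. \<eta> v = 0" using \<phi> \<psi> by (auto simp: \<eta>_def)
        ultimately have "(\<Sum>v\<in>V. c v * \<eta> v) = 0" using insert.prems(2) by blast
        then have "(\<Sum>v\<in>V. c v * \<phi> v) = \<phi> u / \<psi> u * (\<Sum>v\<in>V. c v * \<psi> v)"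
          by (simp add: \<eta>_def algebra_simps sum.distrib sum_subtractf sum_distrib_left)
        then show ?thesis by (simp add: c1)
      qed
      then have "\<exists>c'. (\<forall>v. v \<notin> V0 \<longrightarrow> c' v = c1 v) \<and> (\<forall>\<phi>\<in>\<Phi>. (\<Sum>v\<in>V. c' v * \<phi> v) = 0)"
        using insert.prems by (intro insert.IH) auto
      then obtain c' where "\<forall>v. v \<notin> V0 \<longrightarrow> c' v = c1 v" "\<forall>\<phi>\<in>\<Phi>. (\<Sum>v\<in>V. c' v * \<phi> v) = 0"
        by (elim exE conjE)
      then show ?thesis by (intro exI[of _ c']) (auto simp: c1_def)
    qed
  qed
qed


subsection \<open>Moment conditions along a line and their dual\<close>

text \<open>\<open>E t\<close> says that the line has the segment from node \<open>t\<close> to node \<open>Suc t\<close>. The condition expresses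
  that the truncated powers with coefficients \<open>c\<close> cancel where the segment is missing; the families in
  \<open>edge_polys\<close> describe the annihilator of these coefficients.\<close>

definition moments :: "nat \<Rightarrow> (nat \<Rightarrow> bool) \<Rightarrow> (nat \<Rightarrow> real) \<Rightarrow> (nat \<Rightarrow> real) \<Rightarrow> bool" where
  "moments r E x c \<longleftrightarrow> (\<forall>t. \<not> E t \<longrightarrow> (\<forall>k\<le>r. (\<Sum>i\<le>t. c i * x i ^ k) = 0))"

definition edge_polys :: "nat \<Rightarrow> (nat \<Rightarrow> bool) \<Rightarrow> (nat \<Rightarrow> real poly) \<Rightarrow> bool" where
  "edge_polys r E p \<longleftrightarrow> (\<forall>t. degree (p t) \<le> r) \<and> (\<forall>t. E t \<longrightarrow> p (Suc t) = p t)"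

lemma moments_poly:
  assumes "moments r E x c" "\<not> E t" "degree q \<le> r"
  shows "(\<Sum>i\<le>t. c i * poly q (x i)) = 0"
proof -
  have "(\<Sum>i\<le>t. c i * poly q (x i)) = (\<Sum>i\<le>t. \<Sum>k\<le>degree q. coeff q k * (c i * x i ^ k))"
    by (simp add: poly_altdef sum_distrib_left mult_ac)
  also have "\<dots> = (\<Sum>k\<le>degree q. coeff q k * (\<Sum>i\<le>t. c i * x i ^ k))"
    by (subst sum.swap) (simp add: sum_distrib_left)
  also have "\<dots> = 0"
    using assms by (intro sum.neutral) (auto simp: moments_def)
  finally show ?thesis .
qed

text \<open>In the partial sum up to \<open>t\<close> every polynomial may be replaced by
  \<open>p t\<close>. Passing an edge does not change the polynomial; at a gap the sums against the
  polynomials on either side both vanish.\<close>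

lemma moments_edge_polys:
  assumes "moments r E x c" "edge_polys r E p" "\<not> E t"
  shows "(\<Sum>i\<le>t. c i * poly (p i) (x i)) = 0"
proof -
  have "(\<Sum>i\<le>t. c i * poly (p i) (x i)) = (\<Sum>i\<le>t. c i * poly (p t) (x i))" for t
  proof (induction t)
    case (Suc t)
    show ?case
    proof (cases "E t")
      case True
      then show ?thesis using Suc assms(2) by (simp add: edge_polys_def)
    next
      case False
      have "(\<Sum>i\<le>t. c i * poly (p t) (x i)) = 0" "(\<Sum>i\<le>t. c i * poly (p (Suc t)) (x i)) = 0"
        using assms(1,2) False by (auto intro!: moments_poly simp: edge_polys_def)
      then show ?thesis using Suc by simp
    qed
  qed simp
  then show ?thesis
    using moments_poly[OF assms(1,3)] assms(2) by (simp add: edge_polys_def)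
qed

text \<open>Converse of the duality. The condition of order \<open>k\<close> at a gap
  \<open>t\<close> is tested by the family that is a monomial up to \<open>t\<close> and zero behind
  it; the jump is admissible exactly because the edge at \<open>t\<close> is missing.\<close>

lemma momentsI:
  assumes "\<And>i. i > m \<Longrightarrow> c i = 0"
    and "\<And>p. edge_polys r E p \<Longrightarrow> (\<Sum>i\<le>m. c i * poly (p i) (x i)) = 0"
  shows "moments r E x c"
  unfolding moments_def
proof (intro allI impI)
  fix t k assume *: "\<not> E t" "k \<le> r"
  define p where "p i = (if i \<le> t then monom 1 k else 0 :: real poly)" for i
  have "edge_polys r E p"
    using * by (auto simp: edge_polys_def p_def degree_monom_eq not_less_eq_eq intro: le_antisym)
  then have "(\<Sum>i\<le>m. c i * poly (p i) (x i)) = 0" by (rule assms(2))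
  also have "(\<Sum>i\<le>m. c i * poly (p i) (x i)) = (\<Sum>i\<le>max m t. c i * poly (p i) (x i))"
    by (rule sum.mono_neutral_left) (auto simp: assms(1))
  also have "\<dots> = (\<Sum>i\<le>t. c i * poly (p i) (x i))"
    by (rule sum.mono_neutral_right) (auto simp: p_def)
  also have "\<dots> = (\<Sum>i\<le>t. c i * x i ^ k)"
    by (rule sum.cong) (auto simp: p_def poly_monom)
  finally show "(\<Sum>i\<le>t. c i * x i ^ k) = 0" by simp
qed

text \<open>With a gap on both sides of \<open>t\<close>, two consecutive partial sums of order 0
  vanish, and \<open>c t\<close> is their difference.\<close>

lemma moments_isolated:
  assumes "moments r E x c" "\<not> E t" "t = 0 \<or> \<not> E (t - 1)"
  shows "c t = 0"
proof (cases t)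
  case 0
  then show ?thesis using assms by (auto simp: moments_def dest!: spec[of _ 0])
next
  case (Suc u)
  have "\<forall>k\<le>r. (\<Sum>i\<le>t. c i * x i ^ k) = 0" "\<forall>k\<le>r. (\<Sum>i\<le>u. c i * x i ^ k) = 0"
    using assms Suc by (auto simp: moments_def simp del: sum.atMost_Suc)
  then have "(\<Sum>i\<le>t. c i * x i ^ 0) = 0" "(\<Sum>i\<le>u. c i * x i ^ 0) = 0" by blast+
  then show ?thesis by (simp add: Suc)
qed

lemma moments_add: "moments r E x c \<Longrightarrow> moments r E x d \<Longrightarrow> moments r E x (\<lambda>i. c i + d i)"
  by (auto simp: moments_def algebra_simps sum.distrib)

lemma moments_cmult: "moments r E x c \<Longrightarrow> moments r E x (\<lambda>i. k * c i)"
  by (simp add: moments_def mult.assoc flip: sum_distrib_left)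

lemma moments_0 [simp]: "moments r E x (\<lambda>i. 0)"
  by (simp add: moments_def)

lemma edge_polys_add: "edge_polys r E p \<Longrightarrow> edge_polys r E q \<Longrightarrow> edge_polys r E (\<lambda>t. p t + q t)"
  by (auto simp: edge_polys_def degree_add_le)

lemma edge_polys_smult: "edge_polys r E p \<Longrightarrow> edge_polys r E (\<lambda>t. smult k (p t))"
  using degree_smult_le order_trans by (fastforce simp: edge_polys_def)


subsection \<open>Cells in blocks\<close>

definition is_block :: "nat \<Rightarrow> (nat \<times> nat) set \<Rightarrow> nat \<times> nat \<Rightarrow> nat \<times> nat \<Rightarrow> bool" where
  "is_block n s b c \<longleftrightarrow> fst b \<le> fst c \<and> fst c < fst b + n \<and> snd b \<le> snd c \<and> snd c < snd b + n \<and>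
     {fst b..<fst b + n} \<times> {snd b..<snd b + n} \<subseteq> s"

definition covered_by_blocks :: "nat \<Rightarrow> (nat \<times> nat) set \<Rightarrow> bool" where
  "covered_by_blocks n s \<longleftrightarrow> (\<forall>c\<in>s. \<exists>b. is_block n s b c)"

lemma is_block_converse: "is_block n (s\<inverse>) (j0, i0) (j, i) \<longleftrightarrow> is_block n s (i0, j0) (i, j)"
  by (auto simp: is_block_def)

lemma covered_by_blocks_converse:
  assumes "covered_by_blocks n s" shows "covered_by_blocks n (s\<inverse>)"
  unfolding covered_by_blocks_def
proof
  fix c assume "c \<in> s\<inverse>"
  then obtain i j where c: "c = (j, i)" "(i, j) \<in> s" by (cases c) auto
  then obtain b where b: "is_block n s b (i, j)" using assms by (auto simp: covered_by_blocks_def)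
  then show "\<exists>b. is_block n (s\<inverse>) b c"
    using is_block_converse[of n s "snd b" "fst b" j i] c by (intro exI[of _ "(snd b, fst b)"]) auto
qed

lemma is_blockD:
  assumes "is_block n s (i0, j0) (i, j)"
  shows "i0 \<le> i" "i < i0 + n" "j0 \<le> j" "j < j0 + n" "(i, j) \<in> s"
    "\<And>k. i0 \<le> k \<Longrightarrow> k < i0 + n \<Longrightarrow> (k, j) \<in> s" "\<And>k. j0 \<le> k \<Longrightarrow> k < j0 + n \<Longrightarrow> (i, k) \<in> s"
  using assms by (auto simp: is_block_def)

text \<open>The flag \<open>C\<close> distinguishes the CVR graph (degree \<open>d - 2\<close>, zeros only where a line meets a
  line between two cells of \<open>s\<close>) from the T-mesh (degree \<open>d\<close>, zeros at all mesh lines met).\<close>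

definition mesh_degree :: "bool \<Rightarrow> nat \<Rightarrow> nat" where
  "mesh_degree C d = (if C then d - 2 else d)"

text \<open>Such polynomials arise as the difference, on the new middle line of the row
  \<open>j\<close>, between an element of the dual space and the polynomial already found on the
  cell \<open>(i, j)\<close>. The prescribed zeros are the old vertical lines that the middle line
  meets in an admissible node.\<close>

definition row_bubble :: "bool \<Rightarrow> nat \<Rightarrow> (nat \<times> nat) set \<Rightarrow> (nat \<Rightarrow> real) \<Rightarrow> (nat \<Rightarrow> nat \<Rightarrow> real poly) \<Rightarrow> bool" where
  "row_bubble C d s X D \<longleftrightarrow> (\<forall>i j. degree (D i j) \<le> mesh_degree C d) \<and>
     (\<forall>i j. (i, j) \<in> s \<longrightarrow> (Suc i, j) \<in> s \<longrightarrow> D (Suc i) j = D i j \<and> poly (D i j) (X (Suc i)) = 0) \<and>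
     (\<not> C \<longrightarrow> (\<forall>i j. (i, j) \<in> s \<longrightarrow> poly (D i j) (X i) = 0 \<and> poly (D i j) (X (Suc i)) = 0))"

lemma row_bubbleD:
  assumes "row_bubble C d s X D"
  shows "degree (D i j) \<le> mesh_degree C d"
    "(i, j) \<in> s \<Longrightarrow> (Suc i, j) \<in> s \<Longrightarrow> D (Suc i) j = D i j"
    "(i, j) \<in> s \<Longrightarrow> (Suc i, j) \<in> s \<Longrightarrow> poly (D i j) (X (Suc i)) = 0"
    "\<not> C \<Longrightarrow> (i, j) \<in> s \<Longrightarrow> poly (D i j) (X i) = 0"
    "\<not> C \<Longrightarrow> (i, j) \<in> s \<Longrightarrow> poly (D i j) (X (Suc i)) = 0"
  using assms by (simp_all add: row_bubble_def)

lemma poly_zero_if_many_roots: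
  fixes p :: "real poly"
  assumes "degree p \<le> r" "finite Z" "r < card Z" "\<And>z. z \<in> Z \<Longrightarrow> poly p z = 0"
  shows "p = 0"
proof (rule ccontr)
  assume "p \<noteq> 0"
  then have "card {z. poly p z = 0} \<le> degree p" "finite {z. poly p z = 0}"
    by (auto intro: card_poly_roots_bound poly_roots_finite)
  moreover have "Z \<subseteq> {z. poly p z = 0}" using assms(4) by auto
  ultimately show False using assms(1,3) card_mono[of "{z. poly p z = 0}" Z] by linarith
qed

lemma row_bubble_const:
  assumes "row_bubble C d s X D" "a \<le> b" "\<And>k. a \<le> k \<Longrightarrow> k \<le> b \<Longrightarrow> (k, j) \<in> s"
  shows "D b j = D a j"
  using assms(2,3)
proof (induction b rule: dec_induct)
  case (step n)
  then have "D (Suc n) j = D n j"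
    by (intro row_bubbleD(2)[OF assms(1)]) auto
  then show ?case using step by simp
qed simp

lemma row_bubble_same_block:
  assumes "row_bubble C d s X D" "is_block n s (i0, j0) (i, j)" "i0 \<le> k" "k < i0 + n"
  shows "D k j = D i j"
proof (cases "i \<le> k")
  case True
  then show ?thesis
    using is_blockD[OF assms(2)] assms(3,4) by (intro row_bubble_const[OF assms(1)]) auto
next
  case False
  then have "D i j = D k j"
    using is_blockD[OF assms(2)] assms(3,4) by (intro row_bubble_const[OF assms(1)]) auto
  then show ?thesis by simp
qed

text \<open>\<open>of_bool C\<close> trims the two outer lines of the block. On the T-mesh all
  \<open>d\<close> lines give roots; on the CVR graph only the \<open>d - 2\<close> lines with a
  cell of the block on both sides do.\<close>

lemma row_bubble_root:
  assumes D: "row_bubble C d s X D" and B: "is_block (d - 1) s (i0, j0) (i, j)"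
    and k: "i0 + of_bool C \<le> k" "k + of_bool C \<le> i0 + (d - 1)"
  shows "poly (D i j) (X k) = 0"
proof (cases C)
  case True
  then have k': "i0 \<le> k - 1" "k < i0 + (d - 1)" "Suc (k - 1) = k" using k by auto
  then have "poly (D (k - 1) j) (X (Suc (k - 1))) = 0"
    using is_blockD(6)[OF B, of "k - 1"] is_blockD(6)[OF B, of k]
    by (intro row_bubbleD(3)[OF D]) auto
  moreover have "D (k - 1) j = D i j"
    using k' by (intro row_bubble_same_block[OF D B]) auto
  ultimately show ?thesis using k' by simp
next
  case False
  show ?thesis
  proof (cases "k = i0 + (d - 1)")
    case True
    then have "d - 1 > 0" using is_blockD[OF B] by auto
    then have "i0 \<le> k - 1" "k - 1 < i0 + (d - 1)" "Suc (k - 1) = k" using True by auto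
    then show ?thesis
      using row_bubbleD(5)[OF D \<open>\<not> C\<close> is_blockD(6)[OF B, of "k - 1"]]
        row_bubble_same_block[OF D B, of "k - 1"] by simp
  next
    case False
    then have "i0 \<le> k" "k < i0 + (d - 1)" using k by auto
    then show ?thesis
      using row_bubbleD(4)[OF D \<open>\<not> C\<close> is_blockD(6)[OF B, of k]]
        row_bubble_same_block[OF D B, of k] by simp
  qed
qed

text \<open>The block supplies as many roots as the degree bound allows, \<open>d\<close> or
  \<open>d - 2\<close>, and \<open>x\<close> is one more.\<close>

lemma row_bubble_zero:
  assumes D: "row_bubble C d s X D" and B: "is_block (d - 1) s (i0, j0) (i, j)"
    and X: "strict_mono X" and d: "d \<ge> 2"
    and x: "poly (D i j) x = 0" "\<And>k. i0 + of_bool C \<le> k \<Longrightarrow> k + of_bool C \<le> i0 + (d - 1) \<Longrightarrow> x \<noteq> X k"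
  shows "D i j = 0"
proof -
  define Z where "Z = insert x (X ` {i0 + of_bool C..i0 + (d - 1) - of_bool C})"
  have "card (X ` {i0 + of_bool C..i0 + (d - 1) - of_bool C}) = d - 2 * of_bool C"
    using d by (subst card_image) (auto intro!: inj_on_subset[OF strict_mono_imp_inj_on[OF X]])
  moreover have "x \<notin> X ` {i0 + of_bool C..i0 + (d - 1) - of_bool C}"
  proof
    assume "x \<in> X ` {i0 + of_bool C..i0 + (d - 1) - of_bool C}"
    then obtain k where k: "x = X k" "i0 + of_bool C \<le> k" "k \<le> i0 + (d - 1) - of_bool C" by auto
    from k have "k + of_bool C \<le> i0 + (d - 1)" using d by (cases C) auto
    then show False using x(2)[of k] k by blast
  qed
  ultimately have "card Z = Suc (d - 2 * of_bool C)" "finite Z" by (auto simp: Z_def)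
  moreover have "poly (D i j) z = 0" if "z \<in> Z" for z
    using that x(1) row_bubble_root[OF D B] d by (auto simp: Z_def)
  ultimately show ?thesis
    using D by (intro poly_zero_if_many_roots[of _ "mesh_degree C d" Z])
      (auto simp: row_bubble_def mesh_degree_def)
qed

text \<open>A block containing only one of the two cells would end at their common side, and the
  bubble would then have one root too many. On the T-mesh this root is the far side of the
  neighbouring cell. On the CVR graph it is the common side itself: an outer line of the block, yet
  lying between two cells of \<open>s\<close>.\<close>

lemma row_bubble_same_blocks:
  assumes D: "row_bubble C d s X D" and X: "strict_mono X" and d: "d \<ge> 2"
    and s: "(i, j) \<in> s" "(Suc i, j) \<in> s" and nz: "D i j \<noteq> 0"
  shows "is_block (d - 1) s b (i, j) \<longleftrightarrow> is_block (d - 1) s b (Suc i, j)"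
proof -
  obtain i0 j0 where b: "b = (i0, j0)" by (cases b)
  have eq: "D (Suc i) j = D i j" and root: "poly (D i j) (X (Suc i)) = 0"
    using row_bubbleD[OF D] s by auto
  have inj: "X k \<noteq> X l" if "k \<noteq> l" for k l using X that by (auto simp: strict_mono_eq)
  show ?thesis
  proof
    assume B: "is_block (d - 1) s b (i, j)"
    have "Suc i < i0 + (d - 1)"
    proof (rule ccontr)
      assume "\<not> Suc i < i0 + (d - 1)"
      then have i: "Suc i = i0 + (d - 1)" using B b is_blockD by fastforce
      have "D i j = 0"
      proof (cases C)
        case True
        show ?thesis
          by (rule row_bubble_zero[OF D B[unfolded b] X d root]) (use i True in \<open>auto intro!: inj\<close>)
      next
        case False
        have "poly (D i j) (X (Suc (Suc i))) = 0"
          using row_bubbleD(5)[OF D False s(2)] eq by simp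
        then show ?thesis
          by (rule row_bubble_zero[OF D B[unfolded b] X d]) (use i False in \<open>auto intro!: inj\<close>)
      qed
      with nz show False by simp
    qed
    then show "is_block (d - 1) s b (Suc i, j)" using B by (auto simp: b is_block_def)
  next
    assume B: "is_block (d - 1) s b (Suc i, j)"
    have "i0 \<le> i"
    proof (rule ccontr)
      assume "\<not> i0 \<le> i"
      then have i: "i0 = Suc i" using B b is_blockD by fastforce
      have "D (Suc i) j = 0"
      proof (cases C)
        case True
        show ?thesis
          by (rule row_bubble_zero[OF D B[unfolded b] X d]) (use i True root eq in \<open>auto intro!: inj\<close>)
      next
        case False
        have "poly (D (Suc i) j) (X i) = 0"
          using row_bubbleD(4)[OF D False s(1)] eq by simp
        then show ?thesis
          by (rule row_bubble_zero[OF D B[unfolded b] X d]) (use i False in \<open>auto intro!: inj\<close>)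
      qed
      with nz eq show False by simp
    qed
    then show "is_block (d - 1) s b (i, j)" using B by (auto simp: b is_block_def)
  qed
qed


subsection \<open>Local structure of the dual of the smoothness conditions\<close>

text \<open>All four grid edges at the node are present. The guards \<open>0 < a\<close> and
  \<open>0 < b\<close> keep \<open>a - 1\<close> and \<open>b - 1\<close> from being
  truncated.\<close>

definition cross_nodes :: "(nat \<Rightarrow> nat \<Rightarrow> bool) \<Rightarrow> (nat \<Rightarrow> nat \<Rightarrow> bool) \<Rightarrow> (nat \<times> nat) set" where
  "cross_nodes H V = {(a, b). 0 < a \<and> 0 < b \<and> H (a - 1) b \<and> H a b \<and> V a (b - 1) \<and> V a b}"

text \<open>The nodes that may carry a coefficient. No restriction is imposed on the T-mesh, because
  off the mesh the moment conditions themselves force the coefficient to be zero.\<close>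

definition nodes :: "bool \<Rightarrow> (nat \<Rightarrow> nat \<Rightarrow> bool) \<Rightarrow> (nat \<Rightarrow> nat \<Rightarrow> bool) \<Rightarrow> (nat \<times> nat) set" where
  "nodes C H V = (if C then cross_nodes H V else UNIV)"

text \<open>Refinement doubles the indices: the old node \<open>(i, j)\<close> becomes \<open>(2 * i, 2 * j)\<close>.\<close>

definition refine_h :: "(nat \<Rightarrow> nat \<Rightarrow> bool) \<Rightarrow> (nat \<times> nat) set \<Rightarrow> nat \<Rightarrow> nat \<Rightarrow> bool" where
  "refine_h H s a b = (if even b then H (a div 2) (b div 2) else (a div 2, b div 2) \<in> s)"

definition refine_v :: "(nat \<Rightarrow> nat \<Rightarrow> bool) \<Rightarrow> (nat \<times> nat) set \<Rightarrow> nat \<Rightarrow> nat \<Rightarrow> bool" where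
  "refine_v V s a b = (if even a then V (a div 2) (b div 2) else (a div 2, b div 2) \<in> s)"

text \<open>Bidegree at most \<open>(r, r)\<close> without mention of coefficients: being a
  polynomial in each variable separately with a uniform degree bound amounts to the same, and all
  closure properties can be checked one variable at a time.\<close>

definition bipoly :: "nat \<Rightarrow> (real \<Rightarrow> real \<Rightarrow> real) \<Rightarrow> bool" where
  "bipoly r F \<longleftrightarrow> (\<forall>y. \<exists>p. degree p \<le> r \<and> (\<forall>x. F x y = poly p x)) \<and>
     (\<forall>x. \<exists>p. degree p \<le> r \<and> (\<forall>y. F x y = poly p y))"

text \<open>A linear dependency between the conditions on the rows and those on the columns:
  \<open>P\<close> is a combination of the former, \<open>Q\<close> of the latter, and their sum
  acts as zero on every coefficient at an admissible node.\<close>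

definition dual_pair :: "bool \<Rightarrow> nat \<Rightarrow> (nat \<Rightarrow> nat \<Rightarrow> bool) \<Rightarrow> (nat \<Rightarrow> nat \<Rightarrow> bool) \<Rightarrow> (nat \<Rightarrow> real) \<Rightarrow> (nat \<Rightarrow> real)
    \<Rightarrow> (nat \<Rightarrow> nat \<Rightarrow> real poly) \<Rightarrow> (nat \<Rightarrow> nat \<Rightarrow> real poly) \<Rightarrow> bool" where
  "dual_pair C d H V X Y P Q \<longleftrightarrow>
     (\<forall>b. edge_polys (mesh_degree C d) (\<lambda>a. H a b) (\<lambda>a. P a b)) \<and>
     (\<forall>a. edge_polys (mesh_degree C d) (V a) (Q a)) \<and>
     (\<forall>a b. (a, b) \<in> nodes C H V \<longrightarrow> poly (P a b) (X a) + poly (Q a b) (Y b) = 0)"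

text \<open>On the edges of a cell of \<open>s\<close>, \<open>P\<close> is the trace of the polynomial \<open>F\<close> and \<open>Q\<close> that of \<open>- F\<close>; for the
  CVR graph only the edges between two cells of \<open>s\<close> count.\<close>

definition row_match :: "bool \<Rightarrow> (nat \<times> nat) set \<Rightarrow> (nat \<Rightarrow> real) \<Rightarrow> (nat \<Rightarrow> nat \<Rightarrow> real poly)
    \<Rightarrow> (nat \<Rightarrow> nat \<Rightarrow> real \<Rightarrow> real \<Rightarrow> real) \<Rightarrow> bool" where
  "row_match C s Y P F \<longleftrightarrow> (\<forall>i j. (i, j) \<in> s \<longrightarrow>
     ((C \<longrightarrow> 0 < j \<and> (i, j - 1) \<in> s) \<longrightarrow> (\<forall>x. poly (P i j) x = F i j x (Y j))) \<and>
     ((C \<longrightarrow> (i, Suc j) \<in> s) \<longrightarrow> (\<forall>x. poly (P i (Suc j)) x = F i j x (Y (Suc j)))))"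

definition bipoly_on_cells :: "bool \<Rightarrow> nat \<Rightarrow> (nat \<Rightarrow> real) \<Rightarrow> (nat \<Rightarrow> real) \<Rightarrow> (nat \<times> nat) set
    \<Rightarrow> (nat \<Rightarrow> nat \<Rightarrow> real poly) \<Rightarrow> (nat \<Rightarrow> nat \<Rightarrow> real poly) \<Rightarrow> (nat \<Rightarrow> nat \<Rightarrow> real \<Rightarrow> real \<Rightarrow> real) \<Rightarrow> bool" where
  "bipoly_on_cells C d X Y s P Q F \<longleftrightarrow>
     (\<forall>i j. (i, j) \<in> s \<longrightarrow> bipoly (mesh_degree C d) (F i j)) \<and>
     (\<forall>i j. (i, j) \<in> s \<longrightarrow> (Suc i, j) \<in> s \<longrightarrow> F (Suc i) j = F i j) \<and>
     (\<forall>i j. (i, j) \<in> s \<longrightarrow> (i, Suc j) \<in> s \<longrightarrow> F i (Suc j) = F i j) \<and>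
     row_match C s Y P F \<and>
     row_match C (s\<inverse>) X (\<lambda>j i. Q i j) (\<lambda>j i y x. - F i j x y)"

definition dual_bipoly :: "bool \<Rightarrow> nat \<Rightarrow> (nat \<Rightarrow> nat \<Rightarrow> bool) \<Rightarrow> (nat \<Rightarrow> nat \<Rightarrow> bool) \<Rightarrow> (nat \<Rightarrow> real)
    \<Rightarrow> (nat \<Rightarrow> real) \<Rightarrow> (nat \<times> nat) set \<Rightarrow> bool" where
  "dual_bipoly C d H V X Y s \<longleftrightarrow>
     (\<forall>P Q. dual_pair C d H V X Y P Q \<longrightarrow> (\<exists>F. bipoly_on_cells C d X Y s P Q F))"

lemma bipoly_fst:
  assumes "bipoly r F" obtains p where "degree p \<le> r" "\<And>x. F x y = poly p x"
proof -
  have "\<exists>p. degree p \<le> r \<and> (\<forall>x. F x y = poly p x)" using assms by (simp add: bipoly_def)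
  then show ?thesis by (rule exE) (rule that, auto)
qed

lemma bipoly_snd:
  assumes "bipoly r F" obtains p where "degree p \<le> r" "\<And>y. F x y = poly p y"
proof -
  have "\<exists>p. degree p \<le> r \<and> (\<forall>y. F x y = poly p y)" using assms by (simp add: bipoly_def)
  then show ?thesis by (rule exE) (rule that, auto)
qed

lemma bipolyI:
  assumes "\<And>y. \<exists>p. degree p \<le> r \<and> (\<forall>x. F x y = poly p x)"
    "\<And>x. \<exists>p. degree p \<le> r \<and> (\<forall>y. F x y = poly p y)"
  shows "bipoly r F"
  unfolding bipoly_def using assms by (intro conjI allI)

lemma bipoly_swap:
  assumes "bipoly r F" shows "bipoly r (\<lambda>y x. - F x y)"
proof (rule bipolyI)
  fix x
  obtain p where "degree p \<le> r" "\<And>y. F x y = poly p y" by (rule bipoly_snd[OF assms, where x = x]) (rule that)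
  then show "\<exists>p. degree p \<le> r \<and> (\<forall>y. - F x y = poly p y)" by (intro exI[of _ "- p"]) simp
next
  fix y
  obtain p where "degree p \<le> r" "\<And>x. F x y = poly p x" by (rule bipoly_fst[OF assms, where y = y]) (rule that)
  then show "\<exists>p. degree p \<le> r \<and> (\<forall>x. - F x y = poly p x)" by (intro exI[of _ "- p"]) simp
qed

lemma degree_add_smult_le:
  assumes "degree p \<le> r" "degree q \<le> r" shows "degree (p + smult k q) \<le> r"
  using assms by (meson degree_add_le degree_smult_le order_trans)

lemma bipoly_add_prod:
  assumes F: "bipoly r F" and p: "degree p \<le> r" and q: "degree q \<le> r"
  shows "bipoly r (\<lambda>x y. F x y + poly p x * poly q y / k)"
proof (rule bipolyI)
  fix y
  obtain u where u: "degree u \<le> r" "\<And>x. F x y = poly u x"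
    by (rule bipoly_fst[OF F, where y = y]) (rule that)
  have "\<forall>x. F x y + poly p x * poly q y / k = poly (u + smult (poly q y / k) p) x"
    by (simp add: u(2))
  then show "\<exists>v. degree v \<le> r \<and> (\<forall>x. F x y + poly p x * poly q y / k = poly v x)"
    using degree_add_smult_le[OF u(1) p] by (intro exI conjI)
next
  fix x
  obtain u where u: "degree u \<le> r" "\<And>y. F x y = poly u y"
    by (rule bipoly_snd[OF F, where x = x]) (rule that)
  have "\<forall>y. F x y + poly p x * poly q y / k = poly (u + smult (poly p x / k) q) y"
    by (simp add: u(2))
  then show "\<exists>v. degree v \<le> r \<and> (\<forall>y. F x y + poly p x * poly q y / k = poly v y)"
    using degree_add_smult_le[OF u(1) q] by (intro exI conjI)
qed

lemma nodes_swap: "(a, b) \<in> nodes C (\<lambda>i j. V j i) (\<lambda>i j. H j i) \<longleftrightarrow> (b, a) \<in> nodes C H V"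
  by (auto simp: nodes_def cross_nodes_def)

lemma refine_swap:
  "refine_h (\<lambda>i j. V j i) (s\<inverse>) = (\<lambda>i j. refine_v V s j i)"
  "refine_v (\<lambda>i j. H j i) (s\<inverse>) = (\<lambda>i j. refine_h H s j i)"
  by (auto simp: refine_h_def refine_v_def fun_eq_iff)

lemma dual_pair_swap:
  assumes "dual_pair C d H V X Y P Q"
  shows "dual_pair C d (\<lambda>i j. V j i) (\<lambda>i j. H j i) Y X (\<lambda>i j. Q j i) (\<lambda>i j. P j i)"
  using assms by (simp add: dual_pair_def nodes_swap[of _ _ C V H] add.commute)

lemma bipoly_on_cells_swap:
  assumes "bipoly_on_cells C d X Y s P Q F"
  shows "bipoly_on_cells C d Y X (s\<inverse>) (\<lambda>i j. Q j i) (\<lambda>i j. P j i) (\<lambda>j i y x. - F i j x y)"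
  using assms unfolding bipoly_on_cells_def by (auto simp: bipoly_swap)

section \<open>One refinement step: the polynomial structure of the dual space is inherited\<close>

locale refinement =
  fixes C :: bool and d :: nat and H V :: "nat \<Rightarrow> nat \<Rightarrow> bool" and X Y X' Y' :: "nat \<Rightarrow> real"
    and s :: "(nat \<times> nat) set"
  assumes d: "2 \<le> d"
    and blocks: "covered_by_blocks (d - 1) s"
    and mono: "strict_mono X" "strict_mono Y" "strict_mono X'" "strict_mono Y'"
    and double: "\<And>i. X' (2 * i) = X i" "\<And>i. Y' (2 * i) = Y i"
    and edges: "\<And>i j. (i, j) \<in> s \<Longrightarrow> H i j \<and> H i (Suc j) \<and> V i j \<and> V (Suc i) j"
begin

abbreviation "H' \<equiv> refine_h H s"
abbreviation "V' \<equiv> refine_v V s"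

text \<open>Transposing the mesh gives another refinement, so statements about columns are obtained
  below as the statements about rows of this instance.\<close>

lemma swap: "refinement d (\<lambda>i j. V j i) (\<lambda>i j. H j i) Y X Y' X' (s\<inverse>)"
  using d covered_by_blocks_converse[OF blocks] mono double edges by unfold_locales auto

lemma double_Suc: "X' (Suc (Suc (2 * i))) = X (Suc i)" "Y' (Suc (Suc (2 * i))) = Y (Suc i)"
  using double[of "Suc i"] by simp_all

lemma mid_not_old: "X' (Suc (2 * i)) \<noteq> X k" "Y' (Suc (2 * i)) \<noteq> Y k"
proof -
  have "Suc (2 * i) \<noteq> 2 * k" by presburger
  then show "X' (Suc (2 * i)) \<noteq> X k" "Y' (Suc (2 * i)) \<noteq> Y k"
    using mono(3,4) double by (metis strict_mono_eq)+
qed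

text \<open>The four kinds of nodes of the refined mesh: old nodes, cell centres, and midpoints of
  horizontal and of vertical edges. In the CVR graph a midpoint counts only if the cells on both
  sides of the edge are subdivided.\<close>

lemma nodes_simps:
  "(2 * i, 2 * j) \<in> nodes C H' V' \<longleftrightarrow> (i, j) \<in> nodes C H V"
  "(Suc (2 * i), Suc (2 * j)) \<in> nodes C H' V' \<longleftrightarrow> C \<longrightarrow> (i, j) \<in> s"
  "(Suc (2 * i), 2 * j) \<in> nodes C H' V' \<longleftrightarrow> C \<longrightarrow> (0 < j \<and> (i, j - 1) \<in> s \<and> (i, j) \<in> s)"
  "(2 * i, Suc (2 * j)) \<in> nodes C H' V' \<longleftrightarrow> C \<longrightarrow> (0 < i \<and> (i - 1, j) \<in> s \<and> (i, j) \<in> s)"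
proof -
  have *: "(2 * i - Suc 0) div 2 = i - 1" for i :: nat by presburger
  have **: "even (2 * i - Suc 0) \<longleftrightarrow> i = 0" for i :: nat by presburger
  show "(2 * i, 2 * j) \<in> nodes C H' V' \<longleftrightarrow> (i, j) \<in> nodes C H V"
    by (auto simp: nodes_def cross_nodes_def refine_h_def refine_v_def *)
  show "(Suc (2 * i), Suc (2 * j)) \<in> nodes C H' V' \<longleftrightarrow> C \<longrightarrow> (i, j) \<in> s"
    by (auto simp: nodes_def cross_nodes_def refine_h_def refine_v_def)
  show "(Suc (2 * i), 2 * j) \<in> nodes C H' V' \<longleftrightarrow> C \<longrightarrow> (0 < j \<and> (i, j - 1) \<in> s \<and> (i, j) \<in> s)"
    using edges by (auto simp: nodes_def cross_nodes_def refine_h_def refine_v_def *)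
  show "(2 * i, Suc (2 * j)) \<in> nodes C H' V' \<longleftrightarrow> C \<longrightarrow> (0 < i \<and> (i - 1, j) \<in> s \<and> (i, j) \<in> s)"
    using edges[of "i - 1" j] edges[of i j]
    by (auto simp: nodes_def cross_nodes_def refine_h_def refine_v_def *)
qed

lemma dual_pair_step:
  assumes "dual_pair C d H' V' X' Y' P Q"
  shows "H' a b \<Longrightarrow> P (Suc a) b = P a b" "V' a b \<Longrightarrow> Q a (Suc b) = Q a b"
    "degree (P a b) \<le> mesh_degree C d" "degree (Q a b) \<le> mesh_degree C d"
    "(a, b) \<in> nodes C H' V' \<Longrightarrow> poly (P a b) (X' a) + poly (Q a b) (Y' b) = 0"
  using assms by (auto simp: dual_pair_def edge_polys_def)

lemma dual_pair_coarse:
  assumes "dual_pair C d H' V' X' Y' P Q"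
  shows "dual_pair C d H V X Y (\<lambda>i j. P (2 * i) (2 * j)) (\<lambda>i j. Q (2 * i) (2 * j))"
  unfolding dual_pair_def edge_polys_def
proof (safe)
  note st = dual_pair_step[OF assms]
  show "degree (P (2 * i) (2 * j)) \<le> mesh_degree C d" "degree (Q (2 * i) (2 * j)) \<le> mesh_degree C d" for i j
    using st by auto
  show "P (2 * Suc i) (2 * j) = P (2 * i) (2 * j)" if "H i j" for i j
    using st(1)[of "2 * i" "2 * j"] st(1)[of "Suc (2 * i)" "2 * j"] that by (simp add: refine_h_def)
  show "Q (2 * i) (2 * Suc j) = Q (2 * i) (2 * j)" if "V i j" for i j
    using st(2)[of "2 * i" "2 * j"] st(2)[of "2 * i" "Suc (2 * j)"] that by (simp add: refine_v_def)
  show "poly (P (2 * i) (2 * j)) (X i) + poly (Q (2 * i) (2 * j)) (Y j) = 0"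
    if "(i, j) \<in> nodes C H V" for i j
    using st(5)[of "2 * i" "2 * j"] that by (simp add: nodes_simps double)
qed

text \<open>Where the new line crosses an old vertical line, the relation \<open>P + Q = 0\<close>
  at the node ties the unknown \<open>P\<close> on the new line to \<open>Q\<close> on the old one.
  There \<open>Q\<close> is already known to be the trace of \<open>- F\<close>, so the difference
  of \<open>P\<close> and \<open>F\<close> has a root.\<close>

lemma row_bubble_exists:
  assumes dp: "dual_pair C d H' V' X' Y' P Q"
    and F: "bipoly_on_cells C d X Y s (\<lambda>i j. P (2 * i) (2 * j)) (\<lambda>i j. Q (2 * i) (2 * j)) F"
  shows "\<exists>D. row_bubble C d s X D \<and>
    (\<forall>i j. (i, j) \<in> s \<longrightarrow> (\<forall>x. poly (D i j) x = poly (P (Suc (2 * i)) (Suc (2 * j))) x - F i j x (Y' (Suc (2 * j)))))"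
proof -
  note st = dual_pair_step[OF dp]
  have "\<exists>p. degree p \<le> mesh_degree C d \<and> ((i, j) \<in> s \<longrightarrow>
      (\<forall>x. poly p x = poly (P (Suc (2 * i)) (Suc (2 * j))) x - F i j x (Y' (Suc (2 * j)))))" for i j
  proof (cases "(i, j) \<in> s")
    case True
    then have "bipoly (mesh_degree C d) (F i j)" using F by (simp add: bipoly_on_cells_def)
    then obtain p where p: "degree p \<le> mesh_degree C d" "\<And>x. F i j x (Y' (Suc (2 * j))) = poly p x"
      by (rule bipoly_fst[where y = "Y' (Suc (2 * j))"]) (rule that)
    then show ?thesis
      using st(3) by (intro exI[of _ "P (Suc (2 * i)) (Suc (2 * j)) - p"]) (auto intro: degree_diff_le)
  qed (auto intro: exI[of _ 0])
  then obtain D where D: "\<And>i j. degree (D i j) \<le> mesh_degree C d"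
    "\<And>i j x. (i, j) \<in> s \<Longrightarrow> poly (D i j) x = poly (P (Suc (2 * i)) (Suc (2 * j))) x - F i j x (Y' (Suc (2 * j)))"
    by metis
  have right: "poly (D i j) (X (Suc i)) = 0" if s: "(i, j) \<in> s" "C \<longrightarrow> (Suc i, j) \<in> s" for i j
  proof -
    have "(2 * Suc i, Suc (2 * j)) \<in> nodes C H' V'"
      using s by (subst nodes_simps) auto
    then have "poly (P (Suc (Suc (2 * i))) (Suc (2 * j))) (X (Suc i)) +
        poly (Q (Suc (Suc (2 * i))) (Suc (2 * j))) (Y' (Suc (2 * j))) = 0"
      using st(5)[of "2 * Suc i" "Suc (2 * j)"] double_Suc by simp
    moreover have "P (Suc (Suc (2 * i))) (Suc (2 * j)) = P (Suc (2 * i)) (Suc (2 * j))"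
      using s by (intro st(1)) (simp add: refine_h_def)
    moreover have "Q (Suc (Suc (2 * i))) (Suc (2 * j)) = Q (Suc (Suc (2 * i))) (2 * j)"
      using s edges by (intro st(2)) (simp add: refine_v_def)
    moreover have "poly (Q (2 * Suc i) (2 * j)) (Y' (Suc (2 * j))) = - F i j (X (Suc i)) (Y' (Suc (2 * j)))"
      using F s unfolding bipoly_on_cells_def row_match_def by auto
    ultimately show ?thesis using D(2)[OF s(1)] by simp
  qed
  have left: "poly (D i j) (X i) = 0" if s: "(i, j) \<in> s" "\<not> C" for i j
  proof -
    have "(2 * i, Suc (2 * j)) \<in> nodes C H' V'"
      using s by (subst nodes_simps) auto
    then have "poly (P (2 * i) (Suc (2 * j))) (X i) + poly (Q (2 * i) (Suc (2 * j))) (Y' (Suc (2 * j))) = 0"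
      using st(5)[of "2 * i" "Suc (2 * j)"] double by simp
    moreover have "P (Suc (2 * i)) (Suc (2 * j)) = P (2 * i) (Suc (2 * j))"
      using s by (intro st(1)) (simp add: refine_h_def)
    moreover have "Q (2 * i) (Suc (2 * j)) = Q (2 * i) (2 * j)"
      using s edges by (intro st(2)) (simp add: refine_v_def)
    moreover have "poly (Q (2 * i) (2 * j)) (Y' (Suc (2 * j))) = - F i j (X i) (Y' (Suc (2 * j)))"
      using F s unfolding bipoly_on_cells_def row_match_def by auto
    ultimately show ?thesis using D(2)[OF s(1)] by simp
  qed
  have adj: "D (Suc i) j = D i j" if s: "(i, j) \<in> s" "(Suc i, j) \<in> s" for i j
  proof -
    have "P (Suc (Suc (Suc (2 * i)))) (Suc (2 * j)) = P (Suc (Suc (2 * i))) (Suc (2 * j))"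
      using s by (intro st(1)) (simp add: refine_h_def)
    moreover have "P (Suc (Suc (2 * i))) (Suc (2 * j)) = P (Suc (2 * i)) (Suc (2 * j))"
      using s by (intro st(1)) (simp add: refine_h_def)
    moreover have "F (Suc i) j = F i j" using F s by (simp add: bipoly_on_cells_def)
    ultimately have "poly (D (Suc i) j) = poly (D i j)" using D(2) s by (auto simp: fun_eq_iff)
    then show ?thesis by (simp add: poly_eq_poly_eq_iff)
  qed
  show ?thesis
    unfolding row_bubble_def
    by (rule exI[of _ D]) (use D left right adj in blast)
qed

text \<open>With \<open>r\<close> common roots, the combination of \<open>p\<close> and
  \<open>q\<close> that vanishes at \<open>y\<close> has \<open>r + 1\<close> roots and is therefore
  zero.\<close>

lemma proportional:
  assumes "degree p \<le> r" "degree q \<le> r" "finite Z" "r \<le> card Z" "\<And>z. z \<in> Z \<Longrightarrow> poly p z = 0 \<and> poly q z = 0"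
    "y \<notin> Z" "poly p y \<noteq> 0" "poly q y \<noteq> 0"
  shows "poly p x / poly p y = poly q x / poly (q :: real poly) y"
proof -
  have "smult (poly q y) p - smult (poly p y) q = 0"
  proof (rule poly_zero_if_many_roots)
    show "degree (smult (poly q y) p - smult (poly p y) q) \<le> r"
      using assms by (intro degree_diff_le) (auto intro: order_trans[OF degree_smult_le])
    show "r < card (insert y Z)" "finite (insert y Z)" using assms by auto
  qed (use assms in auto)
  then have "poly (smult (poly q y) p - smult (poly p y) q) x = 0" by simp
  then show ?thesis using assms by (simp add: field_simps)
qed

text \<open>The factor in \<open>x\<close> is the same on both cells because \<open>D\<close> does
  not change across their common side. The factors in \<open>y\<close> belong to different columns;
  but if \<open>D\<close> is nonzero the cells lie in a common block, so both factors have the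
  horizontal lines of this block as roots and agree after normalisation at the middle line.\<close>

lemma bubble_adjacent:
  assumes D: "row_bubble C d s X D" and E: "row_bubble C d (s\<inverse>) Y E"
    and s: "(i, j) \<in> s" "(Suc i, j) \<in> s"
    and cen: "\<And>i j. (i, j) \<in> s \<Longrightarrow> poly (D i j) (X' (Suc (2 * i))) = - poly (E j i) (Y' (Suc (2 * j)))"
  shows "poly (D (Suc i) j) x * poly (E j (Suc i)) y / poly (E j (Suc i)) (Y' (Suc (2 * j))) =
    poly (D i j) x * poly (E j i) y / poly (E j i) (Y' (Suc (2 * j)))"
proof (cases "D i j = 0")
  case True
  then show ?thesis using row_bubbleD(2)[OF D s] by simp
next
  case False
  have eq: "D (Suc i) j = D i j" using row_bubbleD(2)[OF D s] .
  obtain i0 j0 where B: "is_block (d - 1) s (i0, j0) (i, j)"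
    using blocks s(1) unfolding covered_by_blocks_def by force
  have B': "is_block (d - 1) s (i0, j0) (Suc i, j)"
    using row_bubble_same_blocks[OF D mono(1) d s False] B by blast
  have nz: "poly (D i j) (X' (Suc (2 * k))) \<noteq> 0" for k
    using row_bubble_zero[OF D B mono(1) d] False mid_not_old by blast
  have "poly (E j i) (Y' (Suc (2 * j))) \<noteq> 0"
    using cen[OF s(1)] nz by (metis neg_equal_0_iff_equal)
  moreover have "poly (E j (Suc i)) (Y' (Suc (2 * j))) \<noteq> 0"
    using cen[OF s(2)] nz eq by (metis neg_equal_0_iff_equal)
  moreover define Z where "Z = Y ` {j0 + of_bool C..j0 + (d - 1) - of_bool C}"
  moreover have "card Z = d - 2 * of_bool C"
    unfolding Z_def using d
    by (subst card_image) (auto intro!: inj_on_subset[OF strict_mono_imp_inj_on[OF mono(2)]])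
  moreover have "k + of_bool C \<le> j0 + (d - 1)" if "k \<le> j0 + (d - 1) - of_bool C" for k
    using that d by (cases C) auto
  then have "poly (E j i) z = 0 \<and> poly (E j (Suc i)) z = 0" if "z \<in> Z" for z
    using that row_bubble_root[OF E is_block_converse[THEN iffD2, OF B]]
      row_bubble_root[OF E is_block_converse[THEN iffD2, OF B']] by (auto simp: Z_def)
  moreover have "Y' (Suc (2 * j)) \<notin> Z" using mid_not_old by (auto simp: Z_def)
  ultimately have "poly (E j (Suc i)) y / poly (E j (Suc i)) (Y' (Suc (2 * j))) =
      poly (E j i) y / poly (E j i) (Y' (Suc (2 * j)))"
    using row_bubbleD(1)[OF E] by (intro proportional[of _ "mesh_degree C d" _ Z]) (auto simp: mesh_degree_def)
  then show ?thesis by (simp add: eq flip: times_divide_eq_right)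
qed

text \<open>The correction is the product of the two bubbles, normalised so that its factor in
  \<open>y\<close> is 1 on the middle line of the cell. It therefore restores \<open>P\<close>
  there, and it leaves the traces on the old lines unchanged, where \<open>E\<close>
  vanishes.\<close>

lemma row_match_refined:
  assumes dp: "dual_pair C d H' V' X' Y' P Q"
    and F: "bipoly_on_cells C d X Y s (\<lambda>i j. P (2 * i) (2 * j)) (\<lambda>i j. Q (2 * i) (2 * j)) F"
    and s': "\<And>a b. (a, b) \<in> s' \<Longrightarrow> (a div 2, b div 2) \<in> s"
    and D: "row_bubble C d s X D" and E: "row_bubble C d (s\<inverse>) Y E"
    and D_eq: "\<And>i j x. (i, j) \<in> s \<Longrightarrow>
      poly (D i j) x = poly (P (Suc (2 * i)) (Suc (2 * j))) x - F i j x (Y' (Suc (2 * j)))"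
    and cen: "\<And>i j. (i, j) \<in> s \<Longrightarrow> poly (D i j) (X' (Suc (2 * i))) = - poly (E j i) (Y' (Suc (2 * j)))"
  shows "row_match C s' Y' P (\<lambda>a b x y. F (a div 2) (b div 2) x y +
    poly (D (a div 2) (b div 2)) x * poly (E (b div 2) (a div 2)) y /
    poly (E (b div 2) (a div 2)) (Y' (Suc (2 * (b div 2)))))" (is "row_match C s' Y' P ?G")
proof -
  note st = dual_pair_step[OF dp]
  have old: "poly (P a (2 * k)) x = poly (P (2 * i) (2 * k)) x"
    if "(i, j) \<in> s" "i = a div 2" "k = j \<or> k = Suc j" for a i j k x
  proof -
    have "P (Suc (2 * i)) (2 * k) = P (2 * i) (2 * k)"
      using that edges by (intro st(1)) (auto simp: refine_h_def)
    moreover have "a = 2 * i \<or> a = Suc (2 * i)" using that(2) by presburger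
    ultimately show ?thesis by auto
  qed
  have new: "poly (P a (Suc (2 * j))) x = F i j x (Y' (Suc (2 * j))) +
      poly (D i j) x * poly (E j i) (Y' (Suc (2 * j))) / poly (E j i) (Y' (Suc (2 * j)))"
    if "(i, j) \<in> s" "i = a div 2" for a i j x
  proof -
    have "P (Suc (2 * i)) (Suc (2 * j)) = P (2 * i) (Suc (2 * j))"
      using that by (intro st(1)) (auto simp: refine_h_def)
    moreover have "a = 2 * i \<or> a = Suc (2 * i)" using that(2) by presburger
    ultimately have P: "P a (Suc (2 * j)) = P (Suc (2 * i)) (Suc (2 * j))" by auto
    \<comment> \<open>If the normalising value is zero, then by \<open>cen\<close> the bubble
      \<open>D\<close> has a root at the middle of the cell, which is no old grid line. So
      \<open>D\<close> is zero, and the value 0 of a division by zero is the right one.\<close>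
    have "D i j = 0" if z: "poly (E j i) (Y' (Suc (2 * j))) = 0"
    proof -
      obtain i0 j0 where B: "is_block (d - 1) s (i0, j0) (i, j)"
        using blocks \<open>(i, j) \<in> s\<close> unfolding covered_by_blocks_def by force
      have "poly (D i j) (X' (Suc (2 * i))) = 0" using cen \<open>(i, j) \<in> s\<close> z by simp
      then show ?thesis using row_bubble_zero[OF D B mono(1) d] mid_not_old by blast
    qed
    then show ?thesis using D_eq[OF that(1), of x] P by (cases "poly (E j i) (Y' (Suc (2 * j))) = 0") auto
  qed
  have Fold: "poly (P (2 * i) (2 * j)) x = F i j x (Y j)" if "(i, j) \<in> s" "C \<longrightarrow> 0 < j \<and> (i, j - 1) \<in> s" for i j x
    using F that unfolding bipoly_on_cells_def row_match_def by auto
  have Fold': "poly (P (2 * i) (2 * Suc j)) x = F i j x (Y (Suc j))" if "(i, j) \<in> s" "C \<longrightarrow> (i, Suc j) \<in> s" for i j x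
    using F that unfolding bipoly_on_cells_def row_match_def by auto
  have E0: "poly (E j i) (Y j) = 0" if "(i, j) \<in> s" "C \<longrightarrow> 0 < j \<and> (i, j - 1) \<in> s" for i j
    using row_bubbleD(4)[OF E, of j i] row_bubbleD(2,3)[OF E, of "j - 1" i] that by (cases C) auto
  have E1: "poly (E j i) (Y (Suc j)) = 0" if "(i, j) \<in> s" "C \<longrightarrow> (i, Suc j) \<in> s" for i j
    using row_bubbleD(5)[OF E, of j i] row_bubbleD(3)[OF E, of j i] that by (cases C) auto
  show ?thesis
    unfolding row_match_def
  proof (intro allI impI conjI)
    fix a b x
    assume ab: "(a, b) \<in> s'" and low: "C \<longrightarrow> 0 < b \<and> (a, b - 1) \<in> s'"
    define i j where ij: "i = a div 2" "j = b div 2"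
    have s: "(i, j) \<in> s" using s'[OF ab] ij by simp
    show "poly (P a b) x = ?G a b x (Y' b)"
    proof (cases "even b")
      case True
      then have b: "b = 2 * j" by (simp add: ij)
      have "C \<longrightarrow> 0 < j \<and> (i, j - 1) \<in> s"
      proof
        assume C
        then have "(a, b - 1) \<in> s'" "0 < b" using low by auto
        moreover have "(2 * j - 1) div 2 = j - 1" by presburger
        ultimately show "0 < j \<and> (i, j - 1) \<in> s"
          using s'[of a "b - 1"] by (simp add: b flip: ij(1))
      qed
      then have "poly (P (2 * i) (2 * j)) x = F i j x (Y j)" "poly (E j i) (Y j) = 0"
        using Fold[OF s] E0[OF s] by blast+
      then show ?thesis using old[OF s ij(1), of j x] by (simp add: b double flip: ij(1))
    next
      case False
      then have b: "b = Suc (2 * j)" by (simp add: ij)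
      show ?thesis using new[OF s ij(1), of x] by (simp add: b flip: ij(1))
    qed
  next
    fix a b x
    assume ab: "(a, b) \<in> s'" and up: "C \<longrightarrow> (a, Suc b) \<in> s'"
    define i j where ij: "i = a div 2" "j = b div 2"
    have s: "(i, j) \<in> s" using s'[OF ab] ij by simp
    show "poly (P a (Suc b)) x = ?G a b x (Y' (Suc b))"
    proof (cases "even b")
      case True
      then have b: "b = 2 * j" by (simp add: ij)
      show ?thesis using new[OF s ij(1), of x] by (simp add: b flip: ij(1))
    next
      case False
      then have b: "b = Suc (2 * j)" by (simp add: ij)
      have "C \<longrightarrow> (i, Suc j) \<in> s" using up s'[of a "Suc b"] by (simp add: b flip: ij(1))
      then have "poly (P (2 * i) (2 * Suc j)) x = F i j x (Y (Suc j))" "poly (E j i) (Y (Suc j)) = 0"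
        using Fold'[OF s] E1[OF s] by blast+
      then show ?thesis using old[OF s ij(1), of "Suc j" x] by (simp add: b double_Suc flip: ij(1))
    qed
  qed
qed

end


context refinement begin

lemma row_match_cong:
  assumes "row_match C' t Z P F" "\<And>i j. (i, j) \<in> t \<Longrightarrow> F i j = G i j"
  shows "row_match C' t Z P G"
  using assms unfolding row_match_def by auto

text \<open>The relation at a cell centre says that the horizontal bubble and the negative of the
  vertical one have the same value there. Consequently a single product restricts to the horizontal
  bubble on one middle line and to the negative of the vertical bubble on the other, and adding it
  to \<open>F\<close> corrects both \<open>P\<close> and \<open>Q\<close>.\<close>

theorem dual_bipoly_refine:
  assumes db: "dual_bipoly C d H V X Y s" and s': "\<And>a b. (a, b) \<in> s' \<Longrightarrow> (a div 2, b div 2) \<in> s"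
  shows "dual_bipoly C d H' V' X' Y' s'"
  unfolding dual_bipoly_def
proof (intro allI impI)
  fix P Q assume dp: "dual_pair C d H' V' X' Y' P Q"
  obtain F where F: "bipoly_on_cells C d X Y s (\<lambda>i j. P (2 * i) (2 * j)) (\<lambda>i j. Q (2 * i) (2 * j)) F"
    using db dual_pair_coarse[OF dp] unfolding dual_bipoly_def by blast
  obtain D where D: "row_bubble C d s X D" "\<And>i j x. (i, j) \<in> s \<Longrightarrow>
      poly (D i j) x = poly (P (Suc (2 * i)) (Suc (2 * j))) x - F i j x (Y' (Suc (2 * j)))"
    using row_bubble_exists[OF dp F] by blast
  note sw = refinement.row_bubble_exists[OF swap, unfolded refine_swap[of V s] refine_swap[of H s]]
  have dp': "dual_pair C d (\<lambda>i j. V' j i) (\<lambda>i j. H' j i) Y' X' (\<lambda>i j. Q j i) (\<lambda>i j. P j i)"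
    by (rule dual_pair_swap[OF dp])
  have F': "bipoly_on_cells C d Y X (s\<inverse>) (\<lambda>i j. Q (2 * j) (2 * i)) (\<lambda>i j. P (2 * j) (2 * i)) (\<lambda>j i y x. - F i j x y)"
    by (rule bipoly_on_cells_swap[OF F])
  obtain E where E: "row_bubble C d (s\<inverse>) Y E" "\<And>i j y. (i, j) \<in> s \<Longrightarrow>
      poly (E j i) y = poly (Q (Suc (2 * i)) (Suc (2 * j))) y - - F i j (X' (Suc (2 * i))) y"
    using sw[OF dp' F'] by auto
  have cen: "poly (D i j) (X' (Suc (2 * i))) = - poly (E j i) (Y' (Suc (2 * j)))" if "(i, j) \<in> s" for i j
    using dual_pair_step(5)[OF dp, of "Suc (2 * i)" "Suc (2 * j)"] nodes_simps(2)[of i j] D(2) E(2) that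
    by simp
  define B where "B i j x y = poly (D i j) x * poly (E j i) y / poly (E j i) (Y' (Suc (2 * j)))" for i j x y
  define G where "G a b x y = F (a div 2) (b div 2) x y + B (a div 2) (b div 2) x y" for a b x y
  \<comment> \<open>The same product normalised by \<open>D\<close> instead of \<open>E\<close>; by
    \<open>cen\<close> the two normalising values differ only in sign. In this form the statements
    for the transposed mesh apply.\<close>
  have B_eq: "B i j x y = - (poly (E j i) y * poly (D i j) x / poly (D i j) (X' (Suc (2 * i))))"
    if "(i, j) \<in> s" for i j x y
    using cen[OF that] by (simp add: B_def mult.commute)
  have B_h: "B (Suc i) j = B i j" if "(i, j) \<in> s" "(Suc i, j) \<in> s" for i j
    using bubble_adjacent[OF D(1) E(1) that cen] by (auto simp: B_def fun_eq_iff)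
  have cen': "poly (E i j) (Y' (Suc (2 * i))) = - poly (D j i) (X' (Suc (2 * j)))"
    if "(i, j) \<in> s\<inverse>" for i j
    using cen that by simp
  have D': "row_bubble C d ((s\<inverse>)\<inverse>) X D" using D(1) by simp
  have B_v: "B i (Suc j) = B i j" if "(i, j) \<in> s" "(i, Suc j) \<in> s" for i j
    using refinement.bubble_adjacent[OF swap E(1) D' _ _ cen', of j i] that
    by (auto simp: B_eq fun_eq_iff)
  have Fh: "F (Suc i) j = F i j" if "(i, j) \<in> s" "(Suc i, j) \<in> s" for i j
    using F that by (simp add: bipoly_on_cells_def)
  have Fv: "F i (Suc j) = F i j" if "(i, j) \<in> s" "(i, Suc j) \<in> s" for i j
    using F that by (simp add: bipoly_on_cells_def)
  have "bipoly_on_cells C d X' Y' s' P Q G"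
    unfolding bipoly_on_cells_def
  proof (intro conjI allI impI)
    fix a b assume ab: "(a, b) \<in> s'"
    have "bipoly (mesh_degree C d) (F (a div 2) (b div 2))"
      using F s'[OF ab] by (simp add: bipoly_on_cells_def)
    then show "bipoly (mesh_degree C d) (G a b)"
      unfolding G_def B_def
      by (rule bipoly_add_prod) (use row_bubbleD(1)[OF D(1)] row_bubbleD(1)[OF E(1)] in auto)
    show "G (Suc a) b = G a b" if "(Suc a, b) \<in> s'"
    proof -
      have "Suc a div 2 = a div 2 \<or> Suc a div 2 = Suc (a div 2)" by presburger
      then show ?thesis
        using s'[OF ab] s'[OF that] Fh[of "a div 2" "b div 2"] B_h[of "a div 2" "b div 2"]
        by (auto simp: G_def fun_eq_iff)
    qed
    show "G a (Suc b) = G a b" if "(a, Suc b) \<in> s'"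
    proof -
      have "Suc b div 2 = b div 2 \<or> Suc b div 2 = Suc (b div 2)" by presburger
      then show ?thesis
        using s'[OF ab] s'[OF that] Fv[of "a div 2" "b div 2"] B_v[of "a div 2" "b div 2"]
        by (auto simp: G_def fun_eq_iff)
    qed
  next
    show "row_match C s' Y' P G"
      using row_match_refined[OF dp F s' D(1) E(1) D(2) cen] by (simp add: G_def[abs_def] B_def)
  next
    note rm = refinement.row_match_refined[OF swap, unfolded refine_swap[of V s] refine_swap[of H s],
        OF dp' F' _ E(1) D', where s' = "s'\<inverse>"]
    have "row_match C (s'\<inverse>) X' (\<lambda>i j. Q j i) (\<lambda>a b x y. - F (b div 2) (a div 2) y x +
        poly (E (a div 2) (b div 2)) x * poly (D (b div 2) (a div 2)) y /
        poly (D (b div 2) (a div 2)) (X' (Suc (2 * (b div 2)))))"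
      by (rule rm) (use s' E(2) cen in auto)
    then show "row_match C (s'\<inverse>) X' (\<lambda>j i. Q i j) (\<lambda>j i y x. - G i j x y)"
      by (rule row_match_cong) (use s' B_eq in \<open>auto simp: G_def fun_eq_iff\<close>)
  qed
  then show "\<exists>G. bipoly_on_cells C d X' Y' s' P Q G" by blast
qed

end

section \<open>Base case: the dual space of a tensor product mesh\<close>

lemma lagrange_basis:
  fixes y :: "nat \<Rightarrow> real"
  assumes "finite K" "inj_on y K"
  shows "\<exists>L. \<forall>j\<in>K. degree (L j) \<le> card K - 1 \<and> (\<forall>k\<in>K. poly (L j) (y k) = of_bool (k = j))"
proof -
  define L where "L j = (\<Prod>k\<in>K - {j}. smult (1 / (y j - y k)) [:- y k, 1:])" for j
  have "degree (L j) \<le> card K - 1 \<and> (\<forall>k\<in>K. poly (L j) (y k) = of_bool (k = j))" if "j \<in> K" for j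
  proof
    have "degree (L j) \<le> (\<Sum>k\<in>K - {j}. degree (smult (1 / (y j - y k)) [:- y k, 1:]))"
      unfolding L_def by (rule order_trans[OF degree_prod_sum_le]) (use assms in auto)
    also have "\<dots> \<le> (\<Sum>k\<in>K - {j}. 1)" by (rule sum_mono) auto
    finally show "degree (L j) \<le> card K - 1" using assms that by simp
    show "\<forall>k\<in>K. poly (L j) (y k) = of_bool (k = j)"
    proof
      fix k assume "k \<in> K"
      show "poly (L j) (y k) = of_bool (k = j)"
      proof (cases "k = j")
        case True
        have "poly (L j) (y j) = (\<Prod>k\<in>K - {j}. 1)"
          unfolding L_def poly_prod using assms that
          by (intro prod.cong) (auto simp: inj_on_def divide_simps)
        then show ?thesis using True by simp
      next
        case False
        then show ?thesis
          unfolding L_def poly_prod using assms \<open>k \<in> K\<close> by (auto intro!: bexI[of _ k])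
      qed
    qed
  qed
  then show ?thesis by blast
qed

definition tensor_h :: "nat \<Rightarrow> nat \<Rightarrow> nat \<Rightarrow> nat \<Rightarrow> bool" where
  "tensor_h m n a b \<longleftrightarrow> a < m \<and> b \<le> n"

definition tensor_v :: "nat \<Rightarrow> nat \<Rightarrow> nat \<Rightarrow> nat \<Rightarrow> bool" where
  "tensor_v m n a b \<longleftrightarrow> a \<le> m \<and> b < n"

text \<open>On a full grid \<open>P\<close> depends only on the row and \<open>Q\<close> only on the
  column. Interpolating \<open>P\<close> on \<open>r + 1\<close> rows defines \<open>F\<close>. The
  relations at the nodes of these rows identify each \<open>Q\<close> with a trace of
  \<open>- F\<close>, and then the relations on more than \<open>r\<close> columns identify
  \<open>P\<close> with \<open>F\<close> on the remaining rows.\<close>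

lemma dual_bipoly_tensor:
  assumes d: "d \<ge> 2" and X: "strict_mono X" and Y: "strict_mono Y" and mn: "d < m" "d < n"
    and s: "\<And>i j. (i, j) \<in> s \<Longrightarrow> 0 < i \<and> Suc i < m \<and> 0 < j \<and> Suc j < n"
  shows "dual_bipoly C d (tensor_h m n) (tensor_v m n) X Y s"
  unfolding dual_bipoly_def
proof (intro allI impI)
  fix P Q assume dp: "dual_pair C d (tensor_h m n) (tensor_v m n) X Y P Q"
  define r where "r = mesh_degree C d"
  \<comment> \<open>The first line with admissible nodes: on the CVR graph the boundary lines of the
    mesh carry no cross-vertices.\<close>
  define l where "l = (of_bool C :: nat)"
  have lr: "l + r < m - l" "l + r < n - l"
    using mn d by (cases C; simp add: l_def r_def mesh_degree_def)+
  have deg: "degree (P a b) \<le> r" "degree (Q a b) \<le> r" for a b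
    using dp by (auto simp: dual_pair_def edge_polys_def r_def)
  have Pc: "P a b = P 0 b" if "a \<le> m" "b \<le> n" for a b
    using that(1)
  proof (induction a)
    case (Suc a)
    then show ?case using dp that(2) by (auto simp: dual_pair_def edge_polys_def tensor_h_def)
  qed simp
  have Qc: "Q a b = Q a 0" if "b \<le> n" "a \<le> m" for a b
    using that(1)
  proof (induction b)
    case (Suc b)
    then show ?case using dp that(2) by (auto simp: dual_pair_def edge_polys_def tensor_v_def)
  qed simp
  have node: "poly (P 0 b) (X a) + poly (Q a 0) (Y b) = 0"
    if "l \<le> a" "a \<le> m - l" "l \<le> b" "b \<le> n - l" for a b
  proof -
    have "(a, b) \<in> nodes C (tensor_h m n) (tensor_v m n)"
      using that lr by (auto simp: nodes_def cross_nodes_def tensor_h_def tensor_v_def l_def)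
    then have "poly (P a b) (X a) + poly (Q a b) (Y b) = 0" using dp by (simp add: dual_pair_def)
    then show ?thesis using Pc[of a b] Qc[of b a] that by simp
  qed
  define K where "K = {l..l + r}"
  have injY: "inj_on Y A" and injX: "inj_on X A" for A
    using X Y strict_mono_imp_inj_on inj_on_subset by blast+
  obtain L where "\<forall>j\<in>K. degree (L j) \<le> card K - 1 \<and> (\<forall>k\<in>K. poly (L j) (Y k) = of_bool (k = j))"
    using lagrange_basis[OF _ injY, of K] by (auto simp: K_def)
  then have L: "\<And>j. j \<in> K \<Longrightarrow> degree (L j) \<le> r"
    "\<And>j k. j \<in> K \<Longrightarrow> k \<in> K \<Longrightarrow> poly (L j) (Y k) = of_bool (k = j)"
    by (simp_all add: K_def)
  define F where "F x y = (\<Sum>j\<in>K. poly (P 0 j) x * poly (L j) y)" for x y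
  have Fx: "F x y = poly (\<Sum>j\<in>K. smult (poly (L j) y) (P 0 j)) x" for x y
    by (simp add: F_def poly_sum mult.commute)
  have Fy: "F x y = poly (\<Sum>j\<in>K. smult (poly (P 0 j) x) (L j)) y" for x y
    by (simp add: F_def poly_sum)
  have degx: "degree (\<Sum>j\<in>K. smult (poly (L j) y) (P 0 j)) \<le> r" for y
    by (rule degree_sum_le) (use deg order_trans[OF degree_smult_le] in \<open>auto simp: K_def\<close>)
  have degy: "degree (\<Sum>j\<in>K. smult (poly (P 0 j) x) (L j)) \<le> r" for x
    by (rule degree_sum_le) (use L(1) order_trans[OF degree_smult_le] in \<open>auto simp: K_def\<close>)
  have bip: "bipoly r F"
    by (rule bipolyI) (use Fx Fy degx degy in blast)+
  have QF: "poly (Q i 0) y = - F (X i) y" if i: "l \<le> i" "i \<le> m - l" for i y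
  proof -
    have "Q i 0 + (\<Sum>j\<in>K. smult (poly (P 0 j) (X i)) (L j)) = 0"
    proof (rule poly_zero_if_many_roots)
      show "degree (Q i 0 + (\<Sum>j\<in>K. smult (poly (P 0 j) (X i)) (L j))) \<le> r"
        by (intro degree_add_le deg degy)
      show "r < card (Y ` K)" by (subst card_image[OF injY]) (simp add: K_def)
      show "finite (Y ` K)" by (simp add: K_def)
      fix z assume "z \<in> Y ` K"
      then obtain k where k: "k \<in> K" "z = Y k" by auto
      have kl: "l \<le> k" "k \<le> n - l" using k lr by (simp_all add: K_def)
      have "F (X i) (Y k) = (\<Sum>j\<in>K. if j = k then poly (P 0 k) (X i) else 0)"
        unfolding F_def by (rule sum.cong) (use L(2) k in auto)
      also have "\<dots> = poly (P 0 k) (X i)" using k by (simp add: K_def)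
      finally show "poly (Q i 0 + (\<Sum>j\<in>K. smult (poly (P 0 j) (X i)) (L j))) z = 0"
        using node[OF i kl] k(2) by (simp flip: Fy)
    qed
    then have "poly (Q i 0) y + poly (\<Sum>j\<in>K. smult (poly (P 0 j) (X i)) (L j)) y = 0"
      by (metis poly_add poly_0)
    then show ?thesis by (simp flip: Fy)
  qed
  have PF: "poly (P 0 j) x = F x (Y j)" if j: "l \<le> j" "j \<le> n - l" for j x
  proof -
    have "P 0 j - (\<Sum>k\<in>K. smult (poly (L k) (Y j)) (P 0 k)) = 0"
    proof (rule poly_zero_if_many_roots)
      show "degree (P 0 j - (\<Sum>k\<in>K. smult (poly (L k) (Y j)) (P 0 k))) \<le> r"
        by (intro degree_diff_le deg degx)
      show "r < card (X ` {l..m - l})" by (subst card_image[OF injX]) (use lr in simp)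
      show "finite (X ` {l..m - l})" by simp
      fix z assume "z \<in> X ` {l..m - l}"
      then obtain i where i: "l \<le> i" "i \<le> m - l" "z = X i" by auto
      show "poly (P 0 j - (\<Sum>k\<in>K. smult (poly (L k) (Y j)) (P 0 k))) z = 0"
        using node[OF i(1,2) j] QF[OF i(1,2), of "Y j"] i(3) by (simp flip: Fx)
    qed
    then have "poly (P 0 j) x - poly (\<Sum>k\<in>K. smult (poly (L k) (Y j)) (P 0 k)) x = 0"
      by (metis poly_diff poly_0)
    then show ?thesis by (simp flip: Fx)
  qed
  have l1: "l \<le> 1" by (simp add: l_def)
  have "poly (P i j) x = F x (Y j)" "poly (P i (Suc j)) x = F x (Y (Suc j))"
    "poly (Q i j) y = - F (X i) y" "poly (Q (Suc i) j) y = - F (X (Suc i)) y"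
    if "(i, j) \<in> s" for i j x y
    using s[OF that] l1 Pc[of i j] Pc[of i "Suc j"] Qc[of j i] Qc[of j "Suc i"]
      PF[of j x] PF[of "Suc j" x] QF[of i y] QF[of "Suc i" y] by auto
  then have "bipoly_on_cells C d X Y s P Q (\<lambda>i j. F)"
    using bip unfolding bipoly_on_cells_def row_match_def r_def by auto
  then show "\<exists>F. bipoly_on_cells C d X Y s P Q F" by blast
qed


subsection \<open>Spaces of spline coefficients\<close>

text \<open>\<open>R\<close> and \<open>S\<close> select the rows and columns whose conditions are
  imposed. All of them are used for splines, only the odd ones for the coefficients at new
  nodes.\<close>

definition coeff_space :: "nat \<Rightarrow> (nat \<Rightarrow> nat \<Rightarrow> bool) \<Rightarrow> (nat \<Rightarrow> nat \<Rightarrow> bool) \<Rightarrow> (nat \<Rightarrow> real) \<Rightarrow> (nat \<Rightarrow> real)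
    \<Rightarrow> (nat \<times> nat) set \<Rightarrow> nat set \<Rightarrow> nat set \<Rightarrow> (nat \<times> nat \<Rightarrow> real) set" where
  "coeff_space r H V X Y N R S = {c. (\<forall>b\<in>R. moments r (\<lambda>a. H a b) X (\<lambda>a. c (a, b))) \<and>
     (\<forall>a\<in>S. moments r (V a) Y (\<lambda>b. c (a, b))) \<and> (\<forall>v. v \<notin> N \<longrightarrow> c v = 0)}"

definition bounded_edges :: "nat \<Rightarrow> (nat \<Rightarrow> nat \<Rightarrow> bool) \<Rightarrow> (nat \<Rightarrow> nat \<Rightarrow> bool) \<Rightarrow> bool" where
  "bounded_edges M H V \<longleftrightarrow> (\<forall>a b. H a b \<longrightarrow> a < M \<and> b \<le> M) \<and> (\<forall>a b. V a b \<longrightarrow> a \<le> M \<and> b < M)"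

text \<open>All linear combinations of the imposed conditions. In contrast to
  \<open>dual_pair\<close> nothing is required at the nodes; the cut-off beyond \<open>M\<close>
  keeps the sums finite.\<close>

definition dual_family :: "nat \<Rightarrow> (nat \<Rightarrow> nat \<Rightarrow> bool) \<Rightarrow> (nat \<Rightarrow> nat \<Rightarrow> bool) \<Rightarrow> nat \<Rightarrow> nat set \<Rightarrow> nat set
    \<Rightarrow> (nat \<Rightarrow> nat \<Rightarrow> real poly) \<Rightarrow> (nat \<Rightarrow> nat \<Rightarrow> real poly) \<Rightarrow> bool" where
  "dual_family r H V M R S P Q \<longleftrightarrow>
     (\<forall>b\<in>R. edge_polys r (\<lambda>a. H a b) (\<lambda>a. P a b)) \<and> (\<forall>a b. b \<notin> R \<longrightarrow> P a b = 0) \<and>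
     (\<forall>a\<in>S. edge_polys r (V a) (Q a)) \<and> (\<forall>a b. a \<notin> S \<longrightarrow> Q a b = 0) \<and>
     (\<forall>a b. \<not> (a \<le> M \<and> b \<le> M) \<longrightarrow> P a b = 0 \<and> Q a b = 0)"

lemma subspace_coeff_space: "fun_space.subspace (coeff_space r H V X Y N R S)"
  by (rule fun_subspaceI) (auto simp: coeff_space_def intro: moments_add moments_cmult)

lemma dual_family_add:
  assumes "dual_family r H V M R S P Q" "dual_family r H V M R S P' Q'"
  shows "dual_family r H V M R S (\<lambda>a b. P a b + P' a b) (\<lambda>a b. Q a b + Q' a b)"
  using assms unfolding dual_family_def by (auto intro: edge_polys_add)

lemma dual_family_smult:
  assumes "dual_family r H V M R S P Q"
  shows "dual_family r H V M R S (\<lambda>a b. smult k (P a b)) (\<lambda>a b. smult k (Q a b))"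
  using assms unfolding dual_family_def by (auto intro: edge_polys_smult)

text \<open>The Fredholm alternative for coefficients. The values outside \<open>V0\<close> are
  prescribed, those on \<open>V0\<close> are sought, and the only obstructions are the combinations
  of conditions that do not involve \<open>V0\<close>.\<close>

lemma coeff_extend:
  assumes be: "bounded_edges M H V" and V0: "V0 \<subseteq> {..M} \<times> {..M}"
    and c: "\<And>v. v \<notin> {..M} \<times> {..M} \<Longrightarrow> c v = 0"
    and orth: "\<And>P Q. dual_family r H V M R S P Q \<Longrightarrow>
      (\<And>a b. (a, b) \<in> V0 \<Longrightarrow> poly (P a b) (X a) + poly (Q a b) (Y b) = 0) \<Longrightarrow>
      (\<Sum>a\<le>M. \<Sum>b\<le>M. c (a, b) * (poly (P a b) (X a) + poly (Q a b) (Y b))) = 0"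
  shows "\<exists>c'. (\<forall>v. v \<notin> V0 \<longrightarrow> c' v = c v) \<and> (\<forall>b\<in>R. moments r (\<lambda>a. H a b) X (\<lambda>a. c' (a, b))) \<and>
    (\<forall>a\<in>S. moments r (V a) Y (\<lambda>b. c' (a, b)))"
proof -
  define \<phi> where "\<phi> P Q = (\<lambda>(a, b). poly (P a b) (X a) + poly (Q a b) (Y b))" for P Q
  define \<Phi> where "\<Phi> = {\<phi> P Q | P Q. dual_family r H V M R S P Q}"
  have sum_eq: "(\<Sum>v\<in>{..M} \<times> {..M}. e v * \<phi> P Q v) =
      (\<Sum>a\<le>M. \<Sum>b\<le>M. e (a, b) * (poly (P a b) (X a) + poly (Q a b) (Y b)))" for e P Q
    by (simp add: sum.cartesian_product \<phi>_def case_prod_beta)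
  have "\<exists>c'. (\<forall>v. v \<notin> V0 \<longrightarrow> c' v = c v) \<and> (\<forall>f\<in>\<Phi>. (\<Sum>v\<in>{..M} \<times> {..M}. c' v * f v) = 0)"
  proof (rule annihilator_extend)
    fix f g assume "f \<in> \<Phi>" "g \<in> \<Phi>"
    then obtain P Q P' Q' where *: "f = \<phi> P Q" "g = \<phi> P' Q'"
        "dual_family r H V M R S P Q" "dual_family r H V M R S P' Q'"
      by (auto simp: \<Phi>_def)
    then have "(\<lambda>v. f v + g v) = \<phi> (\<lambda>a b. P a b + P' a b) (\<lambda>a b. Q a b + Q' a b)"
      by (auto simp: \<phi>_def fun_eq_iff)
    then show "(\<lambda>v. f v + g v) \<in> \<Phi>" using dual_family_add[OF *(3,4)] by (auto simp: \<Phi>_def)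
  next
    fix k f assume "f \<in> \<Phi>"
    then obtain P Q where *: "f = \<phi> P Q" "dual_family r H V M R S P Q"
      by (auto simp: \<Phi>_def)
    then have "(\<lambda>v. k * f v) = \<phi> (\<lambda>a b. smult k (P a b)) (\<lambda>a b. smult k (Q a b))"
      by (auto simp: \<phi>_def fun_eq_iff algebra_simps)
    then show "(\<lambda>v. k * f v) \<in> \<Phi>" using dual_family_smult[OF *(2)] by (auto simp: \<Phi>_def)
  next
    fix f assume "f \<in> \<Phi>" and f0: "\<forall>v\<in>V0. f v = 0"
    then obtain P Q where *: "f = \<phi> P Q" "dual_family r H V M R S P Q"
      by (auto simp: \<Phi>_def)
    show "(\<Sum>v\<in>{..M} \<times> {..M}. c v * f v) = 0"
      unfolding *(1) sum_eq using f0 * by (intro orth) (auto simp: \<phi>_def)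
  qed (use V0 in auto)
  then obtain c' where c': "\<forall>v. v \<notin> V0 \<longrightarrow> c' v = c v" "\<forall>f\<in>\<Phi>. (\<Sum>v\<in>{..M} \<times> {..M}. c' v * f v) = 0"
    by auto
  have c'0: "c' v = 0" if "v \<notin> {..M} \<times> {..M}" for v
    using c'(1) c[OF that] V0 that by (metis subsetD)
  have orth': "(\<Sum>a\<le>M. \<Sum>b\<le>M. c' (a, b) * (poly (P a b) (X a) + poly (Q a b) (Y b))) = 0"
    if "dual_family r H V M R S P Q" for P Q
    using c'(2) that unfolding sum_eq[symmetric] \<Phi>_def by blast
  have "moments r (\<lambda>a. H a b) X (\<lambda>a. c' (a, b))" if b: "b \<in> R" for b
  proof (rule momentsI[where m = M])
    fix p assume p: "edge_polys r (\<lambda>a. H a b) p"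
    define P where "P a b' = (if b' = b \<and> a \<le> M \<and> b \<le> M then p a else 0)" for a b'
    have "dual_family r H V M R S P (\<lambda>_ _. 0)"
      using p b be unfolding dual_family_def bounded_edges_def edge_polys_def P_def by fastforce
    from orth'[OF this] have "(\<Sum>a\<le>M. \<Sum>b'\<le>M. c' (a, b') * poly (P a b') (X a)) = 0" by simp
    also have "(\<Sum>a\<le>M. \<Sum>b'\<le>M. c' (a, b') * poly (P a b') (X a)) =
        (\<Sum>a\<le>M. \<Sum>b'\<le>M. if b' = b then c' (a, b) * poly (p a) (X a) else 0)"
      by (intro sum.cong refl) (auto simp: P_def)
    also have "\<dots> = (\<Sum>a\<le>M. c' (a, b) * poly (p a) (X a))"
      by (intro sum.cong refl) (auto simp: c'0)
    finally show "(\<Sum>a\<le>M. c' (a, b) * poly (p a) (X a)) = 0" .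
  qed (simp add: c'0)
  moreover have "moments r (V a) Y (\<lambda>b. c' (a, b))" if a: "a \<in> S" for a
  proof (rule momentsI[where m = M])
    fix q assume q: "edge_polys r (V a) q"
    define Q where "Q a' b = (if a' = a \<and> a \<le> M \<and> b \<le> M then q b else 0)" for a' b
    have "dual_family r H V M R S (\<lambda>_ _. 0) Q"
      using q a be unfolding dual_family_def bounded_edges_def edge_polys_def Q_def by fastforce
    from orth'[OF this] have "(\<Sum>a'\<le>M. \<Sum>b\<le>M. c' (a', b) * poly (Q a' b) (Y b)) = 0" by simp
    also have "(\<Sum>a'\<le>M. \<Sum>b\<le>M. c' (a', b) * poly (Q a' b) (Y b)) =
        (\<Sum>b\<le>M. \<Sum>a'\<le>M. if a' = a then c' (a, b) * poly (q b) (Y b) else 0)"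
      by (subst sum.swap) (intro sum.cong refl, auto simp: Q_def)
    also have "\<dots> = (\<Sum>b\<le>M. c' (a, b) * poly (q b) (Y b))"
      by (intro sum.cong refl) (auto simp: c'0)
    finally show "(\<Sum>b\<le>M. c' (a, b) * poly (q b) (Y b)) = 0" .
  qed (simp add: c'0)
  ultimately show ?thesis using c'(1) by blast
qed

lemma coeff_space_bounded:
  assumes "bounded_edges M H V" "c \<in> coeff_space r H V X Y N UNIV UNIV" "(a, b) \<notin> {..M} \<times> {..M}"
  shows "c (a, b) = 0"
proof (cases "a \<le> M")
  case True
  have "moments r (\<lambda>a. H a b) X (\<lambda>a. c (a, b))" using assms by (auto simp: coeff_space_def)
  from moments_isolated[OF this, of a] True assms(1,3) show ?thesis
    by (auto simp: bounded_edges_def)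
next
  case False
  have "moments r (V a) Y (\<lambda>b. c (a, b))" using assms by (auto simp: coeff_space_def)
  from moments_isolated[OF this, of b] False assms(1) show ?thesis
    by (auto simp: bounded_edges_def)
qed

section \<open>Splitting the coefficients into those at old and those at new nodes\<close>

lemma sum_even_odd: "(\<Sum>a\<le>2 * M. f a) = (\<Sum>i\<le>M. f (2 * i)) + (\<Sum>i<M. f (Suc (2 * i)) :: real)"
  by (induction M) (auto simp: algebra_simps)

lemma sum_even_only:
  assumes "\<And>i. f (Suc (2 * i)) = (0::real)"
  shows "(\<Sum>a\<le>t. f a) = (\<Sum>i\<le>t div 2. f (2 * i))"
proof (induction t)
  case (Suc t)
  show ?case
  proof (cases "even t")
    case True
    then have "f (Suc t) = 0" "Suc t div 2 = t div 2" using assms[of "t div 2"] by auto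
    then show ?thesis using Suc by simp
  next
    case False
    then have "Suc t div 2 = Suc (t div 2)" "2 * (Suc t div 2) = Suc t" by presburger+
    then show ?thesis using Suc by simp
  qed
qed simp

text \<open>The two halves of an old edge are present or missing together, and a zero coefficient at
  their common node leaves the partial sum unchanged.\<close>

lemma moments_double:
  assumes "\<And>i. c (Suc (2 * i)) = 0" "\<And>i. X' (2 * i) = X i"
  shows "moments r (\<lambda>a. E (a div 2)) X' c \<longleftrightarrow> moments r E X (\<lambda>i. c (2 * i))"
proof -
  have *: "(\<Sum>a\<le>t. c a * X' a ^ k) = (\<Sum>i\<le>t div 2. c (2 * i) * X i ^ k)" for t k
    by (subst sum_even_only) (auto simp: assms)
  show ?thesis
    unfolding moments_def *
  proof (intro iffI allI impI)
    fix t k assume a: "\<forall>t. \<not> E (t div 2) \<longrightarrow> (\<forall>k\<le>r. (\<Sum>i\<le>t div 2. c (2 * i) * X i ^ k) = 0)" "\<not> E t" "k \<le> r"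
    have "2 * t div 2 = t" by simp
    with a show "(\<Sum>i\<le>t. c (2 * i) * X i ^ k) = 0" by metis
  qed auto
qed

definition odd_nodes :: "(nat \<times> nat) set" where
  "odd_nodes = {(a, b). odd a \<or> odd b}"

locale bounded_refinement = refinement +
  fixes M :: nat
  assumes bounded: "bounded_edges M H V"
begin

lemma s_bounded: "(i, j) \<in> s \<Longrightarrow> i < M \<and> j < M"
  using edges[of i j] bounded unfolding bounded_edges_def by blast

lemma bounded': "bounded_edges (2 * M) H' V'"
  unfolding bounded_edges_def
proof (intro conjI allI impI)
  fix a b
  { assume "H' a b"
    then have "a div 2 < M \<and> (if even b then b div 2 \<le> M else b div 2 < M)"
      using bounded s_bounded by (auto simp: refine_h_def bounded_edges_def split: if_splits)
    then show "a < 2 * M" "b \<le> 2 * M" by (auto split: if_splits) }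
  { assume "V' a b"
    then have "b div 2 < M \<and> (if even a then a div 2 \<le> M else a div 2 < M)"
      using bounded s_bounded by (auto simp: refine_v_def bounded_edges_def split: if_splits)
    then show "a \<le> 2 * M" "b < 2 * M" by (auto split: if_splits) }
qed

lemma new_coeffs_bounded:
  assumes row: "\<And>b. odd b \<Longrightarrow> moments k (\<lambda>a. H' a b) X' (\<lambda>a. u (a, b))"
    and col: "\<And>a. odd a \<Longrightarrow> moments k (V' a) Y' (\<lambda>b. u (a, b))"
    and u0: "\<And>v. v \<notin> odd_nodes \<Longrightarrow> u v = 0" and v: "v \<notin> {..2 * M} \<times> {..2 * M}"
  shows "u v = 0"
proof -
  obtain a b where ab: "v = (a, b)" by (cases v)
  consider "even a" "even b" | "odd a" | "odd b" by auto
  then show ?thesis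
  proof cases
    case 2
    have "V' a k \<Longrightarrow> a \<le> 2 * M \<and> k < 2 * M" for k
      using bounded' by (simp add: bounded_edges_def)
    from this[of b] this[of "b - 1"] have "\<not> V' a b" "\<not> V' a (b - 1)" using v ab by auto
    then show ?thesis using moments_isolated[OF col, of a b] 2 ab by simp
  next
    case 3
    have "H' k b \<Longrightarrow> k < 2 * M \<and> b \<le> 2 * M" for k
      using bounded' by (simp add: bounded_edges_def)
    from this[of a] this[of "a - 1"] have "\<not> H' a b" "\<not> H' (a - 1) b" using v ab by auto
    then show ?thesis using moments_isolated[OF row, of b a] 3 ab by simp
  qed (use u0 ab in \<open>auto simp: odd_nodes_def\<close>)
qed

lemma swap_bounded: "bounded_refinement d (\<lambda>i j. V j i) (\<lambda>i j. H j i) Y X Y' X' (s\<inverse>) M"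
  using swap bounded by (auto simp: bounded_refinement_def bounded_refinement_axioms_def bounded_edges_def)

end

locale dual_refinement = bounded_refinement +
  assumes dual_bipoly: "dual_bipoly C d H V X Y s"
begin

abbreviation "r \<equiv> mesh_degree C d"
abbreviation "N' \<equiv> nodes C H' V'"

definition new_space :: "(nat \<times> nat \<Rightarrow> real) set" where
  "new_space = coeff_space r H' V' X' Y' (N' \<inter> odd_nodes) {b. odd b} {a. odd a}"

text \<open>On a new column, the values of \<open>P\<close> at the old rows are values of
  \<open>F\<close>, read as a polynomial in \<open>y\<close> along this column. The column
  conditions on \<open>u\<close>, tested against that polynomial, trade the contributions at old
  rows for contributions at cell centres.\<close>

lemma half_sum:
  assumes F: "bipoly_on_cells C d X Y s (\<lambda>i j. P (2 * i) (2 * j)) Q F"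
    and P: "\<And>a b. H' a b \<Longrightarrow> P (Suc a) b = P a b"
    and u: "\<forall>a. odd a \<longrightarrow> moments r (V' a) Y' (\<lambda>b. u (a, b))" "\<And>v. v \<notin> N' \<Longrightarrow> u v = 0"
  shows "(\<Sum>i<M. \<Sum>j\<le>M. u (Suc (2 * i), 2 * j) * poly (P (Suc (2 * i)) (2 * j)) (X' (Suc (2 * i)))) =
    - (\<Sum>i<M. \<Sum>j<M. u (Suc (2 * i), Suc (2 * j)) *
        (if (i, j) \<in> s then F i j (X' (Suc (2 * i))) (Y' (Suc (2 * j))) else 0))"
proof -
  have "(\<Sum>j\<le>M. u (Suc (2 * i), 2 * j) * poly (P (Suc (2 * i)) (2 * j)) (X' (Suc (2 * i)))) =
    - (\<Sum>j<M. u (Suc (2 * i), Suc (2 * j)) *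
        (if (i, j) \<in> s then F i j (X' (Suc (2 * i))) (Y' (Suc (2 * j))) else 0))" for i
  proof -
    define x where "x = X' (Suc (2 * i))"
    have "\<exists>p. degree p \<le> r \<and> (\<forall>y. F i j x y = poly p y)" if "(i, j) \<in> s" for j
      using F that unfolding bipoly_on_cells_def bipoly_def by simp
    then obtain p where p: "\<And>j. (i, j) \<in> s \<Longrightarrow> degree (p j) \<le> r" "\<And>j y. (i, j) \<in> s \<Longrightarrow> F i j x y = poly (p j) y"
      by metis
    have p_Suc: "p (Suc j) = p j" if "(i, j) \<in> s" "(i, Suc j) \<in> s" for j
    proof -
      have "F i (Suc j) = F i j" using F that by (simp add: bipoly_on_cells_def)
      then have "poly (p (Suc j)) = poly (p j)" using p(2) that by (metis ext)
      then show ?thesis by (simp add: poly_eq_poly_eq_iff)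
    qed
    \<comment> \<open>At an old row either neighbouring cell may supply the polynomial; if both
      belong to \<open>s\<close>, the two polynomials agree.\<close>
    define q where "q b = (if (i, b div 2) \<in> s then p (b div 2)
        else if even b \<and> b > 0 \<and> (i, b div 2 - 1) \<in> s then p (b div 2 - 1) else 0)" for b
    have "edge_polys r (V' (Suc (2 * i))) q"
      unfolding edge_polys_def
    proof (intro conjI allI impI)
      show "degree (q b) \<le> r" for b using p(1) by (auto simp: q_def)
      fix b assume "V' (Suc (2 * i)) b"
      then have s: "(i, b div 2) \<in> s" by (simp add: refine_v_def)
      show "q (Suc b) = q b"
      proof (cases "even b")
        case True
        then show ?thesis using s by (simp add: q_def)
      next
        case False
        then have "Suc b div 2 = Suc (b div 2)" by simp
        then show ?thesis using s False p_Suc[OF s] by (auto simp: q_def)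
      qed
    qed
    moreover have "moments r (V' (Suc (2 * i))) Y' (\<lambda>b. u (Suc (2 * i), b))" using u(1) by simp
    moreover have "\<not> V' (Suc (2 * i)) (2 * M)" using bounded' by (auto simp: bounded_edges_def)
    ultimately have "(\<Sum>b\<le>2 * M. u (Suc (2 * i), b) * poly (q b) (Y' b)) = 0"
      by (intro moments_edge_polys)
    then have *: "(\<Sum>j\<le>M. u (Suc (2 * i), 2 * j) * poly (q (2 * j)) (Y' (2 * j))) =
      - (\<Sum>j<M. u (Suc (2 * i), Suc (2 * j)) * poly (q (Suc (2 * j))) (Y' (Suc (2 * j))))"
      by (simp add: sum_even_odd)
    have "u (Suc (2 * i), 2 * j) * poly (P (Suc (2 * i)) (2 * j)) x =
        u (Suc (2 * i), 2 * j) * poly (q (2 * j)) (Y' (2 * j))" for j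
    proof (cases "u (Suc (2 * i), 2 * j) = 0")
      case False
      then have N: "C \<longrightarrow> 0 < j \<and> (i, j - 1) \<in> s \<and> (i, j) \<in> s"
        using u(2) nodes_simps(3) by blast
      have "(i, j) \<in> s \<or> 0 < j \<and> (i, j - 1) \<in> s"
      proof (rule ccontr)
        assume n: "\<not> ?thesis"
        have "(2 * j - Suc 0) div 2 = j - 1" by presburger
        then have "u (Suc (2 * i), 2 * j) = 0"
          using n u(1) by (intro moments_isolated[of r "V' (Suc (2 * i))" Y' "\<lambda>b. u (Suc (2 * i), b)" "2 * j"])
            (auto simp: refine_v_def)
        with False show False by simp
      qed
      then show ?thesis
      proof
        assume s: "(i, j) \<in> s"
        have "P (Suc (2 * i)) (2 * j) = P (2 * i) (2 * j)"
          using edges[OF s] by (intro P) (simp add: refine_h_def)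
        moreover have "poly (P (2 * i) (2 * j)) x = F i j x (Y j)"
          using F s N unfolding bipoly_on_cells_def row_match_def by blast
        ultimately show ?thesis using s p(2) double by (simp add: q_def)
      next
        assume s: "0 < j \<and> (i, j - 1) \<in> s"
        then have e: "H i j" using edges[of i "j - 1"] by simp
        have "P (Suc (2 * i)) (2 * j) = P (2 * i) (2 * j)"
          using e by (intro P) (simp add: refine_h_def)
        moreover obtain k where k: "j = Suc k" using s by (cases j) auto
        then have "poly (P (2 * i) (2 * j)) x = F i (j - 1) x (Y j)"
          using F s N unfolding bipoly_on_cells_def row_match_def by simp
        moreover have "q (2 * j) = p (j - 1)"
          using s p_Suc[of "j - 1"] by (auto simp: q_def)
        ultimately show ?thesis using s p(2) double by simp
      qed
    qed simp
    then have "(\<Sum>j\<le>M. u (Suc (2 * i), 2 * j) * poly (P (Suc (2 * i)) (2 * j)) x) =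
        (\<Sum>j\<le>M. u (Suc (2 * i), 2 * j) * poly (q (2 * j)) (Y' (2 * j)))"
      by (intro sum.cong refl)
    also note *
    also have "(\<Sum>j<M. u (Suc (2 * i), Suc (2 * j)) * poly (q (Suc (2 * j))) (Y' (Suc (2 * j)))) =
      (\<Sum>j<M. u (Suc (2 * i), Suc (2 * j)) * (if (i, j) \<in> s then F i j x (Y' (Suc (2 * j))) else 0))"
      using p(2) by (intro sum.cong) (auto simp: q_def)
    finally show ?thesis unfolding x_def .
  qed
  then show ?thesis by (simp add: sum_negf)
qed

end


context dual_refinement begin

lemma swap_dual: "dual_refinement C d (\<lambda>i j. V j i) (\<lambda>i j. H j i) Y X Y' X' (s\<inverse>) M"
proof -
  have "dual_bipoly C d (\<lambda>i j. V j i) (\<lambda>i j. H j i) Y X (s\<inverse>)"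
    unfolding dual_bipoly_def
  proof (intro allI impI)
    fix P Q assume "dual_pair C d (\<lambda>i j. V j i) (\<lambda>i j. H j i) Y X P Q"
    from dual_pair_swap[OF this] have "dual_pair C d H V X Y (\<lambda>i j. Q j i) (\<lambda>i j. P j i)" by simp
    then obtain F where "bipoly_on_cells C d X Y s (\<lambda>i j. Q j i) (\<lambda>i j. P j i) F"
      using dual_bipoly unfolding dual_bipoly_def by blast
    from bipoly_on_cells_swap[OF this]
    show "\<exists>F. bipoly_on_cells C d Y X (s\<inverse>) P Q F" by auto
  qed
  then show ?thesis
    using swap_bounded by (simp add: dual_refinement_def dual_refinement_axioms_def)
qed

text \<open>Only the values at old nodes are sought. A combination not involving them restricts to a
  dependency on the coarse mesh, so \<open>F\<close> exists. New rows and columns contribute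
  nothing; the part on old rows and the part on old columns are both moved to the cell centres by
  \<open>half_sum\<close>, where they cancel because \<open>P\<close> follows \<open>F\<close> and
  \<open>Q\<close> follows \<open>- F\<close>.\<close>

lemma new_space_extends:
  assumes u: "u \<in> new_space"
  shows "\<exists>c\<in>coeff_space r H' V' X' Y' N' UNIV UNIV. \<forall>v\<in>odd_nodes. c v = u v"
proof -
  define V0 where "V0 = {(a, b) \<in> N'. even a \<and> even b \<and> a \<le> 2 * M \<and> b \<le> 2 * M}"
  have row: "moments r (\<lambda>a. H' a b) X' (\<lambda>a. u (a, b))" if "odd b" for b
    using u that by (simp add: new_space_def coeff_space_def)
  have col: "moments r (V' a) Y' (\<lambda>b. u (a, b))" if "odd a" for a
    using u that by (simp add: new_space_def coeff_space_def)
  have u0: "u v = 0" if "v \<notin> N' \<or> v \<notin> odd_nodes" for v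
    using u that by (cases v) (auto simp: new_space_def coeff_space_def)
  have "u v = 0" if "v \<notin> {..2 * M} \<times> {..2 * M}" for v
    by (rule new_coeffs_bounded[OF row col u0 that]) auto
  then have "\<exists>c'. (\<forall>v. v \<notin> V0 \<longrightarrow> c' v = u v) \<and> (\<forall>b\<in>UNIV. moments r (\<lambda>a. H' a b) X' (\<lambda>a. c' (a, b))) \<and>
    (\<forall>a\<in>UNIV. moments r (V' a) Y' (\<lambda>b. c' (a, b)))"
  proof (intro coeff_extend[OF bounded'])
    show "V0 \<subseteq> {..2 * M} \<times> {..2 * M}" by (auto simp: V0_def)
    fix P Q
    assume df: "dual_family r H' V' (2 * M) UNIV UNIV P Q"
      and v0: "\<And>a b. (a, b) \<in> V0 \<Longrightarrow> poly (P a b) (X' a) + poly (Q a b) (Y' b) = 0"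
    have P: "P (Suc a) b = P a b" if "H' a b" for a b
      using df that by (auto simp: dual_family_def edge_polys_def)
    have Q: "Q a (Suc b) = Q a b" if "V' a b" for a b
      using df that by (auto simp: dual_family_def edge_polys_def)
    have "dual_pair C d H V X Y (\<lambda>i j. P (2 * i) (2 * j)) (\<lambda>i j. Q (2 * i) (2 * j))"
      unfolding dual_pair_def edge_polys_def
    proof (safe)
      show "degree (P (2 * i) (2 * j)) \<le> r" "degree (Q (2 * i) (2 * j)) \<le> r" for i j
        using df by (auto simp: dual_family_def edge_polys_def)
      show "P (2 * Suc i) (2 * j) = P (2 * i) (2 * j)" if "H i j" for i j
        using P[of "2 * i" "2 * j"] P[of "Suc (2 * i)" "2 * j"] that by (simp add: refine_h_def)
      show "Q (2 * i) (2 * Suc j) = Q (2 * i) (2 * j)" if "V i j" for i j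
        using Q[of "2 * i" "2 * j"] Q[of "2 * i" "Suc (2 * j)"] that by (simp add: refine_v_def)
      show "poly (P (2 * i) (2 * j)) (X i) + poly (Q (2 * i) (2 * j)) (Y j) = 0"
        if "(i, j) \<in> nodes C H V" for i j
      proof (cases "i \<le> M \<and> j \<le> M")
        case True
        then have "(2 * i, 2 * j) \<in> V0" using that nodes_simps(1) by (auto simp: V0_def)
        from v0[OF this] show ?thesis by (simp add: double)
      next
        case False
        then show ?thesis using df by (auto simp: dual_family_def)
      qed
    qed
    then obtain F where F: "bipoly_on_cells C d X Y s (\<lambda>i j. P (2 * i) (2 * j)) (\<lambda>i j. Q (2 * i) (2 * j)) F"
      using dual_bipoly unfolding dual_bipoly_def by blast
    define I where "I = (\<Sum>i<M. \<Sum>j<M. u (Suc (2 * i), Suc (2 * j)) *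
      (if (i, j) \<in> s then F i j (X' (Suc (2 * i))) (Y' (Suc (2 * j))) else 0))"
    have hP: "(\<Sum>i<M. \<Sum>j\<le>M. u (Suc (2 * i), 2 * j) * poly (P (Suc (2 * i)) (2 * j)) (X' (Suc (2 * i)))) = - I"
      unfolding I_def using col u0 by (intro half_sum[OF F P]) auto
    have F': "bipoly_on_cells C d Y X (s\<inverse>) (\<lambda>i j. Q (2 * j) (2 * i)) (\<lambda>i j. P (2 * j) (2 * i)) (\<lambda>j i y x. - F i j x y)"
      using bipoly_on_cells_swap[OF F] .
    note hs = dual_refinement.half_sum[OF swap_dual, unfolded refine_swap[of V s] refine_swap[of H s],
        where P = "\<lambda>i j. Q j i" and u = "\<lambda>(a, b). u (b, a)", OF F']
    have sw: "(a, b) \<in> nodes C (\<lambda>i j. V' j i) (\<lambda>i j. H' j i) \<longleftrightarrow> (b, a) \<in> N'" for a b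
      by (rule nodes_swap)
    have "(\<Sum>i<M. \<Sum>j\<le>M. u (2 * j, Suc (2 * i)) * poly (Q (2 * j) (Suc (2 * i))) (Y' (Suc (2 * i)))) =
      - (\<Sum>i<M. \<Sum>j<M. u (Suc (2 * j), Suc (2 * i)) *
        (if (i, j) \<in> s\<inverse> then - F j i (X' (Suc (2 * j))) (Y' (Suc (2 * i))) else 0))"
      using hs[unfolded prod.case] row u0 Q sw by (simp add: split_paired_all)
    also have "\<dots> = - (\<Sum>i<M. \<Sum>j<M. - (u (Suc (2 * j), Suc (2 * i)) *
        (if (j, i) \<in> s then F j i (X' (Suc (2 * j))) (Y' (Suc (2 * i))) else 0)))"
      by (intro arg_cong[of _ _ uminus] sum.cong refl) auto
    also have "\<dots> = I"
      unfolding I_def by (subst (2) sum.swap) (simp add: sum_negf)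
    finally have hQ: "(\<Sum>i<M. \<Sum>j\<le>M. u (2 * j, Suc (2 * i)) * poly (Q (2 * j) (Suc (2 * i))) (Y' (Suc (2 * i)))) = I" .
    have even0: "u (2 * i, 2 * j) = 0" for i j using u0 by (auto simp: odd_nodes_def)
    have rowsum: "(\<Sum>a\<le>2 * M. u (a, Suc (2 * j)) * poly (P a (Suc (2 * j))) (X' a)) = 0" for j
      using row df bounded' by (intro moments_edge_polys) (auto simp: bounded_edges_def dual_family_def)
    have colsum: "(\<Sum>b\<le>2 * M. u (Suc (2 * i), b) * poly (Q (Suc (2 * i)) b) (Y' b)) = 0" for i
      using col df bounded' by (intro moments_edge_polys) (auto simp: bounded_edges_def dual_family_def)
    have "(\<Sum>a\<le>2 * M. \<Sum>b\<le>2 * M. u (a, b) * poly (P a b) (X' a)) =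
       (\<Sum>b\<le>2 * M. \<Sum>a\<le>2 * M. u (a, b) * poly (P a b) (X' a))"
      by (rule sum.swap)
    also have "\<dots> = (\<Sum>j\<le>M. \<Sum>a\<le>2 * M. u (a, 2 * j) * poly (P a (2 * j)) (X' a))"
      by (simp only: sum_even_odd[of _ M] rowsum sum.neutral_const add_0_right) (simp add: sum_even_odd rowsum[unfolded sum_even_odd])
    also have "\<dots> = (\<Sum>j\<le>M. \<Sum>i<M. u (Suc (2 * i), 2 * j) * poly (P (Suc (2 * i)) (2 * j)) (X' (Suc (2 * i))))"
      by (simp add: sum_even_odd even0)
    also have "\<dots> = - I" by (subst sum.swap) (rule hP)
    finally have 1: "(\<Sum>a\<le>2 * M. \<Sum>b\<le>2 * M. u (a, b) * poly (P a b) (X' a)) = - I" .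
    have "(\<Sum>a\<le>2 * M. \<Sum>b\<le>2 * M. u (a, b) * poly (Q a b) (Y' b)) =
       (\<Sum>i\<le>M. \<Sum>b\<le>2 * M. u (2 * i, b) * poly (Q (2 * i) b) (Y' b))"
      using colsum by (subst sum_even_odd) simp
    also have "\<dots> = (\<Sum>i\<le>M. \<Sum>j<M. u (2 * i, Suc (2 * j)) * poly (Q (2 * i) (Suc (2 * j))) (Y' (Suc (2 * j))))"
      by (simp add: sum_even_odd even0)
    also have "\<dots> = I" by (subst sum.swap) (rule hQ)
    finally have 2: "(\<Sum>a\<le>2 * M. \<Sum>b\<le>2 * M. u (a, b) * poly (Q a b) (Y' b)) = I" .
    show "(\<Sum>a\<le>2 * M. \<Sum>b\<le>2 * M. u (a, b) * (poly (P a b) (X' a) + poly (Q a b) (Y' b))) = 0"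
      using 1 2 by (simp add: distrib_left sum.distrib)
  qed
  then obtain c where c: "\<forall>v. v \<notin> V0 \<longrightarrow> c v = u v" "\<forall>b. moments r (\<lambda>a. H' a b) X' (\<lambda>a. c (a, b))"
    "\<forall>a. moments r (V' a) Y' (\<lambda>b. c (a, b))" by auto
  have "c v = 0" if "v \<notin> N'" for v
  proof -
    have "v \<notin> V0" using that by (auto simp: V0_def)
    then show ?thesis using c(1) u0 that by (cases v) simp
  qed
  moreover have "v \<notin> V0" if "v \<in> odd_nodes" for v using that by (auto simp: V0_def odd_nodes_def)
  ultimately show ?thesis using c by (auto simp: coeff_space_def intro!: bexI[of _ c])
qed

text \<open>If all coefficients at new nodes vanish, the conditions on new lines are void and those
  on old lines are the conditions of the coarse mesh.\<close>

lemma coarse_dim: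
  "fun_space.dim {c \<in> coeff_space r H' V' X' Y' N' UNIV UNIV. \<forall>v\<in>odd_nodes. c v = 0} =
   fun_space.dim (coeff_space r H V X Y (nodes C H V) UNIV UNIV)"
proof -
  define f where "f c = (\<lambda>(a, b). if even a \<and> even b then c (a div 2, b div 2) else (0::real))"
    for c :: "nat \<times> nat \<Rightarrow> real"
  have m1: "moments r (\<lambda>a. H' a b) X' (\<lambda>a. c (a, b)) \<longleftrightarrow>
      (if even b then moments r (\<lambda>i. H i (b div 2)) X (\<lambda>i. c (2 * i, b)) else True)"
    if "\<And>v. v \<in> odd_nodes \<Longrightarrow> c v = 0" for c b
    using that moments_double[of "\<lambda>a. c (a, b)" X' X r "\<lambda>i. H i (b div 2)"]
    by (auto simp: refine_h_def odd_nodes_def double)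
  have m2: "moments r (V' a) Y' (\<lambda>b. c (a, b)) \<longleftrightarrow>
      (if even a then moments r (V (a div 2)) Y (\<lambda>j. c (a, 2 * j)) else True)"
    if "\<And>v. v \<in> odd_nodes \<Longrightarrow> c v = 0" for c a
    using that moments_double[of "\<lambda>b. c (a, b)" Y' Y r "V (a div 2)"]
    by (auto simp: refine_v_def[abs_def] odd_nodes_def double)
  have "fun_space.dim (coeff_space r H V X Y (nodes C H V) UNIV UNIV) =
    fun_space.dim {c \<in> coeff_space r H' V' X' Y' N' UNIV UNIV. \<forall>v\<in>odd_nodes. c v = 0}"
  proof (rule fun_dim_bij[where f = f])
    show "fun_linear f" by (rule fun_linearI) (auto simp: f_def fun_eq_iff)
    show "fun_space.subspace (coeff_space r H V X Y (nodes C H V) UNIV UNIV)"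
      by (rule subspace_coeff_space)
    fix c assume c: "c \<in> coeff_space r H V X Y (nodes C H V) UNIV UNIV"
    have f0: "f c v = 0" if "v \<in> odd_nodes" for v using that by (auto simp: f_def odd_nodes_def)
    have "f c v = 0" if "v \<notin> N'" for v
    proof (cases "v \<in> odd_nodes")
      case False
      then obtain i j where v: "v = (2 * i, 2 * j)" by (cases v) (auto simp: odd_nodes_def elim!: evenE)
      then have "(i, j) \<notin> nodes C H V" using that nodes_simps(1) by auto
      then show ?thesis using c v by (simp add: f_def coeff_space_def)
    qed (rule f0)
    moreover have "moments r (\<lambda>a. H' a b) X' (\<lambda>a. f c (a, b))" for b
      using c by (subst m1[OF f0]) (auto simp: f_def coeff_space_def)
    moreover have "moments r (V' a) Y' (\<lambda>b. f c (a, b))" for a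
      using c by (subst m2[OF f0]) (auto simp: f_def coeff_space_def)
    ultimately show "f c \<in> {c \<in> coeff_space r H' V' X' Y' N' UNIV UNIV. \<forall>v\<in>odd_nodes. c v = 0}"
      using f0 by (auto simp: coeff_space_def)
    show "c = (\<lambda>_. 0)" if "f c = (\<lambda>_. 0)"
    proof
      fix v :: "nat \<times> nat"
      obtain i j where v: "v = (i, j)" by (cases v)
      have "f c (2 * i, 2 * j) = 0" using that by simp
      then show "c v = 0" by (simp add: f_def v)
    qed
  next
    fix c assume c: "c \<in> {c \<in> coeff_space r H' V' X' Y' N' UNIV UNIV. \<forall>v\<in>odd_nodes. c v = 0}"
    define b where "b = (\<lambda>(i, j). c (2 * i, 2 * j))"
    have c0: "c v = 0" if "v \<in> odd_nodes" for v using c that by auto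
    have "moments r (\<lambda>a. H a j) X (\<lambda>a. b (a, j))" for j
    proof -
      have "moments r (\<lambda>a. H' a (2 * j)) X' (\<lambda>a. c (a, 2 * j))" using c by (simp add: coeff_space_def)
      then show ?thesis by (subst (asm) m1[OF c0]) (auto simp: b_def)
    qed
    moreover have "moments r (V i) Y (\<lambda>j. b (i, j))" for i
    proof -
      have "moments r (V' (2 * i)) Y' (\<lambda>b. c (2 * i, b))" using c by (simp add: coeff_space_def)
      then show ?thesis by (subst (asm) m2[OF c0]) (auto simp: b_def)
    qed
    moreover have "b v = 0" if "v \<notin> nodes C H V" for v
      using that c nodes_simps(1)[of "fst v" "snd v"] by (auto simp: b_def coeff_space_def case_prod_beta)
    ultimately have "b \<in> coeff_space r H V X Y (nodes C H V) UNIV UNIV" by (auto simp: coeff_space_def)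
    moreover have "f b = c"
      using c0 by (auto simp: f_def b_def fun_eq_iff odd_nodes_def)
    ultimately show "\<exists>b\<in>coeff_space r H V X Y (nodes C H V) UNIV UNIV. f b = c" by blast
  qed
  then show ?thesis by simp
qed

text \<open>Rank and nullity for the restriction to new nodes: the kernel is the coarse space, and
  \<open>new_space_extends\<close> makes the restriction surjective.\<close>

theorem dim_refine:
  "fun_space.dim (coeff_space r H' V' X' Y' N' UNIV UNIV) =
   fun_space.dim (coeff_space r H V X Y (nodes C H V) UNIV UNIV) + fun_space.dim new_space"
proof -
  let ?W = "coeff_space r H' V' X' Y' N' UNIV UNIV"
  define f where "f c = (\<lambda>v. if v \<in> odd_nodes then c v else (0::real))" for c :: "nat \<times> nat \<Rightarrow> real"
  have lin: "fun_linear f" by (rule fun_linearI) (auto simp: f_def fun_eq_iff)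
  have "fun_space.dim ?W = fun_space.dim {c \<in> ?W. f c = (\<lambda>_. 0)} + fun_space.dim (f ` ?W)"
    by (rule fun_dim_kernel_image[OF lin subspace_coeff_space, of "{..2 * M} \<times> {..2 * M}"])
      (simp, metis coeff_space_bounded[OF bounded'] surj_pair)
  moreover have "{c \<in> ?W. f c = (\<lambda>_. 0)} = {c \<in> ?W. \<forall>v\<in>odd_nodes. c v = 0}"
    by (auto simp: f_def fun_eq_iff)
  moreover have "f ` ?W = new_space"
  proof (intro equalityI subsetI)
    fix u assume "u \<in> f ` ?W"
    then obtain c where c: "c \<in> ?W" "u = f c" by auto
    have "(\<lambda>a. u (a, b)) = (\<lambda>a. c (a, b))" if "odd b" for b
      using that by (auto simp: c f_def odd_nodes_def)
    moreover have "(\<lambda>b. u (a, b)) = (\<lambda>b. c (a, b))" if "odd a" for a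
      using that by (auto simp: c f_def odd_nodes_def)
    moreover have "u v = 0" if "v \<notin> N' \<inter> odd_nodes" for v
      using that c by (cases v) (auto simp: f_def coeff_space_def)
    ultimately show "u \<in> new_space" using c by (auto simp: new_space_def coeff_space_def)
  next
    fix u assume u: "u \<in> new_space"
    obtain c where c: "c \<in> ?W" "\<forall>v\<in>odd_nodes. c v = u v" using new_space_extends[OF u] by auto
    have "u v = 0" if "v \<notin> odd_nodes" for v
      using that u by (cases v) (auto simp: new_space_def coeff_space_def)
    then have "f c = u" using c by (auto simp: f_def fun_eq_iff)
    then show "u \<in> f ` ?W" using c by auto
  qed
  ultimately show ?thesis using coarse_dim by simp
qed

end


subsection \<open>Comparison of the coefficients at new nodes: cell centres\<close>

text \<open>On the middle line of a row of cells the odd nodes lie inside a cell, while an even node lies on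
  the common side of two cells and takes the value of either.\<close>

definition spread :: "nat set \<Rightarrow> (nat \<Rightarrow> real poly) \<Rightarrow> nat \<Rightarrow> real poly" where
  "spread R f a = (if a div 2 \<in> R then f (a div 2)
     else if even a \<and> 0 < a \<and> a div 2 - 1 \<in> R then f (a div 2 - 1) else 0)"

lemma spread_simps:
  "spread R f (Suc (2 * i)) = (if i \<in> R then f i else 0)"
  "spread R f (2 * i) = (if i \<in> R then f i else if 0 < i \<and> i - 1 \<in> R then f (i - 1) else 0)"
  by (auto simp: spread_def)

lemma edge_polys_spread:
  assumes "\<And>i. i \<in> R \<Longrightarrow> degree (f i) \<le> r" "\<And>i. i \<in> R \<Longrightarrow> Suc i \<in> R \<Longrightarrow> f (Suc i) = f i"
  shows "edge_polys r (\<lambda>a. a div 2 \<in> R) (spread R f)"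
  unfolding edge_polys_def
proof (intro conjI allI impI)
  show "degree (spread R f t) \<le> r" for t using assms(1) by (auto simp: spread_def)
  fix t assume t: "t div 2 \<in> R"
  have "Suc t div 2 = t div 2 \<or> odd t \<and> Suc t div 2 = Suc (t div 2)" by presburger
  then show "spread R f (Suc t) = spread R f t"
    using t assms(2) by (auto simp: spread_def)
qed

text \<open>The chosen block depends only on the set of blocks containing the cell. Adjacent cells
  with a common nonzero bubble lie in the same blocks and so receive the same choice.\<close>

definition block_choice :: "nat \<Rightarrow> (nat \<times> nat) set \<Rightarrow> (nat \<Rightarrow> nat \<Rightarrow> nat \<times> nat) \<Rightarrow> bool" where
  "block_choice n s \<beta> \<longleftrightarrow> (\<forall>i j. (i, j) \<in> s \<longrightarrow> is_block n s (\<beta> i j) (i, j)) \<and>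
     (\<forall>i j k l. (i, j) \<in> s \<longrightarrow> (k, l) \<in> s \<longrightarrow>
       (\<forall>b. is_block n s b (i, j) \<longleftrightarrow> is_block n s b (k, l)) \<longrightarrow> \<beta> i j = \<beta> k l)"

lemma block_choice_exists:
  assumes "covered_by_blocks n s" shows "\<exists>\<beta>. block_choice n s \<beta>"
proof -
  define \<beta> where "\<beta> i j = (SOME b. is_block n s b (i, j))" for i j
  have "block_choice n s \<beta>"
    unfolding block_choice_def
  proof (intro conjI allI impI)
    show "is_block n s (\<beta> i j) (i, j)" if "(i, j) \<in> s" for i j
      using that assms unfolding \<beta>_def covered_by_blocks_def by (meson someI_ex)
    fix i j k l assume "\<forall>b. is_block n s b (i, j) \<longleftrightarrow> is_block n s b (k, l)"
    then have "(\<lambda>b. is_block n s b (i, j)) = (\<lambda>b. is_block n s b (k, l))" by (intro ext) (rule spec)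
    then show "\<beta> i j = \<beta> k l" by (simp add: \<beta>_def)
  qed
  then show ?thesis using exI[of "block_choice n s" \<beta>] by simp
qed

lemma block_choiceD:
  assumes "block_choice n s \<beta>" "(i, j) \<in> s"
  shows "is_block n s (\<beta> i j) (i, j)"
    "(k, l) \<in> s \<Longrightarrow> (\<And>b. is_block n s b (i, j) \<longleftrightarrow> is_block n s b (k, l)) \<Longrightarrow> \<beta> i j = \<beta> k l"
proof -
  note * = assms(1)[unfolded block_choice_def]
  show "is_block n s (\<beta> i j) (i, j)"
    by (rule *[THEN conjunct1, THEN spec, THEN spec, THEN mp, OF assms(2)])
  assume "(k, l) \<in> s" "\<And>b. is_block n s b (i, j) \<longleftrightarrow> is_block n s b (k, l)"
  then show "\<beta> i j = \<beta> k l"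
    by (intro *[THEN conjunct2, THEN spec, THEN spec, THEN spec, THEN spec, THEN mp, THEN mp, THEN mp] assms(2) allI)
qed

lemma block_choice_swap:
  assumes \<beta>: "block_choice n s \<beta>"
  shows "block_choice n (s\<inverse>) (\<lambda>j i. (snd (\<beta> i j), fst (\<beta> i j)))"
  unfolding block_choice_def
proof (intro conjI allI impI)
  fix j i assume s: "(j, i) \<in> s\<inverse>"
  then show "is_block n (s\<inverse>) (snd (\<beta> i j), fst (\<beta> i j)) (j, i)"
    using block_choiceD(1)[OF \<beta>, of i j] by (subst is_block_converse) simp
  fix l k assume s': "(l, k) \<in> s\<inverse>"
    and b: "\<forall>b. is_block n (s\<inverse>) b (j, i) \<longleftrightarrow> is_block n (s\<inverse>) b (l, k)"
  have "is_block n s b (i, j) \<longleftrightarrow> is_block n s b (k, l)" for b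
    using b[THEN spec, of "(snd b, fst b)"] by (simp add: is_block_converse)
  then have "\<beta> i j = \<beta> k l"
    using s s' by (intro block_choiceD(2)[OF \<beta>]) auto
  then show "(snd (\<beta> i j), fst (\<beta> i j)) = (snd (\<beta> k l), fst (\<beta> k l))" by simp
qed

definition end_weight :: "nat \<Rightarrow> (nat \<Rightarrow> real) \<Rightarrow> nat \<Rightarrow> real poly" where
  "end_weight n x i = [:- x i, 1:] * [:- x (i + n), 1:]"

lemma end_weight_simps:
  "poly (end_weight n x i) z = (z - x i) * (z - x (i + n))" "degree (end_weight n x i) = 2"
  "end_weight n x i \<noteq> 0"
  by (auto simp: end_weight_def algebra_simps degree_mult_eq)

lemma end_weight_dvd:
  assumes "poly p (x i) = 0" "poly p (x (i + n)) = 0" "x i \<noteq> x (i + n)"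
  shows "end_weight n x i dvd p"
proof -
  obtain q where q: "p = [:- x i, 1:] * q" using assms(1)[unfolded poly_eq_0_iff_dvd] by (rule dvdE)
  then have "poly q (x (i + n)) = 0" using assms(2,3) by auto
  then show ?thesis
    unfolding end_weight_def q by (intro mult_dvd_mono dvd_refl) (simp only: poly_eq_0_iff_dvd)
qed

lemma degree_div_quadratic:
  fixes p w :: "real poly"
  assumes "w dvd p" "degree w = 2" "degree p \<le> d" shows "degree (p div w) \<le> d - 2"
proof (cases "p = 0")
  case False
  obtain q where q: "p = w * q" using assms(1) by (rule dvdE)
  with False have "q \<noteq> 0" "w \<noteq> 0" by auto
  then show ?thesis using assms(2,3) degree_mult_eq[of w q] by (simp add: q)
qed simp

context bounded_refinement begin

abbreviation mid_x :: "nat \<Rightarrow> real" where "mid_x i \<equiv> X' (Suc (2 * i))"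
abbreviation mid_y :: "nat \<Rightarrow> real" where "mid_y j \<equiv> Y' (Suc (2 * j))"

text \<open>Along a row the second factor is a constant attached to the chosen block and the first
  is the value of a quadratic in \<open>x\<close>; along a column the roles are exchanged. Thus one
  weight serves the conditions in both directions.\<close>

definition centre_weight :: "(nat \<Rightarrow> nat \<Rightarrow> nat \<times> nat) \<Rightarrow> nat \<Rightarrow> nat \<Rightarrow> real" where
  "centre_weight \<beta> i j = poly (end_weight (d - 1) X (fst (\<beta> i j))) (mid_x i) *
     poly (end_weight (d - 1) Y (snd (\<beta> i j))) (mid_y j)"

lemma centre_weight_swap:
  "bounded_refinement.centre_weight d Y X Y' X' (\<lambda>j i. (snd (\<beta> i j), fst (\<beta> i j))) j i =
    centre_weight \<beta> i j"
  unfolding bounded_refinement.centre_weight_def[OF swap_bounded] centre_weight_def by simp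

lemma centre_weight_nonzero: "centre_weight \<beta> i j \<noteq> 0"
  using mid_not_old by (auto simp: centre_weight_def end_weight_simps)

lemma row_edges: "refine_h H s a (Suc (2 * j)) \<longleftrightarrow> a div 2 \<in> {i. (i, j) \<in> s}"
  by (simp add: refine_h_def)

lemma no_row_end: "\<not> 2 * M div 2 \<in> {i. (i, j) \<in> s}"
  using s_bounded by auto

lemma same_block_choice:
  assumes \<beta>: "block_choice (d - 1) s \<beta>" and D: "row_bubble C' d s X D"
    and s: "(i, j) \<in> s" "(Suc i, j) \<in> s" and nz: "D i j \<noteq> 0"
  shows "\<beta> (Suc i) j = \<beta> i j"
  using row_bubble_same_blocks[OF D mono(1) d s nz] s by (intro block_choiceD(2)[OF \<beta>]) auto

text \<open>The bubble times the quadratic of the chosen block has degree at most \<open>d\<close>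
  and vanishes at every old line of the row: between two cells of \<open>s\<close> because of the
  bubble, at an end of a run because the chosen block has to end there. In the relation obtained
  from \<open>v\<close> only the centres survive.\<close>

lemma row_transfer_up:
  assumes \<beta>: "block_choice (d - 1) s \<beta>" and D: "row_bubble True d s X D"
    and v: "moments d (\<lambda>a. a div 2 \<in> {i. (i, j) \<in> s}) X' v"
  shows "(\<Sum>i<M. v (Suc (2 * i)) * (if (i, j) \<in> s then centre_weight \<beta> i j * poly (D i j) (mid_x i) else 0)) = 0"
proof -
  define R where "R = {i. (i, j) \<in> s}"
  define f where "f i = smult (poly (end_weight (d - 1) Y (snd (\<beta> i j))) (mid_y j))
    (D i j * end_weight (d - 1) X (fst (\<beta> i j)))" for i
  have bl: "is_block (d - 1) s (fst (\<beta> i j), snd (\<beta> i j)) (i, j)" if "i \<in> R" for i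
    using block_choiceD(1)[OF \<beta>] that by (simp add: R_def)
  have "edge_polys d (\<lambda>a. a div 2 \<in> R) (spread R f)"
  proof (rule edge_polys_spread)
    fix i
    have "degree (f i) \<le> degree (D i j) + 2"
      unfolding f_def by (intro order_trans[OF degree_smult_le] order_trans[OF degree_mult_le])
        (simp add: end_weight_simps)
    then show "degree (f i) \<le> d"
      using row_bubbleD(1)[OF D, of i j] d by (simp add: mesh_degree_def)
    assume i: "i \<in> R" "Suc i \<in> R"
    then have "D (Suc i) j = D i j" using row_bubbleD(2)[OF D] by (simp add: R_def)
    then show "f (Suc i) = f i"
      using same_block_choice[OF \<beta> D, of i j] i by (cases "D i j = 0") (auto simp: f_def R_def)
  qed
  moreover have "\<not> 2 * M div 2 \<in> R" using no_row_end unfolding R_def .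
  ultimately have "(\<Sum>a\<le>2 * M. v a * poly (spread R f a) (X' a)) = 0"
    by (rule moments_edge_polys[OF v[folded R_def]])
  moreover have "poly (spread R f (2 * i)) (X i) = 0" for i
  proof -
    consider "i \<in> R" "0 < i \<and> i - 1 \<in> R" | "i \<in> R" "\<not> (0 < i \<and> i - 1 \<in> R)"
      | "i \<notin> R" "0 < i \<and> i - 1 \<in> R" | "i \<notin> R" "\<not> (0 < i \<and> i - 1 \<in> R)" by blast
    then show ?thesis
    proof cases
      case 1
      then have "poly (D (i - 1) j) (X i) = 0" "D i j = D (i - 1) j"
        using row_bubbleD(2,3)[OF D, of "i - 1" j] by (auto simp: R_def)
      then show ?thesis using 1 by (simp add: spread_simps f_def)
    next
      case 2
      \<comment> \<open>A block starting further to the left would put the cell \<open>i - 1\<close>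
        into \<open>s\<close>.\<close>
      have "fst (\<beta> i j) = i"
      proof (rule ccontr)
        assume "fst (\<beta> i j) \<noteq> i"
        then have "fst (\<beta> i j) \<le> i - 1" "0 < i" "i - 1 < fst (\<beta> i j) + (d - 1)"
          using is_blockD(1,2)[OF bl[OF 2(1)]] by auto
        then show False using is_blockD(6)[OF bl[OF 2(1)], of "i - 1"] 2(2) by (simp add: R_def)
      qed
      then show ?thesis using 2 by (simp add: spread_simps f_def end_weight_simps)
    next
      case 3
      then have i: "i - 1 \<in> R" by simp
      have "fst (\<beta> (i - 1) j) + (d - 1) = i"
      proof (rule ccontr)
        assume "fst (\<beta> (i - 1) j) + (d - 1) \<noteq> i"
        then have "i < fst (\<beta> (i - 1) j) + (d - 1)" "fst (\<beta> (i - 1) j) \<le> i"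
          using is_blockD(1,2)[OF bl[OF i]] 3 by auto
        then show False using is_blockD(6)[OF bl[OF i], of i] 3(1) by (simp add: R_def)
      qed
      then show ?thesis using 3 by (simp add: spread_simps f_def end_weight_simps)
    qed (auto simp: spread_simps)
  qed
  ultimately have "(\<Sum>i<M. v (Suc (2 * i)) * poly (spread R f (Suc (2 * i))) (mid_x i)) = 0"
    by (simp add: sum_even_odd double)
  also have "(\<Sum>i<M. v (Suc (2 * i)) * poly (spread R f (Suc (2 * i))) (mid_x i)) =
     (\<Sum>i<M. v (Suc (2 * i)) * (if (i, j) \<in> s then centre_weight \<beta> i j * poly (D i j) (mid_x i) else 0))"
    by (intro sum.cong refl) (auto simp: spread_simps f_def R_def centre_weight_def)
  finally show ?thesis .
qed

text \<open>The bubble vanishes on both end lines of the chosen block, so the quadratic divides it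
  and the quotient has degree at most \<open>d - 2\<close>. At an old line between two cells of
  \<open>s\<close> a nonzero bubble makes this an inner line of the block, where the quadratic is
  nonzero and the root stays with the quotient. At all other old lines \<open>v\<close> is
  zero.\<close>

lemma row_transfer_down:
  assumes \<beta>: "block_choice (d - 1) s \<beta>" and D: "row_bubble False d s X D"
    and v: "moments (d - 2) (\<lambda>a. a div 2 \<in> {i. (i, j) \<in> s}) X' v"
    and v0: "\<And>i. \<not> (0 < i \<and> (i - 1, j) \<in> s \<and> (i, j) \<in> s) \<Longrightarrow> v (2 * i) = 0"
  shows "(\<Sum>i<M. v (Suc (2 * i)) * (if (i, j) \<in> s then poly (D i j) (mid_x i) / centre_weight \<beta> i j else 0)) = 0"
proof -
  define R where "R = {i. (i, j) \<in> s}"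
  define w where "w i = end_weight (d - 1) X (fst (\<beta> i j))" for i
  define f where "f i = smult (1 / poly (end_weight (d - 1) Y (snd (\<beta> i j))) (mid_y j)) (D i j div w i)" for i
  have bl: "is_block (d - 1) s (fst (\<beta> i j), snd (\<beta> i j)) (i, j)" if "i \<in> R" for i
    using block_choiceD(1)[OF \<beta>] that by (simp add: R_def)
  have w_dvd: "w i dvd D i j" if "i \<in> R" for i
    unfolding w_def using row_bubble_root[OF D bl[OF that]] mono(1) d
    by (intro end_weight_dvd) (auto simp: strict_mono_eq)
  have w_deg: "degree (w i) = 2" for i by (simp add: w_def end_weight_simps)
  have adj: "D (Suc i) j = D i j" "D i j \<noteq> 0 \<Longrightarrow> \<beta> (Suc i) j = \<beta> i j" if "i \<in> R" "Suc i \<in> R" for i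
    using row_bubbleD(2)[OF D] same_block_choice[OF \<beta> D, of i j] that by (simp_all add: R_def)
  have "edge_polys (d - 2) (\<lambda>a. a div 2 \<in> R) (spread R f)"
  proof (rule edge_polys_spread)
    fix i assume i: "i \<in> R"
    show "degree (f i) \<le> d - 2"
      unfolding f_def using row_bubbleD(1)[OF D, of i j] degree_div_quadratic[OF w_dvd[OF i] w_deg]
      by (intro order_trans[OF degree_smult_le]) (simp add: mesh_degree_def)
    assume "Suc i \<in> R"
    then show "f (Suc i) = f i"
      using adj[of i] i by (cases "D i j = 0") (auto simp: f_def w_def)
  qed
  moreover have "\<not> 2 * M div 2 \<in> R" using no_row_end unfolding R_def .
  ultimately have "(\<Sum>a\<le>2 * M. v a * poly (spread R f a) (X' a)) = 0"
    by (rule moments_edge_polys[OF v[folded R_def]])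
  moreover have "v (2 * i) * poly (spread R f (2 * i)) (X i) = 0" for i
  proof (cases "0 < i \<and> i - 1 \<in> R \<and> i \<in> R")
    case True
    show ?thesis
    proof (cases "D i j = 0")
      case False
      have "D (i - 1) j \<noteq> 0" "\<beta> i j = \<beta> (i - 1) j"
        using adj[of "i - 1"] True False by auto
      then have "fst (\<beta> i j) \<le> i - 1" "i < fst (\<beta> i j) + (d - 1)"
        using is_blockD(1)[OF bl[of "i - 1"]] is_blockD(2)[OF bl[of i]] True by auto
      then have "poly (w i) (X i) \<noteq> 0"
        using mono(1) True by (auto simp: w_def end_weight_simps strict_mono_eq)
      moreover have "poly (D i j) (X i) = 0" using row_bubbleD(4)[OF D] True by (simp add: R_def)
      moreover have "D i j = w i * (D i j div w i)" using w_dvd True by simp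
      ultimately have "poly (D i j div w i) (X i) = 0" by (metis mult_eq_0_iff poly_mult)
      then show ?thesis using True by (simp add: spread_simps f_def)
    qed (use True in \<open>simp add: spread_simps f_def\<close>)
  qed (use v0[of i] in \<open>auto simp: R_def\<close>)
  ultimately have "(\<Sum>i<M. v (Suc (2 * i)) * poly (spread R f (Suc (2 * i))) (mid_x i)) = 0"
    by (simp add: sum_even_odd double)
  also have "(\<Sum>i<M. v (Suc (2 * i)) * poly (spread R f (Suc (2 * i))) (mid_x i)) =
     (\<Sum>i<M. v (Suc (2 * i)) * (if (i, j) \<in> s then poly (D i j) (mid_x i) / centre_weight \<beta> i j else 0))"
  proof (intro sum.cong refl)
    fix i
    show "v (Suc (2 * i)) * poly (spread R f (Suc (2 * i))) (mid_x i) =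
      v (Suc (2 * i)) * (if (i, j) \<in> s then poly (D i j) (mid_x i) / centre_weight \<beta> i j else 0)"
    proof (cases "(i, j) \<in> s")
      case True
      then have "D i j = w i * (D i j div w i)" using w_dvd by (simp add: R_def)
      then have "poly (D i j) (mid_x i) = poly (w i) (mid_x i) * poly (D i j div w i) (mid_x i)"
        by (metis poly_mult)
      moreover have "poly (w i) (mid_x i) \<noteq> 0" using mid_not_old by (simp add: w_def end_weight_simps)
      moreover have "centre_weight \<beta> i j =
          poly (w i) (mid_x i) * poly (end_weight (d - 1) Y (snd (\<beta> i j))) (mid_y j)"
        by (simp add: centre_weight_def w_def)
      ultimately show ?thesis
        using True by (simp add: spread_simps f_def R_def)
    qed (simp add: spread_simps R_def)
  qed
  finally show ?thesis .
qed

end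


section \<open>The possible values at cell centres for both degrees\<close>

definition centre_nodes :: "(nat \<times> nat) set" where
  "centre_nodes = {(a, b). odd a \<and> odd b}"

context bounded_refinement begin

text \<open>The flag is a parameter of its own and not the \<open>C\<close> of the locale, so that
  both degrees can be compared in one context.\<close>

definition new_coeffs :: "bool \<Rightarrow> (nat \<times> nat \<Rightarrow> real) set" where
  "new_coeffs C' = coeff_space (mesh_degree C' d) H' V' X' Y' (nodes C' H' V' \<inter> odd_nodes) {b. odd b} {a. odd a}"

lemma new_coeffsD:
  assumes "u \<in> new_coeffs C'"
  shows "odd b \<Longrightarrow> moments (mesh_degree C' d) (\<lambda>a. H' a b) X' (\<lambda>a. u (a, b))"
    "odd a \<Longrightarrow> moments (mesh_degree C' d) (V' a) Y' (\<lambda>b. u (a, b))"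
    "v \<notin> nodes C' H' V' \<Longrightarrow> u v = 0" "v \<notin> odd_nodes \<Longrightarrow> u v = 0"
    "v \<notin> {..2 * M} \<times> {..2 * M} \<Longrightarrow> u v = 0"
proof -
  show row: "moments (mesh_degree C' d) (\<lambda>a. H' a b) X' (\<lambda>a. u (a, b))" if "odd b" for b
    using assms that by (simp add: new_coeffs_def coeff_space_def)
  show col: "moments (mesh_degree C' d) (V' a) Y' (\<lambda>b. u (a, b))" if "odd a" for a
    using assms that by (simp add: new_coeffs_def coeff_space_def)
  show "u v = 0" if "v \<notin> nodes C' H' V'" for v
    using assms that by (cases v) (simp add: new_coeffs_def coeff_space_def)
  show u0: "u v = 0" if "v \<notin> odd_nodes" for v
    using assms that by (cases v) (simp add: new_coeffs_def coeff_space_def)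
  show "u v = 0" if "v \<notin> {..2 * M} \<times> {..2 * M}"
    by (rule new_coeffs_bounded[OF row col u0 that]) auto
qed

lemma new_coeffs_centre:
  assumes "u \<in> new_coeffs C'" "(i, j) \<notin> s"
  shows "u (Suc (2 * i), Suc (2 * j)) = 0"
  using moments_isolated[OF new_coeffsD(1)[OF assms(1), of "Suc (2 * j)"], of "Suc (2 * i)"] assms(2)
  by (simp add: refine_h_def)

text \<open>Bubbles appear here a second time, now as combinations of row conditions that do not
  involve the edge midpoints.\<close>

lemma row_bubble_of_family:
  assumes P: "\<And>b. odd b \<Longrightarrow> edge_polys (mesh_degree C' d) (\<lambda>a. H' a b) (\<lambda>a. P a b)"
    and P0: "\<And>i j. (2 * i, Suc (2 * j)) \<in> nodes C' H' V' \<Longrightarrow> i \<le> M \<Longrightarrow> j < M \<Longrightarrow> poly (P (2 * i) (Suc (2 * j))) (X i) = 0"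
  shows "row_bubble C' d s X (\<lambda>i j. if (i, j) \<in> s then P (Suc (2 * i)) (Suc (2 * j)) else 0)"
proof -
  note ns = refinement.nodes_simps(4)[OF refinement_axioms, of _ _ C']
  have e: "P (Suc a) (Suc (2 * j)) = P a (Suc (2 * j))" if "(a div 2, j) \<in> s" for a j
    using P[of "Suc (2 * j)"] that by (auto simp: edge_polys_def refine_h_def)
  have e': "P (Suc (2 * i)) (Suc (2 * j)) = P (2 * i) (Suc (2 * j))"
    "P (2 * Suc i) (Suc (2 * j)) = P (Suc (2 * i)) (Suc (2 * j))" if "(i, j) \<in> s" for i j
    using that by (auto simp: e)
  have right: "poly (P (Suc (2 * i)) (Suc (2 * j))) (X (Suc i)) = 0"
    if s: "(i, j) \<in> s" "C' \<longrightarrow> (Suc i, j) \<in> s" for i j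
  proof -
    have "(2 * Suc i, Suc (2 * j)) \<in> nodes C' H' V'" using s by (subst ns) simp
    from P0[OF this] show ?thesis using s_bounded[OF s(1)] e'[OF s(1)] by simp
  qed
  have left: "poly (P (Suc (2 * i)) (Suc (2 * j))) (X i) = 0" if s: "(i, j) \<in> s" "\<not> C'" for i j
  proof -
    have "(2 * i, Suc (2 * j)) \<in> nodes C' H' V'" using s by (subst ns) simp
    from P0[OF this] show ?thesis using s_bounded[OF s(1)] e'[OF s(1)] by simp
  qed
  have "P (Suc (2 * Suc i)) (Suc (2 * j)) = P (Suc (2 * i)) (Suc (2 * j))"
    if s: "(i, j) \<in> s" "(Suc i, j) \<in> s" for i j
    using e'(1)[OF s(2)] e'(2)[OF s(1)] by simp
  moreover have "degree (P a b) \<le> mesh_degree C' d" if "odd b" for a b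
    using P[OF that] by (simp add: edge_polys_def)
  ultimately show ?thesis
    unfolding row_bubble_def using left right by simp
qed

lemma centre_sum:
  assumes "\<And>a b. \<not> (odd a \<and> odd b) \<Longrightarrow> c (a, b) = 0"
  shows "(\<Sum>a\<le>2 * M. \<Sum>b\<le>2 * M. c (a, b) * f a b) =
    (\<Sum>i<M. \<Sum>j<M. c (Suc (2 * i), Suc (2 * j)) * (f (Suc (2 * i)) (Suc (2 * j)) :: real))"
  by (simp add: sum_even_odd assms)

lemma mid_sum_rows:
  assumes "dual_family k H' V' (2 * M) {b. odd b} {a. odd a} P Q"
  shows "odd b \<Longrightarrow> edge_polys k (\<lambda>a. H' a b) (\<lambda>a. P a b)" "odd a \<Longrightarrow> edge_polys k (V' a) (Q a)"
    "even b \<Longrightarrow> P a b = 0" "even a \<Longrightarrow> Q a b = 0"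
  using assms unfolding dual_family_def by auto

lemma swap_eqs:
  "refine_h (\<lambda>i j. V j i) (s\<inverse>) = (\<lambda>i j. V' j i)" "refine_v (\<lambda>i j. H j i) (s\<inverse>) = (\<lambda>i j. H' j i)"
  by (rule refine_swap)+

text \<open>The values at edge midpoints are sought. Each midpoint lies on a single new line, so a
  combination not involving midpoints splits into one bubble for every row and one for every column.
  Orthogonality of the centre values to bubbles, line by line, is therefore sufficient.\<close>

lemma centre_extend:
  assumes c: "\<And>v. v \<notin> centre_nodes \<or> v \<notin> {..2 * M} \<times> {..2 * M} \<Longrightarrow> c v = 0"
    and row: "\<And>D j. row_bubble C' d s X D \<Longrightarrow> (\<forall>i. (i, j) \<notin> s \<longrightarrow> D i j = 0) \<Longrightarrow>
      (\<Sum>i<M. c (Suc (2 * i), Suc (2 * j)) * poly (D i j) (mid_x i)) = 0"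
    and col: "\<And>E i. row_bubble C' d (s\<inverse>) Y E \<Longrightarrow> (\<forall>j. (i, j) \<notin> s \<longrightarrow> E j i = 0) \<Longrightarrow>
      (\<Sum>j<M. c (Suc (2 * i), Suc (2 * j)) * poly (E j i) (mid_y j)) = 0"
    and c_s: "\<And>i j. (i, j) \<notin> s \<Longrightarrow> c (Suc (2 * i), Suc (2 * j)) = 0"
  shows "\<exists>u\<in>new_coeffs C'. \<forall>v\<in>centre_nodes. u v = c v"
proof -
  define V0 where "V0 = {(a, b) \<in> nodes C' H' V'. odd a \<noteq> odd b \<and> a \<le> 2 * M \<and> b \<le> 2 * M}"
  have "\<exists>u. (\<forall>v. v \<notin> V0 \<longrightarrow> u v = c v) \<and>
      (\<forall>b\<in>{b. odd b}. moments (mesh_degree C' d) (\<lambda>a. H' a b) X' (\<lambda>a. u (a, b))) \<and>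
      (\<forall>a\<in>{a. odd a}. moments (mesh_degree C' d) (V' a) Y' (\<lambda>b. u (a, b)))"
  proof (rule coeff_extend[OF bounded'])
    show "V0 \<subseteq> {..2 * M} \<times> {..2 * M}" by (auto simp: V0_def)
    fix P Q
    assume df: "dual_family (mesh_degree C' d) H' V' (2 * M) {b. odd b} {a. odd a} P Q"
      and v0: "\<And>a b. (a, b) \<in> V0 \<Longrightarrow> poly (P a b) (X' a) + poly (Q a b) (Y' b) = 0"
    note fam = mid_sum_rows[OF df]
    define D where "D i j = (if (i, j) \<in> s then P (Suc (2 * i)) (Suc (2 * j)) else 0)" for i j
    define E where "E j i = (if (j, i) \<in> s\<inverse> then Q (Suc (2 * i)) (Suc (2 * j)) else 0)" for i j
    have "row_bubble C' d s X D"
      unfolding D_def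
    proof (rule row_bubble_of_family[OF fam(1)])
      fix i j assume "(2 * i, Suc (2 * j)) \<in> nodes C' H' V'" "i \<le> M" "j < M"
      then have "(2 * i, Suc (2 * j)) \<in> V0" by (simp add: V0_def)
      from v0[OF this] show "poly (P (2 * i) (Suc (2 * j))) (X i) = 0" by (simp add: fam(4) double)
    qed
    then have r: "(\<Sum>i<M. c (Suc (2 * i), Suc (2 * j)) * poly (D i j) (mid_x i)) = 0" for j
      by (rule row) (simp add: D_def)
    have "row_bubble C' d (s\<inverse>) Y E"
      unfolding E_def
    proof (rule bounded_refinement.row_bubble_of_family[OF swap_bounded, of C' "\<lambda>j i. Q i j", unfolded swap_eqs])
      show "edge_polys (mesh_degree C' d) (V' a) (Q a)" if "odd a" for a using fam(2) that .
      fix j i assume "(2 * j, Suc (2 * i)) \<in> nodes C' (\<lambda>i j. V' j i) (\<lambda>i j. H' j i)" "j \<le> M" "i < M"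
      then have "(Suc (2 * i), 2 * j) \<in> V0" by (simp add: V0_def nodes_swap[of _ _ C' V' H'])
      from v0[OF this] show "poly (Q (Suc (2 * i)) (2 * j)) (Y j) = 0" by (simp add: fam(3) double)
    qed
    then have r': "(\<Sum>j<M. c (Suc (2 * i), Suc (2 * j)) * poly (E j i) (mid_y j)) = 0" for i
      by (rule col) (simp add: E_def)
    have "(\<Sum>a\<le>2 * M. \<Sum>b\<le>2 * M. c (a, b) * (poly (P a b) (X' a) + poly (Q a b) (Y' b))) =
      (\<Sum>i<M. \<Sum>j<M. c (Suc (2 * i), Suc (2 * j)) *
        (poly (P (Suc (2 * i)) (Suc (2 * j))) (mid_x i) + poly (Q (Suc (2 * i)) (Suc (2 * j))) (mid_y j)))"
      by (rule centre_sum) (use c in \<open>auto simp: centre_nodes_def\<close>)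
    also have "\<dots> = (\<Sum>i<M. \<Sum>j<M. c (Suc (2 * i), Suc (2 * j)) * poly (D i j) (mid_x i)) +
       (\<Sum>i<M. \<Sum>j<M. c (Suc (2 * i), Suc (2 * j)) * poly (E j i) (mid_y j))"
      unfolding sum.distrib[symmetric]
      by (intro sum.cong refl) (use c_s in \<open>auto simp: D_def E_def distrib_left\<close>)
    also have "\<dots> = 0" using r r' by (subst sum.swap) simp
    finally show "(\<Sum>a\<le>2 * M. \<Sum>b\<le>2 * M. c (a, b) * (poly (P a b) (X' a) + poly (Q a b) (Y' b))) = 0" .
  qed (use c in blast)
  then obtain u where u: "\<forall>v. v \<notin> V0 \<longrightarrow> u v = c v"
    "\<forall>b\<in>{b. odd b}. moments (mesh_degree C' d) (\<lambda>a. H' a b) X' (\<lambda>a. u (a, b))"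
    "\<forall>a\<in>{a. odd a}. moments (mesh_degree C' d) (V' a) Y' (\<lambda>b. u (a, b))" by auto
  have "u v = 0" if "v \<notin> nodes C' H' V' \<inter> odd_nodes" for v
  proof -
    obtain a b where v: "v = (a, b)" by (cases v)
    have "v \<notin> V0" using that by (auto simp: V0_def odd_nodes_def)
    then have uc: "u v = c v" using u(1) v by auto
    show ?thesis
    proof (cases "v \<in> centre_nodes")
      case True
      then obtain i j where ij: "v = (Suc (2 * i), Suc (2 * j))"
        using v by (auto simp: centre_nodes_def elim!: oddE)
      then have "v \<notin> nodes C' H' V'" using that by (auto simp: odd_nodes_def)
      then have "(i, j) \<notin> s" using refinement.nodes_simps(2)[OF refinement_axioms, of i j C'] ij by auto
      then show ?thesis using c_s uc ij by simp
    qed (use c uc in auto)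
  qed
  then have "u \<in> new_coeffs C'" using u(2,3) by (auto simp: new_coeffs_def coeff_space_def)
  moreover have "u v = c v" if "v \<in> centre_nodes" for v
    using u(1) that by (cases v) (auto simp: V0_def centre_nodes_def)
  ultimately show ?thesis by blast
qed

definition scale_centres :: "(nat \<Rightarrow> nat \<Rightarrow> real) \<Rightarrow> (nat \<times> nat \<Rightarrow> real) \<Rightarrow> nat \<times> nat \<Rightarrow> real" where
  "scale_centres g u = (\<lambda>(a, b). if odd a \<and> odd b then u (a, b) * g (a div 2) (b div 2) else 0)"

lemma scale_up:
  assumes \<beta>: "block_choice (d - 1) s \<beta>" and u: "u \<in> new_coeffs False"
  shows "\<exists>u'\<in>new_coeffs True. \<forall>v\<in>centre_nodes. u' v = scale_centres (centre_weight \<beta>) u v"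
proof (rule centre_extend)
  let ?c = "scale_centres (centre_weight \<beta>) u"
  note un = new_coeffsD[OF u]
  show "?c v = 0" if "v \<notin> centre_nodes \<or> v \<notin> {..2 * M} \<times> {..2 * M}" for v
    using that un(5)[of v] by (auto simp: scale_centres_def centre_nodes_def split: prod.splits)
  show "?c (Suc (2 * i), Suc (2 * j)) = 0" if "(i, j) \<notin> s" for i j
    using new_coeffs_centre[OF u that] by (simp add: scale_centres_def)
  fix D j assume D: "row_bubble True d s X D" "\<forall>i. (i, j) \<notin> s \<longrightarrow> D i j = 0"
  have "moments d (\<lambda>a. a div 2 \<in> {i. (i, j) \<in> s}) X' (\<lambda>a. u (a, Suc (2 * j)))"
    using un(1)[of "Suc (2 * j)"] by (simp add: row_edges mesh_degree_def)
  from row_transfer_up[OF \<beta> D(1) this]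
  show "(\<Sum>i<M. ?c (Suc (2 * i), Suc (2 * j)) * poly (D i j) (mid_x i)) = 0"
    using D(2) by (elim trans[rotated]) (intro sum.cong, auto simp: scale_centres_def)
next
  let ?c = "scale_centres (centre_weight \<beta>) u"
  note un = new_coeffsD[OF u]
  fix E i assume E: "row_bubble True d (s\<inverse>) Y E" "\<forall>j. (i, j) \<notin> s \<longrightarrow> E j i = 0"
  have "moments d (\<lambda>a. a div 2 \<in> {j. (j, i) \<in> s\<inverse>}) Y' (\<lambda>b. u (Suc (2 * i), b))"
    using un(2)[of "Suc (2 * i)"] by (simp add: refine_v_def[abs_def] mesh_degree_def)
  from bounded_refinement.row_transfer_up[OF swap_bounded block_choice_swap[OF \<beta>] E(1) this]
  show "(\<Sum>j<M. ?c (Suc (2 * i), Suc (2 * j)) * poly (E j i) (mid_y j)) = 0"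
    using E(2) unfolding centre_weight_swap
    by (elim trans[rotated]) (intro sum.cong, auto simp: scale_centres_def)
qed

lemma scale_down:
  assumes \<beta>: "block_choice (d - 1) s \<beta>" and u: "u \<in> new_coeffs True"
  shows "\<exists>u'\<in>new_coeffs False. \<forall>v\<in>centre_nodes. u' v = scale_centres (\<lambda>i j. 1 / centre_weight \<beta> i j) u v"
proof (rule centre_extend)
  let ?c = "scale_centres (\<lambda>i j. 1 / centre_weight \<beta> i j) u"
  note un = new_coeffsD[OF u]
  show "?c v = 0" if "v \<notin> centre_nodes \<or> v \<notin> {..2 * M} \<times> {..2 * M}" for v
    using that un(5)[of v] by (auto simp: scale_centres_def centre_nodes_def split: prod.splits)
  show "?c (Suc (2 * i), Suc (2 * j)) = 0" if "(i, j) \<notin> s" for i j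
    using new_coeffs_centre[OF u that] by (simp add: scale_centres_def)
  fix D j assume D: "row_bubble False d s X D" "\<forall>i. (i, j) \<notin> s \<longrightarrow> D i j = 0"
  have "moments (d - 2) (\<lambda>a. a div 2 \<in> {i. (i, j) \<in> s}) X' (\<lambda>a. u (a, Suc (2 * j)))"
    using un(1)[of "Suc (2 * j)"] by (simp add: row_edges mesh_degree_def)
  moreover have "u (2 * i, Suc (2 * j)) = 0" if "\<not> (0 < i \<and> (i - 1, j) \<in> s \<and> (i, j) \<in> s)" for i
    using that un(3) refinement.nodes_simps(4)[OF refinement_axioms, of i j True] by auto
  ultimately have "(\<Sum>i<M. u (Suc (2 * i), Suc (2 * j)) *
      (if (i, j) \<in> s then poly (D i j) (mid_x i) / centre_weight \<beta> i j else 0)) = 0"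
    by (rule row_transfer_down[OF \<beta> D(1)])
  then show "(\<Sum>i<M. ?c (Suc (2 * i), Suc (2 * j)) * poly (D i j) (mid_x i)) = 0"
    using D(2) by (elim trans[rotated]) (intro sum.cong, auto simp: scale_centres_def)
next
  let ?c = "scale_centres (\<lambda>i j. 1 / centre_weight \<beta> i j) u"
  note un = new_coeffsD[OF u]
  fix E i assume E: "row_bubble False d (s\<inverse>) Y E" "\<forall>j. (i, j) \<notin> s \<longrightarrow> E j i = 0"
  have "moments (d - 2) (\<lambda>a. a div 2 \<in> {j. (j, i) \<in> s\<inverse>}) Y' (\<lambda>b. u (Suc (2 * i), b))"
    using un(2)[of "Suc (2 * i)"] by (simp add: refine_v_def[abs_def] mesh_degree_def)
  moreover have "u (Suc (2 * i), 2 * j) = 0" if "\<not> (0 < j \<and> (j - 1, i) \<in> s\<inverse> \<and> (j, i) \<in> s\<inverse>)" for j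
    using that un(3) refinement.nodes_simps(3)[OF refinement_axioms, of i j True] by auto
  ultimately have "(\<Sum>j<M. u (Suc (2 * i), Suc (2 * j)) *
      (if (j, i) \<in> s\<inverse> then poly (E j i) (mid_y j) / centre_weight \<beta> i j else 0)) = 0"
    using bounded_refinement.row_transfer_down[OF swap_bounded block_choice_swap[OF \<beta>] E(1)]
    unfolding centre_weight_swap by blast
  then show "(\<Sum>j<M. ?c (Suc (2 * i), Suc (2 * j)) * poly (E j i) (mid_y j)) = 0"
    using E(2) by (elim trans[rotated]) (intro sum.cong, auto simp: scale_centres_def)
qed

definition restrict_centres :: "(nat \<times> nat \<Rightarrow> real) \<Rightarrow> nat \<times> nat \<Rightarrow> real" where
  "restrict_centres u = (\<lambda>v. if v \<in> centre_nodes then u v else 0)"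

lemma fun_linear_restrict_centres: "fun_linear restrict_centres"
  by (rule fun_linearI) (auto simp: restrict_centres_def fun_eq_iff)

lemma subspace_new_coeffs: "fun_space.subspace (new_coeffs C')"
  unfolding new_coeffs_def by (rule subspace_coeff_space)

text \<open>Multiplication by the nowhere vanishing centre weight is a bijection:
  \<open>scale_up\<close> shows that it is well defined, and \<open>scale_down\<close> provides the
  inverse.\<close>

lemma centre_dim:
  "fun_space.dim (restrict_centres ` new_coeffs False) = fun_space.dim (restrict_centres ` new_coeffs True)"
proof -
  obtain \<beta> where \<beta>: "block_choice (d - 1) s \<beta>" using block_choice_exists[OF blocks] by blast
  let ?g = "scale_centres (centre_weight \<beta>)" and ?h = "scale_centres (\<lambda>i j. 1 / centre_weight \<beta> i j)"
  have eq: "restrict_centres u' = scale_centres k (restrict_centres u)"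
    if "\<forall>v\<in>centre_nodes. u' v = scale_centres k u v" for u u' k
    using that by (auto simp: restrict_centres_def scale_centres_def centre_nodes_def fun_eq_iff)
  show ?thesis
  proof (rule fun_dim_bij[where f = ?g])
    show "fun_linear ?g"
      by (rule fun_linearI) (auto simp: scale_centres_def fun_eq_iff algebra_simps)
    show "fun_space.subspace (restrict_centres ` new_coeffs False)"
      by (rule fun_pair.linear_subspace_image[OF fun_linear_restrict_centres subspace_new_coeffs])
    fix c assume "c \<in> restrict_centres ` new_coeffs False"
    then obtain u where u: "u \<in> new_coeffs False" "c = restrict_centres u" by (elim imageE)
    obtain u' where "u' \<in> new_coeffs True" "\<forall>v\<in>centre_nodes. u' v = ?g u v"
      using scale_up[OF \<beta> u(1)] by blast
    then show "?g c \<in> restrict_centres ` new_coeffs True" using eq u(2) by (metis imageI)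
    show "c = (\<lambda>_. 0)" if "?g c = (\<lambda>_. 0)"
    proof
      fix v :: "nat \<times> nat"
      have "?g c v = 0" using that by simp
      then show "c v = 0"
        using centre_weight_nonzero u(2)
        by (cases v) (auto simp: scale_centres_def restrict_centres_def centre_nodes_def split: if_splits)
    qed
  next
    fix c assume "c \<in> restrict_centres ` new_coeffs True"
    then obtain u where u: "u \<in> new_coeffs True" "c = restrict_centres u" by (elim imageE)
    obtain u' where u': "u' \<in> new_coeffs False" "\<forall>v\<in>centre_nodes. u' v = ?h u v"
      using scale_down[OF \<beta> u(1)] by blast
    have "?g (restrict_centres u') = c"
      using u'(2) centre_weight_nonzero u(2)
      by (auto simp: fun_eq_iff scale_centres_def restrict_centres_def centre_nodes_def)
    then show "\<exists>b\<in>restrict_centres ` new_coeffs False. ?g b = c" using u'(1) by blast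
  qed
qed

end


subsection \<open>Comparison of the coefficients at new nodes: edge midpoints\<close>

text \<open>For \<open>i\<close> in \<open>R\<close> the maximal interval of \<open>R\<close> around
  \<open>i\<close> is \<open>{run_lo R i..<run_hi R i}\<close>. As cells have lines on both sides,
  its end lines have the indices \<open>run_lo R i\<close> and \<open>run_hi R i\<close>.\<close>

definition run_lo :: "nat set \<Rightarrow> nat \<Rightarrow> nat" where
  "run_lo R i = (LEAST l. \<forall>t. l \<le> t \<and> t \<le> i \<longrightarrow> t \<in> R)"

definition run_hi :: "nat set \<Rightarrow> nat \<Rightarrow> nat" where
  "run_hi R i = (LEAST h. i < h \<and> h \<notin> R)"

lemma run_lo:
  assumes "i \<in> R"
  shows "run_lo R i \<le> i" "\<And>t. run_lo R i \<le> t \<Longrightarrow> t \<le> i \<Longrightarrow> t \<in> R"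
    "\<And>l. (\<And>t. l \<le> t \<Longrightarrow> t \<le> i \<Longrightarrow> t \<in> R) \<Longrightarrow> run_lo R i \<le> l"
proof -
  have "\<forall>t. i \<le> t \<and> t \<le> i \<longrightarrow> t \<in> R" using assms by auto
  then have "\<forall>t. run_lo R i \<le> t \<and> t \<le> i \<longrightarrow> t \<in> R" "run_lo R i \<le> i"
    unfolding run_lo_def by (rule LeastI, rule Least_le)
  then show "run_lo R i \<le> i" "\<And>t. run_lo R i \<le> t \<Longrightarrow> t \<le> i \<Longrightarrow> t \<in> R" by auto
  show "run_lo R i \<le> l" if "\<And>t. l \<le> t \<Longrightarrow> t \<le> i \<Longrightarrow> t \<in> R" for l
    unfolding run_lo_def using that by (intro Least_le) auto
qed

lemma run_hi:
  assumes "i < m" "m \<notin> R"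
  shows "i < run_hi R i" "run_hi R i \<notin> R" "run_hi R i \<le> m" "\<And>t. i < t \<Longrightarrow> t < run_hi R i \<Longrightarrow> t \<in> R"
proof -
  have "i < run_hi R i \<and> run_hi R i \<notin> R"
    unfolding run_hi_def using assms by (intro LeastI) auto
  then show "i < run_hi R i" "run_hi R i \<notin> R" by auto
  show "run_hi R i \<le> m" unfolding run_hi_def using assms by (intro Least_le) auto
  show "t \<in> R" if "i < t" "t < run_hi R i" for t
    using that not_less_Least[of t "\<lambda>h. i < h \<and> h \<notin> R"] unfolding run_hi_def by auto
qed

text \<open>The weight vanishes exactly at the ends of a run, where the middle line of the cells meets a side
  without forming a cross-vertex.\<close>

definition run_weight :: "nat set \<Rightarrow> (nat \<Rightarrow> real) \<Rightarrow> nat \<Rightarrow> real poly" where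
  "run_weight R x i = end_weight (run_hi R i - run_lo R i) x (run_lo R i)"

text \<open>One row or one column of cells, \<open>R\<close> being the indices of its subdivided
  cells. The locale is used in both directions.\<close>

locale mesh_row =
  fixes R :: "nat set" and M d :: nat and x x' :: "nat \<Rightarrow> real"
  assumes R: "\<And>i. i \<in> R \<Longrightarrow> i < M" and mono: "strict_mono x" and double: "\<And>i. x' (2 * i) = x i"
    and d2: "2 \<le> d"
begin

lemma hi:
  assumes "i \<in> R"
  shows "i < run_hi R i" "run_hi R i \<notin> R" "run_hi R i \<le> M" "\<And>t. i \<le> t \<Longrightarrow> t < run_hi R i \<Longrightarrow> t \<in> R"
proof -
  have "i < M" "M \<notin> R" using R assms by auto
  note h = run_hi[OF this]
  show "i < run_hi R i" "run_hi R i \<notin> R" "run_hi R i \<le> M" using h by auto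
  show "t \<in> R" if "i \<le> t" "t < run_hi R i" for t
    using that h(4) assms by (cases "t = i") auto
qed

lemma lo_end:
  assumes "i \<in> R" "\<not> (0 < i \<and> i - 1 \<in> R)" shows "run_lo R i = i"
proof (rule ccontr)
  assume "run_lo R i \<noteq> i"
  then have "run_lo R i \<le> i - 1" "0 < i" using run_lo(1)[OF assms(1)] by auto
  then show False using run_lo(2)[OF assms(1), of "i - 1"] assms(2) by auto
qed

lemma hi_end:
  assumes "i \<in> R" "Suc i \<notin> R" shows "run_hi R i = Suc i"
  using hi[OF assms(1)] assms(2) by (metis Suc_leI le_Suc_eq le_neq_implies_less not_less_eq_eq order_refl)

lemma run_weight_Suc:
  assumes "i \<in> R" "Suc i \<in> R" shows "run_weight R x (Suc i) = run_weight R x i"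
proof -
  have "run_lo R (Suc i) \<le> run_lo R i"
    using run_lo(2)[OF assms(1)] assms by (intro run_lo(3)) (auto simp: le_Suc_eq)
  moreover have "run_lo R i \<le> run_lo R (Suc i)"
    using run_lo(2)[OF assms(2)] by (intro run_lo(3)) (auto simp: assms)
  moreover have "run_hi R (Suc i) = run_hi R i"
  proof -
    have "i < h \<and> h \<notin> R \<longleftrightarrow> Suc i < h \<and> h \<notin> R" for h using assms by (metis Suc_lessI Suc_lessD)
    then show ?thesis by (simp add: run_hi_def)
  qed
  ultimately show ?thesis by (simp add: run_weight_def)
qed

lemma poly_run_weight:
  assumes "i \<in> R"
  shows "poly (run_weight R x i) z = (z - x (run_lo R i)) * (z - x (run_hi R i))"
    "degree (run_weight R x i) = 2" "run_weight R x i \<noteq> 0"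
  using run_lo(1)[OF assms] hi(1)[OF assms] by (simp_all add: run_weight_def end_weight_simps)

definition weight :: "nat \<Rightarrow> real poly" where
  "weight = spread R (run_weight R x)"

lemma weight_edge_polys: "edge_polys 2 (\<lambda>a. a div 2 \<in> R) weight"
  unfolding weight_def using poly_run_weight(2) run_weight_Suc by (intro edge_polys_spread) auto

text \<open>The nonzero values occur at exactly those edge midpoints that \<open>nodes_simps\<close>
  shows to be cross-vertices of the refined mesh.\<close>

lemma weight_even_nonzero_iff: "poly (weight (2 * i)) (x i) \<noteq> 0 \<longleftrightarrow> 0 < i \<and> i - 1 \<in> R \<and> i \<in> R"
proof -
  consider "i \<in> R" "0 < i \<and> i - 1 \<in> R" | "i \<in> R" "\<not> (0 < i \<and> i - 1 \<in> R)"
    | "i \<notin> R" "0 < i \<and> i - 1 \<in> R" | "i \<notin> R" "\<not> (0 < i \<and> i - 1 \<in> R)" by blast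
  then show ?thesis
  proof cases
    case 1
    then have "i < run_hi R i" using hi(1)[of i] by auto
    moreover have "run_lo R i \<le> i - 1"
    proof -
      have "run_lo R i \<noteq> i"
      proof
        assume "run_lo R i = i"
        moreover have "run_lo R i \<le> i - 1"
        proof (rule run_lo(3)[OF 1(1)])
          fix t assume "i - 1 \<le> t" "t \<le> i"
          then have "t = i - 1 \<or> t = i" by auto
          then show "t \<in> R" using 1 by auto
        qed
        ultimately show False using 1 by linarith
      qed
      then show ?thesis using run_lo(1)[OF 1(1)] by simp
    qed
    ultimately show ?thesis
      using 1 mono by (auto simp: weight_def spread_simps poly_run_weight strict_mono_eq)
  next
    case 2
    then show ?thesis using lo_end by (simp add: weight_def spread_simps poly_run_weight)
  next
    case 3
    then show ?thesis using hi_end[of "i - 1"] by (auto simp: weight_def spread_simps poly_run_weight)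
  qed (auto simp: weight_def spread_simps)
qed

text \<open>Multiplying by the weight turns a test family of degree \<open>d - 2\<close> into one of
  degree \<open>d\<close>, since the weight does not change within a run.\<close>

lemma moments_weight:
  assumes "moments d (\<lambda>a. a div 2 \<in> R) x' v" "\<And>a. a > 2 * M \<Longrightarrow> v a = 0"
  shows "moments (d - 2) (\<lambda>a. a div 2 \<in> R) x' (\<lambda>a. v a * poly (weight a) (x' a))"
proof (rule momentsI[where m = "2 * M"])
  fix p assume p: "edge_polys (d - 2) (\<lambda>a. a div 2 \<in> R) p"
  have "edge_polys d (\<lambda>a. a div 2 \<in> R) (\<lambda>a. p a * weight a)"
    unfolding edge_polys_def
  proof (intro conjI allI impI)
    fix t
    have "degree (p t) \<le> d - 2" "degree (weight t) \<le> 2"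
      using p weight_edge_polys by (auto simp: edge_polys_def)
    then show "degree (p t * weight t) \<le> d"
      using degree_mult_le[of "p t" "weight t"] d2 by linarith
  qed (use p weight_edge_polys in \<open>auto simp: edge_polys_def\<close>)
  moreover have "\<not> 2 * M div 2 \<in> R" using R by auto
  ultimately have "(\<Sum>a\<le>2 * M. v a * poly (p a * weight a) (x' a)) = 0"
    by (rule moments_edge_polys[OF assms(1)])
  then show "(\<Sum>a\<le>2 * M. v a * poly (weight a) (x' a) * poly (p a) (x' a)) = 0"
    by (simp add: mult_ac)
qed (simp add: assms(2))

lemma edge_polys_run:
  assumes "edge_polys k (\<lambda>a. a div 2 \<in> R) p" "i \<le> j" "\<And>t. i \<le> t \<Longrightarrow> t < j \<Longrightarrow> t \<in> R"
  shows "p (2 * j) = p (2 * i)"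
  using assms(2,3)
proof (induction j rule: dec_induct)
  case (step n)
  then have "n \<in> R" by auto
  then have "p (2 * Suc n) = p (Suc (2 * n))" "p (Suc (2 * n)) = p (2 * n)"
    using assms(1) by (auto simp: edge_polys_def)
  then show ?case using step by simp
qed simp

text \<open>A test family of degree \<open>d\<close> that vanishes at both ends of each run is
  divisible by the weight, and the quotient is a test family of degree \<open>d - 2\<close> for
  \<open>v\<close>. Where the weight is zero, so is \<open>v\<close>, and the quotient
  \<open>v a / 0\<close> is consistently 0.\<close>

lemma weighted_sum_zero:
  assumes p: "edge_polys d (\<lambda>a. a div 2 \<in> R) p"
    and p0: "\<And>i. i \<le> M \<Longrightarrow> poly (weight (2 * i)) (x i) = 0 \<Longrightarrow> (0 < i \<and> i - 1 \<in> R) \<or> i \<in> R \<Longrightarrow> poly (p (2 * i)) (x i) = 0"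
    and v: "moments (d - 2) (\<lambda>a. a div 2 \<in> R) x' v" "\<And>i. v (Suc (2 * i)) = 0"
      "\<And>i. poly (weight (2 * i)) (x i) = 0 \<Longrightarrow> v (2 * i) = 0"
  shows "(\<Sum>a\<le>2 * M. v a / poly (weight a) (x' a) * poly (p a) (x' a)) = 0"
proof -
  have dvd: "run_weight R x i dvd p (2 * i)" if i: "i \<in> R" for i
  proof -
    define l h where lh: "l = run_lo R i" "h = run_hi R i"
    have l: "l \<le> i" "l \<in> R" "\<not> (0 < l \<and> l - 1 \<in> R)"
    proof -
      show l: "l \<le> i" "l \<in> R" using run_lo(1,2)[OF i] by (auto simp: lh)
      show "\<not> (0 < l \<and> l - 1 \<in> R)"
      proof
        \<comment> \<open>A cell of \<open>R\<close> just before the run would extend it, against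
          the minimality of \<open>run_lo\<close>.\<close>
        assume a: "0 < l \<and> l - 1 \<in> R"
        have "l \<le> l - 1"
          unfolding lh(1)
        proof (rule run_lo(3)[OF i])
          fix t assume "run_lo R i - 1 \<le> t" "t \<le> i"
          then have "t = l - 1 \<or> l \<le> t" unfolding lh(1) by linarith
          then show "t \<in> R" using a run_lo(2)[OF i] \<open>t \<le> i\<close> by (auto simp: lh(1))
        qed
        with a show False by linarith
      qed
    qed
    have h: "i < h" "h \<notin> R" "h \<le> M" "h - 1 \<in> R" "0 < h"
      using hi[OF i] by (auto simp: lh)
    have "p (2 * i) = p (2 * l)"
      using l(1) run_lo(2)[OF i] by (intro edge_polys_run[OF p]) (auto simp: lh)
    moreover have "poly (p (2 * l)) (x l) = 0"
      using l weight_even_nonzero_iff[of l] R[OF l(2)] by (intro p0) auto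
    moreover have "p (2 * h) = p (2 * i)"
      using h(1) hi(4)[OF i] by (intro edge_polys_run[OF p]) (auto simp: lh)
    moreover have "poly (p (2 * h)) (x h) = 0"
      using h weight_even_nonzero_iff[of h] by (intro p0) auto
    moreover have "x l \<noteq> x (l + (h - l))" using l(1) h(1) mono by (simp add: strict_mono_eq)
    moreover have "l + (h - l) = h" using l(1) h(1) by simp
    ultimately show ?thesis
      unfolding run_weight_def by (intro end_weight_dvd) (auto simp flip: lh)
  qed
  define q where "q a = p a div weight a" for a
  have pc: "p (Suc a) = p a" if "a div 2 \<in> R" for a using p that by (simp add: edge_polys_def)
  have dvd': "weight a dvd p a" if "weight a \<noteq> 0" for a
  proof (cases "a div 2 \<in> R")
    case True
    have "a = 2 * (a div 2) \<or> a = Suc (2 * (a div 2))" by presburger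
    then have "p a = p (2 * (a div 2))" using pc[of "2 * (a div 2)"] True by (metis Suc_double_not_eq_double nonzero_mult_div_cancel_left zero_neq_numeral)
    then show ?thesis using dvd[OF True] True by (simp add: weight_def spread_def)
  next
    case False
    then have a: "even a" "0 < a" "a div 2 - 1 \<in> R"
      using that by (auto simp: weight_def spread_def split: if_splits)
    define i where "i = a div 2 - 1"
    have ai: "a = 2 * Suc i" using a by (auto simp: i_def elim!: evenE)
    have "p (2 * Suc i) = p (2 * i)"
    proof (rule edge_polys_run[OF p])
      fix t assume "i \<le> t" "t < Suc i"
      then have "t = i" by simp
      then show "t \<in> R" using a(3) by (simp add: i_def)
    qed simp
    moreover have "weight a = run_weight R x i"
      using a False by (simp add: weight_def spread_def i_def)
    moreover have "i \<in> R" using a(3) by (simp add: i_def)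
    ultimately show ?thesis using dvd[of i] by (simp only: ai)
  qed
  have w2: "degree (weight a) = 2" if "weight a \<noteq> 0" for a
    using that by (auto simp: weight_def spread_def poly_run_weight split: if_splits)
  have "edge_polys (d - 2) (\<lambda>a. a div 2 \<in> R) q"
    unfolding edge_polys_def
  proof (intro conjI allI impI)
    show "degree (q t) \<le> d - 2" for t
      using degree_div_quadratic[OF dvd' w2, of t] p by (cases "weight t = 0") (auto simp: q_def edge_polys_def)
    show "q (Suc t) = q t" if "t div 2 \<in> R" for t
      using that p weight_edge_polys by (simp add: q_def edge_polys_def)
  qed
  moreover have "\<not> 2 * M div 2 \<in> R" using R by auto
  ultimately have "(\<Sum>a\<le>2 * M. v a * poly (q a) (x' a)) = 0"
    by (rule moments_edge_polys[OF v(1)])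
  also have "(\<Sum>a\<le>2 * M. v a * poly (q a) (x' a)) = (\<Sum>a\<le>2 * M. v a / poly (weight a) (x' a) * poly (p a) (x' a))"
  proof (intro sum.cong refl)
    fix a
    show "v a * poly (q a) (x' a) = v a / poly (weight a) (x' a) * poly (p a) (x' a)"
    proof (cases "poly (weight a) (x' a) = 0")
      case True
      have "v a = 0"
      proof (cases "even a")
        case True
        then obtain i where "a = 2 * i" by (elim evenE)
        then show ?thesis using v(3) \<open>poly (weight a) (x' a) = 0\<close> double by simp
      qed (use v(2) in \<open>auto elim!: oddE\<close>)
      then show ?thesis by simp
    next
      case False
      then have "weight a \<noteq> 0" by auto
      from dvd'[OF this] have "p a = weight a * q a" by (simp add: q_def)
      then show ?thesis using False by simp
    qed
  qed
  finally show ?thesis .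
qed

text \<open>After multiplication by the weight only the two ends of each run can have escaped. The
  moments of order 0 and 1 over the run are two independent conditions on these two values.
  Proceeding from left to right, everything before the run is already known to vanish.\<close>

lemma moments_weight_inj:
  assumes v: "moments d (\<lambda>a. a div 2 \<in> R) x' v" "\<And>i. v (Suc (2 * i)) = 0"
    and w: "\<And>i. v (2 * i) * poly (weight (2 * i)) (x i) = 0"
  shows "v a = 0"
proof (induction a rule: less_induct)
  case (less a)
  show ?case
  proof (cases "even a")
    case True
    then obtain i where a: "a = 2 * i" by (elim evenE)
    have v0: "v (2 * k) = 0" if "0 < k" "k - 1 \<in> R" "k \<in> R" for k
      using w[of k] weight_even_nonzero_iff[of k] that by auto
    have sum0: "(\<Sum>t\<le>2 * h. v t * x' t ^ k) = 0" if "h \<notin> R" "k \<le> d" for h k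
      using v(1) that by (simp add: moments_def)
    have lt: "v (2 * k) = 0" if "k < i" for k using less.IH[of "2 * k"] that a by simp
    show ?thesis
    proof (cases "i \<in> R")
      case False
      then have "(\<Sum>t\<le>2 * i. v t * x' t ^ 0) = 0" by (intro sum0) auto
      moreover have "(\<Sum>t\<le>2 * i. v t * x' t ^ 0) = (\<Sum>t\<le>2 * i. if t = 2 * i then v (2 * i) else 0)"
        using less.IH a by (intro sum.cong refl) auto
      ultimately show ?thesis by (simp add: a)
    next
      case True
      define h where "h = run_hi R i"
      note h = hi[OF True, folded h_def]
      have *: "(\<Sum>t\<le>2 * h. v t * x' t ^ k) = v (2 * i) * x i ^ k + v (2 * h) * x h ^ k" for k
      proof -
        have "(\<Sum>t\<le>2 * h. v t * x' t ^ k) = (\<Sum>t\<le>h. v (2 * t) * x t ^ k)"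
          by (subst sum_even_only) (auto simp: v(2) double)
        also have "\<dots> = (\<Sum>t\<in>{i, h}. v (2 * t) * x t ^ k)"
        proof (rule sum.mono_neutral_right)
          show "\<forall>t\<in>{..h} - {i, h}. v (2 * t) * x t ^ k = 0"
          proof
            fix t assume t: "t \<in> {..h} - {i, h}"
            show "v (2 * t) * x t ^ k = 0"
              using lt[of t] v0[of t] h(4)[of t] h(4)[of "t - 1"] t by (cases "t < i") auto
          qed
        qed (use h(1) in auto)
        finally show ?thesis using h(1) by simp
      qed
      have "v (2 * i) * x i ^ 0 + v (2 * h) * x h ^ 0 = 0" "v (2 * i) * x i ^ 1 + v (2 * h) * x h ^ 1 = 0"
        unfolding *[symmetric] by (rule sum0[OF h(2)], use d2 in simp)+
      then have "v (2 * h) = - v (2 * i)" "v (2 * i) * x i + v (2 * h) * x h = 0" by auto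
      then have "v (2 * i) * (x i - x h) = 0" by (simp add: algebra_simps)
      moreover have "x i < x h" using mono h(1) by (simp add: strict_mono_less)
      ultimately show ?thesis by (simp add: a)
    qed
  qed (use v(2) in \<open>auto elim!: oddE\<close>)
qed

end


context bounded_refinement begin

lemma mesh_row_h: "mesh_row {i. (i, j) \<in> s} M d X X'"
  using s_bounded mono(1) double(1) d by unfold_locales auto

lemma mesh_row_v: "mesh_row {j. (i, j) \<in> s} M d Y Y'"
  using s_bounded mono(2) double(2) d by unfold_locales auto

text \<open>A midpoint takes the weight of the one new line on which it lies. At centres and at old
  nodes the value is immaterial, because the functions multiplied by it vanish there.\<close>

definition mid_weight :: "nat \<times> nat \<Rightarrow> real" where
  "mid_weight = (\<lambda>(a, b). if odd b then poly (mesh_row.weight {i. (i, b div 2) \<in> s} X a) (X' a)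
     else poly (mesh_row.weight {j. (a div 2, j) \<in> s} Y b) (Y' b))"

lemma mid_weight_nonzero_iff:
  "mid_weight (2 * i, Suc (2 * j)) \<noteq> 0 \<longleftrightarrow> 0 < i \<and> (i - 1, j) \<in> s \<and> (i, j) \<in> s"
  "mid_weight (Suc (2 * i), 2 * j) \<noteq> 0 \<longleftrightarrow> 0 < j \<and> (i, j - 1) \<in> s \<and> (i, j) \<in> s"
  using mesh_row.weight_even_nonzero_iff[OF mesh_row_h[of j], of i]
    mesh_row.weight_even_nonzero_iff[OF mesh_row_v[of i], of j]
  by (simp_all add: mid_weight_def double)

definition mid_coeffs :: "bool \<Rightarrow> (nat \<times> nat \<Rightarrow> real) set" where
  "mid_coeffs C' = {u \<in> new_coeffs C'. restrict_centres u = (\<lambda>_. 0)}"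

lemma mid_coeffsD:
  assumes "u \<in> mid_coeffs C'"
  shows "u \<in> new_coeffs C'" "u (Suc (2 * i), Suc (2 * j)) = 0"
proof -
  show "u \<in> new_coeffs C'" using assms by (simp add: mid_coeffs_def)
  have "restrict_centres u (Suc (2 * i), Suc (2 * j)) = 0" using assms by (simp add: mid_coeffs_def)
  then show "u (Suc (2 * i), Suc (2 * j)) = 0" by (simp add: restrict_centres_def centre_nodes_def)
qed

lemma node_cases:
  obtains i j where "v = (2 * i, 2 * j)" | i j where "v = (2 * i, Suc (2 * j))"
    | i j where "v = (Suc (2 * i), 2 * j)" | i j where "v = (Suc (2 * i), Suc (2 * j))"
proof -
  have e: "\<exists>k. n = 2 * k \<or> n = Suc (2 * k)" for n :: nat by presburger
  obtain k l where "fst v = 2 * k \<or> fst v = Suc (2 * k)" "snd v = 2 * l \<or> snd v = Suc (2 * l)"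
    using e by metis
  then show ?thesis using that by (cases v) auto
qed

text \<open>Without values at the centres the new rows and columns decouple, and on each line the
  weight turns degree \<open>d\<close> into degree \<open>d - 2\<close>. Injectivity comes from the
  moments of order 0 and 1 on a run, surjectivity from the divisibility of test families by the
  weight.\<close>

lemma mid_dim: "fun_space.dim (mid_coeffs False) = fun_space.dim (mid_coeffs True)"
proof -
  define f where "f u = (\<lambda>v. u v * mid_weight v)" for u :: "nat \<times> nat \<Rightarrow> real"
  have f_row: "(\<lambda>a. f u (a, Suc (2 * j))) = (\<lambda>a. u (a, Suc (2 * j)) * poly (mesh_row.weight {i. (i, j) \<in> s} X a) (X' a))" for u j
    by (simp add: f_def mid_weight_def)
  have f_col: "(\<lambda>b. f u (Suc (2 * i), b)) = (\<lambda>b. u (Suc (2 * i), b) * poly (mesh_row.weight {j. (i, j) \<in> s} Y b) (Y' b))"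
    if "\<And>j. u (Suc (2 * i), Suc (2 * j)) = 0" for u i
    using that by (auto simp: f_def mid_weight_def fun_eq_iff elim!: oddE)
  show ?thesis
  proof (rule fun_dim_bij[where f = f])
    show "fun_linear f" by (rule fun_linearI) (auto simp: f_def fun_eq_iff algebra_simps)
    show "fun_space.subspace (mid_coeffs False)"
      using fun_space.subspace_inter[OF subspace_new_coeffs[of False]
        fun_pair.linear_subspace_kernel[OF fun_linear_restrict_centres]]
      by (simp add: mid_coeffs_def Int_def zero_fun_def)
    fix u assume u: "u \<in> mid_coeffs False"
    note un = new_coeffsD[OF mid_coeffsD(1)[OF u]] and u0 = mid_coeffsD(2)[OF u]
    have "moments (d - 2) (\<lambda>a. H' a b) X' (\<lambda>a. f u (a, b))" if b: "odd b" for b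
    proof -
      obtain j where j: "b = Suc (2 * j)" using b by (auto elim!: oddE)
      have "moments d (\<lambda>a. a div 2 \<in> {i. (i, j) \<in> s}) X' (\<lambda>a. u (a, b))"
        using un(1)[OF b] by (simp add: j row_edges mesh_degree_def)
      from mesh_row.moments_weight[OF mesh_row_h this] show ?thesis
        using un(5) unfolding j f_row by (simp add: row_edges)
    qed
    moreover have "moments (d - 2) (V' a) Y' (\<lambda>b. f u (a, b))" if a: "odd a" for a
    proof -
      obtain i where i: "a = Suc (2 * i)" using a by (auto elim!: oddE)
      have "moments d (\<lambda>b. b div 2 \<in> {j. (i, j) \<in> s}) Y' (\<lambda>b. u (a, b))"
        using un(2)[OF a] by (simp add: i refine_v_def[abs_def] mesh_degree_def)
      from mesh_row.moments_weight[OF mesh_row_v this] show ?thesis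
        using un(5) unfolding i f_col[of u i, OF u0] by (simp add: refine_v_def[abs_def])
    qed
    moreover have "f u v = 0" if v: "v \<notin> nodes True H' V' \<inter> odd_nodes" for v
    proof (cases rule: node_cases[of v])
      case (1 i j)
      then have "v \<notin> odd_nodes" by (simp add: odd_nodes_def)
      then show ?thesis using un(4) by (simp add: f_def)
    next
      case (2 i j)
      then have "v \<notin> nodes True H' V'" using v by (auto simp: odd_nodes_def)
      then have "mid_weight v = 0"
        using mid_weight_nonzero_iff(1)[of i j] refinement.nodes_simps(4)[OF refinement_axioms, of i j True] 2 by auto
      then show ?thesis by (simp add: f_def)
    next
      case (3 i j)
      then have "v \<notin> nodes True H' V'" using v by (auto simp: odd_nodes_def)
      then have "mid_weight v = 0"
        using mid_weight_nonzero_iff(2)[of i j] refinement.nodes_simps(3)[OF refinement_axioms, of i j True] 3 by auto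
      then show ?thesis by (simp add: f_def)
    qed (use u0 in \<open>simp add: f_def\<close>)
    ultimately have "f u \<in> new_coeffs True"
      by (auto simp: new_coeffs_def coeff_space_def mesh_degree_def)
    moreover have "restrict_centres (f u) = (\<lambda>_. 0)"
    proof -
      have "restrict_centres (f u) = (\<lambda>v. restrict_centres u v * mid_weight v)"
        by (auto simp: restrict_centres_def f_def)
      then show ?thesis using u by (simp add: mid_coeffs_def)
    qed
    ultimately show "f u \<in> mid_coeffs True" by (simp add: mid_coeffs_def)
    show "u = (\<lambda>_. 0)" if "f u = (\<lambda>_. 0)"
    proof
      fix v
      have fu: "u v * mid_weight v = 0" for v using that unfolding f_def by meson
      show "u v = 0"
      proof (cases rule: node_cases[of v])
        case (1 i j)
        then have "v \<notin> odd_nodes" by (simp add: odd_nodes_def)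
        then show ?thesis using un(4) by simp
      next
        case (2 i j)
        have "moments d (\<lambda>a. a div 2 \<in> {i. (i, j) \<in> s}) X' (\<lambda>a. u (a, Suc (2 * j)))"
          using un(1)[of "Suc (2 * j)"] by (simp add: row_edges mesh_degree_def)
        from mesh_row.moments_weight_inj[OF mesh_row_h this] show ?thesis
          using fu[of "(2 * _, Suc (2 * j))"] u0 by (simp add: 2 mid_weight_def double)
      next
        case (3 i j)
        have "moments d (\<lambda>b. b div 2 \<in> {j. (i, j) \<in> s}) Y' (\<lambda>b. u (Suc (2 * i), b))"
          using un(2)[of "Suc (2 * i)"] by (simp add: refine_v_def[abs_def] mesh_degree_def)
        from mesh_row.moments_weight_inj[OF mesh_row_v this] show ?thesis
          using fu[of "(Suc (2 * i), 2 * _)"] u0 by (simp add: 3 mid_weight_def double)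
      qed (use u0 in simp)
    qed
  next
    fix w assume w: "w \<in> mid_coeffs True"
    note wn = new_coeffsD[OF mid_coeffsD(1)[OF w]] and w0 = mid_coeffsD(2)[OF w]
    define c where "c v = w v / mid_weight v" for v
    \<comment> \<open>The nodes where division by the weight gives no information; their values are
      sought so that the conditions of order \<open>d\<close> hold.\<close>
    define V0 where "V0 = {(a, b). odd a \<noteq> odd b \<and> mid_weight (a, b) = 0 \<and> a \<le> 2 * M \<and> b \<le> 2 * M}"
    have w_end: "w (2 * i, Suc (2 * j)) = 0" if "mid_weight (2 * i, Suc (2 * j)) = 0" for i j
      using that mid_weight_nonzero_iff(1)[of i j] refinement.nodes_simps(4)[OF refinement_axioms, of i j True] wn(3)
      by blast
    have w_end': "w (Suc (2 * i), 2 * j) = 0" if "mid_weight (Suc (2 * i), 2 * j) = 0" for i j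
      using that mid_weight_nonzero_iff(2)[of i j] refinement.nodes_simps(3)[OF refinement_axioms, of i j True] wn(3)
      by blast
    have c_odd: "c v = 0" if "v \<notin> odd_nodes \<or> v \<notin> {..2 * M} \<times> {..2 * M}" for v
      using that wn(4)[of v] wn(5)[of v] by (auto simp: c_def)
    have c_centre: "c (Suc (2 * i), Suc (2 * j)) = 0" for i j using w0 by (simp add: c_def)
    have "\<exists>u. (\<forall>v. v \<notin> V0 \<longrightarrow> u v = c v) \<and> (\<forall>b\<in>{b. odd b}. moments d (\<lambda>a. H' a b) X' (\<lambda>a. u (a, b))) \<and>
        (\<forall>a\<in>{a. odd a}. moments d (V' a) Y' (\<lambda>b. u (a, b)))"
    proof (rule coeff_extend[OF bounded'])
      show "V0 \<subseteq> {..2 * M} \<times> {..2 * M}" by (auto simp: V0_def)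
      fix P Q
      assume df: "dual_family d H' V' (2 * M) {b. odd b} {a. odd a} P Q"
        and v0: "\<And>a b. (a, b) \<in> V0 \<Longrightarrow> poly (P a b) (X' a) + poly (Q a b) (Y' b) = 0"
      note fam = mid_sum_rows[OF df]
      have row: "(\<Sum>a\<le>2 * M. c (a, b) * poly (P a b) (X' a)) = 0" if "b \<le> 2 * M" for b
      proof (cases "even b")
        case False
        then obtain j where j: "b = Suc (2 * j)" by (auto elim!: oddE)
        have "(\<Sum>a\<le>2 * M. w (a, b) / poly (mesh_row.weight {i. (i, j) \<in> s} X a) (X' a) * poly (P a b) (X' a)) = 0"
        proof (rule mesh_row.weighted_sum_zero[OF mesh_row_h])
          show "edge_polys d (\<lambda>a. a div 2 \<in> {i. (i, j) \<in> s}) (\<lambda>a. P a b)"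
            using fam(1)[of b] False by (simp add: j row_edges)
          show "moments (d - 2) (\<lambda>a. a div 2 \<in> {i. (i, j) \<in> s}) X' (\<lambda>a. w (a, b))"
            using wn(1)[of b] False by (simp add: j row_edges mesh_degree_def)
          show "w (Suc (2 * i), b) = 0" for i using w0 by (simp add: j)
          show "w (2 * i, b) = 0" if "poly (mesh_row.weight {i. (i, j) \<in> s} X (2 * i)) (X i) = 0" for i
            using w_end[of i j] that by (simp add: j mid_weight_def double)
          show "poly (P (2 * i) b) (X i) = 0"
            if "i \<le> M" "poly (mesh_row.weight {i. (i, j) \<in> s} X (2 * i)) (X i) = 0" for i
          proof -
            have "(2 * i, b) \<in> V0" using that \<open>b \<le> 2 * M\<close> by (simp add: V0_def mid_weight_def j double)
            from v0[OF this] show ?thesis by (simp add: fam(4) double)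
          qed
        qed
        moreover have "c (a, b) = w (a, b) / poly (mesh_row.weight {i. (i, j) \<in> s} X a) (X' a)" for a
          by (simp add: c_def mid_weight_def j)
        ultimately show ?thesis by simp
      qed (simp add: fam(3))
      have col: "(\<Sum>b\<le>2 * M. c (a, b) * poly (Q a b) (Y' b)) = 0" if "a \<le> 2 * M" for a
      proof (cases "even a")
        case False
        then obtain i where i: "a = Suc (2 * i)" by (auto elim!: oddE)
        have "(\<Sum>b\<le>2 * M. w (a, b) / poly (mesh_row.weight {j. (i, j) \<in> s} Y b) (Y' b) * poly (Q a b) (Y' b)) = 0"
        proof (rule mesh_row.weighted_sum_zero[OF mesh_row_v])
          show "edge_polys d (\<lambda>b. b div 2 \<in> {j. (i, j) \<in> s}) (Q a)"
            using fam(2)[of a] False by (simp add: i refine_v_def[abs_def])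
          show "moments (d - 2) (\<lambda>b. b div 2 \<in> {j. (i, j) \<in> s}) Y' (\<lambda>b. w (a, b))"
            using wn(2)[of a] False by (simp add: i refine_v_def[abs_def] mesh_degree_def)
          show "w (a, Suc (2 * j)) = 0" for j using w0 by (simp add: i)
          show "w (a, 2 * j) = 0" if "poly (mesh_row.weight {j. (i, j) \<in> s} Y (2 * j)) (Y j) = 0" for j
            using w_end'[of i j] that by (simp add: i mid_weight_def double)
          show "poly (Q a (2 * j)) (Y j) = 0"
            if "j \<le> M" "poly (mesh_row.weight {j. (i, j) \<in> s} Y (2 * j)) (Y j) = 0" for j
          proof -
            have "(a, 2 * j) \<in> V0" using that \<open>a \<le> 2 * M\<close> by (simp add: V0_def mid_weight_def i double)
            from v0[OF this] show ?thesis by (simp add: fam(3) double)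
          qed
        qed
        moreover have "c (a, b) = w (a, b) / poly (mesh_row.weight {j. (i, j) \<in> s} Y b) (Y' b)" for b
          using w0 by (cases "even b") (auto simp: c_def mid_weight_def i elim!: oddE)
        ultimately show ?thesis by simp
      qed (simp add: fam(4))
      have "(\<Sum>a\<le>2 * M. \<Sum>b\<le>2 * M. c (a, b) * poly (P a b) (X' a)) = 0"
        by (subst sum.swap) (simp add: row)
      then show "(\<Sum>a\<le>2 * M. \<Sum>b\<le>2 * M. c (a, b) * (poly (P a b) (X' a) + poly (Q a b) (Y' b))) = 0"
        by (simp add: distrib_left sum.distrib col)
    qed (use c_odd in blast)
    then obtain u where u: "\<forall>v. v \<notin> V0 \<longrightarrow> u v = c v"
      "\<forall>b\<in>{b. odd b}. moments d (\<lambda>a. H' a b) X' (\<lambda>a. u (a, b))"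
      "\<forall>a\<in>{a. odd a}. moments d (V' a) Y' (\<lambda>b. u (a, b))" by auto
    have "u v = 0" if "v \<notin> nodes False H' V' \<inter> odd_nodes" for v
    proof -
      have "v \<notin> odd_nodes" using that by (auto simp: nodes_def)
      then show ?thesis using u(1) c_odd by (cases v) (auto simp: V0_def odd_nodes_def)
    qed
    then have "u \<in> new_coeffs False"
      using u(2,3) by (auto simp: new_coeffs_def coeff_space_def mesh_degree_def)
    moreover have "restrict_centres u = (\<lambda>_. 0)"
    proof
      fix v
      show "restrict_centres u v = 0"
      proof (cases rule: node_cases[of v])
        case (4 i j)
        then have "v \<notin> V0" by (simp add: V0_def)
        then show ?thesis using u(1) c_centre 4 by (simp add: restrict_centres_def)
      qed (auto simp: restrict_centres_def centre_nodes_def)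
    qed
    moreover have "f u v = w v" for v
    proof (cases "mid_weight v = 0 \<or> v \<in> V0")
      case True
      then have mw: "mid_weight v = 0" by (auto simp: V0_def)
      have "w v = 0"
      proof (cases rule: node_cases[of v])
        case (1 i j)
        then have "v \<notin> odd_nodes" by (simp add: odd_nodes_def)
        then show ?thesis using wn(4) by simp
      qed (use w_end w_end' w0 mw in auto)
      then show ?thesis using mw by (simp add: f_def)
    next
      case False
      then have "u v = c v" using u(1) by (cases v) auto
      then show ?thesis using False by (simp add: f_def c_def)
    qed
    then have "f u = w" by (rule ext)
    ultimately show "\<exists>b\<in>mid_coeffs False. f b = w" by (auto simp: mid_coeffs_def)
  qed
qed

theorem new_coeffs_dim: "fun_space.dim (new_coeffs False) = fun_space.dim (new_coeffs True)"
proof -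
  have "fun_space.dim (new_coeffs C') =
    fun_space.dim (mid_coeffs C') + fun_space.dim (restrict_centres ` new_coeffs C')" for C'
    unfolding mid_coeffs_def
    by (rule fun_dim_kernel_image[OF fun_linear_restrict_centres subspace_new_coeffs, of "{..2 * M} \<times> {..2 * M}"])
      (simp, metis new_coeffsD(5))
  then show ?thesis using mid_dim centre_dim by simp
qed

end

context dual_refinement begin

lemma new_space_eq: "new_space = new_coeffs C"
  by (simp add: new_space_def new_coeffs_def)

end

theorem dim_refine_eq:
  assumes "dual_refinement False d H V X Y X' Y' s M" "dual_refinement True d H V X Y X' Y' s M"
    and "fun_space.dim (coeff_space d H V X Y UNIV UNIV UNIV) =
      fun_space.dim (coeff_space (d - 2) H V X Y (cross_nodes H V) UNIV UNIV)"
  shows "fun_space.dim (coeff_space d (refine_h H s) (refine_v V s) X' Y' UNIV UNIV UNIV) =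
    fun_space.dim (coeff_space (d - 2) (refine_h H s) (refine_v V s) X' Y'
      (cross_nodes (refine_h H s) (refine_v V s)) UNIV UNIV)"
proof -
  interpret T: dual_refinement False d H V X Y X' Y' s M by (rule assms(1))
  interpret G: dual_refinement True d H V X Y X' Y' s M by (rule assms(2))
  show ?thesis
    using T.dim_refine G.dim_refine assms(3) T.new_coeffs_dim T.new_space_eq G.new_space_eq
    by (simp add: mesh_degree_def nodes_def)
qed


subsection \<open>Tensor product meshes\<close>

text \<open>Separate orders \<open>r\<close>, \<open>r'\<close> and index sets \<open>K\<close>,
  \<open>L\<close> for the two directions allow one direction to be reduced at a time.\<close>

definition tensor_space :: "nat \<Rightarrow> nat \<Rightarrow> (nat \<Rightarrow> real) \<Rightarrow> (nat \<Rightarrow> real) \<Rightarrow> nat set \<Rightarrow> nat set \<Rightarrow> (nat \<times> nat \<Rightarrow> real) set" where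
  "tensor_space r r' X Y K L = {c. (\<forall>v. v \<notin> K \<times> L \<longrightarrow> c v = 0) \<and>
     (\<forall>j. \<forall>k\<le>r. (\<Sum>i\<in>K. c (i, j) * X i ^ k) = 0) \<and> (\<forall>i. \<forall>k\<le>r'. (\<Sum>j\<in>L. c (i, j) * Y j ^ k) = 0)}"

lemma moments_interval:
  "moments r (\<lambda>a. a < m) x c \<longleftrightarrow> (\<forall>a>m. c a = 0) \<and> (\<forall>k\<le>r. (\<Sum>i\<le>m. c i * x i ^ k) = 0)"
proof (intro iffI conjI allI impI)
  assume mo: "moments r (\<lambda>a. a < m) x c"
  show "c a = 0" if "m < a" for a using moments_isolated[OF mo, of a] that by auto
  show "(\<Sum>i\<le>m. c i * x i ^ k) = 0" if "k \<le> r" for k using mo that by (simp add: moments_def)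
next
  assume a: "(\<forall>a>m. c a = 0) \<and> (\<forall>k\<le>r. (\<Sum>i\<le>m. c i * x i ^ k) = 0)"
  show "moments r (\<lambda>a. a < m) x c"
    unfolding moments_def
  proof (intro allI impI)
    fix t k assume "\<not> t < m" "k \<le> r"
    then have "(\<Sum>i\<le>m. c i * x i ^ k) = (\<Sum>i\<le>t. c i * x i ^ k)"
      using a by (intro sum.mono_neutral_left) auto
    then show "(\<Sum>i\<le>t. c i * x i ^ k) = 0" using a \<open>k \<le> r\<close> by simp
  qed
qed

lemma moments_no_edge: "moments r (\<lambda>a. False) x c \<longleftrightarrow> (\<forall>a. c a = 0)"
  using moments_isolated[of r "\<lambda>a. False" x c] by (auto simp: moments_def)

lemma coeff_space_tensor:
  assumes "N = UNIV \<or> N \<subseteq> {..m} \<times> {..n}"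
  shows "coeff_space r (tensor_h m n) (tensor_v m n) X Y N UNIV UNIV =
    {c \<in> tensor_space r r X Y {..m} {..n}. \<forall>v. v \<notin> N \<longrightarrow> c v = 0}"
proof -
  have row: "moments r (\<lambda>a. tensor_h m n a b) X v \<longleftrightarrow>
      (if b \<le> n then (\<forall>a>m. v a = 0) \<and> (\<forall>k\<le>r. (\<Sum>i\<le>m. v i * X i ^ k) = 0) else \<forall>a. v a = 0)" for b v
    using moments_interval[of r m X v] moments_no_edge[of r X v] by (auto simp: tensor_h_def)
  have col: "moments r (tensor_v m n a) Y v \<longleftrightarrow>
      (if a \<le> m then (\<forall>b>n. v b = 0) \<and> (\<forall>k\<le>r. (\<Sum>j\<le>n. v j * Y j ^ k) = 0) else \<forall>b. v b = 0)" for a v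
    using moments_interval[of r n Y v] moments_no_edge[of r Y v] by (auto simp: tensor_v_def[abs_def])
  show ?thesis
  proof (intro equalityI subsetI)
    fix c assume c: "c \<in> coeff_space r (tensor_h m n) (tensor_v m n) X Y N UNIV UNIV"
    have z: "c (a, b) = 0" if "\<not> (a \<le> m \<and> b \<le> n)" for a b
      using c that unfolding coeff_space_def row col by (cases "a \<le> m"; cases "b \<le> n") auto
    then show "c \<in> {c \<in> tensor_space r r X Y {..m} {..n}. \<forall>v. v \<notin> N \<longrightarrow> c v = 0}"
      using c unfolding coeff_space_def row col tensor_space_def
      by (auto split: if_splits)
  next
    fix c assume c: "c \<in> {c \<in> tensor_space r r X Y {..m} {..n}. \<forall>v. v \<notin> N \<longrightarrow> c v = 0}"
    then show "c \<in> coeff_space r (tensor_h m n) (tensor_v m n) X Y N UNIV UNIV"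
      unfolding coeff_space_def row col tensor_space_def by auto
  qed
qed

lemma subspace_tensor_space: "fun_space.subspace (tensor_space r r' X Y K L)"
  by (rule fun_subspaceI)
    (auto simp: tensor_space_def algebra_simps sum.distrib simp flip: sum_distrib_left)

lemma tensor_space_swap:
  "fun_space.dim (tensor_space r r' X Y K L) = fun_space.dim (tensor_space r' r Y X L K)"
proof (rule fun_dim_bij[where f = "\<lambda>c (a, b). c (b, a)"])
  show "fun_linear (\<lambda>(c :: nat \<times> nat \<Rightarrow> real) (a, b). c (b, a))"
    by (rule fun_linearI) (auto simp: fun_eq_iff)
  show "c = (\<lambda>_. 0)" if "(\<lambda>(a, b). c (b, a)) = (\<lambda>_. 0 :: real)" for c :: "nat \<times> nat \<Rightarrow> real"
    using that by (auto simp: fun_eq_iff)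
  show "\<exists>b\<in>tensor_space r r' X Y K L. (\<lambda>(a, ba). b (ba, a)) = c" if "c \<in> tensor_space r' r Y X L K" for c
    using that by (intro bexI[of _ "\<lambda>(a, b). c (b, a)"]) (auto simp: tensor_space_def)
qed (auto simp: subspace_tensor_space, auto simp: tensor_space_def)

lemma sum_moments_poly:
  assumes "\<forall>k\<le>r. (\<Sum>i\<in>K. c i * x i ^ k) = 0" "degree q \<le> r"
  shows "(\<Sum>i\<in>K. c i * poly q (x i)) = (0 :: real)"
proof -
  have "(\<Sum>i\<in>K. c i * poly q (x i)) = (\<Sum>i\<in>K. \<Sum>k\<le>degree q. coeff q k * (c i * x i ^ k))"
    by (simp add: poly_altdef sum_distrib_left mult_ac)
  also have "\<dots> = (\<Sum>k\<le>degree q. coeff q k * (\<Sum>i\<in>K. c i * x i ^ k))"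
    by (subst sum.swap) (simp add: sum_distrib_left)
  also have "\<dots> = 0" using assms by (intro sum.neutral) auto
  finally show ?thesis .
qed

text \<open>Multiplication by the quadratic with zeros at the first and last line lowers the order
  by two and removes these two lines. Conversely the two removed values are forced by the moments of
  order 0 and 1.\<close>

lemma tensor_space_shrink:
  assumes d: "d \<ge> 2" and m: "m \<ge> 1" and X: "strict_mono X"
  shows "fun_space.dim (tensor_space d r' X Y {..m} L) = fun_space.dim (tensor_space (d - 2) r' X Y {0<..<m} L)"
proof -
  define w where "w = end_weight m X 0"
  have wz: "poly w (X i) \<noteq> 0" if "0 < i" "i < m" for i
    using that X by (auto simp: w_def end_weight_simps strict_mono_eq)
  have w0: "poly w (X 0) = 0" "poly w (X m) = 0" by (auto simp: w_def end_weight_simps)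
  have wd: "degree w = 2" by (simp add: w_def end_weight_simps)
  have ne: "X m \<noteq> X 0" using X m by (simp add: strict_mono_eq)
  have split: "(\<Sum>i\<le>m. f i) = f 0 + f m + (\<Sum>i\<in>{0<..<m}. f i)" for f :: "nat \<Rightarrow> real"
  proof -
    have "{..m} = insert 0 (insert m {0<..<m})" using m by auto
    then show ?thesis using m by simp
  qed
  define f where "f c = (\<lambda>(i, j). c (i, j) * poly w (X i))" for c :: "nat \<times> nat \<Rightarrow> real"
  show ?thesis
  proof (rule fun_dim_bij[where f = f])
    show "fun_linear f" by (rule fun_linearI) (auto simp: f_def fun_eq_iff algebra_simps)
    show "fun_space.subspace (tensor_space d r' X Y {..m} L)" by (rule subspace_tensor_space)
    fix c assume c: "c \<in> tensor_space d r' X Y {..m} L"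
    have supp: "c (i, j) = 0" if "\<not> (i \<le> m \<and> j \<in> L)" for i j using c that by (auto simp: tensor_space_def)
    have row: "(\<Sum>i\<le>m. c (i, j) * X i ^ k) = 0" if "k \<le> d" for j k using c that by (auto simp: tensor_space_def)
    have "(\<Sum>i\<in>{0<..<m}. f c (i, j) * X i ^ k) = 0" if k: "k \<le> d - 2" for j k
    proof -
      have "degree (w * monom 1 k) \<le> d"
        using degree_mult_le[of w "monom 1 k"] k d wd by (simp add: degree_monom_eq)
      then have "(\<Sum>i\<le>m. c (i, j) * poly (w * monom 1 k) (X i)) = 0"
        using row by (intro sum_moments_poly) auto
      then show ?thesis by (simp add: split w0 f_def poly_monom mult.assoc)
    qed
    moreover have "(\<Sum>j\<in>L. f c (i, j) * Y j ^ k) = 0" if "k \<le> r'" for i k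
    proof -
      have "(\<Sum>j\<in>L. f c (i, j) * Y j ^ k) = poly w (X i) * (\<Sum>j\<in>L. c (i, j) * Y j ^ k)"
        by (simp add: f_def sum_distrib_left mult_ac)
      then show ?thesis using c that by (auto simp: tensor_space_def)
    qed
    moreover have "f c (i, j) = 0" if "(i, j) \<notin> {0<..<m} \<times> L" for i j
    proof -
      have "i = 0 \<or> i = m \<or> \<not> (i \<le> m \<and> j \<in> L)" using that by auto
      then show ?thesis using w0 supp by (auto simp: f_def)
    qed
    ultimately show "f c \<in> tensor_space (d - 2) r' X Y {0<..<m} L" by (auto simp: tensor_space_def)
    show "c = (\<lambda>_. 0)" if "f c = (\<lambda>_. 0)"
    proof
      fix v :: "nat \<times> nat"
      obtain i j where v: "v = (i, j)" by (cases v)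
      have int: "c (k, j) = 0" if "0 < k" "k < m" for k
      proof -
        have "f c (k, j) = 0" using \<open>f c = (\<lambda>_. 0)\<close> by simp
        then show ?thesis using wz[OF that] by (simp add: f_def)
      qed
      have "c (0, j) * X 0 ^ k + c (m, j) * X m ^ k = 0" if "k \<le> d" for k
        using row[OF that, of j] int by (simp add: split)
      from this[of 0] this[of 1] have e: "c (m, j) = - c (0, j)" "c (0, j) * X 0 + c (m, j) * X m = 0"
        using d by auto
      then have "c (0, j) * (X 0 - X m) = 0" by (simp add: algebra_simps)
      with e(1) have "c (0, j) = 0" "c (m, j) = 0" using ne by auto
      then show "c v = 0" using int[of i] supp[of i j] v by (metis bot_nat_0.not_eq_extremum nat_less_le not_le)
    qed
  next
    fix e assume e: "e \<in> tensor_space (d - 2) r' X Y {0<..<m} L"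
    define c0 where "c0 i j = e (i, j) / poly w (X i)" for i j
    \<comment> \<open>The end values are minus the sums of the inner values, weighted as in linear
      interpolation between \<open>X 0\<close> and \<open>X m\<close>; this makes the moments of
      order 0 and 1 vanish.\<close>
    define c where "c = (\<lambda>(i, j). if i = 0 then - (\<Sum>k\<in>{0<..<m}. c0 k j * ((X m - X k) / (X m - X 0)))
      else if i = m then - (\<Sum>k\<in>{0<..<m}. c0 k j * ((X k - X 0) / (X m - X 0))) else c0 i j)"
    have supp: "e (i, j) = 0" if "\<not> (0 < i \<and> i < m \<and> j \<in> L)" for i j using e that by (auto simp: tensor_space_def)
    have rowe: "(\<Sum>i\<in>{0<..<m}. e (i, j) * X i ^ k) = 0" if "k \<le> d - 2" for j k
      using e that by (auto simp: tensor_space_def)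
    have cole: "(\<Sum>j\<in>L. c0 i j * Y j ^ k) = 0" if "k \<le> r'" for i k
    proof -
      have "(\<Sum>j\<in>L. c0 i j * Y j ^ k) = (\<Sum>j\<in>L. e (i, j) * Y j ^ k) / poly w (X i)"
        by (simp add: c0_def sum_divide_distrib)
      then show ?thesis using e that by (auto simp: tensor_space_def)
    qed
    have "(\<Sum>i\<le>m. c (i, j) * X i ^ k) = 0" if k: "k \<le> d" for j k
    proof -
      \<comment> \<open>The monomial minus its linear interpolant at \<open>X 0\<close> and
        \<open>X m\<close>. It vanishes at both ends, so \<open>w\<close> divides it and the
        quotient is tested by the conditions of order \<open>d - 2\<close> on
        \<open>e\<close>.\<close>
      define g where "g = monom 1 k - smult (X 0 ^ k / (X m - X 0)) [:X m, - 1:]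
        - smult (X m ^ k / (X m - X 0)) [:- X 0, 1:]"
      have gz: "poly g z = z ^ k - (X m - z) / (X m - X 0) * X 0 ^ k - (z - X 0) / (X m - X 0) * X m ^ k" for z
        using ne by (simp add: g_def poly_monom divide_simps) (simp add: algebra_simps)
      have "w dvd g"
        unfolding w_def using ne by (intro end_weight_dvd) (simp_all add: gz)
      moreover have "degree g \<le> d"
        unfolding g_def using k d by (intro degree_diff_le) (auto simp: degree_monom_eq)
      ultimately have "degree (g div w) \<le> d - 2" by (intro degree_div_quadratic[OF _ wd])
      then have "(\<Sum>i\<in>{0<..<m}. e (i, j) * poly (g div w) (X i)) = 0"
        using rowe by (intro sum_moments_poly) auto
      moreover have "c0 i j * poly g (X i) = e (i, j) * poly (g div w) (X i)" if "i \<in> {0<..<m}" for i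
      proof -
        have "poly g (X i) = poly w (X i) * poly (g div w) (X i)"
          using \<open>w dvd g\<close> by (metis dvd_mult_div_cancel poly_mult)
        then show ?thesis using wz that by (simp add: c0_def)
      qed
      ultimately have g0: "(\<Sum>i\<in>{0<..<m}. c0 i j * poly g (X i)) = 0" by simp
      have "(\<Sum>i\<le>m. c (i, j) * X i ^ k) = (\<Sum>i\<in>{0<..<m}. c0 i j * X i ^ k)
          - (\<Sum>i\<in>{0<..<m}. c0 i j * ((X m - X i) / (X m - X 0))) * X 0 ^ k
          - (\<Sum>i\<in>{0<..<m}. c0 i j * ((X i - X 0) / (X m - X 0))) * X m ^ k"
        using m by (simp add: split c_def)
      also have "\<dots> = (\<Sum>i\<in>{0<..<m}. c0 i j * poly g (X i))"
        unfolding gz by (simp only: sum_distrib_right sum_subtractf right_diff_distrib mult.assoc)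
      finally show ?thesis using g0 by simp
    qed
    moreover have "(\<Sum>j\<in>L. c (i, j) * Y j ^ k) = 0" if k: "k \<le> r'" for i k
    proof -
      have *: "(\<Sum>j\<in>L. - (\<Sum>l\<in>{0<..<m}. c0 l j * t l) * Y j ^ k) = 0" for t
      proof -
        have "(\<Sum>j\<in>L. - (\<Sum>l\<in>{0<..<m}. c0 l j * t l) * Y j ^ k) =
          - (\<Sum>l\<in>{0<..<m}. t l * (\<Sum>j\<in>L. c0 l j * Y j ^ k))"
          by (simp add: sum_distrib_left sum_distrib_right sum_negf mult_ac) (rule sum.swap)
        then show ?thesis using cole[OF k] by simp
      qed
      consider "i = 0" | "i = m" "i \<noteq> 0" | "i \<noteq> 0" "i \<noteq> m" by blast
      then show ?thesis
      proof cases
        case 1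
        then show ?thesis using *[of "\<lambda>l. (X m - X l) / (X m - X 0)"] by (simp add: c_def)
      next
        case 2
        then show ?thesis using *[of "\<lambda>l. (X l - X 0) / (X m - X 0)"] by (simp add: c_def)
      next
        case 3
        then show ?thesis using cole[OF k] by (simp add: c_def)
      qed
    qed
    moreover have "c (i, j) = 0" if "\<not> (i \<le> m \<and> j \<in> L)" for i j
      using that supp by (auto simp: c_def c0_def)
    ultimately have "c \<in> tensor_space d r' X Y {..m} L" by (auto simp: tensor_space_def)
    moreover have "f c = e"
    proof
      fix v :: "nat \<times> nat"
      obtain i j where v: "v = (i, j)" by (cases v)
      show "f c v = e v"
      proof (cases "0 < i \<and> i < m")
        case True
        then show ?thesis using wz[of i] by (simp add: v f_def c_def c0_def)
      next
        case False
        then have "e v = 0" using supp v by auto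
        moreover have "i = 0 \<or> i = m \<or> i > m" using False by auto
        then have "f c v = 0" using w0 supp[of i j] by (auto simp: v f_def c_def c0_def)
        ultimately show ?thesis by simp
      qed
    qed
    ultimately show "\<exists>c\<in>tensor_space d r' X Y {..m} L. f c = e" by blast
  qed
qed

lemma cross_nodes_tensor: "cross_nodes (tensor_h m n) (tensor_v m n) = {0<..<m} \<times> {0<..<n}"
  by (auto simp: cross_nodes_def tensor_h_def tensor_v_def)

theorem tensor_dim_eq:
  assumes d: "d \<ge> 2" and mn: "m \<ge> 1" "n \<ge> 1" and X: "strict_mono X" and Y: "strict_mono Y"
  shows "fun_space.dim (coeff_space d (tensor_h m n) (tensor_v m n) X Y UNIV UNIV UNIV) =
    fun_space.dim (coeff_space (d - 2) (tensor_h m n) (tensor_v m n) X Y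
      (cross_nodes (tensor_h m n) (tensor_v m n)) UNIV UNIV)"
proof -
  have 1: "coeff_space d (tensor_h m n) (tensor_v m n) X Y UNIV UNIV UNIV = tensor_space d d X Y {..m} {..n}"
    by (subst coeff_space_tensor) auto
  have sum_eq: "(\<Sum>i\<le>m. g i) = (\<Sum>i\<in>{0<..<m}. g i)" if "\<And>i. \<not> (0 < i \<and> i < m) \<Longrightarrow> g i = 0" for g :: "nat \<Rightarrow> real" and m
    using that by (intro sum.mono_neutral_right) auto
  have 2: "coeff_space (d - 2) (tensor_h m n) (tensor_v m n) X Y ({0<..<m} \<times> {0<..<n}) UNIV UNIV =
      tensor_space (d - 2) (d - 2) X Y {0<..<m} {0<..<n}"
  proof -
    have "coeff_space (d - 2) (tensor_h m n) (tensor_v m n) X Y ({0<..<m} \<times> {0<..<n}) UNIV UNIV =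
      {c \<in> tensor_space (d - 2) (d - 2) X Y {..m} {..n}. \<forall>v. v \<notin> {0<..<m} \<times> {0<..<n} \<longrightarrow> c v = 0}"
      by (rule coeff_space_tensor) auto
    also have "\<dots> = tensor_space (d - 2) (d - 2) X Y {0<..<m} {0<..<n}"
    proof -
      have "(\<Sum>i\<le>m. c (i, j) * X i ^ k) = (\<Sum>i\<in>{0<..<m}. c (i, j) * X i ^ k)"
        "(\<Sum>j\<le>n. c (i, j) * Y j ^ k) = (\<Sum>j\<in>{0<..<n}. c (i, j) * Y j ^ k)"
        if "\<forall>v. v \<notin> {0<..<m} \<times> {0<..<n} \<longrightarrow> c v = 0" for c i j k
      proof -
        have z: "c (i, j) = 0" if "\<not> (0 < i \<and> i < m \<and> 0 < j \<and> j < n)" for i j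
          using that \<open>\<forall>v. v \<notin> {0<..<m} \<times> {0<..<n} \<longrightarrow> c v = 0\<close> by auto
        show "(\<Sum>i\<le>m. c (i, j) * X i ^ k) = (\<Sum>i\<in>{0<..<m}. c (i, j) * X i ^ k)"
          by (rule sum_eq) (use z in auto)
        show "(\<Sum>j\<le>n. c (i, j) * Y j ^ k) = (\<Sum>j\<in>{0<..<n}. c (i, j) * Y j ^ k)"
          by (rule sum_eq) (use z in auto)
      qed
      then show ?thesis unfolding tensor_space_def by auto
    qed
    finally show ?thesis .
  qed
  show ?thesis
    unfolding cross_nodes_tensor 1 2
    \<comment> \<open>The passage goes through the space of order \<open>d - 2\<close> in
      \<open>x\<close> and \<open>d\<close> in \<open>y\<close>, with one transposition before and
      one after the second reduction.\<close>
    using tensor_space_shrink[OF d mn(1) X, of d Y "{..n}"]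
      tensor_space_shrink[OF d mn(2) Y, of "d - 2" X "{0<..<m}"]
      tensor_space_swap[of "d - 2" d X Y "{0<..<m}" "{..n}"]
      tensor_space_swap[of "d - 2" "d - 2" Y X "{0<..<n}" "{0<..<m}"] by simp
qed


subsection \<open>Univariate jumps\<close>

text \<open>Behind the node \<open>t\<close> the truncated powers with knots up to \<open>t\<close>
  add up to the sum on the right. Its coefficients as a polynomial in \<open>z\<close> are the
  moments times nonzero binomial coefficients, so it vanishes identically exactly when the moments
  do.\<close>

lemma moments_iff_power_sum:
  fixes x :: "nat \<Rightarrow> real"
  shows "(\<forall>k\<le>e. (\<Sum>i\<le>t. c i * x i ^ k) = 0) \<longleftrightarrow> (\<forall>z. (\<Sum>i\<le>t. c i * (z - x i) ^ e) = 0)"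
proof (intro iffI allI impI)
  fix z
  assume "\<forall>k\<le>e. (\<Sum>i\<le>t. c i * x i ^ k) = 0"
  then have "(\<Sum>i\<le>t. c i * poly ([:z, - 1:] ^ e) (x i)) = 0"
    by (rule sum_moments_poly) (rule order_trans[OF degree_power_le], simp)
  then show "(\<Sum>i\<le>t. c i * (z - x i) ^ e) = 0" by (simp add: poly_power)
next
  fix k assume z: "\<forall>z. (\<Sum>i\<le>t. c i * (z - x i) ^ e) = 0" and k: "k \<le> e"
  define p where "p = (\<Sum>i\<le>t. smult (c i) ([:- x i, 1:] ^ e))"
  have "poly p z = 0" for z using z by (simp add: p_def poly_sum poly_power)
  then have "p = 0" using poly_all_0_iff_0 by blast
  then have "coeff p (e - k) = 0" by simp
  then have "(\<Sum>i\<le>t. c i * (real (e choose (e - k)) * (- x i) ^ k)) = 0"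
    using k by (simp add: p_def coeff_sum coeff_linear_poly_power)
  moreover have "(\<Sum>i\<le>t. c i * (real (e choose (e - k)) * (- x i) ^ k)) =
      real (e choose (e - k)) * (- 1) ^ k * (\<Sum>i\<le>t. c i * x i ^ k)"
    by (simp add: sum_distrib_left power_minus[of "x _"] mult_ac)
  moreover have "e choose (e - k) \<noteq> 0" by simp
  ultimately show "(\<Sum>i\<le>t. c i * x i ^ k) = 0" by auto
qed

lemma poly_eq_on_interval:
  fixes p q :: "real poly"
  assumes "l < u" "\<And>t. l < t \<Longrightarrow> t < u \<Longrightarrow> poly p t = poly q t" shows "p = q"
proof (rule ccontr)
  assume "p \<noteq> q"
  then have "finite {t. poly (p - q) t = 0}" by (intro poly_roots_finite) simp
  moreover have "{l<..<u} \<subseteq> {t. poly (p - q) t = 0}" using assms(2) by auto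
  ultimately have "finite {l<..<u}" using finite_subset by blast
  then show False using infinite_Ioo[OF assms(1)] by simp
qed

text \<open>In the Taylor expansion at \<open>a\<close> only the term of order \<open>e\<close> is
  left. The induction passes to the derivative and integrates back, the constant of integration
  being fixed by the value at \<open>a\<close>.\<close>

lemma poly_vanishing_derivatives:
  fixes p :: "real poly"
  assumes "degree p \<le> e" "\<And>i. i < e \<Longrightarrow> poly ((pderiv ^^ i) p) a = 0"
  shows "\<exists>k. p = smult k ([:- a, 1:] ^ e)"
  using assms
proof (induction e arbitrary: p)
  case 0
  then obtain k where "p = [:k:]" using degree_eq_zeroE by blast
  then show ?case by (intro exI[of _ k]) simp
next
  case (Suc e)
  have "\<exists>k. pderiv p = smult k ([:- a, 1:] ^ e)"
  proof (rule Suc.IH)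
    show "degree (pderiv p) \<le> e" using Suc.prems(1) by (simp add: degree_pderiv)
    show "poly ((pderiv ^^ i) (pderiv p)) a = 0" if "i < e" for i
      using Suc.prems(2)[of "Suc i"] that by (simp del: funpow.simps add: funpow_Suc_right)
  qed
  then obtain k where k: "pderiv p = smult k ([:- a, 1:] ^ e)" by blast
  define s where "s = p - smult (k / real (Suc e)) ([:- a, 1:] ^ Suc e)"
  have "pderiv s = 0"
    by (simp add: s_def pderiv_diff pderiv_smult pderiv_power_Suc k pderiv_pCons del: power_Suc)
  then obtain b where b: "s = [:b:]" using pderiv_eq_0_iff degree_eq_zeroE by metis
  have "poly s a = 0" using Suc.prems(2)[of 0] by (simp add: s_def poly_power)
  then have "s = 0" using b by simp
  then show ?case by (auto simp: s_def)
qed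

lemma derivative_of_poly_piece:
  fixes g :: "nat \<Rightarrow> real \<Rightarrow> real"
  assumes "l < u" "\<And>t. l < t \<Longrightarrow> t < u \<Longrightarrow> g 0 t = poly p t"
    and "\<And>i t. Suc i < e \<Longrightarrow> (g i has_real_derivative g (Suc i) t) (at t)"
  shows "i < e \<Longrightarrow> l < t \<Longrightarrow> t < u \<Longrightarrow> g i t = poly ((pderiv ^^ i) p) t"
proof (induction i arbitrary: t)
  case 0
  then show ?case using assms(2) by simp
next
  case (Suc i)
  have "(g i has_real_derivative g (Suc i) t) (at t)" using assms(3) Suc.prems by blast
  moreover have "(g i has_real_derivative poly (pderiv ((pderiv ^^ i) p)) t) (at t)"
  proof (rule has_field_derivative_transform_within_open[where S = "{l<..<u}"])
    show "((\<lambda>t. poly ((pderiv ^^ i) p) t) has_real_derivative poly (pderiv ((pderiv ^^ i) p)) t) (at t)"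
      by (rule poly_DERIV)
  qed (use Suc in auto)
  ultimately show ?case using DERIV_unique by fastforce
qed

lemma poly_piece_limit:
  fixes g :: "real \<Rightarrow> real"
  assumes "continuous_on UNIV g"
  shows "a < u \<Longrightarrow> (\<And>t. a < t \<Longrightarrow> t < u \<Longrightarrow> g t = poly p t) \<Longrightarrow> g a = poly p a"
    and "l < a \<Longrightarrow> (\<And>t. l < t \<Longrightarrow> t < a \<Longrightarrow> g t = poly p t) \<Longrightarrow> g a = poly p a"
proof -
  have lim: "(g \<longlongrightarrow> g a) (at a within S)" "((\<lambda>t. poly p t) \<longlongrightarrow> poly p a) (at a within S)" for S
    using assms poly_isCont[of a p]
    by (auto simp: continuous_on_eq_continuous_at isCont_def intro: tendsto_within_subset)
  { assume *: "a < u" "\<And>t. a < t \<Longrightarrow> t < u \<Longrightarrow> g t = poly p t"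
    have "eventually (\<lambda>t. g t = poly p t) (at_right a)"
      using *(1) by (auto simp: eventually_at_right intro!: exI[of _ u] *(2))
    then have "((\<lambda>t. poly p t) \<longlongrightarrow> g a) (at_right a)"
      using lim(1) tendsto_cong by blast
    then show "g a = poly p a" using lim(2) tendsto_unique[OF trivial_limit_at_right_real] by blast }
  { assume *: "l < a" "\<And>t. l < t \<Longrightarrow> t < a \<Longrightarrow> g t = poly p t"
    have "eventually (\<lambda>t. g t = poly p t) (at_left a)"
      using *(1) by (auto simp: eventually_at_left intro!: exI[of _ l] *(2))
    then have "((\<lambda>t. poly p t) \<longlongrightarrow> g a) (at_left a)"
      using lim(1) tendsto_cong by blast
    then show "g a = poly p a" using lim(2) tendsto_unique[OF trivial_limit_at_left_real] by blast }
qed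

text \<open>At the knot the derivatives of both pieces up to order \<open>e - 1\<close> are limits
  of the same continuous functions \<open>g i\<close>, so they agree and their difference vanishes
  to order \<open>e\<close>.\<close>

lemma spline_jump:
  fixes g :: "nat \<Rightarrow> real \<Rightarrow> real"
  assumes cont: "\<And>i. i < e \<Longrightarrow> continuous_on UNIV (g i)"
    and der: "\<And>i t. Suc i < e \<Longrightarrow> (g i has_real_derivative g (Suc i) t) (at t)"
    and deg: "degree p \<le> e" "degree q \<le> e"
    and p: "l < a" "\<And>t. l < t \<Longrightarrow> t < a \<Longrightarrow> g 0 t = poly p t"
    and q: "a < u" "\<And>t. a < t \<Longrightarrow> t < u \<Longrightarrow> g 0 t = poly q t"
  shows "\<exists>k. q - p = smult k ([:- a, 1:] ^ e)"
proof (rule poly_vanishing_derivatives)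
  show "degree (q - p) \<le> e" using deg by (intro degree_diff_le)
  fix i assume i: "i < e"
  have "g i a = poly ((pderiv ^^ i) p) a"
    by (rule poly_piece_limit(2)[OF cont[OF i] p(1)]) (rule derivative_of_poly_piece[OF p der i])
  moreover have "g i a = poly ((pderiv ^^ i) q) a"
    by (rule poly_piece_limit(1)[OF cont[OF i] q(1)]) (rule derivative_of_poly_piece[OF q der i])
  moreover have "q - p = q + smult (- 1) p" by simp
  ultimately show "poly ((pderiv ^^ i) (q - p)) a = 0"
    by (simp only: higher_pderiv_add higher_pderiv_smult) simp
qed


subsection \<open>Bivariate polynomials\<close>

lemma bipoly_eqI:
  assumes F: "bipoly r F" and G: "bipoly r G" and "x0 < x1" "y0 < y1"
    and eq: "\<And>x y. x0 < x \<Longrightarrow> x < x1 \<Longrightarrow> y0 < y \<Longrightarrow> y < y1 \<Longrightarrow> F x y = G x y"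
  shows "F x y = G x y"
proof -
  have 1: "F x y = G x y" if y: "y0 < y" "y < y1" for x y
  proof -
    obtain p where p: "\<And>x. F x y = poly p x" by (rule bipoly_fst[OF F, where y = y]) (rule that)
    obtain q where q: "\<And>x. G x y = poly q x" by (rule bipoly_fst[OF G, where y = y]) (rule that)
    have "p = q"
    proof (rule poly_eq_on_interval[OF \<open>x0 < x1\<close>])
      show "poly p t = poly q t" if "x0 < t" "t < x1" for t
        using eq[OF that y] p[of t] q[of t] by simp
    qed
    then show ?thesis using p q by simp
  qed
  obtain p where p: "\<And>y. F x y = poly p y" by (rule bipoly_snd[OF F, where x = x]) (rule that)
  obtain q where q: "\<And>y. G x y = poly q y" by (rule bipoly_snd[OF G, where x = x]) (rule that)
  have "p = q"
  proof (rule poly_eq_on_interval[OF \<open>y0 < y1\<close>])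
    show "poly p t = poly q t" if "y0 < t" "t < y1" for t
      using 1[OF that, of x] p[of t] q[of t] by simp
  qed
  then show ?thesis using p q by simp
qed

lemma bipoly_zero: "bipoly r (\<lambda>x y. 0)"
  by (rule bipolyI) (auto intro!: exI[of _ 0])

lemma bipoly_coeffs:
  fixes \<alpha> :: "nat \<Rightarrow> nat \<Rightarrow> real"
  shows "bipoly e (\<lambda>x y. \<Sum>i\<le>e. \<Sum>j\<le>e. \<alpha> i j * x ^ i * y ^ j)"
proof (rule bipolyI)
  fix y
  have "degree (\<Sum>i\<le>e. monom (\<Sum>j\<le>e. \<alpha> i j * y ^ j) i) \<le> e"
    by (rule degree_sum_le) (auto intro: order_trans[OF degree_monom_le])
  then show "\<exists>p. degree p \<le> e \<and> (\<forall>x. (\<Sum>i\<le>e. \<Sum>j\<le>e. \<alpha> i j * x ^ i * y ^ j) = poly p x)"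
    by (intro exI[of _ "\<Sum>i\<le>e. monom (\<Sum>j\<le>e. \<alpha> i j * y ^ j) i"])
      (simp add: poly_sum poly_monom sum_distrib_left sum_distrib_right mult_ac)
next
  fix x
  have "degree (\<Sum>i\<le>e. \<Sum>j\<le>e. monom (\<alpha> i j * x ^ i) j) \<le> e"
    by (intro degree_sum_le) (auto intro: order_trans[OF degree_monom_le])
  then show "\<exists>p. degree p \<le> e \<and> (\<forall>y. (\<Sum>i\<le>e. \<Sum>j\<le>e. \<alpha> i j * x ^ i * y ^ j) = poly p y)"
    by (intro exI[of _ "\<Sum>i\<le>e. \<Sum>j\<le>e. monom (\<alpha> i j * x ^ i) j"])
      (simp add: poly_sum poly_monom mult_ac)
qed

text \<open>For fixed \<open>y\<close> in the strip the jump is a constant multiple of the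
  \<open>e\<close>-th power of \<open>x - a\<close>, and at \<open>x = a + 1\<close> this power is
  1, which reads off the constant. Both sides are polynomials in \<open>y\<close>, so the identity
  extends from the strip to all \<open>y\<close>.\<close>

lemma column_jump:
  assumes sm: "smooth_in_x e f" and p: "bipoly e p" and q: "bipoly e q"
    and lu: "l < a" "a < u" "y0 < y1"
    and fp: "\<And>t y. l < t \<Longrightarrow> t < a \<Longrightarrow> y0 < y \<Longrightarrow> y < y1 \<Longrightarrow> f (t, y) = p t y"
    and fq: "\<And>t y. a < t \<Longrightarrow> t < u \<Longrightarrow> y0 < y \<Longrightarrow> y < y1 \<Longrightarrow> f (t, y) = q t y"
  shows "q x y - p x y = (x - a) ^ e * (q (a + 1) y - p (a + 1) y)"
proof -
  obtain g where g: "g 0 = f" "\<And>i. i < e \<Longrightarrow> continuous_on UNIV (g i)"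
    "\<And>i x y. Suc i < e \<Longrightarrow> ((\<lambda>t. g i (t, y)) has_real_derivative g (Suc i) (x, y)) (at x)"
    using sm unfolding smooth_in_x_def by blast
  have 1: "q x y - p x y = (x - a) ^ e * (q (a + 1) y - p (a + 1) y)" if y: "y0 < y" "y < y1" for x y
  proof -
    obtain P where P: "degree P \<le> e" "\<And>x. p x y = poly P x"
      by (rule bipoly_fst[OF p, where y = y]) (rule that)
    obtain Q where Q: "degree Q \<le> e" "\<And>x. q x y = poly Q x"
      by (rule bipoly_fst[OF q, where y = y]) (rule that)
    have "\<exists>k. Q - P = smult k ([:- a, 1:] ^ e)"
    proof (rule spline_jump[where g = "\<lambda>i t. g i (t, y)"])
      show "continuous_on UNIV (\<lambda>t. g i (t, y))" if "i < e" for i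
        by (rule continuous_on_compose2[OF g(2)[OF that]]) (auto intro!: continuous_intros)
      show "g 0 (t, y) = poly P t" if "l < t" "t < a" for t using fp[OF that y] P(2) g(1) by simp
      show "g 0 (t, y) = poly Q t" if "a < t" "t < u" for t using fq[OF that y] Q(2) g(1) by simp
    qed (use g(3) P Q lu in auto)
    then obtain k where k: "Q - P = smult k ([:- a, 1:] ^ e)" by blast
    have "q x y - p x y = k * (x - a) ^ e" for x
      using arg_cong[OF k, of "\<lambda>p. poly p x"] by (simp add: P Q poly_power)
    then show ?thesis by simp
  qed
  obtain P0 where P0: "\<And>y. p x y = poly P0 y" by (rule bipoly_snd[OF p, where x = x]) (rule that)
  obtain Q0 where Q0: "\<And>y. q x y = poly Q0 y" by (rule bipoly_snd[OF q, where x = x]) (rule that)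
  obtain P1 where P1: "\<And>y. p (a + 1) y = poly P1 y"
    by (rule bipoly_snd[OF p, where x = "a + 1"]) (rule that)
  obtain Q1 where Q1: "\<And>y. q (a + 1) y = poly Q1 y"
    by (rule bipoly_snd[OF q, where x = "a + 1"]) (rule that)
  have "Q0 - P0 = smult ((x - a) ^ e) (Q1 - P1)"
    using 1[of _ x] by (intro poly_eq_on_interval[OF lu(3)]) (simp add: P0 Q0 P1 Q1)
  from arg_cong[OF this, of "\<lambda>p. poly p y"] show ?thesis by (simp add: P0 Q0 P1 Q1)
qed

lemma continuous_on_flip:
  fixes h :: "real \<times> real \<Rightarrow> real"
  assumes "continuous_on UNIV h" shows "continuous_on UNIV (\<lambda>(x, y). h (y, x))"
proof -
  have "continuous_on UNIV (\<lambda>p. h (snd p, fst p))"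
    by (rule continuous_on_compose2[OF assms]) (auto intro!: continuous_intros)
  then show ?thesis by (simp add: case_prod_beta)
qed

lemma smooth_swap: "smooth_in_y e f \<longleftrightarrow> smooth_in_x e (\<lambda>(x, y). f (y, x))"
proof
  assume "smooth_in_y e f"
  then obtain g where g: "g 0 = f" "\<forall>i<e. continuous_on UNIV (g i)"
    "\<forall>i. Suc i < e \<longrightarrow> (\<forall>x y. ((\<lambda>t. g i (x, t)) has_real_derivative g (Suc i) (x, y)) (at y))"
    unfolding smooth_in_y_def by blast
  have "continuous_on UNIV (\<lambda>(x, y). g i (y, x))" if "i < e" for i
    using g(2) that by (intro continuous_on_flip) simp
  then show "smooth_in_x e (\<lambda>(x, y). f (y, x))"
    unfolding smooth_in_x_def using g by (intro exI[of _ "\<lambda>i (x, y). g i (y, x)"]) auto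
next
  assume "smooth_in_x e (\<lambda>(x, y). f (y, x))"
  then obtain g where g: "g 0 = (\<lambda>(x, y). f (y, x))" "\<forall>i<e. continuous_on UNIV (g i)"
    "\<forall>i. Suc i < e \<longrightarrow> (\<forall>x y. ((\<lambda>t. g i (t, y)) has_real_derivative g (Suc i) (x, y)) (at x))"
    unfolding smooth_in_x_def by blast
  have "continuous_on UNIV (\<lambda>(x, y). g i (y, x))" if "i < e" for i
    using g(2) that by (intro continuous_on_flip) simp
  then show "smooth_in_y e f"
    unfolding smooth_in_y_def using g by (intro exI[of _ "\<lambda>i (x, y). g i (y, x)"]) auto
qed

subsection \<open>Truncated powers\<close>

text \<open>For \<open>e = 0\<close> this is the right-continuous step function, in agreement with
  the half-open cells \<open>X a \<le> x < X (Suc a)\<close> used below.\<close>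

definition trunc_pow :: "nat \<Rightarrow> real \<Rightarrow> real" where
  "trunc_pow e t = (if t \<ge> 0 then t ^ e else 0)"

lemma continuous_trunc_pow: "e > 0 \<Longrightarrow> continuous_on UNIV (trunc_pow e)"
proof -
  assume "e > 0"
  then have "trunc_pow e = (\<lambda>t. max 0 t ^ e)" by (auto simp: trunc_pow_def fun_eq_iff max_def)
  then show ?thesis by (simp add: continuous_intros)
qed

lemma trunc_pow_derivative:
  assumes "e \<ge> 2"
  shows "(trunc_pow e has_real_derivative (real e * trunc_pow (e - 1) t)) (at t)"
proof -
  consider "t > 0" | "t < 0" | "t = 0" by linarith
  then show ?thesis
  proof cases
    case 1
    have "((\<lambda>s. s ^ e) has_real_derivative (real e * t ^ (e - 1))) (at t)"
      by (auto intro!: derivative_eq_intros)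
    then have "(trunc_pow e has_real_derivative (real e * t ^ (e - 1))) (at t)"
      by (rule has_field_derivative_transform_within_open[where S = "{0<..}"]) (use 1 in \<open>auto simp: trunc_pow_def\<close>)
    then show ?thesis using 1 by (simp add: trunc_pow_def)
  next
    case 2
    have "((\<lambda>s. 0) has_real_derivative 0) (at t)" by simp
    then have "(trunc_pow e has_real_derivative 0) (at t)"
      by (rule has_field_derivative_transform_within_open[where S = "{..<0}"]) (use 2 in \<open>auto simp: trunc_pow_def\<close>)
    then show ?thesis using 2 by (simp add: trunc_pow_def)
  next
    case 3
    have "((\<lambda>h. trunc_pow (e - 1) h) \<longlongrightarrow> trunc_pow (e - 1) 0) (at 0)"
      using continuous_trunc_pow[of "e - 1"] assms by (simp add: continuous_on_eq_continuous_at isCont_def)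
    moreover have "trunc_pow (e - 1) 0 = 0" using assms by (simp add: trunc_pow_def)
    moreover have "(trunc_pow e (0 + h) - trunc_pow e 0) / h = trunc_pow (e - 1) h" if "h \<noteq> 0" for h
      using that assms by (cases e) (auto simp: trunc_pow_def)
    then have "eventually (\<lambda>h. trunc_pow (e - 1) h = (trunc_pow e (0 + h) - trunc_pow e 0) / h) (at 0)"
      by (auto simp: eventually_at_filter)
    ultimately show ?thesis
      unfolding 3 DERIV_def using tendsto_cong by fastforce
  qed
qed


subsection \<open>Splines on the faces of a grid graph and their coefficients\<close>

lemma bipoly_flip: "bipoly r F \<Longrightarrow> bipoly r (\<lambda>y x. F x y)"
  by (simp add: bipoly_def)

lemma smooth_trunc_sum:
  fixes x y :: "nat \<Rightarrow> real" and c :: "nat \<times> nat \<Rightarrow> real"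
  assumes "e > 0"
  shows "smooth_in_x e (\<lambda>(s, t). \<Sum>a\<le>A. \<Sum>b\<le>B. c (a, b) * trunc_pow e (s - x a) * trunc_pow e (t - y b))"
proof -
  \<comment> \<open>The falling factorial produced by differentiating the power \<open>i\<close>
    times.\<close>
  define k where "k i = (\<Prod>j<i. real (e - j))" for i
  define g where "g i = (\<lambda>(s, t). \<Sum>a\<le>A. \<Sum>b\<le>B. c (a, b) * (k i * trunc_pow (e - i) (s - x a)) * trunc_pow e (t - y b))" for i
  have c1: "continuous_on UNIV (\<lambda>p :: real \<times> real. trunc_pow n (fst p - z))"
    "continuous_on UNIV (\<lambda>p :: real \<times> real. trunc_pow n (snd p - z))" if "n > 0" for n z
    by (rule continuous_on_compose2[OF continuous_trunc_pow[OF that]]; auto intro!: continuous_intros)+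
  have "continuous_on UNIV (g i)" if "i < e" for i
    unfolding g_def case_prod_beta using that assms by (intro continuous_intros c1) auto
  moreover have "((\<lambda>s. g i (s, t)) has_real_derivative g (Suc i) (s, t)) (at s)" if i: "Suc i < e" for i s t
  proof -
    have d: "((\<lambda>s. trunc_pow (e - i) (s - z)) has_real_derivative real (e - i) * trunc_pow (e - Suc i) (s - z)) (at s)" for z
    proof -
      have "((\<lambda>s. s - z) has_real_derivative 1) (at s)" by (auto intro!: derivative_eq_intros)
      from DERIV_chain2[OF trunc_pow_derivative[of "e - i"] this] show ?thesis using i by simp
    qed
    show ?thesis
      unfolding g_def prod.case
      by (rule derivative_eq_intros d refl | simp add: k_def mult_ac)+
  qed
  ultimately show ?thesis
    unfolding smooth_in_x_def by (intro exI[of _ g]) (auto simp: g_def k_def)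
qed

text \<open>Common form of the T-mesh and of the CVR graph. \<open>Gh\<close> and \<open>Gv\<close>
  tell which grid edges belong to the mesh; \<open>F\<close> consists of the open faces, which
  extend over missing edges and need not be rectangles. In the last assumption points with both
  coordinates on the grid are left out: an isolated cross-vertex has no edge, yet it lies in no
  face.\<close>

locale spline_mesh =
  fixes e :: nat and X Y :: "nat \<Rightarrow> real" and Gh Gv :: "nat \<Rightarrow> nat \<Rightarrow> bool" and A1 A2 B1 B2 :: nat
    and \<Omega> :: "(real \<times> real) set" and F :: "(real \<times> real) set set"
  assumes mono: "strict_mono X" "strict_mono Y"
    and unbounded: "\<And>x. \<exists>i. x < X i" "\<And>y. \<exists>j. y < Y j"
    and h_rect: "\<And>a b. Gh a b \<Longrightarrow> A1 \<le> a \<and> a < A2 \<and> B1 \<le> b \<and> b \<le> B2"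
    and v_rect: "\<And>a b. Gv a b \<Longrightarrow> A1 \<le> a \<and> a \<le> A2 \<and> B1 \<le> b \<and> b < B2"
    and h_bdry: "\<And>a. A1 \<le> a \<Longrightarrow> a < A2 \<Longrightarrow> B1 < B2 \<Longrightarrow> Gh a B1 \<and> Gh a B2"
    and v_bdry: "\<And>b. B1 \<le> b \<Longrightarrow> b < B2 \<Longrightarrow> A1 < A2 \<Longrightarrow> Gv A1 b \<and> Gv A2 b"
    and \<Omega>: "\<Omega> = cbox (X A1, Y B1) (X A2, Y B2)"
    and faces: "\<And>K. K \<in> F \<Longrightarrow> connected K" "\<And>K. K \<in> F \<Longrightarrow> K \<subseteq> box (X A1, Y B1) (X A2, Y B2)"
    and avoid_h: "\<And>K x a b. K \<in> F \<Longrightarrow> (x, Y b) \<in> K \<Longrightarrow> X a \<le> x \<Longrightarrow> x \<le> X (Suc a) \<Longrightarrow> \<not> Gh a b"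
    and avoid_v: "\<And>K y a b. K \<in> F \<Longrightarrow> (X a, y) \<in> K \<Longrightarrow> Y b \<le> y \<Longrightarrow> y \<le> Y (Suc b) \<Longrightarrow> \<not> Gv a b"
    and face_cell: "\<And>K x y a b. K \<in> F \<Longrightarrow> (x, y) \<in> K \<Longrightarrow> X a \<le> x \<Longrightarrow> x \<le> X (Suc a) \<Longrightarrow> Y b \<le> y \<Longrightarrow> y \<le> Y (Suc b)
      \<Longrightarrow> {X a<..<X (Suc a)} \<times> {Y b<..<Y (Suc b)} \<subseteq> K"
    and cover: "\<And>x y. (x, y) \<in> \<Omega> \<Longrightarrow> x \<notin> range X \<or> y \<notin> range Y \<Longrightarrow>
      (\<And>a b. y = Y b \<Longrightarrow> X a \<le> x \<Longrightarrow> x \<le> X (Suc a) \<Longrightarrow> \<not> Gh a b) \<Longrightarrow>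
      (\<And>a b. x = X a \<Longrightarrow> Y b \<le> y \<Longrightarrow> y \<le> Y (Suc b) \<Longrightarrow> \<not> Gv a b) \<Longrightarrow> \<exists>K\<in>F. (x, y) \<in> K"
begin

definition open_cell :: "nat \<Rightarrow> nat \<Rightarrow> (real \<times> real) set" where
  "open_cell a b = {X a<..<X (Suc a)} \<times> {Y b<..<Y (Suc b)}"

abbreviation inside :: "nat \<Rightarrow> nat \<Rightarrow> bool" where
  "inside a b \<equiv> A1 \<le> a \<and> a < A2 \<and> B1 \<le> b \<and> b < B2"

abbreviation "W \<equiv> coeff_space e Gh Gv X Y UNIV UNIV UNIV"

lemma X_less: "X i < X j \<longleftrightarrow> i < j" "Y i < Y j \<longleftrightarrow> i < j"
  and X_le: "X i \<le> X j \<longleftrightarrow> i \<le> j" "Y i \<le> Y j \<longleftrightarrow> i \<le> j"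
  and X_eq: "X i = X j \<longleftrightarrow> i = j" "Y i = Y j \<longleftrightarrow> i = j"
  using mono by (auto simp: strict_mono_less strict_mono_less_eq strict_mono_eq)

lemmas grid_order = X_less X_le X_eq

lemma X_Suc: "X a < X (Suc a)" and Y_Suc: "Y b < Y (Suc b)"
  by (simp_all add: grid_order)

lemma cell_index:
  fixes Z :: "nat \<Rightarrow> real"
  assumes "Z 0 \<le> x" "\<And>x. \<exists>i. x < Z i"
  shows "\<exists>a. Z a \<le> x \<and> x < Z (Suc a)"
proof -
  define n where "n = (LEAST i. x < Z i)"
  have n: "x < Z n" using assms(2)[of x] unfolding n_def by (rule LeastI_ex)
  then obtain a where a: "n = Suc a" using assms(1) by (cases n) auto
  have "\<not> x < Z a" using not_less_Least[of a "\<lambda>i. x < Z i"] a unfolding n_def by simp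
  then show ?thesis using n a by (intro exI[of _ a]) auto
qed

lemma x_index: "X 0 \<le> x \<Longrightarrow> \<exists>a. X a \<le> x \<and> x < X (Suc a)"
  and y_index: "Y 0 \<le> y \<Longrightarrow> \<exists>b. Y b \<le> y \<and> y < Y (Suc b)"
  using cell_index[of X] cell_index[of Y] unbounded by blast+

lemma index_unique:
  assumes "X a \<le> x" "x < X (Suc a)" "X i \<le> x" "x \<le> X (Suc i)"
  shows "i = a \<or> (x = X a \<and> a = Suc i)"
proof -
  have "X a \<le> X (Suc i)" "X i < X (Suc a)" using assms by linarith+
  then have "a = i \<or> a = Suc i" by (simp add: grid_order) linarith
  then show ?thesis using assms by auto
qed

lemma y_index_unique:
  assumes "Y a \<le> x" "x < Y (Suc a)" "Y i \<le> x" "x \<le> Y (Suc i)"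
  shows "i = a \<or> (x = Y a \<and> a = Suc i)"
proof -
  have "Y a \<le> Y (Suc i)" "Y i < Y (Suc a)" using assms by linarith+
  then have "a = i \<or> a = Suc i" by (simp add: grid_order) linarith
  then show ?thesis using assms by auto
qed

lemma open_cell_outside:
  assumes "\<not> inside a b" "p \<in> open_cell a b" shows "p \<notin> \<Omega>"
proof
  assume "p \<in> \<Omega>"
  then obtain x y where p: "p = (x, y)" "X A1 \<le> x" "x \<le> X A2" "Y B1 \<le> y" "y \<le> Y B2"
    by (cases p) (auto simp: \<Omega> cbox_Pair_eq)
  moreover have "X a < x" "x < X (Suc a)" "Y b < y" "y < Y (Suc b)"
    using assms(2) p by (auto simp: open_cell_def)
  ultimately have "X A1 < X (Suc a)" "X a < X A2" "Y B1 < Y (Suc b)" "Y b < Y B2" by linarith+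
  then show False using assms(1) by (auto simp: grid_order)
qed

lemma open_cell_inside:
  assumes "inside a b" shows "\<exists>K\<in>F. open_cell a b \<subseteq> K"
proof -
  define x y where xy: "x = (X a + X (Suc a)) / 2" "y = (Y b + Y (Suc b)) / 2"
  have x: "X a < x" "x < X (Suc a)" and y: "Y b < y" "y < Y (Suc b)"
    using X_Suc[of a] Y_Suc[of b] by (simp_all add: xy)
  have nX: "x \<noteq> X i" for i
  proof
    assume "x = X i"
    then have "a < i" "i < Suc a" using x by (simp_all add: grid_order)
    then show False by simp
  qed
  have nY: "y \<noteq> Y i" for i
  proof
    assume "y = Y i"
    then have "b < i" "i < Suc b" using y by (simp_all add: grid_order)
    then show False by simp
  qed
  have "X A1 \<le> X a" "X (Suc a) \<le> X A2" "Y B1 \<le> Y b" "Y (Suc b) \<le> Y B2"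
    using assms by (auto simp: grid_order)
  then have "(x, y) \<in> \<Omega>" using x y unfolding \<Omega> cbox_Pair_eq by auto
  then have "\<exists>K\<in>F. (x, y) \<in> K" using nX nY by (intro cover) auto
  then show ?thesis using face_cell[of _ x y a b] x y unfolding open_cell_def by auto
qed

text \<open>The midpoint of the missing edge lies in some face, which then contains the open cells
  on both sides of the edge.\<close>

lemma h_adjacent:
  assumes "\<not> Gh a b" "A1 \<le> a" "a < A2" "B1 < b" "b < B2"
  shows "\<exists>K\<in>F. open_cell a b \<subseteq> K \<and> open_cell a (b - 1) \<subseteq> K"
proof -
  define x where "x = (X a + X (Suc a)) / 2"
  have x: "X a < x" "x < X (Suc a)" using X_Suc[of a] by (simp_all add: x_def)
  have uniq: "i = a" if "X i \<le> x" "x \<le> X (Suc i)" for i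
    using index_unique[of a x i] x that by auto
  have nX: "x \<noteq> X i" for i
  proof
    assume "x = X i"
    then have "a < i" "i < Suc a" using x by (simp_all add: grid_order)
    then show False by simp
  qed
  have "X A1 \<le> X a" "X (Suc a) \<le> X A2" "Y B1 \<le> Y b" "Y b \<le> Y B2"
    using assms by (auto simp: grid_order)
  then have "(x, Y b) \<in> \<Omega>" using x unfolding \<Omega> cbox_Pair_eq by auto
  then have "\<exists>K\<in>F. (x, Y b) \<in> K"
    using nX uniq assms(1) by (intro cover) (auto simp: grid_order)
  then obtain K where K: "K \<in> F" "(x, Y b) \<in> K" by auto
  have "open_cell a b \<subseteq> K" "open_cell a (b - 1) \<subseteq> K"
    unfolding open_cell_def using x assms(4) by (intro face_cell[OF K]; simp add: grid_order)+
  then show ?thesis using K by auto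
qed

lemma v_adjacent:
  assumes "\<not> Gv a b" "A1 < a" "a < A2" "B1 \<le> b" "b < B2"
  shows "\<exists>K\<in>F. open_cell a b \<subseteq> K \<and> open_cell (a - 1) b \<subseteq> K"
proof -
  define y where "y = (Y b + Y (Suc b)) / 2"
  have y: "Y b < y" "y < Y (Suc b)" using Y_Suc[of b] by (simp_all add: y_def)
  have uniq: "i = b" if "Y i \<le> y" "y \<le> Y (Suc i)" for i
    using y_index_unique[of b y i] y that by auto
  have nY: "y \<noteq> Y i" for i
  proof
    assume "y = Y i"
    then have "b < i" "i < Suc b" using y by (simp_all add: grid_order)
    then show False by simp
  qed
  have "X A1 \<le> X a" "X a \<le> X A2" "Y B1 \<le> Y b" "Y (Suc b) \<le> Y B2"
    using assms by (auto simp: grid_order)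
  then have "(X a, y) \<in> \<Omega>" using y unfolding \<Omega> cbox_Pair_eq by auto
  then have "\<exists>K\<in>F. (X a, y) \<in> K"
    using nY uniq assms(1) by (intro cover) (auto simp: grid_order)
  then obtain K where K: "K \<in> F" "(X a, y) \<in> K" by auto
  have "open_cell a b \<subseteq> K" "open_cell (a - 1) b \<subseteq> K"
    unfolding open_cell_def using y assms(2) by (intro face_cell[OF K]; simp add: grid_order)+
  then show ?thesis using K by auto
qed

text \<open>The polynomial to which the sum of truncated powers reduces on the cell
  \<open>(a, b)\<close>: exactly the knots to the lower left are active there.\<close>

definition cell_poly :: "(nat \<times> nat \<Rightarrow> real) \<Rightarrow> nat \<Rightarrow> nat \<Rightarrow> real \<Rightarrow> real \<Rightarrow> real" where
  "cell_poly c a b x y = (\<Sum>i\<le>a. \<Sum>j\<le>b. c (i, j) * (x - X i) ^ e * (y - Y j) ^ e)"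

lemma W_row: "c \<in> W \<Longrightarrow> \<not> Gh a b \<Longrightarrow> (\<Sum>i\<le>a. c (i, b) * (x - X i) ^ e) = 0"
  using moments_iff_power_sum[where e = e and t = a and c = "\<lambda>i. c (i, b)" and x = X] by (auto simp: coeff_space_def moments_def)

lemma W_col: "c \<in> W \<Longrightarrow> \<not> Gv a b \<Longrightarrow> (\<Sum>j\<le>b. c (a, j) * (y - Y j) ^ e) = 0"
  using moments_iff_power_sum[where e = e and t = b and c = "\<lambda>j. c (a, j)" and x = Y] by (auto simp: coeff_space_def moments_def)

lemma cell_poly_Suc:
  "cell_poly c a (Suc b) x y = cell_poly c a b x y + (\<Sum>i\<le>a. c (i, Suc b) * (x - X i) ^ e) * (y - Y (Suc b)) ^ e"
  "cell_poly c (Suc a) b x y = cell_poly c a b x y + (x - X (Suc a)) ^ e * (\<Sum>j\<le>b. c (Suc a, j) * (y - Y j) ^ e)"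
  by (simp_all add: cell_poly_def sum.distrib sum_distrib_left sum_distrib_right mult_ac)

lemma cell_poly_0:
  "cell_poly c a 0 x y = (\<Sum>i\<le>a. c (i, 0) * (x - X i) ^ e) * (y - Y 0) ^ e"
  "cell_poly c 0 b x y = (x - X 0) ^ e * (\<Sum>j\<le>b. c (0, j) * (y - Y j) ^ e)"
  by (simp_all add: cell_poly_def sum_distrib_left sum_distrib_right mult_ac)

text \<open>The condition at a missing edge says that the jump across it is zero, so the polynomial
  continues unchanged. For \<open>b = 0\<close> the region below the grid takes the place of the
  lower cell, with polynomial zero.\<close>

lemma cell_poly_h: "c \<in> W \<Longrightarrow> \<not> Gh a b \<Longrightarrow> cell_poly c a b = (if b = 0 then (\<lambda>_ _. 0) else cell_poly c a (b - 1))"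
  by (cases b) (auto simp: fun_eq_iff cell_poly_Suc cell_poly_0 W_row)

lemma cell_poly_v: "c \<in> W \<Longrightarrow> \<not> Gv a b \<Longrightarrow> cell_poly c a b = (if a = 0 then (\<lambda>_ _. 0) else cell_poly c (a - 1) b)"
  by (cases a) (auto simp: fun_eq_iff cell_poly_Suc cell_poly_0 W_col)

text \<open>Beside the rectangle no edge is met on the way in from index 0, where the polynomial is
  zero. A cell outside in \<open>y\<close> is reached along its row, any other outside cell along
  its column.\<close>

lemma cell_poly_outside:
  assumes c: "c \<in> W" and out: "\<not> inside a b" shows "cell_poly c a b = (\<lambda>_ _. 0)"
proof (cases "B1 \<le> b \<and> b < B2")
  case False
  then show ?thesis
  proof (induction a)
    case 0
    have "\<not> Gv 0 b" using 0 v_rect by blast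
    then show ?case using cell_poly_v[OF c] by simp
  next
    case (Suc a)
    have "\<not> Gv (Suc a) b" using Suc v_rect by blast
    then show ?case using cell_poly_v[OF c] Suc by simp
  qed
next
  case True
  then have "\<not> (A1 \<le> a \<and> a < A2)" using out by auto
  then show ?thesis
  proof (induction b)
    case 0
    have "\<not> Gh a 0" using 0 h_rect by blast
    then show ?case using cell_poly_h[OF c] by simp
  next
    case (Suc b)
    have "\<not> Gh a (Suc b)" using Suc h_rect by blast
    then show ?case using cell_poly_h[OF c] Suc by simp
  qed
qed

lemma cell_poly_coeffs:
  "cell_poly c a b x y = (\<Sum>k\<le>e. \<Sum>l\<le>e. (\<Sum>i\<le>a. \<Sum>j\<le>b. c (i, j) * coeff ([:- X i, 1:] ^ e) k * coeff ([:- Y j, 1:] ^ e) l)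
     * x ^ k * y ^ l)"
proof -
  have p: "(x - z) ^ e = (\<Sum>k\<le>e. coeff ([:- z, 1:] ^ e) k * x ^ k)" for x z :: real
  proof -
    have "(x - z) ^ e = poly ([:- z, 1:] ^ e) x" by (simp add: poly_power)
    also have "\<dots> = (\<Sum>k\<le>e. coeff ([:- z, 1:] ^ e) k * x ^ k)"
      unfolding poly_altdef by (simp add: degree_linear_power)
    finally show ?thesis .
  qed
  have "cell_poly c a b x y = (\<Sum>i\<le>a. \<Sum>j\<le>b. \<Sum>k\<le>e. \<Sum>l\<le>e.
      c (i, j) * coeff ([:- X i, 1:] ^ e) k * coeff ([:- Y j, 1:] ^ e) l * x ^ k * y ^ l)"
    unfolding cell_poly_def p[of x] p[of y] by (simp add: sum_distrib_left sum_distrib_right mult_ac)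
  also have "\<dots> = (\<Sum>i\<le>a. \<Sum>k\<le>e. \<Sum>j\<le>b. \<Sum>l\<le>e.
      c (i, j) * coeff ([:- X i, 1:] ^ e) k * coeff ([:- Y j, 1:] ^ e) l * x ^ k * y ^ l)"
    by (intro sum.cong refl sum.swap)
  also have "\<dots> = (\<Sum>k\<le>e. \<Sum>i\<le>a. \<Sum>l\<le>e. \<Sum>j\<le>b.
      c (i, j) * coeff ([:- X i, 1:] ^ e) k * coeff ([:- Y j, 1:] ^ e) l * x ^ k * y ^ l)"
    by (subst sum.swap) (intro sum.cong refl sum.swap)
  also have "\<dots> = (\<Sum>k\<le>e. \<Sum>l\<le>e. \<Sum>i\<le>a. \<Sum>j\<le>b.
      c (i, j) * coeff ([:- X i, 1:] ^ e) k * coeff ([:- Y j, 1:] ^ e) l * x ^ k * y ^ l)"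
    by (intro sum.cong refl sum.swap)
  finally show ?thesis by (simp add: sum_distrib_right)
qed

lemma bipoly_cell_poly: "bipoly e (cell_poly c a b)"
  unfolding cell_poly_coeffs[abs_def] by (rule bipoly_coeffs)

text \<open>The special case for \<open>e = 0\<close> imposes the normalisation on the mesh lines
  that is part of \<open>homogeneous_splines\<close>.\<close>

definition spline_of :: "(nat \<times> nat \<Rightarrow> real) \<Rightarrow> real \<times> real \<Rightarrow> real" where
  "spline_of c = (\<lambda>(x, y). if e = 0 \<and> (x, y) \<notin> \<Union>F then 0
     else \<Sum>a\<le>A2. \<Sum>b\<le>B2. c (a, b) * trunc_pow e (x - X a) * trunc_pow e (y - Y b))"

lemma spline_of_off_faces: "e = 0 \<Longrightarrow> p \<notin> \<Union>F \<Longrightarrow> spline_of c p = 0"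
  unfolding spline_of_def by (cases p) simp

lemma W_support:
  assumes "c \<in> W" "\<not> (a \<le> A2 \<and> b \<le> B2)" shows "c (a, b) = 0"
proof (cases "a \<le> A2")
  case True
  have "\<not> Gh a b" "a = 0 \<or> \<not> Gh (a - 1) b" using assms(2) True h_rect[of _ b] by fastforce+
  moreover have "moments e (\<lambda>a. Gh a b) X (\<lambda>a. c (a, b))" using assms(1) by (simp add: coeff_space_def)
  ultimately show ?thesis using moments_isolated[of e "\<lambda>a. Gh a b" X "\<lambda>a. c (a, b)" a] by simp
next
  case False
  have "\<not> Gv a b" "b = 0 \<or> \<not> Gv a (b - 1)" using False v_rect[of a] by fastforce+
  moreover have "moments e (Gv a) Y (\<lambda>b. c (a, b))" using assms(1) by (simp add: coeff_space_def)
  ultimately show ?thesis using moments_isolated[of e "Gv a" Y "\<lambda>b. c (a, b)" b] by simp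
qed

lemma trunc_sum:
  assumes c: "c \<in> W" and x: "X a \<le> x" "x < X (Suc a)" and y: "Y b \<le> y" "y < Y (Suc b)"
  shows "(\<Sum>i\<le>A2. \<Sum>j\<le>B2. c (i, j) * trunc_pow e (x - X i) * trunc_pow e (y - Y j)) = cell_poly c a b x y"
proof -
  define g where "g i j = c (i, j) * trunc_pow e (x - X i) * trunc_pow e (y - Y j)" for i j
  have gx: "g i j = 0" if "i > a" for i j
  proof -
    have "X (Suc a) \<le> X i" using that by (simp add: grid_order)
    then have "\<not> X i \<le> x" using x by linarith
    then show ?thesis by (simp add: g_def trunc_pow_def)
  qed
  have gy: "g i j = 0" if "j > b" for i j
  proof -
    have "Y (Suc b) \<le> Y j" using that by (simp add: grid_order)
    then have "\<not> Y j \<le> y" using y by linarith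
    then show ?thesis by (simp add: g_def trunc_pow_def)
  qed
  have gs: "g i j = 0" if "\<not> (i \<le> A2 \<and> j \<le> B2)" for i j using W_support[OF c that] by (simp add: g_def)
  have "(\<Sum>i\<le>A2. \<Sum>j\<le>B2. g i j) = (\<Sum>i\<le>max a A2. \<Sum>j\<le>max b B2. g i j)"
  proof -
    have "(\<Sum>i\<le>max a A2. \<Sum>j\<le>max b B2. g i j) = (\<Sum>i\<le>A2. \<Sum>j\<le>max b B2. g i j)"
      by (rule sum.mono_neutral_right) (auto intro!: sum.neutral gs)
    also have "\<dots> = (\<Sum>i\<le>A2. \<Sum>j\<le>B2. g i j)"
      by (intro sum.cong refl sum.mono_neutral_right) (auto intro!: gs)
    finally show ?thesis by simp
  qed
  also have "\<dots> = (\<Sum>i\<le>a. \<Sum>j\<le>max b B2. g i j)"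
    by (rule sum.mono_neutral_right) (auto intro!: sum.neutral gx)
  also have "\<dots> = (\<Sum>i\<le>a. \<Sum>j\<le>b. g i j)"
    by (intro sum.cong refl sum.mono_neutral_right) (auto intro!: gy)
  also have "\<dots> = cell_poly c a b x y"
    unfolding cell_poly_def
  proof (intro sum.cong refl)
    fix i j assume "i \<in> {..a}" "j \<in> {..b}"
    then have "X i \<le> X a" "Y j \<le> Y b" by (simp_all add: grid_order)
    then have "X i \<le> x" "Y j \<le> y" using x y by linarith+
    then show "g i j = c (i, j) * (x - X i) ^ e * (y - Y j) ^ e"
      by (simp add: g_def trunc_pow_def)
  qed
  finally show ?thesis by (simp add: g_def)
qed

lemma trunc_sum_below:
  assumes "x < X 0 \<or> y < Y 0"
  shows "(\<Sum>i\<le>A2. \<Sum>j\<le>B2. c (i, j) * trunc_pow e (x - X i) * trunc_pow e (y - Y j)) = 0"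
proof -
  have X0: "X 0 \<le> X i" and Y0: "Y 0 \<le> Y i" for i by (simp_all add: grid_order)
  have "trunc_pow e (x - X i) = 0 \<or> trunc_pow e (y - Y j) = 0" for i j
  proof -
    have "\<not> X i \<le> x \<or> \<not> Y j \<le> y" using assms X0[of i] Y0[of j] by linarith
    then show ?thesis by (auto simp: trunc_pow_def)
  qed
  then have "c (i, j) * trunc_pow e (x - X i) * trunc_pow e (y - Y j) = 0" for i j
    by (metis mult_eq_0_iff)
  then show ?thesis by (intro sum.neutral ballI)
qed

lemma spline_of_face:
  assumes c: "c \<in> W" and K: "K \<in> F" "(x, y) \<in> K"
    and ab: "X a \<le> x" "x < X (Suc a)" "Y b \<le> y" "y < Y (Suc b)"
  shows "spline_of c (x, y) = cell_poly c a b x y"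
  using trunc_sum[OF c ab] K by (auto simp: spline_of_def)

lemma near_index:
  fixes Z :: "nat \<Rightarrow> real"
  assumes "strict_mono Z" "Z a \<le> x" "x < Z (Suc a)" "Z 0 < x"
  shows "\<exists>\<delta>>0. \<forall>x'. \<bar>x' - x\<bar> < \<delta> \<longrightarrow> (Z a \<le> x' \<and> x' < Z (Suc a)) \<or>
    (\<exists>k. x = Z a \<and> a = Suc k \<and> Z k \<le> x' \<and> x' < Z (Suc k))"
proof (cases "x = Z a")
  case False
  then show ?thesis
    using assms by (intro exI[of _ "min (x - Z a) (Z (Suc a) - x)"]) auto
next
  case True
  then obtain k where k: "a = Suc k" using assms(4) by (cases a) auto
  have "Z k < Z a" using assms(1) k by (simp add: strict_mono_less)
  then show ?thesis
    using assms True k by (intro exI[of _ "min (x - Z k) (Z (Suc a) - x)"]) auto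
qed

text \<open>Within a face only missing edges are crossed, so the polynomial of the current cell is
  locally constant on \<open>K\<close>, and connectedness makes it constant. The shape of the face
  does not enter.\<close>

lemma spline_of_poly_on_face:
  assumes c: "c \<in> W" and K: "K \<in> F"
  shows "bidegree_poly_on e K (spline_of c)"
proof (cases "K = {}")
  case False
  \<comment> \<open>The polynomial of the half-open cell containing \<open>p\<close>; half-open
    cells make it unique also on grid lines.\<close>
  define \<phi> where "\<phi> p = (THE q. \<exists>a b. X a \<le> fst p \<and> fst p < X (Suc a) \<and> Y b \<le> snd p \<and> snd p < Y (Suc b) \<and>
    q = cell_poly c a b)" for p
  have \<phi>: "\<phi> (x, y) = cell_poly c a b" if "X a \<le> x" "x < X (Suc a)" "Y b \<le> y" "y < Y (Suc b)" for x y a b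
    unfolding \<phi>_def
  proof (rule the_equality)
    show "\<exists>i j. X i \<le> fst (x, y) \<and> fst (x, y) < X (Suc i) \<and> Y j \<le> snd (x, y) \<and> snd (x, y) < Y (Suc j) \<and>
        cell_poly c a b = cell_poly c i j" using that by auto
    fix q assume "\<exists>a b. X a \<le> fst (x, y) \<and> fst (x, y) < X (Suc a) \<and> Y b \<le> snd (x, y) \<and> snd (x, y) < Y (Suc b) \<and>
        q = cell_poly c a b"
    then obtain i j where ij: "X i \<le> x" "x < X (Suc i)" "Y j \<le> y" "y < Y (Suc j)" "q = cell_poly c i j" by auto
    have "i = a" using index_unique[OF that(1,2), of i] index_unique[OF ij(1,2), of a] that ij by auto
    moreover have "j = b" using y_index_unique[OF that(3,4), of j] y_index_unique[OF ij(3,4), of b] that ij by auto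
    ultimately show "q = cell_poly c a b" using ij by simp
  qed
  have pos: "X 0 < x" "Y 0 < y" if "(x, y) \<in> K" for x y
  proof -
    have "X A1 < x" "Y B1 < y" using faces(2)[OF K] that by (auto simp: mem_box Basis_prod_def)
    then show "X 0 < x" "Y 0 < y" using X_le(1)[THEN iffD2, of 0 A1] X_le(2)[THEN iffD2, of 0 B1] by linarith+
  qed
  have idx: "\<exists>a b. X a \<le> x \<and> x < X (Suc a) \<and> Y b \<le> y \<and> y < Y (Suc b)" if "(x, y) \<in> K" for x y
    using x_index[of x] y_index[of y] pos[OF that] by (meson less_imp_le)
  have "\<forall>p\<in>K. eventually (\<lambda>p'. \<phi> p = \<phi> p') (at p within K)"
  proof
    fix p assume p: "p \<in> K"
    obtain x y where xy: "p = (x, y)" by (cases p)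
    obtain a b where ab: "X a \<le> x" "x < X (Suc a)" "Y b \<le> y" "y < Y (Suc b)" using idx p xy by blast
    obtain \<delta>1 where \<delta>1: "\<delta>1 > 0" "\<And>x'. \<bar>x' - x\<bar> < \<delta>1 \<Longrightarrow> (X a \<le> x' \<and> x' < X (Suc a)) \<or>
        (\<exists>k. x = X a \<and> a = Suc k \<and> X k \<le> x' \<and> x' < X (Suc k))"
      using near_index[OF mono(1) ab(1,2)] pos p xy by blast
    obtain \<delta>2 where \<delta>2: "\<delta>2 > 0" "\<And>y'. \<bar>y' - y\<bar> < \<delta>2 \<Longrightarrow> (Y b \<le> y' \<and> y' < Y (Suc b)) \<or>
        (\<exists>k. y = Y b \<and> b = Suc k \<and> Y k \<le> y' \<and> y' < Y (Suc k))"
      using near_index[OF mono(2) ab(3,4)] pos p xy by blast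
    have "\<phi> p = \<phi> p'" if p': "p' \<in> K" "dist p' p < min \<delta>1 \<delta>2" for p'
    proof -
      obtain x' y' where xy': "p' = (x', y')" by (cases p')
      have "dist x' x \<le> dist p' p" "dist y' y \<le> dist p' p"
        unfolding xy xy' by (metis dist_fst_le fst_conv, metis dist_snd_le snd_conv)
      then have d: "\<bar>x' - x\<bar> < \<delta>1" "\<bar>y' - y\<bar> < \<delta>2" using p'(2) by (auto simp: dist_real_def)
      have h: "cell_poly c i (Suc k) = cell_poly c i k" if "y = Y (Suc k)" "X i \<le> x" "x \<le> X (Suc i)" for i k
        using cell_poly_h[OF c, of i "Suc k"] avoid_h[OF K, of x "Suc k" i] p xy that by simp
      have v: "cell_poly c (Suc k) j = cell_poly c k j" if "x = X (Suc k)" "Y j \<le> y" "y \<le> Y (Suc j)" for j k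
        using cell_poly_v[OF c, of "Suc k" j] avoid_v[OF K, of "Suc k" y j] p xy that by simp
      have "\<phi> p = cell_poly c a b" using \<phi>[OF ab] xy by simp
      also have "\<dots> = \<phi> p'"
      proof -
        consider (1) "X a \<le> x' \<and> x' < X (Suc a)" "Y b \<le> y' \<and> y' < Y (Suc b)"
          | (2) k where "x = X a" "a = Suc k" "X k \<le> x'" "x' < X (Suc k)" "Y b \<le> y' \<and> y' < Y (Suc b)"
          | (3) l where "X a \<le> x' \<and> x' < X (Suc a)" "y = Y b" "b = Suc l" "Y l \<le> y'" "y' < Y (Suc l)"
          | (4) k l where "x = X a" "a = Suc k" "X k \<le> x'" "x' < X (Suc k)" "y = Y b" "b = Suc l" "Y l \<le> y'" "y' < Y (Suc l)"
          using \<delta>1(2)[OF d(1)] \<delta>2(2)[OF d(2)] by blast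
        then show ?thesis
        proof cases
          case 1
          then show ?thesis using \<phi>[of a x' b y'] xy' by simp
        next
          case (2 k)
          then show ?thesis using \<phi>[of k x' b y'] xy' v[of k b] ab by simp
        next
          case (3 l)
          then show ?thesis using \<phi>[of a x' l y'] xy' h[of l a] ab by simp
        next
          case (4 k l)
          then show ?thesis using \<phi>[of k x' l y'] xy' v[of k b] h[of l k] ab by simp
        qed
      qed
      finally show ?thesis .
    qed
    then show "eventually (\<lambda>p'. \<phi> p = \<phi> p') (at p within K)"
      unfolding eventually_at using \<delta>1(1) \<delta>2(1) by (intro exI[of _ "min \<delta>1 \<delta>2"]) auto
  qed
  then have const: "\<phi> p = \<phi> q" if "p \<in> K" "q \<in> K" for p q
    using connected_local_const[OF faces(1)[OF K] that] by blast
  obtain x0 y0 where p0: "(x0, y0) \<in> K" using False by auto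
  obtain a0 b0 where a0: "X a0 \<le> x0" "x0 < X (Suc a0)" "Y b0 \<le> y0" "y0 < Y (Suc b0)" using idx p0 by blast
  have "spline_of c (x, y) = cell_poly c a0 b0 x y" if xy: "(x, y) \<in> K" for x y
  proof -
    obtain a b where ab: "X a \<le> x" "x < X (Suc a)" "Y b \<le> y" "y < Y (Suc b)" using idx[OF xy] by blast
    have "cell_poly c a b = cell_poly c a0 b0"
      using const[OF xy p0] \<phi>[OF ab] \<phi>[OF a0] by simp
    then show ?thesis using spline_of_face[OF c K xy ab] by simp
  qed
  then show ?thesis
    unfolding bidegree_poly_on_def cell_poly_coeffs
    by (intro exI[of _ "\<lambda>k l. \<Sum>i\<le>a0. \<Sum>j\<le>b0. c (i, j) * coeff ([:- X i, 1:] ^ e) k * coeff ([:- Y j, 1:] ^ e) l"]) auto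
qed (simp add: bidegree_poly_on_def)

lemma spline_of_outside:
  assumes c: "c \<in> W" and p: "(x, y) \<notin> \<Omega>" shows "spline_of c (x, y) = 0"
proof (cases "x < X 0 \<or> y < Y 0")
  case True
  then show ?thesis using trunc_sum_below by (simp add: spline_of_def)
next
  case False
  then obtain a b where ab: "X a \<le> x" "x < X (Suc a)" "Y b \<le> y" "y < Y (Suc b)"
    using x_index[of x] y_index[of y] by auto
  have "\<not> inside a b"
  proof
    assume "inside a b"
    then have "X A1 \<le> X a" "X (Suc a) \<le> X A2" "Y B1 \<le> Y b" "Y (Suc b) \<le> Y B2"
      by (auto simp: grid_order)
    then show False using p ab unfolding \<Omega> cbox_Pair_eq by auto
  qed
  then show ?thesis using trunc_sum[OF c ab] cell_poly_outside[OF c] by (simp add: spline_of_def)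
qed

lemma spline_of_in_splines:
  assumes c: "c \<in> W" shows "spline_of c \<in> homogeneous_splines e \<Omega> F"
proof -
  have "smooth_in_x e (spline_of c) \<and> smooth_in_y e (spline_of c)"
  proof (cases "e = 0")
    case True
    then show ?thesis unfolding smooth_in_x_def smooth_in_y_def by (auto intro!: exI[of _ "\<lambda>_. spline_of c"])
  next
    case False
    then have eq: "spline_of c = (\<lambda>(x, y). \<Sum>a\<le>A2. \<Sum>b\<le>B2. c (a, b) * trunc_pow e (x - X a) * trunc_pow e (y - Y b))"
      by (simp add: spline_of_def)
    have "(\<lambda>(x, y). spline_of c (y, x)) =
        (\<lambda>(x, y). \<Sum>b\<le>B2. \<Sum>a\<le>A2. c (a, b) * trunc_pow e (x - Y b) * trunc_pow e (y - X a))"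
      unfolding eq by (auto simp: fun_eq_iff mult_ac intro: sum.swap)
    then show ?thesis
      using smooth_trunc_sum[where e = e and c = "\<lambda>(b, a). c (a, b)" and x = Y and y = X and A = B2 and B = A2]
        smooth_trunc_sum[where e = e and c = c and x = X and y = Y and A = A2 and B = B2] False
      by (simp add: eq smooth_swap)
  qed
  moreover have "spline_of c p = 0" if "e = 0" "p \<notin> \<Union>F" for p
    using that by (rule spline_of_off_faces)
  ultimately show ?thesis
    using spline_of_poly_on_face[OF c] spline_of_outside[OF c] by (auto simp: homogeneous_splines_def)
qed

text \<open>All cell polynomials vanish. Their differences isolate first a row and then a single
  coefficient. Evaluation one unit beyond a knot turns the power into 1, for \<open>e = 0\<close> as
  well.\<close>

lemma spline_of_inj:
  assumes c: "c \<in> W" and z: "spline_of c = (\<lambda>_. 0)" shows "c = (\<lambda>_. 0)"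
proof
  have cp: "cell_poly c a b x y = 0" for a b x y
  proof (cases "inside a b")
    case True
    then obtain K where K: "K \<in> F" "open_cell a b \<subseteq> K" using open_cell_inside by blast
    show ?thesis
    proof (rule bipoly_eqI[OF bipoly_cell_poly bipoly_zero X_Suc[of a] Y_Suc[of b]])
      fix x y assume xy: "X a < x" "x < X (Suc a)" "Y b < y" "y < Y (Suc b)"
      then have "(x, y) \<in> K" using K(2) by (auto simp: open_cell_def)
      from spline_of_face[OF c K(1) this, of a b] xy z show "cell_poly c a b x y = 0" by simp
    qed
  next
    case False
    then show ?thesis using cell_poly_outside[OF c] by simp
  qed
  have row: "(\<Sum>i\<le>a. c (i, b) * (x - X i) ^ e) = 0" for a b x
  proof (cases b)
    case 0
    then show ?thesis using cp[of a 0 x "Y 0 + 1"] by (simp add: cell_poly_0)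
  next
    case (Suc k)
    then show ?thesis
      using cp[of a "Suc k" x "Y (Suc k) + 1"] cp[of a k x "Y (Suc k) + 1"] by (simp add: cell_poly_Suc)
  qed
  fix v :: "nat \<times> nat"
  obtain a b where v: "v = (a, b)" by (cases v)
  show "c v = 0"
  proof (cases a)
    case 0
    then show ?thesis using row[where a = 0 and b = b and x = "X 0 + 1"] v by simp
  next
    case (Suc k)
    then show ?thesis
      using row[where a = a and b = b and x = "X a + 1"] row[where a = k and b = b and x = "X a + 1"] v by simp
  qed
qed

lemma double_telescope:
  fixes u :: "nat \<Rightarrow> nat \<Rightarrow> real"
  assumes "\<And>a. u a 0 = 0" "\<And>b. u 0 b = 0"
  shows "(\<Sum>i\<le>a. \<Sum>j\<le>b. u (Suc i) (Suc j) - u i (Suc j) - u (Suc i) j + u i j) = u (Suc a) (Suc b)"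
proof -
  have inner: "(\<Sum>j\<le>b. u (Suc i) (Suc j) - u i (Suc j) - u (Suc i) j + u i j) = u (Suc i) (Suc b) - u i (Suc b)" for i
    by (induction b) (simp_all add: assms)
  have "(\<Sum>i\<le>a. u (Suc i) (Suc b) - u i (Suc b)) = u (Suc a) (Suc b)"
    by (induction a) (simp_all add: assms)
  then show ?thesis by (simp only: inner)
qed

text \<open>The jump across a vertical line is the power of \<open>x - X a\<close> times a function
  of \<open>y\<close>, and the jump of this function across a horizontal line is the power of
  \<open>y - Y b\<close> times a number. So the mixed second difference of the cell polynomials
  around a node is a multiple of the product of both powers, and this multiple is the
  coefficient.\<close>

lemma spline_of_surj:
  assumes f: "f \<in> homogeneous_splines e \<Omega> F" shows "\<exists>c\<in>W. spline_of c = f"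
proof -
  have sx: "smooth_in_x e f" and sy: "smooth_in_y e f" and pol: "\<And>K. K \<in> F \<Longrightarrow> bidegree_poly_on e K f"
    and out: "\<And>p. p \<notin> \<Omega> \<Longrightarrow> f p = 0" and e0: "\<And>p. e = 0 \<Longrightarrow> p \<notin> \<Union>F \<Longrightarrow> f p = 0"
    using f by (auto simp: homogeneous_splines_def)
  have "\<exists>q. bipoly e q \<and> (\<not> inside a b \<longrightarrow> q = (\<lambda>_ _. 0)) \<and> (\<forall>x y. (x, y) \<in> open_cell a b \<longrightarrow> f (x, y) = q x y)" for a b
  proof (cases "inside a b")
    case True
    then obtain K where K: "K \<in> F" "open_cell a b \<subseteq> K" using open_cell_inside by blast
    then obtain \<alpha> where "\<And>x y. (x, y) \<in> K \<Longrightarrow> f (x, y) = (\<Sum>i\<le>e. \<Sum>j\<le>e. \<alpha> i j * x ^ i * y ^ j)"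
      using pol unfolding bidegree_poly_on_def by blast
    then show ?thesis
      using K True by (intro exI[of _ "\<lambda>x y. \<Sum>i\<le>e. \<Sum>j\<le>e. \<alpha> i j * x ^ i * y ^ j"]) (auto simp: bipoly_coeffs)
  next
    case False
    then show ?thesis
      using open_cell_outside[OF False] out bipoly_zero by (intro exI[of _ "\<lambda>_ _. 0"]) blast
  qed
  then obtain q where q: "\<And>a b. bipoly e (q a b)" "\<And>a b. \<not> inside a b \<Longrightarrow> q a b = (\<lambda>_ _. 0)"
    "\<And>a b x y. (x, y) \<in> open_cell a b \<Longrightarrow> f (x, y) = q a b x y"
    by metis
  have face_q: "f (x, y) = q a b x y" if K: "K \<in> F" "open_cell a b \<subseteq> K" "(x, y) \<in> K" for K a b x y
  proof -
    obtain \<alpha> where \<alpha>: "\<And>x y. (x, y) \<in> K \<Longrightarrow> f (x, y) = (\<Sum>i\<le>e. \<Sum>j\<le>e. \<alpha> i j * x ^ i * y ^ j)"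
      using pol[OF K(1)] unfolding bidegree_poly_on_def by blast
    have "(\<Sum>i\<le>e. \<Sum>j\<le>e. \<alpha> i j * x ^ i * y ^ j) = q a b x y"
    proof (rule bipoly_eqI[OF bipoly_coeffs q(1) X_Suc[of a] Y_Suc[of b]])
      fix x y assume "X a < x" "x < X (Suc a)" "Y b < y" "y < Y (Suc b)"
      then have "(x, y) \<in> open_cell a b" by (simp add: open_cell_def)
      then show "(\<Sum>i\<le>e. \<Sum>j\<le>e. \<alpha> i j * x ^ i * y ^ j) = q a b x y"
        using \<alpha>[of x y] q(3)[of x y a b] K(2) by auto
    qed
    then show ?thesis using \<alpha>[OF K(3)] by simp
  qed
  have q_eq: "q a b = q i j" if "K \<in> F" "open_cell a b \<subseteq> K" "open_cell i j \<subseteq> K" for K a b i j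
  proof -
    have "q a b x y = q i j x y" for x y
    proof (rule bipoly_eqI[OF q(1) q(1) X_Suc[of a] Y_Suc[of b]])
      fix x y assume "X a < x" "x < X (Suc a)" "Y b < y" "y < Y (Suc b)"
      then have "(x, y) \<in> K" using that(2) by (auto simp: open_cell_def)
      then show "q a b x y = q i j x y" using face_q[of K] that by metis
    qed
    then show ?thesis by blast
  qed
  \<comment> \<open>Indices are shifted by one so that the zero function stands to the left of and
    below the first cells, and every node has four surrounding polynomials.\<close>
  define u where "u a b = (if a = 0 \<or> b = 0 then (\<lambda>_ _. 0) else q (a - 1) (b - 1))" for a b
  have u_bi: "bipoly e (u a b)" for a b using q(1) bipoly_zero by (auto simp: u_def)
  have u0: "u a 0 = (\<lambda>_ _. 0)" "u 0 b = (\<lambda>_ _. 0)" for a b by (simp_all add: u_def)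
  have u_cell: "f (x, y) = u a (Suc b) x y"
    if "(a = 0 \<and> x < X 0) \<or> (a > 0 \<and> X (a - 1) < x \<and> x < X a)" "Y b < y" "y < Y (Suc b)" for a b x y
  proof (cases "a = 0")
    case True
    then have "x < X 0" using that by simp
    moreover have "X 0 \<le> X A1" by (simp add: grid_order)
    ultimately have "(x, y) \<notin> \<Omega>" unfolding \<Omega> cbox_Pair_eq by auto
    then show ?thesis using out True by (simp add: u_def)
  next
    case False
    then have "(x, y) \<in> open_cell (a - 1) b" using that by (simp add: open_cell_def)
    then show ?thesis using q(3) False by (simp add: u_def)
  qed
  have u_cell': "f (x, y) = u (Suc a) b x y"
    if "(b = 0 \<and> y < Y 0) \<or> (b > 0 \<and> Y (b - 1) < y \<and> y < Y b)" "X a < x" "x < X (Suc a)" for a b x y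
  proof (cases "b = 0")
    case True
    then have "y < Y 0" using that by simp
    moreover have "Y 0 \<le> Y B1" by (simp add: grid_order)
    ultimately have "(x, y) \<notin> \<Omega>" unfolding \<Omega> cbox_Pair_eq by auto
    then show ?thesis using out True by (simp add: u_def)
  next
    case False
    then have "(x, y) \<in> open_cell a (b - 1)" using that by (simp add: open_cell_def)
    then show ?thesis using q(3) False by (simp add: u_def)
  qed
  have Hx: "u (Suc a) b x y - u a b x y = (x - X a) ^ e * (u (Suc a) b (X a + 1) y - u a b (X a + 1) y)" for a b x y
  proof (cases b)
    case 0
    then show ?thesis by (simp add: u0)
  next
    case (Suc k)
    define l where "l = (if a = 0 then X 0 - 1 else X (a - 1))"
    have l: "l < X a" by (simp add: l_def grid_order)
    show ?thesis
      unfolding Suc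
    proof (rule column_jump[OF sx u_bi u_bi l X_Suc Y_Suc])
      show "f (t, y) = u a (Suc k) t y" if "l < t" "t < X a" "Y k < y" "y < Y (Suc k)" for t y
        using that by (intro u_cell) (auto simp: l_def split: if_splits)
      show "f (t, y) = u (Suc a) (Suc k) t y" if "X a < t" "t < X (Suc a)" "Y k < y" "y < Y (Suc k)" for t y
        using that by (intro u_cell) auto
    qed
  qed
  have Hy: "u a (Suc b) x y - u a b x y = (y - Y b) ^ e * (u a (Suc b) x (Y b + 1) - u a b x (Y b + 1))" for a b x y
  proof (cases a)
    case 0
    then show ?thesis by (simp add: u0)
  next
    case (Suc k)
    define l where "l = (if b = 0 then Y 0 - 1 else Y (b - 1))"
    have l: "l < Y b" by (simp add: l_def grid_order)
    show ?thesis
      unfolding Suc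
    proof (rule column_jump[OF sy[unfolded smooth_swap] bipoly_flip[OF u_bi] bipoly_flip[OF u_bi] l Y_Suc X_Suc])
      show "(\<lambda>(x, y). f (y, x)) (t, x) = u (Suc k) b x t" if "l < t" "t < Y b" "X k < x" "x < X (Suc k)" for t x
        using that by (simp, intro u_cell') (auto simp: l_def split: if_splits)
      show "(\<lambda>(x, y). f (y, x)) (t, x) = u (Suc k) (Suc b) x t" if "Y b < t" "t < Y (Suc b)" "X k < x" "x < X (Suc k)" for t x
        using that by (simp, intro u_cell') auto
    qed
  qed
  define c where "c = (\<lambda>(a, b). u (Suc a) (Suc b) (X a + 1) (Y b + 1) - u a (Suc b) (X a + 1) (Y b + 1)
    - u (Suc a) b (X a + 1) (Y b + 1) + u a b (X a + 1) (Y b + 1))"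
  have D: "c (a, b) * (x - X a) ^ e * (y - Y b) ^ e =
    u (Suc a) (Suc b) x y - u a (Suc b) x y - u (Suc a) b x y + u a b x y" for a b x y
  proof -
    have "u (Suc a) (Suc b) x y - u a (Suc b) x y - u (Suc a) b x y + u a b x y =
      (u (Suc a) (Suc b) x y - u a (Suc b) x y) - (u (Suc a) b x y - u a b x y)" by simp
    also have "\<dots> = (x - X a) ^ e * ((u (Suc a) (Suc b) (X a + 1) y - u (Suc a) b (X a + 1) y)
        - (u a (Suc b) (X a + 1) y - u a b (X a + 1) y))"
      unfolding Hx[of a "Suc b" x y] Hx[of a b x y] by (simp add: algebra_simps)
    also have "\<dots> = (x - X a) ^ e * ((y - Y b) ^ e * c (a, b))"
      unfolding Hy[of "Suc a" b "X a + 1" y] Hy[of a b "X a + 1" y] by (simp add: c_def algebra_simps)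
    finally show ?thesis by (simp add: mult_ac)
  qed
  have cp: "cell_poly c a b x y = u (Suc a) (Suc b) x y" for a b x y
    unfolding cell_poly_def D by (rule double_telescope) (simp_all add: u0)
  \<comment> \<open>All edges on the boundary of the rectangle are present. A missing edge therefore
    lies either strictly inside, with one face on both sides, or has outside cells on both
    sides.\<close>
  have Gh_u: "u (Suc a) (Suc b) = u (Suc a) b" if G: "\<not> Gh a b" for a b
  proof (cases "inside a b")
    case True
    have "b \<noteq> B1" using G h_bdry[of a] True by auto
    then have b: "B1 < b" "0 < b" using True by auto
    obtain K where "K \<in> F" "open_cell a b \<subseteq> K" "open_cell a (b - 1) \<subseteq> K"
      using h_adjacent[OF G] True b by blast
    from q_eq[OF this] show ?thesis using b by (simp add: u_def)
  next
    case False
    have "\<not> inside a (b - 1)" if "b > 0"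
    proof
      assume "inside a (b - 1)"
      then have "b = B2" "A1 \<le> a" "a < A2" "B1 < B2" using False that by auto
      then show False using G h_bdry[of a] by blast
    qed
    then show ?thesis using q(2)[OF False] q(2)[of a "b - 1"] by (cases "b = 0") (auto simp: u_def)
  qed
  have Gv_u: "u (Suc a) (Suc b) = u a (Suc b)" if G: "\<not> Gv a b" for a b
  proof (cases "inside a b")
    case True
    have "a \<noteq> A1" using G v_bdry[of b] True by auto
    then have b: "A1 < a" "0 < a" using True by auto
    obtain K where "K \<in> F" "open_cell a b \<subseteq> K" "open_cell (a - 1) b \<subseteq> K"
      using v_adjacent[OF G] True b by blast
    from q_eq[OF this] show ?thesis using b by (simp add: u_def)
  next
    case False
    have "\<not> inside (a - 1) b" if "a > 0"
    proof
      assume "inside (a - 1) b"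
      then have "a = A2" "B1 \<le> b" "b < B2" "A1 < A2" using False that by auto
      then show False using G v_bdry[of b] by blast
    qed
    then show ?thesis using q(2)[OF False] q(2)[of "a - 1" b] by (cases "a = 0") (auto simp: u_def)
  qed
  have "c \<in> W"
  proof -
    have row: "(\<Sum>i\<le>a. c (i, b) * (z - X i) ^ e) = 0" if "\<not> Gh a b" for a b z
    proof (cases b)
      case 0
      then show ?thesis
        using cp[of a b z "Y b + 1"] Gh_u[OF that] by (simp add: cell_poly_0 u0)
    next
      case (Suc k)
      then show ?thesis
        using cp[of a "Suc k" z "Y b + 1"] cp[of a k z "Y b + 1"] Gh_u[OF that] by (simp add: cell_poly_Suc)
    qed
    have col: "(\<Sum>j\<le>b. c (a, j) * (z - Y j) ^ e) = 0" if "\<not> Gv a b" for a b z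
    proof (cases a)
      case 0
      then show ?thesis
        using cp[of a b "X a + 1" z] Gv_u[OF that] by (simp add: cell_poly_0 u0)
    next
      case (Suc k)
      then show ?thesis
        using cp[of "Suc k" b "X a + 1" z] cp[of k b "X a + 1" z] Gv_u[OF that] by (simp add: cell_poly_Suc)
    qed
    show ?thesis
      unfolding coeff_space_def moments_def moments_iff_power_sum using row col by auto
  qed
  moreover have "spline_of c p = f p" for p
  proof -
    obtain x y where p: "p = (x, y)" by (cases p)
    show ?thesis
    proof (cases "x < X 0 \<or> y < Y 0")
      case True
      have "X 0 \<le> X A1" "Y 0 \<le> Y B1" by (simp_all add: grid_order)
      then have "(x, y) \<notin> \<Omega>" using True unfolding \<Omega> cbox_Pair_eq by auto
      then show ?thesis using spline_of_outside[OF \<open>c \<in> W\<close>] out p by simp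
    next
      case False
      then obtain a b where ab: "X a \<le> x" "x < X (Suc a)" "Y b \<le> y" "y < Y (Suc b)"
        using x_index[of x] y_index[of y] by auto
      have sum: "(\<Sum>i\<le>A2. \<Sum>j\<le>B2. c (i, j) * trunc_pow e (x - X i) * trunc_pow e (y - Y j)) = q a b x y"
        using trunc_sum[OF \<open>c \<in> W\<close> ab] cp by (simp add: u_def)
      consider K where "K \<in> F" "(x, y) \<in> K" | "e = 0" "(x, y) \<notin> \<Union>F" | "e > 0" by blast
      then show ?thesis
      proof cases
        case (1 K)
        have "open_cell a b \<subseteq> K" unfolding open_cell_def using face_cell[OF 1] ab by auto
        then show ?thesis using face_q[OF 1(1) _ 1(2)] sum 1 p by (auto simp: spline_of_def)
      next
        case 2
        then show ?thesis using e0[OF 2(1)] spline_of_off_faces[OF 2(1)] p by metis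
      next
        case 3
        \<comment> \<open>A point on the mesh lines is reached by continuity from the cell to its
          upper right, first in \<open>y\<close> and then in \<open>x\<close>.\<close>
        then have cont: "continuous_on UNIV f" using sx unfolding smooth_in_x_def by auto
        have 1: "f (t, y) = q a b t y" if t: "X a < t" "t < X (Suc a)" for t
        proof (cases "y = Y b")
          case False
          then show ?thesis using q(3)[of t y a b] t ab by (simp add: open_cell_def)
        next
          case True
          obtain P where P: "\<And>y. q a b t y = poly P y"
            by (rule bipoly_snd[OF q(1)[of a b], where x = t]) (rule that)
          have "continuous_on UNIV (\<lambda>s. f (t, s))"
            by (rule continuous_on_compose2[OF cont]) (auto intro!: continuous_intros)
          then have "f (t, Y b) = poly P (Y b)"
            by (rule poly_piece_limit(1)[OF _ Y_Suc[of b]])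
              (use q(3)[of t _ a b] t P in \<open>auto simp: open_cell_def\<close>)
          then show ?thesis using True P by simp
        qed
        have "f (x, y) = q a b x y"
        proof (cases "x = X a")
          case False
          then show ?thesis using 1 ab by simp
        next
          case True
          obtain P where P: "\<And>x. q a b x y = poly P x"
            by (rule bipoly_fst[OF q(1)[of a b], where y = y]) (rule that)
          have "continuous_on UNIV (\<lambda>s. f (s, y))"
            by (rule continuous_on_compose2[OF cont]) (auto intro!: continuous_intros)
          then have "f (X a, y) = poly P (X a)"
            by (rule poly_piece_limit(1)[OF _ X_Suc[of a]]) (use 1 P in auto)
          then show ?thesis using True P by simp
        qed
        then show ?thesis using sum 3 p by (simp add: spline_of_def)
      qed
    qed
  qed
  ultimately show ?thesis by blast
qed

theorem dim_homogeneous_splines: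
  "fun_space.dim (homogeneous_splines e \<Omega> F) = fun_space.dim W"
proof -
  have "fun_space.dim W = fun_space.dim (homogeneous_splines e \<Omega> F)"
  proof (rule fun_dim_bij[where f = spline_of])
    show "fun_linear spline_of"
    proof (rule fun_linearI)
      show "spline_of (c + d) = spline_of c + spline_of d" for c d
        by (auto simp: spline_of_def fun_eq_iff distrib_right sum.distrib)
      show "spline_of (\<lambda>p. k * c p) = (\<lambda>p. k * spline_of c p)" for k c
        by (auto simp: spline_of_def fun_eq_iff sum_distrib_left mult.assoc)
    qed
    show "fun_space.subspace W" by (rule subspace_coeff_space)
  qed (use spline_of_in_splines spline_of_inj spline_of_surj in auto)
  then show ?thesis by simp
qed

end


subsection \<open>Coefficients on the CVR graph\<close>

definition cvr_h :: "(nat \<Rightarrow> nat \<Rightarrow> bool) \<Rightarrow> (nat \<Rightarrow> nat \<Rightarrow> bool) \<Rightarrow> nat \<Rightarrow> nat \<Rightarrow> bool" where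
  "cvr_h H V a b \<longleftrightarrow> (\<exists>a1 a2. a1 \<le> a \<and> a < a2 \<and> (a1, b) \<in> cross_nodes H V \<and> (a2, b) \<in> cross_nodes H V \<and>
     (\<forall>i. a1 \<le> i \<and> i < a2 \<longrightarrow> H i b))"

definition cvr_v :: "(nat \<Rightarrow> nat \<Rightarrow> bool) \<Rightarrow> (nat \<Rightarrow> nat \<Rightarrow> bool) \<Rightarrow> nat \<Rightarrow> nat \<Rightarrow> bool" where
  "cvr_v H V a b \<longleftrightarrow> (\<exists>b1 b2. b1 \<le> b \<and> b < b2 \<and> (a, b1) \<in> cross_nodes H V \<and> (a, b2) \<in> cross_nodes H V \<and>
     (\<forall>j. b1 \<le> j \<and> j < b2 \<longrightarrow> V a j))"

text \<open>Let the edge at \<open>t\<close> be present but not between two nodes of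
  \<open>Z\<close> in its run. Then in this run either no node of \<open>Z\<close> lies at or before
  \<open>t\<close>, and the partial sum equals the one at the preceding gap, or none lies behind
  \<open>t\<close>, and it equals the one at the following gap.\<close>

lemma moments_between:
  assumes mo: "moments r E x c" and c0: "\<And>i. i \<notin> Z \<Longrightarrow> c i = 0" and bd: "\<And>i. E i \<Longrightarrow> i < m"
    and E'_def: "\<And>t. E' t \<longleftrightarrow> (\<exists>t1 t2. t1 \<le> t \<and> t < t2 \<and> t1 \<in> Z \<and> t2 \<in> Z \<and> (\<forall>i. t1 \<le> i \<and> i < t2 \<longrightarrow> E i))"
  shows "moments r E' x c"
  unfolding moments_def
proof (intro allI impI)
  fix t k assume nE': "\<not> E' t" and k: "k \<le> r"
  define g where "g i = c i * x i ^ k" for i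
  have pre: "(\<Sum>i\<le>u. g i) = 0" if "\<not> E u" for u using mo that k by (simp add: moments_def g_def)
  have g0: "g i = 0" if "i \<notin> Z" for i using c0[OF that] by (simp add: g_def)
  show "(\<Sum>i\<le>t. c i * x i ^ k) = 0"
  proof (cases "E t")
    case False
    then show ?thesis using pre by (simp add: g_def)
  next
    case True
    define l where "l = (LEAST l. \<forall>i. l \<le> i \<and> i \<le> t \<longrightarrow> E i)"
    have l: "\<And>i. l \<le> i \<Longrightarrow> i \<le> t \<Longrightarrow> E i" "l \<le> t"
    proof -
      have "\<forall>i. t \<le> i \<and> i \<le> t \<longrightarrow> E i" using True by auto
      then have "\<forall>i. l \<le> i \<and> i \<le> t \<longrightarrow> E i" "l \<le> t" unfolding l_def by (rule LeastI, rule Least_le)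
      then show "\<And>i. l \<le> i \<Longrightarrow> i \<le> t \<Longrightarrow> E i" "l \<le> t" by auto
    qed
    have l_end: "\<not> E (l - 1)" if "l > 0"
    proof
      assume "E (l - 1)"
      then have "\<forall>i. l - 1 \<le> i \<and> i \<le> t \<longrightarrow> E i" using l that by (metis Suc_pred' le_antisym not_less_eq_eq)
      then have "l \<le> l - 1" unfolding l_def by (rule Least_le)
      then show False using that by simp
    qed
    define h where "h = (LEAST h. t \<le> h \<and> \<not> E h)"
    have "t \<le> max t m \<and> \<not> E (max t m)" using bd[of "max t m"] by auto
    then have h: "t \<le> h" "\<not> E h" unfolding h_def by (metis (mono_tags, lifting) LeastI)+
    have hE: "E i" if "t \<le> i" "i < h" for i
      using that not_less_Least[of i "\<lambda>h. t \<le> h \<and> \<not> E h"] unfolding h_def by auto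
    show ?thesis
    proof (cases "\<exists>t1\<in>Z. l \<le> t1 \<and> t1 \<le> t")
      case False
      have "(\<Sum>i\<le>t. g i) = 0"
      proof (cases "l = 0")
        case True
        then show ?thesis using False g0 by (intro sum.neutral) auto
      next
        case nz: False
        have "(\<Sum>i\<le>t. g i) = (\<Sum>i\<le>l - 1. g i)"
        proof (rule sum.mono_neutral_right)
          show "\<forall>i\<in>{..t} - {..l - 1}. g i = 0"
          proof
            fix i assume "i \<in> {..t} - {..l - 1}"
            then have "l \<le> i" "i \<le> t" using nz by auto
            then show "g i = 0" using False g0 by blast
          qed
        qed (use l(2) in auto)
        then show ?thesis using pre[OF l_end] nz by simp
      qed
      then show ?thesis by (simp add: g_def)
    next
      case True
      then obtain t1 where t1: "t1 \<in> Z" "l \<le> t1" "t1 \<le> t" by blast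
      have "g i = 0" if "t < i" "i \<le> h" for i
      proof (rule g0)
        show "i \<notin> Z"
        proof
          assume "i \<in> Z"
          moreover have "\<forall>j. t1 \<le> j \<and> j < i \<longrightarrow> E j"
          proof (intro allI impI)
            fix j assume "t1 \<le> j \<and> j < i"
            then show "E j" using l(1)[of j] hE[of j] t1 that by (cases "j \<le> t") auto
          qed
          ultimately have "E' t" unfolding E'_def using t1 that by blast
          then show False using nE' by simp
        qed
      qed
      then have "(\<Sum>i\<le>h. g i) = (\<Sum>i\<le>t. g i)"
        using h(1) by (intro sum.mono_neutral_right) auto
      then show ?thesis using pre[OF h(2)] by (simp add: g_def)
    qed
  qed
qed

text \<open>A node that is not a cross-node but meets a retained segment has mesh edges on both
  sides in the direction of that segment. This cannot hold in both directions, so in one direction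
  the node is isolated in the CVR graph and its coefficient vanishes.\<close>

lemma coeff_space_cvr:
  assumes be: "bounded_edges M H V"
  shows "coeff_space r (cvr_h H V) (cvr_v H V) X Y UNIV UNIV UNIV =
    coeff_space r H V X Y (cross_nodes H V) UNIV UNIV"
proof (intro equalityI subsetI)
  fix c assume c: "c \<in> coeff_space r H V X Y (cross_nodes H V) UNIV UNIV"
  have c0: "c v = 0" if "v \<notin> cross_nodes H V" for v using c that by (cases v) (auto simp: coeff_space_def)
  have "moments r (\<lambda>a. cvr_h H V a b) X (\<lambda>a. c (a, b))" for b
  proof (rule moments_between[where Z = "{a. (a, b) \<in> cross_nodes H V}" and E = "\<lambda>a. H a b" and m = M])
    show "moments r (\<lambda>a. H a b) X (\<lambda>a. c (a, b))" using c by (simp add: coeff_space_def)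
  qed (use c0 be in \<open>auto simp: bounded_edges_def cvr_h_def\<close>)
  moreover have "moments r (cvr_v H V a) Y (\<lambda>b. c (a, b))" for a
  proof (rule moments_between[where Z = "{b. (a, b) \<in> cross_nodes H V}" and E = "V a" and m = M])
    show "moments r (V a) Y (\<lambda>b. c (a, b))" using c by (simp add: coeff_space_def)
  qed (use c0 be in \<open>auto simp: bounded_edges_def cvr_v_def\<close>)
  ultimately show "c \<in> coeff_space r (cvr_h H V) (cvr_v H V) X Y UNIV UNIV UNIV"
    by (simp add: coeff_space_def)
next
  fix c assume c: "c \<in> coeff_space r (cvr_h H V) (cvr_v H V) X Y UNIV UNIV UNIV"
  have row: "moments r (\<lambda>a. cvr_h H V a b) X (\<lambda>a. c (a, b))" for b using c by (simp add: coeff_space_def)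
  have col: "moments r (cvr_v H V a) Y (\<lambda>b. c (a, b))" for a using c by (simp add: coeff_space_def)
  have "c (a, b) = 0" if nc: "(a, b) \<notin> cross_nodes H V" for a b
  proof (cases "0 < a \<and> H (a - 1) b \<and> H a b")
    case False
    have "\<not> cvr_h H V a b"
    proof
      assume "cvr_h H V a b"
      then obtain a1 a2 where *: "a1 \<le> a" "a < a2" "(a1, b) \<in> cross_nodes H V" "\<forall>i. a1 \<le> i \<and> i < a2 \<longrightarrow> H i b"
        unfolding cvr_h_def by blast
      then have "a1 < a" using nc by (cases "a1 = a") auto
      then have "a1 \<le> a - 1" "a - 1 < a2" "0 < a" using *(2) by linarith+
      then have "H (a - 1) b" "H a b" "0 < a" using *(1,2,4) by blast+
      then show False using False by simp
    qed
    moreover have "a = 0 \<or> \<not> cvr_h H V (a - 1) b"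
    proof (rule ccontr)
      assume "\<not> ?thesis"
      then obtain a1 a2 where *: "0 < a" "a1 \<le> a - 1" "a - 1 < a2" "(a2, b) \<in> cross_nodes H V"
          "\<forall>i. a1 \<le> i \<and> i < a2 \<longrightarrow> H i b"
        unfolding cvr_h_def by blast
      then have "a < a2" using nc by (cases "a2 = a") auto
      moreover have "a1 \<le> a" using *(2) by linarith
      ultimately have "H (a - 1) b" "H a b" using *(2,3,5) by blast+
      then show False using False *(1) by simp
    qed
    ultimately show ?thesis by (rule moments_isolated[OF row])
  next
    case True
    then have False': "\<not> (0 < b \<and> V a (b - 1) \<and> V a b)" using nc by (auto simp: cross_nodes_def)
    have "\<not> cvr_v H V a b"
    proof
      assume "cvr_v H V a b"
      then obtain b1 b2 where *: "b1 \<le> b" "b < b2" "(a, b1) \<in> cross_nodes H V" "\<forall>j. b1 \<le> j \<and> j < b2 \<longrightarrow> V a j"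
        unfolding cvr_v_def by blast
      then have "b1 < b" using nc by (cases "b1 = b") auto
      then have "b1 \<le> b - 1" "b - 1 < b2" "0 < b" using *(2) by linarith+
      then have "V a (b - 1)" "V a b" "0 < b" using *(1,2,4) by blast+
      then show False using False' by simp
    qed
    moreover have "b = 0 \<or> \<not> cvr_v H V a (b - 1)"
    proof (rule ccontr)
      assume "\<not> ?thesis"
      then obtain b1 b2 where *: "0 < b" "b1 \<le> b - 1" "b - 1 < b2" "(a, b2) \<in> cross_nodes H V"
          "\<forall>j. b1 \<le> j \<and> j < b2 \<longrightarrow> V a j"
        unfolding cvr_v_def by blast
      then have "b < b2" using nc by (cases "b2 = b") auto
      moreover have "b1 \<le> b" using *(2) by linarith
      ultimately have "V a (b - 1)" "V a b" using *(2,3,5) by blast+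
      then show False using False' *(1) by simp
    qed
    ultimately show ?thesis by (rule moments_isolated[OF col])
  qed
  moreover have "moments r (\<lambda>a. H a b) X (\<lambda>a. c (a, b))" for b
    using row[of b] unfolding moments_def cvr_h_def by blast
  moreover have "moments r (V a) Y (\<lambda>b. c (a, b))" for a
    using col[of a] unfolding moments_def cvr_v_def by blast
  ultimately show "c \<in> coeff_space r H V X Y (cross_nodes H V) UNIV UNIV"
    by (auto simp: coeff_space_def)
qed


subsection \<open>Meshes of index rectangles\<close>

type_synonym index_rect = "nat \<times> nat \<times> nat \<times> nat"

text \<open>The rectangle \<open>(a1, a2, b1, b2)\<close> stands for the cell \<open>{X a1..X a2} \<times> {Y b1..Y b2}\<close>.\<close>

locale tiling =
  fixes X Y :: "nat \<Rightarrow> real" and M N :: nat and D :: "index_rect set"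
  assumes mono: "strict_mono X" "strict_mono Y"
    and unbounded: "\<And>x. \<exists>i. x < X i" "\<And>y. \<exists>j. y < Y j"
    and rect: "\<And>a1 a2 b1 b2. (a1, a2, b1, b2) \<in> D \<Longrightarrow> a1 < a2 \<and> a2 \<le> M \<and> b1 < b2 \<and> b2 \<le> N"
    and cover: "\<And>a b. a < M \<Longrightarrow> b < N \<Longrightarrow> \<exists>a1 a2 b1 b2. (a1, a2, b1, b2) \<in> D \<and> a1 \<le> a \<and> a < a2 \<and> b1 \<le> b \<and> b < b2"
    and unique: "\<And>a b a1 a2 b1 b2 a1' a2' b1' b2'.
      (a1, a2, b1, b2) \<in> D \<Longrightarrow> a1 \<le> a \<Longrightarrow> a < a2 \<Longrightarrow> b1 \<le> b \<Longrightarrow> b < b2 \<Longrightarrow>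
      (a1', a2', b1', b2') \<in> D \<Longrightarrow> a1' \<le> a \<Longrightarrow> a < a2' \<Longrightarrow> b1' \<le> b \<Longrightarrow> b < b2' \<Longrightarrow>
      (a1, a2, b1, b2) = (a1', a2', b1', b2')"
    and pos: "0 < M" "0 < N"
begin

definition H :: "nat \<Rightarrow> nat \<Rightarrow> bool" where
  "H a b \<longleftrightarrow> (\<exists>a1 a2 b1 b2. (a1, a2, b1, b2) \<in> D \<and> a1 \<le> a \<and> a < a2 \<and> (b = b1 \<or> b = b2))"

definition V :: "nat \<Rightarrow> nat \<Rightarrow> bool" where
  "V a b \<longleftrightarrow> (\<exists>a1 a2 b1 b2. (a1, a2, b1, b2) \<in> D \<and> b1 \<le> b \<and> b < b2 \<and> (a = a1 \<or> a = a2))"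

definition mesh :: mesh where
  "mesh = {cbox (X a1, Y b1) (X a2, Y b2) | a1 a2 b1 b2. (a1, a2, b1, b2) \<in> D}"

lemma swap: "tiling Y X N M {(b1, b2, a1, a2) | a1 a2 b1 b2. (a1, a2, b1, b2) \<in> D}"
proof unfold_locales
  fix b a assume "b < N" "a < M"
  then show "\<exists>b1 b2 a1 a2. (b1, b2, a1, a2) \<in> {(b1, b2, a1, a2) | a1 a2 b1 b2. (a1, a2, b1, b2) \<in> D} \<and>
      b1 \<le> b \<and> b < b2 \<and> a1 \<le> a \<and> a < a2" using cover[of a b] by blast
next
  fix b a b1 b2 a1 a2 b1' b2' a1' a2'
  assume "(b1, b2, a1, a2) \<in> {(b1, b2, a1, a2) | a1 a2 b1 b2. (a1, a2, b1, b2) \<in> D}"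
    "(b1', b2', a1', a2') \<in> {(b1, b2, a1, a2) | a1 a2 b1 b2. (a1, a2, b1, b2) \<in> D}"
    "b1 \<le> b" "b < b2" "a1 \<le> a" "a < a2" "b1' \<le> b" "b < b2'" "a1' \<le> a" "a < a2'"
  then show "(b1, b2, a1, a2) = (b1', b2', a1', a2')"
    using unique[of a1 a2 b1 b2 a b a1' a2' b1' b2'] by simp
qed (use mono unbounded rect pos in auto)

lemma swap_H: "tiling.H {(b1, b2, a1, a2) | a1 a2 b1 b2. (a1, a2, b1, b2) \<in> D} b a \<longleftrightarrow> V a b"
  by (auto simp: tiling.H_def[OF swap] V_def)

lemma grid_order:
  "X i < X j \<longleftrightarrow> i < j" "Y i < Y j \<longleftrightarrow> i < j" "X i \<le> X j \<longleftrightarrow> i \<le> j" "Y i \<le> Y j \<longleftrightarrow> i \<le> j"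
  "X i = X j \<longleftrightarrow> i = j" "Y i = Y j \<longleftrightarrow> i = j"
  using mono by (auto simp: strict_mono_less strict_mono_less_eq strict_mono_eq)

lemma H_bounded: "H a b \<Longrightarrow> a < M \<and> b \<le> N"
  unfolding H_def using rect by (meson less_le_trans less_imp_le_nat order_trans)

lemma V_bounded: "V a b \<Longrightarrow> a \<le> M \<and> b < N"
  unfolding V_def using rect by (meson less_le_trans less_imp_le_nat order_trans)

text \<open>The edge would be a side of a rectangle that covers the index cell just above or just
  below it. By uniqueness this is the given rectangle, of which \<open>b\<close> is not a
  side.\<close>

lemma H_not_inside:
  assumes "(a1, a2, b1, b2) \<in> D" "a1 \<le> a" "a < a2" "b1 < b" "b < b2" shows "\<not> H a b"
proof
  assume "H a b"
  then obtain i1 i2 j1 j2 where ij: "(i1, i2, j1, j2) \<in> D" "i1 \<le> a" "a < i2" "b = j1 \<or> b = j2"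
    unfolding H_def by blast
  from ij(4) have "(a1, a2, b1, b2) = (i1, i2, j1, j2)"
  proof
    assume "b = j1"
    then show ?thesis
      using rect[OF ij(1)] by (intro unique[OF assms(1-3) _ _ ij(1-3), of b]) (use assms(4,5) in auto)
  next
    assume "b = j2"
    then show ?thesis
      using rect[OF ij(1)] by (intro unique[OF assms(1-3) _ _ ij(1-3), of "b - 1"]) (use assms(4,5) in auto)
  qed
  then show False using ij(4) assms(4,5) by auto
qed

lemma V_not_inside:
  assumes "(a1, a2, b1, b2) \<in> D" "a1 < a" "a < a2" "b1 \<le> b" "b < b2" shows "\<not> V a b"
  using tiling.H_not_inside[OF swap, of b1 b2 a1 a2 b a] assms unfolding swap_H by blast

lemma H_boundary:
  assumes "a < M" shows "H a 0" "H a N"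
proof -
  obtain a1 a2 b1 b2 where *: "(a1, a2, b1, b2) \<in> D" "a1 \<le> a" "a < a2" "b1 \<le> 0" using cover[OF assms pos(2)] by blast
  then show "H a 0" unfolding H_def by auto
  obtain a1 a2 b1 b2 where *: "(a1, a2, b1, b2) \<in> D" "a1 \<le> a" "a < a2" "N - 1 < b2"
    using cover[OF assms, of "N - 1"] pos by auto
  moreover have "b2 = N" using rect[OF *(1)] *(4) by auto
  ultimately show "H a N" unfolding H_def by blast
qed

lemma V_boundary:
  assumes "b < N" shows "V 0 b" "V M b"
  using tiling.H_boundary[OF swap assms] unfolding swap_H by auto

lemma X_cell: "X 0 \<le> x \<Longrightarrow> x \<le> X m \<Longrightarrow> 0 < m \<Longrightarrow> \<exists>a<m. X a \<le> x \<and> x \<le> X (Suc a)"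
proof (induction m)
  case (Suc m)
  show ?case
  proof (cases "x \<le> X m \<and> 0 < m")
    case True
    then show ?thesis using Suc by (meson less_SucI)
  next
    case False
    then show ?thesis using Suc.prems by (intro exI[of _ m]) auto
  qed
qed simp

lemma Y_cell: "Y 0 \<le> y \<Longrightarrow> y \<le> Y n \<Longrightarrow> 0 < n \<Longrightarrow> \<exists>b<n. Y b \<le> y \<and> y \<le> Y (Suc b)"
  using tiling.X_cell[OF swap] .

lemma point_rect:
  assumes "X 0 \<le> x" "x \<le> X M" "Y 0 \<le> y" "y \<le> Y N"
  shows "\<exists>a b a1 a2 b1 b2. (a1, a2, b1, b2) \<in> D \<and> a1 \<le> a \<and> a < a2 \<and> b1 \<le> b \<and> b < b2 \<and>
    X a \<le> x \<and> x \<le> X (Suc a) \<and> Y b \<le> y \<and> y \<le> Y (Suc b)"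
proof -
  obtain a where a: "a < M" "X a \<le> x" "x \<le> X (Suc a)" using X_cell[OF assms(1,2) pos(1)] by blast
  obtain b where b: "b < N" "Y b \<le> y" "y \<le> Y (Suc b)" using Y_cell[OF assms(3,4) pos(2)] by blast
  then show ?thesis using cover[OF a(1) b(1)] a b by blast
qed

lemma Union_mesh: "\<Union>mesh = cbox (X 0, Y 0) (X M, Y N)"
proof (intro equalityI subsetI)
  fix p assume "p \<in> \<Union>mesh"
  then obtain a1 a2 b1 b2 where *: "(a1, a2, b1, b2) \<in> D" "p \<in> cbox (X a1, Y b1) (X a2, Y b2)"
    unfolding mesh_def by blast
  have "X 0 \<le> X a1" "X a2 \<le> X M" "Y 0 \<le> Y b1" "Y b2 \<le> Y N" using rect[OF *(1)] by (auto simp: grid_order)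
  then show "p \<in> cbox (X 0, Y 0) (X M, Y N)" using *(2) by (auto simp: cbox_Pair_eq)
next
  fix p assume "p \<in> cbox (X 0, Y 0) (X M, Y N)"
  then obtain x y where p: "p = (x, y)" "X 0 \<le> x" "x \<le> X M" "Y 0 \<le> y" "y \<le> Y N" by (cases p) (auto simp: cbox_Pair_eq)
  obtain a b a1 a2 b1 b2 where *: "(a1, a2, b1, b2) \<in> D" "a1 \<le> a" "a < a2" "b1 \<le> b" "b < b2"
    "X a \<le> x" "x \<le> X (Suc a)" "Y b \<le> y" "y \<le> Y (Suc b)" using point_rect[OF p(2-5)] by blast
  have "X a1 \<le> X a" "X (Suc a) \<le> X a2" "Y b1 \<le> Y b" "Y (Suc b) \<le> Y b2" using * by (auto simp: grid_order)
  then have "p \<in> cbox (X a1, Y b1) (X a2, Y b2)" using * p by (auto simp: cbox_Pair_eq)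
  then show "p \<in> \<Union>mesh" using *(1) unfolding mesh_def by blast
qed

lemma box_Pair: "(x, y) \<in> box (a, c) (b, d) \<longleftrightarrow> a < x \<and> x < b \<and> c < y \<and> y < (d :: real)" for a b :: real
  by (auto simp: mem_box Basis_prod_def)

lemma mesh_splines_dim:
  "fun_space.dim (mesh_splines e mesh) = fun_space.dim (coeff_space e H V X Y UNIV UNIV UNIV)"
proof -
  have int: "interior ` mesh = {box (X a1, Y b1) (X a2, Y b2) | a1 a2 b1 b2. (a1, a2, b1, b2) \<in> D}"
  proof -
    have "interior ` mesh = {interior (cbox (X a1, Y b1) (X a2, Y b2)) | a1 a2 b1 b2. (a1, a2, b1, b2) \<in> D}"
      unfolding mesh_def by blast
    then show ?thesis by (simp add: interior_cbox)
  qed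
  have inside: "a1 \<le> a \<and> a < a2" if "X a1 < x" "x < X a2" "X a \<le> x" "x \<le> X (Suc a)" for a1 a2 a x
  proof -
    have "X a1 < X (Suc a)" "X a < X a2" using that by linarith+
    then show ?thesis by (auto simp: grid_order)
  qed
  have inside': "b1 \<le> b \<and> b < b2" if "Y b1 < y" "y < Y b2" "Y b \<le> y" "y \<le> Y (Suc b)" for b1 b2 b y
  proof -
    have "Y b1 < Y (Suc b)" "Y b < Y b2" using that by linarith+
    then show ?thesis by (auto simp: grid_order)
  qed
  interpret S: spline_mesh e X Y H V 0 M 0 N "\<Union>mesh" "interior ` mesh"
  proof unfold_locales
    show "H a 0 \<and> H a N" if "a < M" for a using H_boundary[OF that] by simp
    show "V 0 b \<and> V M b" if "b < N" for b using V_boundary[OF that] by simp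
    show "\<Union>mesh = cbox (X 0, Y 0) (X M, Y N)" by (rule Union_mesh)
    fix K assume "K \<in> interior ` mesh"
    then obtain a1 a2 b1 b2 where K: "K = box (X a1, Y b1) (X a2, Y b2)" "(a1, a2, b1, b2) \<in> D"
      unfolding int by blast
    show "connected K" unfolding K by (simp add: convex_connected)
    have "X 0 \<le> X a1" "X a2 \<le> X M" "Y 0 \<le> Y b1" "Y b2 \<le> Y N" using rect[OF K(2)] by (auto simp: grid_order)
    then show "K \<subseteq> box (X 0, Y 0) (X M, Y N)" unfolding K by (auto simp: box_Pair)
    show "\<not> H a b" if "(x, Y b) \<in> K" "X a \<le> x" "x \<le> X (Suc a)" for x a b
      using that K inside[of a1 x a2 a] H_not_inside[OF K(2), of a b] by (auto simp: box_Pair grid_order)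
    show "\<not> V a b" if "(X a, y) \<in> K" "Y b \<le> y" "y \<le> Y (Suc b)" for y a b
      using that K inside'[of b1 y b2 b] V_not_inside[OF K(2), of a b] by (auto simp: box_Pair grid_order)
    show "{X a<..<X (Suc a)} \<times> {Y b<..<Y (Suc b)} \<subseteq> K"
      if "(x, y) \<in> K" "X a \<le> x" "x \<le> X (Suc a)" "Y b \<le> y" "y \<le> Y (Suc b)" for x y a b
    proof -
      have "a1 \<le> a \<and> a < a2" "b1 \<le> b \<and> b < b2"
        using that inside[of a1 x a2 a] inside'[of b1 y b2 b] by (auto simp: K box_Pair)
      then have "X a1 \<le> X a" "X (Suc a) \<le> X a2" "Y b1 \<le> Y b" "Y (Suc b) \<le> Y b2" by (auto simp: grid_order)
      then show ?thesis by (auto simp: K box_Pair)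
    qed
  next
    fix x y
    assume p: "(x, y) \<in> \<Union>mesh"
      and nH: "\<And>a b. y = Y b \<Longrightarrow> X a \<le> x \<Longrightarrow> x \<le> X (Suc a) \<Longrightarrow> \<not> H a b"
      and nV: "\<And>a b. x = X a \<Longrightarrow> Y b \<le> y \<Longrightarrow> y \<le> Y (Suc b) \<Longrightarrow> \<not> V a b"
    then obtain a b a1 a2 b1 b2 where *: "(a1, a2, b1, b2) \<in> D" "a1 \<le> a" "a < a2" "b1 \<le> b" "b < b2"
      "X a \<le> x" "x \<le> X (Suc a)" "Y b \<le> y" "y \<le> Y (Suc b)"
      using point_rect[of x y] unfolding Union_mesh cbox_Pair_eq by auto
    have "X a1 \<le> X a" "X (Suc a) \<le> X a2" "Y b1 \<le> Y b" "Y (Suc b) \<le> Y b2" using * by (auto simp: grid_order)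
    moreover have "H a b1" "H a b2" "V a1 b" "V a2 b" using * unfolding H_def V_def by blast+
    then have "y \<noteq> Y b1" "y \<noteq> Y b2" "x \<noteq> X a1" "x \<noteq> X a2" using nH nV * by blast+
    ultimately have "(x, y) \<in> box (X a1, Y b1) (X a2, Y b2)" using * by (auto simp: box_Pair)
    then show "\<exists>K\<in>interior ` mesh. (x, y) \<in> K" unfolding int using *(1) by blast
  qed (use mono unbounded H_bounded V_bounded in auto)
  show ?thesis unfolding mesh_splines_def by (rule S.dim_homogeneous_splines)
qed

end


subsection \<open>Vertices and edges of a tiling\<close>

definition h_seg :: "real \<Rightarrow> real \<Rightarrow> real \<Rightarrow> (real \<times> real) set" where "h_seg x1 x2 y = {x1..x2} \<times> {y}"
definition v_seg :: "real \<Rightarrow> real \<Rightarrow> real \<Rightarrow> (real \<times> real) set" where "v_seg x y1 y2 = {x} \<times> {y1..y2}"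

lemma closed_segment_h: "x1 \<le> x2 \<Longrightarrow> closed_segment (x1, y) (x2, y) = h_seg x1 x2 y"
proof -
  assume "x1 \<le> x2"
  then have "{x1..x2} = closed_segment x1 x2" by (simp add: closed_segment_eq_real_ivl)
  then show ?thesis
    unfolding h_seg_def closed_segment_def by (auto simp: algebra_simps)
qed

lemma closed_segment_v: "y1 \<le> y2 \<Longrightarrow> closed_segment (x, y1) (x, y2) = v_seg x y1 y2"
proof -
  assume "y1 \<le> y2"
  then have "{y1..y2} = closed_segment y1 y2" by (simp add: closed_segment_eq_real_ivl)
  then show ?thesis
    unfolding v_seg_def closed_segment_def by (auto simp: algebra_simps)
qed

lemma open_segment_h: "x1 \<le> x2 \<Longrightarrow> open_segment (x1, y) (x2, y) = {x1<..<x2} \<times> {y}" for x1 x2 y :: real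
  unfolding open_segment_def by (subst closed_segment_h) (auto simp: h_seg_def less_le)

lemma open_segment_v: "y1 \<le> y2 \<Longrightarrow> open_segment (x, y1) (x, y2) = {x} \<times> {y1<..<y2}" for x y1 y2 :: real
  unfolding open_segment_def by (subst closed_segment_v) (auto simp: v_seg_def less_le)

text \<open>At most one edge leaves a vertex in each of the four directions, so there are four edges
  exactly when every direction has one.\<close>

lemma card_four_rays:
  assumes "\<And>E E'. E \<in> A \<Longrightarrow> E' \<in> A \<Longrightarrow> E = E'" "\<And>E E'. E \<in> B \<Longrightarrow> E' \<in> B \<Longrightarrow> E = E'"
    "\<And>E E'. E \<in> C \<Longrightarrow> E' \<in> C \<Longrightarrow> E = E'" "\<And>E E'. E \<in> D \<Longrightarrow> E' \<in> D \<Longrightarrow> E = E'"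
    and "A \<inter> B = {}" "A \<inter> C = {}" "A \<inter> D = {}" "B \<inter> C = {}" "B \<inter> D = {}" "C \<inter> D = {}"
  shows "card (A \<union> B \<union> C \<union> D) = 4 \<longleftrightarrow> A \<noteq> {} \<and> B \<noteq> {} \<and> C \<noteq> {} \<and> D \<noteq> {}"
proof -
  have c: "finite S \<and> card S = of_bool (S \<noteq> {})" if "\<And>E E'. E \<in> S \<Longrightarrow> E' \<in> S \<Longrightarrow> E = E'" for S :: "'a set"
  proof (cases "S = {}")
    case False
    then obtain E where "E \<in> S" by auto
    then have "S = {E}" using that by auto
    then show ?thesis by simp
  qed simp
  note cs = c[OF assms(1)] c[OF assms(2)] c[OF assms(3)] c[OF assms(4)]
  have "card (A \<union> B \<union> C \<union> D) = card A + card B + card C + card D"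
    using cs assms(5-10) by (simp add: card_Un_disjoint Int_Un_distrib2)
  then show ?thesis using cs by (auto simp: of_bool_def split: if_splits)
qed

context tiling begin

definition corners :: "(nat \<times> nat) set" where
  "corners = {(a, b). \<exists>a1 a2 b1 b2. (a1, a2, b1, b2) \<in> D \<and> (a = a1 \<or> a = a2) \<and> (b = b1 \<or> b = b2)}"

definition h_edge :: "nat \<Rightarrow> nat \<Rightarrow> nat \<Rightarrow> bool" where
  "h_edge a a' b \<longleftrightarrow> a < a' \<and> (a, b) \<in> corners \<and> (a', b) \<in> corners \<and> (\<forall>i. a < i \<and> i < a' \<longrightarrow> (i, b) \<notin> corners) \<and>
     (\<exists>a1 a2 b1 b2. (a1, a2, b1, b2) \<in> D \<and> a1 \<le> a \<and> a' \<le> a2 \<and> (b = b1 \<or> b = b2))"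

definition v_edge :: "nat \<Rightarrow> nat \<Rightarrow> nat \<Rightarrow> bool" where
  "v_edge a b b' \<longleftrightarrow> b < b' \<and> (a, b) \<in> corners \<and> (a, b') \<in> corners \<and> (\<forall>j. b < j \<and> j < b' \<longrightarrow> (a, j) \<notin> corners) \<and>
     (\<exists>a1 a2 b1 b2. (a1, a2, b1, b2) \<in> D \<and> b1 \<le> b \<and> b' \<le> b2 \<and> (a = a1 \<or> a = a2))"

lemma swap_corners: "(b, a) \<in> tiling.corners {(b1, b2, a1, a2) | a1 a2 b1 b2. (a1, a2, b1, b2) \<in> D} \<longleftrightarrow> (a, b) \<in> corners"
  unfolding tiling.corners_def[OF swap] corners_def by auto

lemma swap_h_edge: "tiling.h_edge {(b1, b2, a1, a2) | a1 a2 b1 b2. (a1, a2, b1, b2) \<in> D} b b' a \<longleftrightarrow> v_edge a b b'"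
  unfolding tiling.h_edge_def[OF swap] v_edge_def swap_corners by auto

text \<open>The ends are the nearest corners on either side of \<open>i\<close>. The corners of the
  rectangle carrying the edge bound the search, so the result stays within a side of this
  rectangle.\<close>

lemma h_edge_cover:
  assumes "H i b" shows "\<exists>a a'. a \<le> i \<and> i < a' \<and> h_edge a a' b"
proof -
  obtain a1 a2 b1 b2 where *: "(a1, a2, b1, b2) \<in> D" "a1 \<le> i" "i < a2" "b = b1 \<or> b = b2"
    using assms unfolding H_def by blast
  have corner: "(a1, b) \<in> corners" "(a2, b) \<in> corners" using * unfolding corners_def by blast+
  define a where "a = (GREATEST k. k \<le> i \<and> (k, b) \<in> corners)"
  have a: "a \<le> i \<and> (a, b) \<in> corners" "a1 \<le> a"
    unfolding a_def
     using GreatestI_nat[of "\<lambda>k. k \<le> i \<and> (k, b) \<in> corners" a1 i]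
      Greatest_le_nat[of "\<lambda>k. k \<le> i \<and> (k, b) \<in> corners" a1 i] corner *(2) by simp_all
  have a_max: "k \<le> a" if "k \<le> i" "(k, b) \<in> corners" for k
    unfolding a_def using Greatest_le_nat[of "\<lambda>k. k \<le> i \<and> (k, b) \<in> corners" k i] that by simp
  define a' where "a' = (LEAST k. i < k \<and> (k, b) \<in> corners)"
  have a': "i < a' \<and> (a', b) \<in> corners" unfolding a'_def
    using LeastI[of "\<lambda>k. i < k \<and> (k, b) \<in> corners" a2] corner *(3) by simp
  have a'_min: "a' \<le> k" if "i < k" "(k, b) \<in> corners" for k
    unfolding a'_def using Least_le[of "\<lambda>k. i < k \<and> (k, b) \<in> corners" k] that by simp
  have "(k, b) \<notin> corners" if "a < k" "k < a'" for k
    using a_max[of k] a'_min[of k] that by (cases "k \<le> i") auto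
  then have "h_edge a a' b"
    unfolding h_edge_def using a(1) a' le_trans[of a i] a(2) a'_min[OF *(3) corner(2)] *(1,4)
    by (metis le_less_trans)
  then show ?thesis using a a' by blast
qed

lemma h_edge_H: "h_edge a a' b \<Longrightarrow> a \<le> i \<Longrightarrow> i < a' \<Longrightarrow> H i b"
  unfolding h_edge_def H_def using le_trans less_le_trans by blast

lemma v_edge_cover: "V a j \<Longrightarrow> \<exists>b b'. b \<le> j \<and> j < b' \<and> v_edge a b b'"
  using tiling.h_edge_cover[OF swap] unfolding swap_H swap_h_edge .

lemma v_edge_V: "v_edge a b b' \<Longrightarrow> b \<le> j \<Longrightarrow> j < b' \<Longrightarrow> V a j"
  using tiling.h_edge_H[OF swap] unfolding swap_H swap_h_edge .

lemma h_edge_right: "(a, b) \<in> corners \<Longrightarrow> (\<exists>a'. h_edge a a' b) \<longleftrightarrow> H a b"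
proof
  assume c: "(a, b) \<in> corners" and "H a b"
  then obtain k a' where "k \<le> a" "a < a'" "h_edge k a' b" using h_edge_cover by blast
  then have "k = a" using c unfolding h_edge_def by (metis le_neq_implies_less)
  then show "\<exists>a'. h_edge a a' b" using \<open>h_edge k a' b\<close> by blast
next
  assume "\<exists>a'. h_edge a a' b"
  then obtain a' where "h_edge a a' b" by blast
  then show "H a b" by (rule h_edge_H) (use \<open>h_edge a a' b\<close> in \<open>auto simp: h_edge_def\<close>)
qed

lemma h_edge_left: "(a, b) \<in> corners \<Longrightarrow> (\<exists>k. h_edge k a b) \<longleftrightarrow> 0 < a \<and> H (a - 1) b"
proof
  assume c: "(a, b) \<in> corners" and a: "0 < a \<and> H (a - 1) b"
  then obtain k a' where k: "k \<le> a - 1" "a - 1 < a'" "h_edge k a' b" using h_edge_cover by blast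
  then have "\<not> a < a'" using c a unfolding h_edge_def by auto
  then have "a' = a" using k(2) by simp
  then show "\<exists>k. h_edge k a b" using k by blast
next
  assume "\<exists>k. h_edge k a b"
  then obtain k where k: "h_edge k a b" by blast
  then have "k < a" by (simp add: h_edge_def)
  then show "0 < a \<and> H (a - 1) b" using h_edge_H[OF k, of "a - 1"] by auto
qed

lemma h_edge_unique:
  "h_edge a a' b \<Longrightarrow> h_edge a a'' b \<Longrightarrow> a' = a''" "h_edge a' a b \<Longrightarrow> h_edge a'' a b \<Longrightarrow> a' = a''"
  unfolding h_edge_def by (metis linorder_neqE_nat)+

lemmas v_edge_up = tiling.h_edge_right[OF swap, unfolded swap_corners swap_h_edge swap_H]
lemmas v_edge_down = tiling.h_edge_left[OF swap, unfolded swap_corners swap_h_edge swap_H]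
lemmas v_edge_unique = tiling.h_edge_unique[OF swap, unfolded swap_h_edge]

lemma mesh_vertices: "mesh_vertices mesh = {(X a, Y b) | a b. (a, b) \<in> corners}"
proof (intro equalityI subsetI)
  fix v assume "v \<in> mesh_vertices mesh"
  then obtain a b c d where v: "a < b" "c < d" "cbox (a, c) (b, d) \<in> mesh" "v \<in> {a, b} \<times> {c, d}"
    unfolding mesh_vertices_def by blast
  then obtain a1 a2 b1 b2 where *: "(a1, a2, b1, b2) \<in> D" "cbox (a, c) (b, d) = cbox (X a1, Y b1) (X a2, Y b2)"
    unfolding mesh_def by blast
  have "a = X a1 \<and> b = X a2 \<and> c = Y b1 \<and> d = Y b2"
  proof -
    have "cbox (a, c) (b, d) \<noteq> {}" using v(1,2) by (auto simp: cbox_Pair_eq)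
    then show ?thesis using *(2) unfolding eq_cbox by auto
  qed
  then show "v \<in> {(X a, Y b) | a b. (a, b) \<in> corners}" using v(4) *(1) unfolding corners_def by blast
next
  fix v assume "v \<in> {(X a, Y b) | a b. (a, b) \<in> corners}"
  then obtain a b a1 a2 b1 b2 where *: "v = (X a, Y b)" "(a1, a2, b1, b2) \<in> D" "a = a1 \<or> a = a2" "b = b1 \<or> b = b2"
    unfolding corners_def by blast
  have "X a1 < X a2" "Y b1 < Y b2" using rect[OF *(2)] by (auto simp: grid_order)
  moreover have "cbox (X a1, Y b1) (X a2, Y b2) \<in> mesh" using *(2) unfolding mesh_def by blast
  moreover have "v \<in> {X a1, X a2} \<times> {Y b1, Y b2}" using * by auto
  ultimately show "v \<in> mesh_vertices mesh" unfolding mesh_vertices_def by blast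
qed

lemma mem_frontier:
  "(x, y) \<in> frontier (cbox (X a1, Y b1) (X a2, Y b2)) \<longleftrightarrow>
    X a1 \<le> x \<and> x \<le> X a2 \<and> Y b1 \<le> y \<and> y \<le> Y b2 \<and> \<not> (X a1 < x \<and> x < X a2 \<and> Y b1 < y \<and> y < Y b2)"
  unfolding frontier_cbox by (simp add: box_Pair cbox_Pair_eq)

lemma h_seg_in_edges:
  assumes "h_edge a a' b" shows "h_seg (X a) (X a') (Y b) \<in> mesh_edges mesh"
proof -
  obtain a1 a2 b1 b2 where *: "(a1, a2, b1, b2) \<in> D" "a1 \<le> a" "a' \<le> a2" "b = b1 \<or> b = b2"
    using assms unfolding h_edge_def by blast
  have e: "a < a'" "(a, b) \<in> corners" "(a', b) \<in> corners" "\<forall>i. a < i \<and> i < a' \<longrightarrow> (i, b) \<notin> corners"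
    using assms unfolding h_edge_def by blast+
  have "X a < X a'" "X a1 \<le> X a" "X a' \<le> X a2" "Y b1 \<le> Y b" "Y b \<le> Y b2"
    using e * rect[OF *(1)] by (auto simp: grid_order)
  then have "closed_segment (X a, Y b) (X a', Y b) \<subseteq> frontier (cbox (X a1, Y b1) (X a2, Y b2))"
    using *(4) by (auto simp: closed_segment_h h_seg_def mem_frontier)
  moreover have "cbox (X a1, Y b1) (X a2, Y b2) \<in> mesh" using *(1) unfolding mesh_def by blast
  moreover have "open_segment (X a, Y b) (X a', Y b) \<inter> mesh_vertices mesh = {}"
    using e \<open>X a < X a'\<close> by (auto simp: open_segment_h mesh_vertices grid_order)
  moreover have "(X a, Y b) \<in> mesh_vertices mesh" "(X a', Y b) \<in> mesh_vertices mesh" "(X a, Y b) \<noteq> (X a', Y b)"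
    using e by (auto simp: mesh_vertices grid_order)
  ultimately have "closed_segment (X a, Y b) (X a', Y b) \<in> mesh_edges mesh"
    unfolding mesh_edges_def by blast
  then show ?thesis using \<open>X a < X a'\<close> by (simp add: closed_segment_h)
qed

lemma v_seg_in_edges:
  assumes "v_edge a b b'" shows "v_seg (X a) (Y b) (Y b') \<in> mesh_edges mesh"
proof -
  obtain a1 a2 b1 b2 where *: "(a1, a2, b1, b2) \<in> D" "b1 \<le> b" "b' \<le> b2" "a = a1 \<or> a = a2"
    using assms unfolding v_edge_def by blast
  have e: "b < b'" "(a, b) \<in> corners" "(a, b') \<in> corners" "\<forall>j. b < j \<and> j < b' \<longrightarrow> (a, j) \<notin> corners"
    using assms unfolding v_edge_def by blast+
  have "Y b < Y b'" "X a1 \<le> X a" "X a \<le> X a2" "Y b1 \<le> Y b" "Y b' \<le> Y b2"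
    using e * rect[OF *(1)] by (auto simp: grid_order)
  then have "closed_segment (X a, Y b) (X a, Y b') \<subseteq> frontier (cbox (X a1, Y b1) (X a2, Y b2))"
    using *(4) by (auto simp: closed_segment_v v_seg_def mem_frontier)
  moreover have "cbox (X a1, Y b1) (X a2, Y b2) \<in> mesh" using *(1) unfolding mesh_def by blast
  moreover have "open_segment (X a, Y b) (X a, Y b') \<inter> mesh_vertices mesh = {}"
    using e \<open>Y b < Y b'\<close> by (auto simp: open_segment_v mesh_vertices grid_order)
  moreover have "(X a, Y b) \<in> mesh_vertices mesh" "(X a, Y b') \<in> mesh_vertices mesh" "(X a, Y b) \<noteq> (X a, Y b')"
    using e by (auto simp: mesh_vertices grid_order)
  ultimately have "closed_segment (X a, Y b) (X a, Y b') \<in> mesh_edges mesh"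
    unfolding mesh_edges_def by blast
  then show ?thesis using \<open>Y b < Y b'\<close> by (simp add: closed_segment_v)
qed

lemma edge_h_edge:
  assumes ab: "(a, b) \<in> corners" "(a', b) \<in> corners" "a < a'"
    and op: "open_segment (X a, Y b) (X a', Y b) \<inter> mesh_vertices mesh = {}"
    and K: "K \<in> mesh" "closed_segment (X a, Y b) (X a', Y b) \<subseteq> frontier K"
  shows "h_edge a a' b"
proof -
  obtain a1 a2 b1 b2 where *: "(a1, a2, b1, b2) \<in> D" "K = cbox (X a1, Y b1) (X a2, Y b2)"
    using K(1) unfolding mesh_def by blast
  have X: "X a < X a'" using ab by (simp add: grid_order)
  have m: "(X a, Y b) \<in> frontier K" "(X a', Y b) \<in> frontier K" "((X a + X a') / 2, Y b) \<in> frontier K"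
    using K(2) X by (auto simp: closed_segment_h h_seg_def)
  then have le: "X a1 \<le> X a" "X a' \<le> X a2" "Y b1 \<le> Y b" "Y b \<le> Y b2" unfolding * mem_frontier by auto
  then have "X a1 < (X a + X a') / 2" "(X a + X a') / 2 < X a2" using X by (simp_all add: field_simps)
  then have "\<not> (Y b1 < Y b \<and> Y b < Y b2)" using m(3) unfolding * mem_frontier by auto
  then have "b = b1 \<or> b = b2" using le by (auto simp: grid_order)
  moreover have "a1 \<le> a" "a' \<le> a2" using le by (simp_all add: grid_order)
  moreover have "(i, b) \<notin> corners" if "a < i" "i < a'" for i
  proof
    assume "(i, b) \<in> corners"
    then have "(X i, Y b) \<in> open_segment (X a, Y b) (X a', Y b) \<inter> mesh_vertices mesh"
      using that X by (auto simp: open_segment_h mesh_vertices grid_order)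
    then show False using op by simp
  qed
  ultimately show ?thesis unfolding h_edge_def using ab *(1) by blast
qed

lemma edge_v_edge:
  assumes ab: "(a, b) \<in> corners" "(a, b') \<in> corners" "b < b'"
    and op: "open_segment (X a, Y b) (X a, Y b') \<inter> mesh_vertices mesh = {}"
    and K: "K \<in> mesh" "closed_segment (X a, Y b) (X a, Y b') \<subseteq> frontier K"
  shows "v_edge a b b'"
proof -
  obtain a1 a2 b1 b2 where *: "(a1, a2, b1, b2) \<in> D" "K = cbox (X a1, Y b1) (X a2, Y b2)"
    using K(1) unfolding mesh_def by blast
  have X: "Y b < Y b'" using ab by (simp add: grid_order)
  have m: "(X a, Y b) \<in> frontier K" "(X a, Y b') \<in> frontier K" "(X a, (Y b + Y b') / 2) \<in> frontier K"
    using K(2) X by (auto simp: closed_segment_v v_seg_def)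
  then have le: "X a1 \<le> X a" "X a \<le> X a2" "Y b1 \<le> Y b" "Y b' \<le> Y b2" unfolding * mem_frontier by auto
  then have "Y b1 < (Y b + Y b') / 2" "(Y b + Y b') / 2 < Y b2" using X by (simp_all add: field_simps)
  then have "\<not> (X a1 < X a \<and> X a < X a2)" using m(3) unfolding * mem_frontier by auto
  then have "a = a1 \<or> a = a2" using le by (auto simp: grid_order)
  moreover have "b1 \<le> b" "b' \<le> b2" using le by (simp_all add: grid_order)
  moreover have "(a, j) \<notin> corners" if "b < j" "j < b'" for j
  proof
    assume "(a, j) \<in> corners"
    then have "(X a, Y j) \<in> open_segment (X a, Y b) (X a, Y b') \<inter> mesh_vertices mesh"
      using that X by (auto simp: open_segment_v mesh_vertices grid_order)
    then show False using op by simp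
  qed
  ultimately show ?thesis unfolding v_edge_def using ab *(1) by blast
qed

lemma mesh_edges:
  "mesh_edges mesh = {h_seg (X a) (X a') (Y b) | a a' b. h_edge a a' b} \<union> {v_seg (X a) (Y b) (Y b') | a b b'. v_edge a b b'}"
    (is "_ = ?R")
proof (intro equalityI subsetI)
  fix E assume "E \<in> mesh_edges mesh"
  then obtain p q K where E: "E = closed_segment p q" "p \<in> mesh_vertices mesh" "q \<in> mesh_vertices mesh" "p \<noteq> q"
    "open_segment p q \<inter> mesh_vertices mesh = {}" "K \<in> mesh" "closed_segment p q \<subseteq> frontier K"
    unfolding mesh_edges_def by blast
  obtain a b a' b' where pq: "p = (X a, Y b)" "(a, b) \<in> corners" "q = (X a', Y b')" "(a', b') \<in> corners"
    using E(2,3) unfolding mesh_vertices by blast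
  \<comment> \<open>An edge lies in the frontier of one cell, but the midpoint of an oblique segment
    between points of the cell is interior to it.\<close>
  have "a = a' \<or> b = b'"
  proof (rule ccontr)
    assume ne: "\<not> (a = a' \<or> b = b')"
    obtain a1 a2 b1 b2 where K: "K = cbox (X a1, Y b1) (X a2, Y b2)" using E(6) unfolding mesh_def by blast
    have "p \<in> frontier K" "q \<in> frontier K" "midpoint p q \<in> frontier K"
      using E(7) by (auto simp: midpoint_in_closed_segment)
    then have "(X a, Y b) \<in> frontier K" "(X a', Y b') \<in> frontier K" "((X a + X a') / 2, (Y b + Y b') / 2) \<in> frontier K"
      by (simp_all add: pq midpoint_def)
    then have "X a1 \<le> X a" "X a \<le> X a2" "X a1 \<le> X a'" "X a' \<le> X a2" "Y b1 \<le> Y b" "Y b \<le> Y b2" "Y b1 \<le> Y b'" "Y b' \<le> Y b2"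
      "\<not> (X a1 < (X a + X a') / 2 \<and> (X a + X a') / 2 < X a2 \<and> Y b1 < (Y b + Y b') / 2 \<and> (Y b + Y b') / 2 < Y b2)"
      unfolding K mem_frontier by blast+
    moreover have "X a \<noteq> X a'" "Y b \<noteq> Y b'" using ne by (auto simp: grid_order)
    ultimately show False by (simp add: field_simps)
  qed
  then consider "b = b'" "a < a'" | "b = b'" "a' < a" | "a = a'" "b < b'" | "a = a'" "b' < b"
    using E(4) pq by (metis linorder_neqE_nat)
  then show "E \<in> ?R"
  proof cases
    case 1
    then have "h_edge a a' b" using edge_h_edge[of a b a' K] E pq by simp
    moreover have "E = h_seg (X a) (X a') (Y b)" using 1 E(1) pq by (simp add: closed_segment_h grid_order)
    ultimately show ?thesis by blast
  next
    case 2
    then have "h_edge a' a b" using edge_h_edge[of a' b a K] E pq by (simp add: closed_segment_commute open_segment_commute)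
    moreover have "E = h_seg (X a') (X a) (Y b)"
      using 2 E(1) pq closed_segment_h[of "X a'" "X a" "Y b"] by (simp add: closed_segment_commute[of p q] grid_order closed_segment_commute[of "(X a, Y b')"])
    ultimately show ?thesis by blast
  next
    case 3
    then have "v_edge a b b'" using edge_v_edge[of a b b' K] E pq by simp
    moreover have "E = v_seg (X a) (Y b) (Y b')" using 3 E(1) pq by (simp add: closed_segment_v grid_order)
    ultimately show ?thesis by blast
  next
    case 4
    then have "v_edge a b' b" using edge_v_edge[of a b' b K] E pq by (simp add: closed_segment_commute open_segment_commute)
    moreover have "E = v_seg (X a) (Y b') (Y b)"
      using 4 E(1) pq closed_segment_v[of "Y b'" "Y b" "X a"] by (simp add: closed_segment_commute[of p q] grid_order closed_segment_commute[of "(X a', Y b)"])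
    ultimately show ?thesis by blast
  qed
qed (use h_seg_in_edges v_seg_in_edges in blast)

lemma edges_at_corner:
  assumes c: "(a, b) \<in> corners"
  shows "{E \<in> mesh_edges mesh. (X a, Y b) \<in> E} =
    {h_seg (X a) (X a') (Y b) | a'. h_edge a a' b} \<union> {h_seg (X k) (X a) (Y b) | k. h_edge k a b} \<union>
    {v_seg (X a) (Y b) (Y b') | b'. v_edge a b b'} \<union> {v_seg (X a) (Y k) (Y b) | k. v_edge a k b}"
    (is "?L = ?R")
proof (intro equalityI subsetI)
  fix E assume "E \<in> ?L"
  then have E: "E \<in> mesh_edges mesh" "(X a, Y b) \<in> E" by auto
  from E(1) show "E \<in> ?R"
    unfolding mesh_edges
  proof
    assume "E \<in> {h_seg (X a) (X a') (Y b) | a a' b. h_edge a a' b}"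
    then obtain k a' b' where k: "E = h_seg (X k) (X a') (Y b')" "h_edge k a' b'" by blast
    then have le: "k \<le> a" "a \<le> a'" "b = b'" using E(2) by (auto simp: h_seg_def grid_order)
    then have "a = k \<or> a = a'" using k(2) c unfolding h_edge_def by (metis le_neq_implies_less)
    then show ?thesis using k le by blast
  next
    assume "E \<in> {v_seg (X a) (Y b) (Y b') | a b b'. v_edge a b b'}"
    then obtain k a' b' where k: "E = v_seg (X a') (Y k) (Y b')" "v_edge a' k b'" by blast
    then have le: "k \<le> b" "b \<le> b'" "a = a'" using E(2) by (auto simp: v_seg_def grid_order)
    then have "b = k \<or> b = b'" using k(2) c unfolding v_edge_def by (metis le_neq_implies_less)
    then show ?thesis using k le by blast
  qed
next
  fix E assume "E \<in> ?R"
  then have "E \<in> mesh_edges mesh" unfolding mesh_edges by blast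
  moreover have "(X a, Y b) \<in> h_seg (X k) (X a') (Y b)" if "h_edge k a' b" "a = k \<or> a = a'" for k a'
    using that by (auto simp: h_seg_def h_edge_def grid_order)
  moreover have "(X a, Y b) \<in> v_seg (X a) (Y k) (Y b')" if "v_edge a k b'" "b = k \<or> b = b'" for k b'
    using that by (auto simp: v_seg_def v_edge_def grid_order)
  ultimately show "E \<in> ?L" using \<open>E \<in> ?R\<close> by blast
qed

text \<open>The rectangle covering the index cell to the upper right of the node must have
  \<open>a\<close> as its left and \<open>b\<close> as its lower side, since otherwise one of the
  two edges starting at the node would run through its inside.\<close>

lemma cross_node_corner:
  assumes "(a, b) \<in> cross_nodes H V" shows "(a, b) \<in> corners"
proof -
  have HV: "0 < a" "0 < b" "H a b" "V a b" using assms by (auto simp: cross_nodes_def)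
  have "a < M" "b < N" using H_bounded[OF HV(3)] V_bounded[OF HV(4)] by auto
  then obtain a1 a2 b1 b2 where *: "(a1, a2, b1, b2) \<in> D" "a1 \<le> a" "a < a2" "b1 \<le> b" "b < b2" using cover by blast
  have "a1 = a" using V_not_inside[OF *(1), of a b] * HV(4) by (meson le_neq_implies_less)
  moreover have "b1 = b" using H_not_inside[OF *(1), of a b] * HV(3) by (meson le_neq_implies_less)
  ultimately show ?thesis using *(1) unfolding corners_def by blast
qed

lemma cross_vertices: "cross_vertices mesh = {(X a, Y b) | a b. (a, b) \<in> cross_nodes H V}"
proof -
  have card: "card {E \<in> mesh_edges mesh. (X a, Y b) \<in> E} = 4 \<longleftrightarrow> (a, b) \<in> cross_nodes H V"
    if c: "(a, b) \<in> corners" for a b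
  proof -
    let ?R = "{h_seg (X a) (X a') (Y b) | a'. h_edge a a' b}" and ?L = "{h_seg (X k) (X a) (Y b) | k. h_edge k a b}"
      and ?U = "{v_seg (X a) (Y b) (Y b') | b'. v_edge a b b'}" and ?D = "{v_seg (X a) (Y k) (Y b) | k. v_edge a k b}"
    have R: "\<exists>p\<in>E. fst p > X a" "\<forall>p\<in>E. fst p \<ge> X a \<and> snd p = Y b" if "E \<in> ?R" for E
    proof -
      obtain a' where E: "E = h_seg (X a) (X a') (Y b)" "h_edge a a' b" using \<open>E \<in> _\<close> by blast
      show "\<exists>p\<in>E. fst p > X a"
        using E(2) by (intro bexI[of _ "(X a', Y b)"]) (auto simp: E(1) h_seg_def h_edge_def grid_order)
      show "\<forall>p\<in>E. fst p \<ge> X a \<and> snd p = Y b" by (auto simp: E(1) h_seg_def)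
    qed
    have L: "\<exists>p\<in>E. fst p < X a" "\<forall>p\<in>E. fst p \<le> X a \<and> snd p = Y b" if "E \<in> ?L" for E
    proof -
      obtain a' where E: "E = h_seg (X a') (X a) (Y b)" "h_edge a' a b" using \<open>E \<in> _\<close> by blast
      show "\<exists>p\<in>E. fst p < X a"
        using E(2) by (intro bexI[of _ "(X a', Y b)"]) (auto simp: E(1) h_seg_def h_edge_def grid_order)
      show "\<forall>p\<in>E. fst p \<le> X a \<and> snd p = Y b" by (auto simp: E(1) h_seg_def)
    qed
    have U: "\<exists>p\<in>E. snd p > Y b" "\<forall>p\<in>E. fst p = X a \<and> snd p \<ge> Y b" if "E \<in> ?U" for E
    proof -
      obtain b' where E: "E = v_seg (X a) (Y b) (Y b')" "v_edge a b b'" using \<open>E \<in> _\<close> by blast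
      show "\<exists>p\<in>E. snd p > Y b"
        using E(2) by (intro bexI[of _ "(X a, Y b')"]) (auto simp: E(1) v_seg_def v_edge_def grid_order)
      show "\<forall>p\<in>E. fst p = X a \<and> snd p \<ge> Y b" by (auto simp: E(1) v_seg_def)
    qed
    have D: "\<exists>p\<in>E. snd p < Y b" "\<forall>p\<in>E. fst p = X a \<and> snd p \<le> Y b" if "E \<in> ?D" for E
    proof -
      obtain b' where E: "E = v_seg (X a) (Y b') (Y b)" "v_edge a b' b" using \<open>E \<in> _\<close> by blast
      show "\<exists>p\<in>E. snd p < Y b"
        using E(2) by (intro bexI[of _ "(X a, Y b')"]) (auto simp: E(1) v_seg_def v_edge_def grid_order)
      show "\<forall>p\<in>E. fst p = X a \<and> snd p \<le> Y b" by (auto simp: E(1) v_seg_def)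
    qed
    have "card (?R \<union> ?L \<union> ?U \<union> ?D) = 4 \<longleftrightarrow> ?R \<noteq> {} \<and> ?L \<noteq> {} \<and> ?U \<noteq> {} \<and> ?D \<noteq> {}"
    proof (rule card_four_rays)
      show "?R \<inter> ?L = {}" using R(1) L(2) by fastforce
      show "?R \<inter> ?U = {}" using R(1) U(2) by fastforce
      show "?R \<inter> ?D = {}" using R(1) D(2) by fastforce
      show "?L \<inter> ?U = {}" using L(1) U(2) by fastforce
      show "?L \<inter> ?D = {}" using L(1) D(2) by fastforce
      show "?U \<inter> ?D = {}" using U(1) D(2) by fastforce
      show "E = E'" if "E \<in> ?R" "E' \<in> ?R" for E E' using that h_edge_unique(1) by auto
      show "E = E'" if "E \<in> ?L" "E' \<in> ?L" for E E' using that h_edge_unique(2) by auto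
      show "E = E'" if "E \<in> ?U" "E' \<in> ?U" for E E' using that v_edge_unique(1) by auto
      show "E = E'" if "E \<in> ?D" "E' \<in> ?D" for E E' using that v_edge_unique(2) by auto
    qed
    moreover have "?R \<noteq> {} \<longleftrightarrow> H a b" using h_edge_right[OF c] by blast
    moreover have "?L \<noteq> {} \<longleftrightarrow> 0 < a \<and> H (a - 1) b" using h_edge_left[OF c] by blast
    moreover have "?U \<noteq> {} \<longleftrightarrow> V a b" using v_edge_up[of a b] c by blast
    moreover have "?D \<noteq> {} \<longleftrightarrow> 0 < b \<and> V a (b - 1)" using v_edge_down[of a b] c by blast
    ultimately show ?thesis unfolding edges_at_corner[OF c] by (auto simp: cross_nodes_def)
  qed
  have inner: "(X a, Y b) \<notin> frontier (\<Union>mesh)" if "(a, b) \<in> cross_nodes H V" for a b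
  proof -
    have "0 < a" "0 < b" "a < M" "b < N" using that H_bounded V_bounded by (auto simp: cross_nodes_def)
    then show ?thesis unfolding Union_mesh mem_frontier by (auto simp: grid_order)
  qed
  show ?thesis
  proof (intro equalityI subsetI)
    fix v assume "v \<in> cross_vertices mesh"
    then obtain a b where "v = (X a, Y b)" "(a, b) \<in> corners" "card {E \<in> mesh_edges mesh. v \<in> E} = 4"
      unfolding cross_vertices_def mesh_vertices by blast
    then show "v \<in> {(X a, Y b) | a b. (a, b) \<in> cross_nodes H V}" using card by blast
  next
    fix v assume "v \<in> {(X a, Y b) | a b. (a, b) \<in> cross_nodes H V}"
    then obtain a b where v: "v = (X a, Y b)" "(a, b) \<in> cross_nodes H V" by blast
    then show "v \<in> cross_vertices mesh"
      unfolding cross_vertices_def mesh_vertices using card inner cross_node_corner by blast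
  qed
qed

end


subsection \<open>Splines on the CVR graph\<close>

text \<open>An oblique segment meets every grid line at most once, so finitely many lines cover only
  finitely many of its points.\<close>

lemma segment_avoiding_grid:
  fixes p q :: "real \<times> real"
  assumes "finite A" "finite B" "fst p \<noteq> fst q" "snd p \<noteq> snd q"
  shows "\<exists>z\<in>closed_segment p q. fst z \<notin> A \<and> snd z \<notin> B"
proof -
  have fin: "finite {t. (1 - t) * u + t * v \<in> C}" if "finite C" "u \<noteq> v" for C :: "real set" and u v
  proof -
    have "inj (\<lambda>t. (1 - t) * u + t * v)"
    proof (rule injI)
      fix s t assume "(1 - s) * u + s * v = (1 - t) * u + t * v"
      then have "(s - t) * (v - u) = 0" by (simp add: algebra_simps)
      then show "s = t" using that(2) by simp
    qed
    then show ?thesis using finite_vimageI[OF that(1)] by (simp add: vimage_def)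
  qed
  have "\<not> {0..1} \<subseteq> {t. (1 - t) * fst p + t * fst q \<in> A} \<union> {t. (1 - t) * snd p + t * snd q \<in> B}"
    using fin[OF assms(1,3)] fin[OF assms(2,4)] infinite_Icc[of 0 "1 :: real"] by (meson finite_UnI finite_subset zero_less_one)
  then obtain t where "t \<in> {0..1}"
    "t \<notin> {t. (1 - t) * fst p + t * fst q \<in> A} \<union> {t. (1 - t) * snd p + t * snd q \<in> B}" by blast
  then show ?thesis
    by (intro bexI[of _ "(1 - t) *\<^sub>R p + t *\<^sub>R q"]) (auto simp: closed_segment_def)
qed

context tiling begin

lemma X_cell_between:
  assumes "X a1 \<le> x" "x \<le> X a2" "a1 < a2" shows "\<exists>i. a1 \<le> i \<and> i < a2 \<and> X i \<le> x \<and> x \<le> X (Suc i)"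
proof -
  have "X 0 \<le> x" using assms(1) grid_order(3)[of 0 a1] by linarith
  then obtain i where i: "i < a2" "X i \<le> x" "x \<le> X (Suc i)" using X_cell[of x a2] assms by auto
  show ?thesis
  proof (cases "a1 \<le> i")
    case False
    then have "X (Suc i) \<le> X a1" by (simp add: grid_order)
    then have "x \<le> X (Suc a1)" using i(3) grid_order(3)[of a1 "Suc a1"] by linarith
    then show ?thesis using assms by blast
  qed (use i in blast)
qed

lemma Y_cell_between:
  assumes "Y b1 \<le> y" "y \<le> Y b2" "b1 < b2" shows "\<exists>j. b1 \<le> j \<and> j < b2 \<and> Y j \<le> y \<and> y \<le> Y (Suc j)"
  using tiling.X_cell_between[OF swap assms] .

lemma edge_in_Union_h: "H i b \<Longrightarrow> {X i..X (Suc i)} \<times> {Y b} \<subseteq> \<Union>(mesh_edges mesh)"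
proof -
  assume "H i b"
  then obtain a a' where e: "a \<le> i" "i < a'" "h_edge a a' b" using h_edge_cover by blast
  have "X a \<le> X i" "X (Suc i) \<le> X a'" using e by (auto simp: grid_order)
  then have "{X i..X (Suc i)} \<times> {Y b} \<subseteq> h_seg (X a) (X a') (Y b)" by (auto simp: h_seg_def)
  then show ?thesis using h_seg_in_edges[OF e(3)] by blast
qed

lemma edge_in_Union_v: "V a j \<Longrightarrow> {X a} \<times> {Y j..Y (Suc j)} \<subseteq> \<Union>(mesh_edges mesh)"
proof -
  assume "V a j"
  then obtain b b' where e: "b \<le> j" "j < b'" "v_edge a b b'" using v_edge_cover by blast
  have "Y b \<le> Y j" "Y (Suc j) \<le> Y b'" using e by (auto simp: grid_order)
  then have "{X a} \<times> {Y j..Y (Suc j)} \<subseteq> v_seg (X a) (Y b) (Y b')" by (auto simp: v_seg_def)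
  then show ?thesis using v_seg_in_edges[OF e(3)] by blast
qed

lemma Union_edges:
  assumes "z \<in> \<Union>(mesh_edges mesh)"
  shows "(\<exists>i b. H i b \<and> z \<in> {X i..X (Suc i)} \<times> {Y b}) \<or> (\<exists>a j. V a j \<and> z \<in> {X a} \<times> {Y j..Y (Suc j)})"
proof -
  obtain E where E: "E \<in> mesh_edges mesh" "z \<in> E" using assms by blast
  then consider a a' b where "E = h_seg (X a) (X a') (Y b)" "h_edge a a' b"
    | a b b' where "E = v_seg (X a) (Y b) (Y b')" "v_edge a b b'" unfolding mesh_edges by blast
  then show ?thesis
  proof cases
    case 1
    obtain x where x: "z = (x, Y b)" "X a \<le> x" "x \<le> X a'" using E 1 by (auto simp: h_seg_def)
    have "a < a'" using 1 by (simp add: h_edge_def)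
    then obtain i where "a \<le> i" "i < a'" "X i \<le> x" "x \<le> X (Suc i)" using X_cell_between[OF x(2,3)] by blast
    then show ?thesis using x h_edge_H[OF 1(2)] by auto
  next
    case 2
    obtain y where y: "z = (X a, y)" "Y b \<le> y" "y \<le> Y b'" using E 2 by (auto simp: v_seg_def)
    have "b < b'" using 2 by (simp add: v_edge_def)
    then obtain j where "b \<le> j" "j < b'" "Y j \<le> y" "y \<le> Y (Suc j)" using Y_cell_between[OF y(2,3)] by blast
    then show ?thesis using y v_edge_V[OF 2(2)] by auto
  qed
qed

lemma cross_vertex_iff: "(X a, Y b) \<in> cross_vertices mesh \<longleftrightarrow> (a, b) \<in> cross_nodes H V"
  unfolding cross_vertices by (auto simp: grid_order)

lemma h_line_in_graph:
  assumes "(a1, b) \<in> cross_nodes H V" "(a2, b) \<in> cross_nodes H V" "a1 \<le> a2" "\<And>i. a1 \<le> i \<Longrightarrow> i < a2 \<Longrightarrow> H i b"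
  shows "{X a1..X a2} \<times> {Y b} \<subseteq> cvr_graph mesh"
proof (cases "a1 = a2")
  case True
  then show ?thesis using assms(1) unfolding cvr_graph_def by (auto simp: cross_vertex_iff)
next
  case False
  have cs: "closed_segment (X a1, Y b) (X a2, Y b) = {X a1..X a2} \<times> {Y b}"
    using assms(3) closed_segment_h[of "X a1" "X a2" "Y b"] by (simp add: grid_order h_seg_def)
  have "{X a1..X a2} \<times> {Y b} \<subseteq> \<Union>(mesh_edges mesh)"
  proof
    fix z assume "z \<in> {X a1..X a2} \<times> {Y b}"
    then obtain x where x: "z = (x, Y b)" "X a1 \<le> x" "x \<le> X a2" by auto
    obtain i where i: "a1 \<le> i" "i < a2" "X i \<le> x" "x \<le> X (Suc i)"
      using X_cell_between[OF x(2,3)] False assms(3) by auto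
    then have "z \<in> {X i..X (Suc i)} \<times> {Y b}" by (simp add: x)
    then show "z \<in> \<Union>(mesh_edges mesh)" using edge_in_Union_h[OF assms(4)[OF i(1,2)]] by blast
  qed
  then show ?thesis unfolding cvr_graph_def using assms(1,2) cs cross_vertex_iff by blast
qed

lemma v_line_in_graph:
  assumes "(a, b1) \<in> cross_nodes H V" "(a, b2) \<in> cross_nodes H V" "b1 \<le> b2" "\<And>j. b1 \<le> j \<Longrightarrow> j < b2 \<Longrightarrow> V a j"
  shows "{X a} \<times> {Y b1..Y b2} \<subseteq> cvr_graph mesh"
proof (cases "b1 = b2")
  case True
  then show ?thesis using assms(1) unfolding cvr_graph_def by (auto simp: cross_vertex_iff)
next
  case False
  have cs: "closed_segment (X a, Y b1) (X a, Y b2) = {X a} \<times> {Y b1..Y b2}"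
    using assms(3) closed_segment_v[of "Y b1" "Y b2" "X a"] by (simp add: grid_order v_seg_def)
  have "{X a} \<times> {Y b1..Y b2} \<subseteq> \<Union>(mesh_edges mesh)"
  proof
    fix z assume "z \<in> {X a} \<times> {Y b1..Y b2}"
    then obtain y where y: "z = (X a, y)" "Y b1 \<le> y" "y \<le> Y b2" by auto
    obtain j where j: "b1 \<le> j" "j < b2" "Y j \<le> y" "y \<le> Y (Suc j)"
      using Y_cell_between[OF y(2,3)] False assms(3) by auto
    then have "z \<in> {X a} \<times> {Y j..Y (Suc j)}" by (simp add: y)
    then show "z \<in> \<Union>(mesh_edges mesh)" using edge_in_Union_v[OF assms(4)[OF j(1,2)]] by blast
  qed
  then show ?thesis unfolding cvr_graph_def using assms(1,2) cs cross_vertex_iff by blast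
qed

text \<open>The midpoint of the \<open>i\<close>-th grid interval lies on no vertical grid line, so
  among the grid edges only the \<open>i\<close>-th one on this row can contain it.\<close>

lemma segment_h_edges:
  assumes "a < a'" "closed_segment (X a, Y b) (X a', Y b) \<subseteq> \<Union>(mesh_edges mesh)" "a \<le> i" "i < a'"
  shows "H i b"
proof -
  let ?x = "(X i + X (Suc i)) / 2"
  have "X i < X (Suc i)" "X a \<le> X i" "X (Suc i) \<le> X a'" using assms by (auto simp: grid_order)
  then have x: "X i < ?x" "?x < X (Suc i)" "X a \<le> ?x" "?x \<le> X a'" by simp_all
  then have "(?x, Y b) \<in> closed_segment (X a, Y b) (X a', Y b)"
    using assms(1) by (subst closed_segment_h) (auto simp: h_seg_def grid_order)
  then have "(?x, Y b) \<in> \<Union>(mesh_edges mesh)" using assms(2) by blast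
  then consider k l where "H k l" "(?x, Y b) \<in> {X k..X (Suc k)} \<times> {Y l}"
    | k l where "V k l" "(?x, Y b) \<in> {X k} \<times> {Y l..Y (Suc l)}" using Union_edges by blast
  then show ?thesis
  proof cases
    case 1
    then have "X k \<le> ?x" "?x \<le> X (Suc k)" "l = b" by (auto simp: grid_order(6))
    then have "X i < X (Suc k)" "X k < X (Suc i)" "l = b" using x(1,2) by linarith+
    then have "k = i" "l = b" by (simp_all add: grid_order)
    then show ?thesis using 1 by simp
  next
    case 2
    then have "X i < X k" "X k < X (Suc i)" using x by auto
    then show ?thesis by (simp add: grid_order)
  qed
qed

lemma segment_v_edges:
  assumes "b < b'" "closed_segment (X a, Y b) (X a, Y b') \<subseteq> \<Union>(mesh_edges mesh)" "b \<le> j" "j < b'"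
  shows "V a j"
proof -
  let ?y = "(Y j + Y (Suc j)) / 2"
  have "Y j < Y (Suc j)" "Y b \<le> Y j" "Y (Suc j) \<le> Y b'" using assms by (auto simp: grid_order)
  then have y: "Y j < ?y" "?y < Y (Suc j)" "Y b \<le> ?y" "?y \<le> Y b'" by simp_all
  then have "(X a, ?y) \<in> closed_segment (X a, Y b) (X a, Y b')"
    using assms(1) by (subst closed_segment_v) (auto simp: v_seg_def grid_order)
  then have "(X a, ?y) \<in> \<Union>(mesh_edges mesh)" using assms(2) by blast
  then consider k l where "H k l" "(X a, ?y) \<in> {X k..X (Suc k)} \<times> {Y l}"
    | k l where "V k l" "(X a, ?y) \<in> {X k} \<times> {Y l..Y (Suc l)}" using Union_edges by blast
  then show ?thesis
  proof cases
    case 1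
    then have "Y j < Y l" "Y l < Y (Suc j)" using y by auto
    then show ?thesis by (simp add: grid_order)
  next
    case 2
    then have "Y l \<le> ?y" "?y \<le> Y (Suc l)" "k = a" by (auto simp: grid_order(5))
    then have "Y j < Y (Suc l)" "Y l < Y (Suc j)" "k = a" using y(1,2) by linarith+
    then have "l = j" "k = a" by (simp_all add: grid_order)
    then show ?thesis using 2 by simp
  qed
qed

lemma segment_in_edges_axis_parallel:
  assumes "closed_segment (X a, Y b) (X a', Y b') \<subseteq> \<Union>(mesh_edges mesh)" shows "a = a' \<or> b = b'"
proof (rule ccontr)
  assume "\<not> (a = a' \<or> b = b')"
  then have "X a \<noteq> X a'" "Y b \<noteq> Y b'" by (simp_all add: grid_order)
  then obtain z where z: "z \<in> closed_segment (X a, Y b) (X a', Y b')" "fst z \<notin> X ` {..M}" "snd z \<notin> Y ` {..N}"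
    using segment_avoiding_grid[of "X ` {..M}" "Y ` {..N}" "(X a, Y b)" "(X a', Y b')"] by auto
  then have "z \<in> \<Union>(mesh_edges mesh)" using assms by blast
  then show False using Union_edges[of z] z(2,3) H_bounded V_bounded by auto
qed

lemma graph_cases:
  assumes "z \<in> cvr_graph mesh"
  obtains (vertex) "z \<in> cross_vertices mesh"
    | (h) a b where "cvr_h H V a b" "z \<in> {X a..X (Suc a)} \<times> {Y b}"
    | (v) a b where "cvr_v H V a b" "z \<in> {X a} \<times> {Y b..Y (Suc b)}"
proof (cases "z \<in> cross_vertices mesh")
  case False
  then obtain p q where pq: "p \<in> cross_vertices mesh" "q \<in> cross_vertices mesh"
    "closed_segment p q \<subseteq> \<Union>(mesh_edges mesh)" "z \<in> closed_segment p q"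
    using assms unfolding cvr_graph_def by blast
  obtain a b a' b' where ab: "p = (X a, Y b)" "(a, b) \<in> cross_nodes H V" "q = (X a', Y b')" "(a', b') \<in> cross_nodes H V"
    using pq(1,2) unfolding cross_vertices by blast
  have hs: thesis if *: "k < k'" "(k, l) \<in> cross_nodes H V" "(k', l) \<in> cross_nodes H V"
    "closed_segment (X k, Y l) (X k', Y l) \<subseteq> \<Union>(mesh_edges mesh)" "z \<in> closed_segment (X k, Y l) (X k', Y l)" for k k' l
  proof -
    have "X k \<le> X k'" using *(1) by (simp add: grid_order)
    then obtain x where x: "z = (x, Y l)" "X k \<le> x" "x \<le> X k'" using *(5) closed_segment_h[of "X k" "X k'" "Y l"]
      by (auto simp: h_seg_def)
    obtain i where i: "k \<le> i" "i < k'" "X i \<le> x" "x \<le> X (Suc i)" using X_cell_between[OF x(2,3) *(1)] by blast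
    have "cvr_h H V i l" unfolding cvr_h_def using i(1,2) *(2,3) segment_h_edges[OF *(1,4)] by blast
    then show thesis using x i *(2) h[of i l] by auto
  qed
  have vs: thesis if *: "k < k'" "(l, k) \<in> cross_nodes H V" "(l, k') \<in> cross_nodes H V"
    "closed_segment (X l, Y k) (X l, Y k') \<subseteq> \<Union>(mesh_edges mesh)" "z \<in> closed_segment (X l, Y k) (X l, Y k')" for k k' l
  proof -
    have "Y k \<le> Y k'" using *(1) by (simp add: grid_order)
    then obtain y where y: "z = (X l, y)" "Y k \<le> y" "y \<le> Y k'" using *(5) closed_segment_v[of "Y k" "Y k'" "X l"]
      by (auto simp: v_seg_def)
    obtain i where i: "k \<le> i" "i < k'" "Y i \<le> y" "y \<le> Y (Suc i)" using Y_cell_between[OF y(2,3) *(1)] by blast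
    have "cvr_v H V l i" unfolding cvr_v_def using i(1,2) *(2,3) segment_v_edges[OF *(1,4)] by blast
    then show thesis using y i *(2) v[of l i] by auto
  qed
  have "p \<noteq> q" using pq False by auto
  moreover have "a = a' \<or> b = b'" using pq(3) unfolding ab by (rule segment_in_edges_axis_parallel)
  ultimately consider "b = b'" "a < a'" | "b = b'" "a' < a" | "a = a'" "b < b'" | "a = a'" "b' < b"
    using ab by (metis linorder_neqE_nat)
  then show thesis
  proof cases
    case 1 then show ?thesis using hs[of a a' b] pq ab by simp
  next
    case 2 then show ?thesis using hs[of a' a b] pq ab by (simp add: closed_segment_commute)
  next
    case 3 then show ?thesis using vs[of b b' a] pq ab by simp
  next
    case 4 then show ?thesis using vs[of b' b a] pq ab by (simp add: closed_segment_commute)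
  qed
qed

lemma cvr_h_in_graph: "cvr_h H V a b \<Longrightarrow> {X a..X (Suc a)} \<times> {Y b} \<subseteq> cvr_graph mesh"
proof -
  assume "cvr_h H V a b"
  then obtain a1 a2 where *: "a1 \<le> a" "a < a2" "(a1, b) \<in> cross_nodes H V" "(a2, b) \<in> cross_nodes H V"
    "\<forall>i. a1 \<le> i \<and> i < a2 \<longrightarrow> H i b" unfolding cvr_h_def by blast
  then have "{X a1..X a2} \<times> {Y b} \<subseteq> cvr_graph mesh" by (intro h_line_in_graph) auto
  moreover have "X a1 \<le> X a" "X (Suc a) \<le> X a2" using * by (simp_all add: grid_order)
  then have "{X a..X (Suc a)} \<times> {Y b} \<subseteq> {X a1..X a2} \<times> {Y b}" by auto
  ultimately show ?thesis by blast
qed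

lemma cvr_v_in_graph: "cvr_v H V a b \<Longrightarrow> {X a} \<times> {Y b..Y (Suc b)} \<subseteq> cvr_graph mesh"
proof -
  assume "cvr_v H V a b"
  then obtain b1 b2 where *: "b1 \<le> b" "b < b2" "(a, b1) \<in> cross_nodes H V" "(a, b2) \<in> cross_nodes H V"
    "\<forall>j. b1 \<le> j \<and> j < b2 \<longrightarrow> V a j" unfolding cvr_v_def by blast
  then have "{X a} \<times> {Y b1..Y b2} \<subseteq> cvr_graph mesh" by (intro v_line_in_graph) auto
  moreover have "Y b1 \<le> Y b" "Y (Suc b) \<le> Y b2" using * by (simp_all add: grid_order)
  then have "{X a} \<times> {Y b..Y (Suc b)} \<subseteq> {X a} \<times> {Y b1..Y b2}" by auto
  ultimately show ?thesis by blast
qed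

end

section \<open>The rectangle occupied by the CVR graph and its faces\<close>

text \<open>The frame bounds the CVR region. It is allowed to be empty, with \<open>A1 > A2\<close>
  or \<open>B1 > B2\<close>; then there are no cross-nodes, the region is empty as well, and the
  guards make the remaining assumptions vacuous.\<close>

locale framed_tiling = tiling +
  fixes A1 A2 B1 B2 :: nat
  assumes cross_in: "cross_nodes H V \<subseteq> {A1..A2} \<times> {B1..B2}"
    and frame_corners: "A1 \<le> A2 \<Longrightarrow> B1 \<le> B2 \<Longrightarrow> {A1, A2} \<times> {B1, B2} \<subseteq> cross_nodes H V"
    and frame_h: "\<And>i. A1 \<le> i \<Longrightarrow> i < A2 \<Longrightarrow> B1 \<le> B2 \<Longrightarrow> H i B1 \<and> H i B2"
    and frame_v: "\<And>j. B1 \<le> j \<Longrightarrow> j < B2 \<Longrightarrow> A1 \<le> A2 \<Longrightarrow> V A1 j \<and> V A2 j"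
begin

lemma cvr_region: "cvr_region mesh = cbox (X A1, Y B1) (X A2, Y B2)"
proof (intro equalityI)
  have "cross_vertices mesh \<subseteq> cbox (X A1, Y B1) (X A2, Y B2)"
    using cross_in unfolding cross_vertices by (fastforce simp: grid_order cbox_Pair_eq)
  then show "cvr_region mesh \<subseteq> cbox (X A1, Y B1) (X A2, Y B2)"
    unfolding cvr_region_def by (rule hull_minimal) simp
  show "cbox (X A1, Y B1) (X A2, Y B2) \<subseteq> cvr_region mesh"
  proof (cases "A1 \<le> A2 \<and> B1 \<le> B2")
    case True
    then have le: "X A1 \<le> X A2" "Y B1 \<le> Y B2" by (simp_all add: grid_order)
    have "cbox (X A1, Y B1) (X A2, Y B2) = (convex hull {X A1, X A2}) \<times> (convex hull {Y B1, Y B2})"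
      using le by (simp add: cbox_Pair_eq closed_segment_eq_real_ivl flip: segment_convex_hull)
    also have "\<dots> = convex hull ({X A1, X A2} \<times> {Y B1, Y B2})" by (simp only: convex_hull_Times)
    also have "\<dots> \<subseteq> cvr_region mesh"
      unfolding cvr_region_def
      by (rule hull_mono) (use frame_corners True in \<open>auto simp: cross_vertex_iff\<close>)
    finally show ?thesis .
  next
    case False
    then have "\<not> X A1 \<le> X A2 \<or> \<not> Y B1 \<le> Y B2" by (simp add: grid_order)
    then have "cbox (X A1, Y B1) (X A2, Y B2) = {}" by (auto simp: cbox_Pair_eq)
    then show ?thesis by simp
  qed
qed

lemma frame_in_graph:
  assumes "(x, y) \<in> cvr_region mesh" "(x, y) \<notin> box (X A1, Y B1) (X A2, Y B2)" shows "(x, y) \<in> cvr_graph mesh"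
proof -
  have xy: "X A1 \<le> x" "x \<le> X A2" "Y B1 \<le> y" "y \<le> Y B2" using assms(1) unfolding cvr_region by (auto simp: cbox_Pair_eq)
  then have "X A1 \<le> X A2" "Y B1 \<le> Y B2" by linarith+
  then have le: "A1 \<le> A2" "B1 \<le> B2" by (simp_all add: grid_order)
  note c = frame_corners[OF le]
  have "{X A1..X A2} \<times> {Y B1} \<subseteq> cvr_graph mesh" "{X A1..X A2} \<times> {Y B2} \<subseteq> cvr_graph mesh"
    by (rule h_line_in_graph; use c le frame_h in simp)+
  moreover have "{X A1} \<times> {Y B1..Y B2} \<subseteq> cvr_graph mesh" "{X A2} \<times> {Y B1..Y B2} \<subseteq> cvr_graph mesh"
    by (rule v_line_in_graph; use c le frame_v in simp)+
  moreover have "x = X A1 \<or> x = X A2 \<or> y = Y B1 \<or> y = Y B2" using assms(2) xy by (auto simp: box_Pair)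
  ultimately show ?thesis using xy by auto
qed

lemma graph_avoids_cell: "({X a<..<X (Suc a)} \<times> {Y b<..<Y (Suc b)}) \<inter> cvr_graph mesh = {}"
proof -
  have X: "\<not> (X a < X k \<and> X k < X (Suc a))" and Y: "\<not> (Y b < Y l \<and> Y l < Y (Suc b))" for k l
    by (auto simp: grid_order)
  have "(x, y) \<notin> cvr_graph mesh" if "X a < x" "x < X (Suc a)" "Y b < y" "y < Y (Suc b)" for x y
  proof
    assume "(x, y) \<in> cvr_graph mesh"
    then show False by (cases rule: graph_cases) (use that X Y in \<open>auto simp: cross_vertices\<close>)
  qed
  then show ?thesis by auto
qed

lemma cvr_splines_dim:
  "fun_space.dim (cvr_splines e mesh) = fun_space.dim (coeff_space e H V X Y (cross_nodes H V) UNIV UNIV)"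
proof -
  have cross: "A1 \<le> a \<and> a \<le> A2 \<and> B1 \<le> b \<and> b \<le> B2" if "(a, b) \<in> cross_nodes H V" for a b using cross_in that by auto
  interpret S: spline_mesh e X Y "cvr_h H V" "cvr_v H V" A1 A2 B1 B2 "cvr_region mesh" "cvr_faces mesh"
  proof unfold_locales
    show "A1 \<le> a \<and> a < A2 \<and> B1 \<le> b \<and> b \<le> B2" if "cvr_h H V a b" for a b
    proof -
      obtain a1 a2 where "a1 \<le> a" "a < a2" "(a1, b) \<in> cross_nodes H V" "(a2, b) \<in> cross_nodes H V"
        using \<open>cvr_h H V a b\<close> unfolding cvr_h_def by blast
      then show ?thesis using cross[of a1 b] cross[of a2 b] by linarith
    qed
    show "A1 \<le> a \<and> a \<le> A2 \<and> B1 \<le> b \<and> b < B2" if "cvr_v H V a b" for a b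
    proof -
      obtain b1 b2 where "b1 \<le> b" "b < b2" "(a, b1) \<in> cross_nodes H V" "(a, b2) \<in> cross_nodes H V"
        using \<open>cvr_v H V a b\<close> unfolding cvr_v_def by blast
      then show ?thesis using cross[of a b1] cross[of a b2] by linarith
    qed
    show "cvr_h H V a B1 \<and> cvr_h H V a B2" if "A1 \<le> a" "a < A2" "B1 < B2" for a
    proof -
      have "{A1, A2} \<times> {B1, B2} \<subseteq> cross_nodes H V" using that frame_corners by simp
      moreover have "\<forall>i. A1 \<le> i \<and> i < A2 \<longrightarrow> H i B1 \<and> H i B2" using that frame_h by simp
      ultimately show ?thesis unfolding cvr_h_def using that(1,2) by blast
    qed
    show "cvr_v H V A1 b \<and> cvr_v H V A2 b" if "B1 \<le> b" "b < B2" "A1 < A2" for b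
    proof -
      have "{A1, A2} \<times> {B1, B2} \<subseteq> cross_nodes H V" using that frame_corners by simp
      moreover have "\<forall>j. B1 \<le> j \<and> j < B2 \<longrightarrow> V A1 j \<and> V A2 j" using that frame_v by simp
      ultimately show ?thesis unfolding cvr_v_def using that(1,2) by blast
    qed
    fix K assume K: "K \<in> cvr_faces mesh"
    then show "connected K" unfolding cvr_faces_def by (rule in_components_connected)
    have sub: "K \<subseteq> cvr_region mesh - cvr_graph mesh" using K unfolding cvr_faces_def by (rule in_components_subset)
    show box: "K \<subseteq> box (X A1, Y B1) (X A2, Y B2)"
    proof
      fix z assume "z \<in> K"
      then have "z \<in> cvr_region mesh" "z \<notin> cvr_graph mesh" using sub by auto
      then show "z \<in> box (X A1, Y B1) (X A2, Y B2)" using frame_in_graph[of "fst z" "snd z"] by auto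
    qed
    show "\<not> cvr_h H V a b" if "(x, Y b) \<in> K" "X a \<le> x" "x \<le> X (Suc a)" for x a b
    proof
      assume "cvr_h H V a b"
      moreover have "(x, Y b) \<in> {X a..X (Suc a)} \<times> {Y b}" using that by simp
      ultimately show False using cvr_h_in_graph[of a b] sub that(1) by blast
    qed
    show "\<not> cvr_v H V a b" if "(X a, y) \<in> K" "Y b \<le> y" "y \<le> Y (Suc b)" for y a b
    proof
      assume "cvr_v H V a b"
      moreover have "(X a, y) \<in> {X a} \<times> {Y b..Y (Suc b)}" using that by simp
      ultimately show False using cvr_v_in_graph[of a b] sub that(1) by blast
    qed
    show "{X a<..<X (Suc a)} \<times> {Y b<..<Y (Suc b)} \<subseteq> K"
      if xy: "(x, y) \<in> K" "X a \<le> x" "x \<le> X (Suc a)" "Y b \<le> y" "y \<le> Y (Suc b)" for x y a b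
    proof -
      let ?Q = "{X a<..<X (Suc a)} \<times> {Y b<..<Y (Suc b)}"
      have "X A1 < x" "x < X A2" "Y B1 < y" "y < Y B2" using xy(1) box by (auto simp: box_Pair)
      then have "X A1 < X (Suc a)" "X a < X A2" "Y B1 < Y (Suc b)" "Y b < Y B2" using xy by linarith+
      then have "X A1 \<le> X a" "X (Suc a) \<le> X A2" "Y B1 \<le> Y b" "Y (Suc b) \<le> Y B2" by (simp_all add: grid_order)
      then have "?Q \<subseteq> cvr_region mesh" unfolding cvr_region by (auto simp: cbox_Pair_eq)
      then have "?Q \<subseteq> cvr_region mesh - cvr_graph mesh" using graph_avoids_cell[of a b] by blast
      then have "insert (x, y) ?Q \<subseteq> cvr_region mesh - cvr_graph mesh" using sub xy(1) by blast
      moreover have "X a < X (Suc a)" "Y b < Y (Suc b)" by (simp_all add: grid_order)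
      \<comment> \<open>The point may lie on the border of the open cell. Together with the cell it
        forms a set between a connected set and its closure, hence connected and contained in the
        component \<open>K\<close>.\<close>
      then have "insert (x, y) ?Q \<subseteq> closure ?Q" using xy(2-5) by (simp add: closure_Times subset_iff)
      then have "connected (insert (x, y) ?Q)"
        by (rule connected_intermediate_closure[rotated 2]) (auto intro: connected_Times)
      ultimately have "insert (x, y) ?Q \<subseteq> K"
        using components_maximal[of K] K xy(1) unfolding cvr_faces_def by blast
      then show ?thesis by blast
    qed
  next
    fix x y
    assume p: "(x, y) \<in> cvr_region mesh" "x \<notin> range X \<or> y \<notin> range Y"
      and nH: "\<And>a b. y = Y b \<Longrightarrow> X a \<le> x \<Longrightarrow> x \<le> X (Suc a) \<Longrightarrow> \<not> cvr_h H V a b"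
      and nV: "\<And>a b. x = X a \<Longrightarrow> Y b \<le> y \<Longrightarrow> y \<le> Y (Suc b) \<Longrightarrow> \<not> cvr_v H V a b"
    have "(x, y) \<notin> cvr_graph mesh"
    proof
      assume "(x, y) \<in> cvr_graph mesh"
      then show False by (cases rule: graph_cases) (use p(2) nH nV in \<open>auto simp: cross_vertices\<close>)
    qed
    then have "(x, y) \<in> \<Union>(cvr_faces mesh)" using p(1) unfolding cvr_faces_def by simp
    then show "\<exists>K\<in>cvr_faces mesh. (x, y) \<in> K" by blast
  qed (use mono unbounded cvr_region in auto)
  have "bounded_edges (max M N) H V"
    using H_bounded V_bounded unfolding bounded_edges_def by fastforce
  then show ?thesis
    unfolding cvr_splines_def S.dim_homogeneous_splines by (simp only: coeff_space_cvr)
qed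

end


subsection \<open>Hierarchical meshes as index rectangles\<close>

text \<open>No corner fits strictly between the ends of a side of length one, so each side of the
  cell is a whole mesh edge. A side on the boundary of the mesh would make the cell a boundary
  cell.\<close>

lemma (in tiling) unit_interior_cell:
  assumes ij: "(i, Suc i, j, Suc j) \<in> D" and K: "interior_cell mesh (cbox (X i, Y j) (X (Suc i), Y (Suc j)))" (is "interior_cell _ ?K")
  shows "0 < i \<and> Suc i < M \<and> 0 < j \<and> Suc j < N"
proof -
  have no: "\<not> (E \<in> mesh_edges mesh \<and> E \<subseteq> frontier ?K \<and> E \<subseteq> frontier (\<Union>mesh))" for E
    using K unfolding interior_cell_def boundary_cell_def by blast
  have X: "X i < X (Suc i)" "X 0 \<le> X i" "X (Suc i) \<le> X M" and Y: "Y j < Y (Suc j)" "Y 0 \<le> Y j" "Y (Suc j) \<le> Y N"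
    using rect[OF ij] by (auto simp: grid_order)
  have corner: "(i, j) \<in> corners" "(Suc i, j) \<in> corners" "(i, Suc j) \<in> corners" "(Suc i, Suc j) \<in> corners"
    using ij unfolding corners_def by blast+
  have v: "a \<noteq> 0 \<and> a \<noteq> M" if a: "a = i \<or> a = Suc i" for a
  proof (rule ccontr)
    assume "\<not> (a \<noteq> 0 \<and> a \<noteq> M)"
    have "\<exists>a1 a2 b1 b2. (a1, a2, b1, b2) \<in> D \<and> b1 \<le> j \<and> Suc j \<le> b2 \<and> (a = a1 \<or> a = a2)" using ij a by blast
    then have "v_edge a j (Suc j)" using corner a unfolding v_edge_def by auto
    then have "v_seg (X a) (Y j) (Y (Suc j)) \<in> mesh_edges mesh" by (rule v_seg_in_edges)
    moreover have "v_seg (X a) (Y j) (Y (Suc j)) \<subseteq> frontier ?K" using X Y a by (auto simp: v_seg_def mem_frontier)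
    moreover have "X a = X 0 \<or> X a = X M" using \<open>\<not> (a \<noteq> 0 \<and> a \<noteq> M)\<close> by auto
    then have "v_seg (X a) (Y j) (Y (Suc j)) \<subseteq> frontier (\<Union>mesh)"
      unfolding Union_mesh using X Y by (auto simp: v_seg_def mem_frontier)
    ultimately show False using no by blast
  qed
  have h: "b \<noteq> 0 \<and> b \<noteq> N" if b: "b = j \<or> b = Suc j" for b
  proof (rule ccontr)
    assume "\<not> (b \<noteq> 0 \<and> b \<noteq> N)"
    have "\<exists>a1 a2 b1 b2. (a1, a2, b1, b2) \<in> D \<and> a1 \<le> i \<and> Suc i \<le> a2 \<and> (b = b1 \<or> b = b2)" using ij b by blast
    then have "h_edge i (Suc i) b" using corner b unfolding h_edge_def by auto
    then have "h_seg (X i) (X (Suc i)) (Y b) \<in> mesh_edges mesh" by (rule h_seg_in_edges)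
    moreover have "h_seg (X i) (X (Suc i)) (Y b) \<subseteq> frontier ?K" using X Y b by (auto simp: h_seg_def mem_frontier)
    moreover have "Y b = Y 0 \<or> Y b = Y N" using \<open>\<not> (b \<noteq> 0 \<and> b \<noteq> N)\<close> by auto
    then have "h_seg (X i) (X (Suc i)) (Y b) \<subseteq> frontier (\<Union>mesh)"
      unfolding Union_mesh using X Y by (auto simp: h_seg_def mem_frontier)
    ultimately show False using no by blast
  qed
  show ?thesis using v[of i] v[of "Suc i"] h[of j] h[of "Suc j"] rect[OF ij] by auto
qed

primrec dyadic :: "(nat \<Rightarrow> real) \<Rightarrow> nat \<Rightarrow> nat \<Rightarrow> real" where
  "dyadic x 0 = x"
| "dyadic x (Suc k) = (\<lambda>i. if even i then dyadic x k (i div 2)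
     else (dyadic x k (i div 2) + dyadic x k (Suc (i div 2))) / 2)"

lemma dyadic_even: "dyadic x (Suc k) (2 * i) = dyadic x k i"
  by simp

lemma dyadic_odd: "dyadic x (Suc k) (Suc (2 * i)) = (dyadic x k i + dyadic x k (Suc i)) / 2"
  by simp

lemma strict_mono_dyadic: "strict_mono x \<Longrightarrow> strict_mono (dyadic x k)"
proof (induction k)
  case (Suc k)
  then have IH: "dyadic x k i < dyadic x k (Suc i)" for i by (simp add: strict_mono_def)
  show ?case
    unfolding strict_mono_Suc_iff
  proof
    fix i
    show "dyadic x (Suc k) i < dyadic x (Suc k) (Suc i)"
    proof (cases "even i")
      case True
      then obtain j where "i = 2 * j" by (elim evenE)
      then show ?thesis using IH[of j] by simp
    next
      case False
      then obtain j where "i = Suc (2 * j)" by (elim oddE) simp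
      moreover have "dyadic x (Suc k) (Suc (Suc (2 * j))) = dyadic x k (Suc j)" using dyadic_even[of x k "Suc j"] by simp
      ultimately show ?thesis using IH[of j] by (simp del: dyadic.simps add: dyadic_odd)
    qed
  qed
qed simp

lemma dyadic_unbounded: "(\<And>z. \<exists>i. z < x i) \<Longrightarrow> \<exists>i. z < dyadic x k i"
  by (induction k) (auto simp del: dyadic.simps(2), metis dyadic_even)

fun double_rect :: "index_rect \<Rightarrow> index_rect" where
  "double_rect (a1, a2, b1, b2) = (2 * a1, 2 * a2, 2 * b1, 2 * b2)"

fun unit_rect :: "nat \<times> nat \<Rightarrow> index_rect" where
  "unit_rect (i, j) = (i, Suc i, j, Suc j)"

lemma mem_double_rects:
  "(a1, a2, b1, b2) \<in> double_rect ` Z \<longleftrightarrow>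
    (\<exists>a1' a2' b1' b2'. (a1', a2', b1', b2') \<in> Z \<and> a1 = 2 * a1' \<and> a2 = 2 * a2' \<and> b1 = 2 * b1' \<and> b2 = 2 * b2')"
  by (force simp: image_iff)

lemma mem_unit_rects:
  "(a1, a2, b1, b2) \<in> unit_rect ` Z \<longleftrightarrow> (a1, b1) \<in> Z \<and> a2 = Suc a1 \<and> b2 = Suc b1"
  by (force simp: image_iff)

fun in_rect :: "nat \<times> nat \<Rightarrow> index_rect \<Rightarrow> bool" where
  "in_rect (a, b) (a1, a2, b1, b2) \<longleftrightarrow> a1 \<le> a \<and> a < a2 \<and> b1 \<le> b \<and> b < b2"

lemma in_double_rect: "in_rect (a, b) (double_rect R) \<longleftrightarrow> in_rect (a div 2, b div 2) R"
  by (cases R) auto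

lemma in_unit_rect: "in_rect v (unit_rect c) \<longleftrightarrow> v = c"
  by (cases v; cases c) auto

fun flip_rect :: "index_rect \<Rightarrow> index_rect" where
  "flip_rect (a1, a2, b1, b2) = (b1, b2, a1, a2)"

definition h_line :: "index_rect set \<Rightarrow> nat \<Rightarrow> nat \<Rightarrow> bool" where
  "h_line D a b \<longleftrightarrow> (\<exists>a1 a2 b1 b2. (a1, a2, b1, b2) \<in> D \<and> a1 \<le> a \<and> a < a2 \<and> (b = b1 \<or> b = b2))"

text \<open>A doubled rectangle keeps its lines, now at even indices. The unit cells replacing a
  subdivided one contribute its old sides again and, at an odd index, its middle line.\<close>

lemma refine_h_line:
  assumes "unit_rect ` s \<subseteq> D"
  shows "h_line (double_rect ` (D - unit_rect ` s) \<union> unit_rect ` {(a, b). (a div 2, b div 2) \<in> s}) = refine_h (h_line D) s"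
    (is "h_line ?D = _")
proof (intro ext)
  have edges: "h_line D i j" "h_line D i (Suc j)" if "(i, j) \<in> s" for i j
  proof -
    have "unit_rect (i, j) \<in> D" using that assms by blast
    then show "h_line D i j" "h_line D i (Suc j)" unfolding h_line_def by (auto intro: exI[of _ i] exI[of _ "Suc i"])
  qed
  fix a b
  show "h_line ?D a b = refine_h (h_line D) s a b"
  proof
    assume "h_line ?D a b"
    then obtain a1 a2 b1 b2 where R: "(a1, a2, b1, b2) \<in> ?D" "a1 \<le> a" "a < a2" "b = b1 \<or> b = b2"
      unfolding h_line_def by blast
    from R(1) show "refine_h (h_line D) s a b"
    proof
      assume "(a1, a2, b1, b2) \<in> double_rect ` (D - unit_rect ` s)"
      then obtain a1' a2' b1' b2' where R': "(a1', a2', b1', b2') \<in> D" "a1 = 2 * a1'" "a2 = 2 * a2'" "b1 = 2 * b1'" "b2 = 2 * b2'"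
        unfolding mem_double_rects by blast
      have "even b" "b div 2 = b1' \<or> b div 2 = b2'" "a1' \<le> a div 2" "a div 2 < a2'" using R(2-4) R'(2-5) by auto
      then have "h_line D (a div 2) (b div 2)" using R'(1) unfolding h_line_def by blast
      then show ?thesis using \<open>even b\<close> by (simp add: refine_h_def)
    next
      assume "(a1, a2, b1, b2) \<in> unit_rect ` {(a, b). (a div 2, b div 2) \<in> s}"
      then have sc: "(a div 2, b1 div 2) \<in> s" "b2 = Suc b1" using R(2,3) unfolding mem_unit_rects by (auto simp: le_less_Suc_eq)
      show ?thesis
      proof (cases "b = b1")
        case True
        then show ?thesis using sc edges(1)[OF sc(1)] by (simp add: refine_h_def)
      next
        case False
        then have b: "b = Suc b1" using R(4) sc by simp
        show ?thesis
        proof (cases "even b")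
          case True
          then have "b div 2 = Suc (b1 div 2)" using b by (auto elim!: evenE)
          then show ?thesis using True edges(2)[OF sc(1)] by (simp add: refine_h_def)
        next
          case False
          then have "b div 2 = b1 div 2" using b by auto
          then show ?thesis using False sc(1) by (simp add: refine_h_def)
        qed
      qed
    qed
  next
    assume r: "refine_h (h_line D) s a b"
    have unit: "h_line ?D a c" if "(a div 2, b' div 2) \<in> s" "c = b' \<or> c = Suc b'" for b' c
    proof -
      have "unit_rect (a, b') \<in> ?D" using that(1) by blast
      then have "(a, Suc a, b', Suc b') \<in> ?D" by simp
      then show ?thesis using that(2) unfolding h_line_def by (metis le_refl lessI)
    qed
    show "h_line ?D a b"
    proof (cases "even b")
      case False
      then show ?thesis using r unit[of b b] by (simp add: refine_h_def)
    next
      case True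
      then have "h_line D (a div 2) (b div 2)" using r by (simp add: refine_h_def)
      then obtain a1 a2 b1 b2 where R: "(a1, a2, b1, b2) \<in> D" "a1 \<le> a div 2" "a div 2 < a2" "b div 2 = b1 \<or> b div 2 = b2"
        unfolding h_line_def by blast
      show ?thesis
      proof (cases "(a1, a2, b1, b2) \<in> unit_rect ` s")
        case True
        then have sc: "(a div 2, b1) \<in> s" "b2 = Suc b1" using R(2,3) unfolding mem_unit_rects by (auto simp: le_less_Suc_eq)
        show ?thesis
        proof (cases "b div 2 = b1")
          case True
          then show ?thesis using unit[of b b] sc by simp
        next
          case False
          then have "b = Suc (2 * b1 + 1)" using R(4) sc(2) \<open>even b\<close> by (auto elim!: evenE)
          then show ?thesis using unit[of "2 * b1 + 1" b] sc(1) by simp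
        qed
      next
        case False
        then have "double_rect (a1, a2, b1, b2) \<in> ?D" using R(1) by blast
        then have "(2 * a1, 2 * a2, 2 * b1, 2 * b2) \<in> ?D" by simp
        moreover have "2 * a1 \<le> a" "a < 2 * a2" "b = 2 * b1 \<or> b = 2 * b2" using R(2-4) True by (auto elim!: evenE)
        ultimately show ?thesis unfolding h_line_def by blast
      qed
    qed
  qed
qed

section \<open>The levels of a hierarchical mesh on index grids\<close>

text \<open>The coordinates are infinite increasing sequences, of which only the indices up to
  \<open>m\<close> and \<open>n\<close> belong to the initial mesh; no bounds then have to be
  carried along with the coordinates.\<close>

locale hierarchy =
  fixes d m n :: nat and x y :: "nat \<Rightarrow> real" and S :: "nat \<Rightarrow> mesh"
  assumes d: "2 \<le> d" and mn: "1 \<le> m" "1 \<le> n" and mono: "strict_mono x" "strict_mono y"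
    and unbounded: "\<And>z. \<exists>i. z < x i" "\<And>z. \<exists>j. z < y j"
begin

definition X where "X k = dyadic x k"
definition Y where "Y k = dyadic y k"

definition cell :: "nat \<Rightarrow> nat \<times> nat \<Rightarrow> (real \<times> real) set" where
  "cell k c = cbox (X k (fst c), Y k (snd c)) (X k (Suc (fst c)), Y k (Suc (snd c)))"

definition s :: "nat \<Rightarrow> (nat \<times> nat) set" where
  "s k = {c. cell k c \<in> S k}"

primrec A :: "nat \<Rightarrow> (nat \<times> nat) set" where
  "A 0 = {..<m} \<times> {..<n}"
| "A (Suc k) = {(a, b). (a div 2, b div 2) \<in> s k}"

text \<open>The cells of level less than \<open>k\<close> that are not subdivided, on the index scale of level \<open>k\<close>.\<close>

primrec old_rects :: "nat \<Rightarrow> index_rect set" where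
  "old_rects 0 = {}"
| "old_rects (Suc k) = double_rect ` (old_rects k \<union> unit_rect ` (A k - s k))"

definition rects :: "nat \<Rightarrow> index_rect set" where
  "rects k = old_rects k \<union> unit_rect ` A k"

lemmas A_Suc = A.simps(2)

abbreviation M0 :: mesh where "M0 \<equiv> cell 0 ` A 0"

lemma mono_XY: "strict_mono (X k)" "strict_mono (Y k)"
  unfolding X_def Y_def using mono by (auto intro: strict_mono_dyadic)

lemma order_XY:
  "X k i < X k j \<longleftrightarrow> i < j" "Y k i < Y k j \<longleftrightarrow> i < j" "X k i = X k j \<longleftrightarrow> i = j" "Y k i = Y k j \<longleftrightarrow> i = j"
  using mono_XY by (auto simp: strict_mono_less strict_mono_eq)

lemma double_XY: "X (Suc k) (2 * i) = X k i" "Y (Suc k) (2 * i) = Y k i"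
  unfolding X_def Y_def by (rule dyadic_even)+

lemma mid_XY:
  "X (Suc k) (Suc (2 * i)) = (X k i + X k (Suc i)) / 2" "Y (Suc k) (Suc (2 * i)) = (Y k i + Y k (Suc i)) / 2"
  "X (Suc k) (Suc (Suc (2 * i))) = X k (Suc i)" "Y (Suc k) (Suc (Suc (2 * i))) = Y k (Suc i)"
  using double_XY(1)[of k "Suc i"] double_XY(2)[of k "Suc i"] unfolding X_def Y_def
  by (simp_all del: dyadic.simps add: dyadic_odd)

lemma cell_eq_iff:
  "cbox (a, b) (a', b') = cell k (i, j) \<longleftrightarrow> a = X k i \<and> b = Y k j \<and> a' = X k (Suc i) \<and> b' = Y k (Suc j)"
proof -
  have "cell k (i, j) \<noteq> {}" using order_XY(1)[of k i "Suc i"] order_XY(2)[of k j "Suc j"]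
    by (auto simp: cell_def cbox_Pair_eq)
  then show ?thesis unfolding cell_def eq_cbox by auto
qed

lemma inj_cell: "inj (cell k)"
proof (rule injI)
  fix c c' assume "cell k c = cell k c'"
  then have "cbox (X k (fst c), Y k (snd c)) (X k (Suc (fst c)), Y k (Suc (snd c))) = cell k (fst c', snd c')"
    by (simp add: cell_def)
  then show "c = c'" unfolding cell_eq_iff by (simp add: order_XY prod_eq_iff)
qed

lemma cross_subdivision_cell:
  "cross_subdivision (cell k (i, j)) =
    cell (Suc k) ` {(2 * i, 2 * j), (Suc (2 * i), 2 * j), (2 * i, Suc (2 * j)), (Suc (2 * i), Suc (2 * j))}"
proof -
  have lt: "X k i < X k (Suc i)" "Y k j < Y k (Suc j)" by (simp_all add: order_XY)
  have "Q \<in> cross_subdivision (cell k (i, j)) \<longleftrightarrow>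
      Q \<in> {cbox (X k i, Y k j) ((X k i + X k (Suc i)) / 2, (Y k j + Y k (Suc j)) / 2),
        cbox ((X k i + X k (Suc i)) / 2, Y k j) (X k (Suc i), (Y k j + Y k (Suc j)) / 2),
        cbox (X k i, (Y k j + Y k (Suc j)) / 2) ((X k i + X k (Suc i)) / 2, Y k (Suc j)),
        cbox ((X k i + X k (Suc i)) / 2, (Y k j + Y k (Suc j)) / 2) (X k (Suc i), Y k (Suc j))}" for Q
    unfolding cross_subdivision_def mem_Collect_eq eq_commute[of "cell k (i, j)"] cell_eq_iff using lt by blast
  then show ?thesis unfolding set_eq_iff by (simp add: cell_def double_XY mid_XY)
qed

end

locale hierarchical_splines = hierarchy +
  assumes blocks: "\<And>k. union_of_blocks (d - 1) (level_cells M0 S k) (S k)"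
    and interior: "\<And>K. K \<in> S 0 \<Longrightarrow> interior_cell (hierarchical_mesh M0 S 0) K"
begin

lemma level_cells: "level_cells M0 S k = cell k ` A k" "S k = cell k ` s k" "s k \<subseteq> A k"
proof -
  have S: "S k = cell k ` s k" "s k \<subseteq> A k" if L: "level_cells M0 S k = cell k ` A k" for k
  proof -
    have sub: "S k \<subseteq> cell k ` A k" using blocks[of k] L unfolding union_of_blocks_def by blast
    then show "S k = cell k ` s k" unfolding s_def by blast
    show "s k \<subseteq> A k"
    proof
      fix c assume "c \<in> s k"
      then have "cell k c \<in> cell k ` A k" using sub unfolding s_def by blast
      then show "c \<in> A k" using inj_cell by (simp add: inj_image_mem_iff)
    qed
  qed
  have "level_cells M0 S k = cell k ` A k" for k
  proof (induction k)
    case (Suc k)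
    have "level_cells M0 S (Suc k) = (\<Union>c\<in>s k. cross_subdivision (cell k c))" using S(1)[OF Suc] by simp
    also have "\<dots> = (\<Union>(i, j)\<in>s k. cell (Suc k) ` {(2 * i, 2 * j), (Suc (2 * i), 2 * j), (2 * i, Suc (2 * j)), (Suc (2 * i), Suc (2 * j))})"
      using cross_subdivision_cell by (intro SUP_cong) auto
    also have "\<dots> = cell (Suc k) ` (\<Union>(i, j)\<in>s k. {(2 * i, 2 * j), (Suc (2 * i), 2 * j), (2 * i, Suc (2 * j)), (Suc (2 * i), Suc (2 * j))})"
      by (simp add: image_UN split_def)
    also have "(\<Union>(i, j)\<in>s k. {(2 * i, 2 * j), (Suc (2 * i), 2 * j), (2 * i, Suc (2 * j)), (Suc (2 * i), Suc (2 * j))}) = A (Suc k)"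
    proof (intro equalityI subsetI)
      fix v assume "v \<in> A (Suc k)"
      then obtain a b where v: "v = (a, b)" "(a div 2, b div 2) \<in> s k" by auto
      have "a = 2 * (a div 2) \<or> a = Suc (2 * (a div 2))" "b = 2 * (b div 2) \<or> b = Suc (2 * (b div 2))" by linarith+
      then have "v \<in> {(2 * (a div 2), 2 * (b div 2)), (Suc (2 * (a div 2)), 2 * (b div 2)),
          (2 * (a div 2), Suc (2 * (b div 2))), (Suc (2 * (a div 2)), Suc (2 * (b div 2)))}" using v(1) by blast
      then show "v \<in> (\<Union>(i, j)\<in>s k. {(2 * i, 2 * j), (Suc (2 * i), 2 * j), (2 * i, Suc (2 * j)), (Suc (2 * i), Suc (2 * j))})"
        using v(2) by blast
    qed auto
    finally show ?case .
  qed simp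
  then show "level_cells M0 S k = cell k ` A k" "S k = cell k ` s k" "s k \<subseteq> A k" using S[of k] by simp_all
qed

text \<open>Every cell of the tensor grid is a level-\<open>k\<close> cell, so each coordinate of
  the grid determines the next one as the neighbouring level-\<open>k\<close> line. The grid is thus
  a block of consecutive indices.\<close>

lemma covered: "covered_by_blocks (d - 1) (s k)"
  unfolding covered_by_blocks_def
proof
  fix c assume c: "c \<in> s k"
  then have "cell k c \<in> S k" by (simp add: s_def)
  obtain \<B> where \<B>: "\<forall>B\<in>\<B>. B \<subseteq> cell k ` A k \<and> tensor_grid (d - 1) (d - 1) B" "S k = \<Union>\<B>"
    using blocks[of k] unfolding union_of_blocks_def level_cells(1)[of k] by (elim exE conjE)
  obtain B where "B \<in> \<B>" "cell k c \<in> B" using \<open>cell k c \<in> S k\<close> \<B>(2) by auto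
  then have B: "cell k c \<in> B" "B \<subseteq> cell k ` A k" "B \<subseteq> S k" "tensor_grid (d - 1) (d - 1) B"
    using \<B> by auto
  obtain u v :: "nat \<Rightarrow> real" where uv:
    "B = {cbox (u i, v j) (u (Suc i), v (Suc j)) | i j. i < d - 1 \<and> j < d - 1}"
    using B(4) unfolding tensor_grid_def by blast
  have d0: "0 < d - 1" using d by simp
  have ex: "\<exists>p q. u i = X k p \<and> v j = Y k q \<and> u (Suc i) = X k (Suc p) \<and> v (Suc j) = Y k (Suc q)"
    if "i < d - 1" "j < d - 1" for i j
  proof -
    have "cbox (u i, v j) (u (Suc i), v (Suc j)) \<in> B" using that uv by blast
    then obtain p q where "cbox (u i, v j) (u (Suc i), v (Suc j)) = cell k (p, q)"
      using B(2) by (auto simp: subset_iff image_iff)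
    then show ?thesis unfolding cell_eq_iff by blast
  qed
  obtain p q where pq: "u 0 = X k p" "v 0 = Y k q" using ex[OF d0 d0] by blast
  have u: "u i = X k (p + i)" if "i \<le> d - 1" for i
    using that
  proof (induction i)
    case (Suc i)
    then obtain p' where "u i = X k p'" "u (Suc i) = X k (Suc p')" using ex[of i 0] d0 by auto
    then show ?case using Suc by (simp add: order_XY)
  qed (use pq in simp)
  have v: "v j = Y k (q + j)" if "j \<le> d - 1" for j
    using that
  proof (induction j)
    case (Suc j)
    then obtain q' where "v j = Y k q'" "v (Suc j) = Y k (Suc q')" using ex[of 0 j] d0 by auto
    then show ?case using Suc by (simp add: order_XY)
  qed (use pq in simp)
  have uv_cell: "cbox (u i, v j) (u (Suc i), v (Suc j)) = cell k (p + i, q + j)" if "i < d - 1" "j < d - 1" for i j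
    unfolding cell_eq_iff using that by (simp add: u v)
  obtain i j where ij: "cell k c = cell k (p + i, q + j)" "i < d - 1" "j < d - 1" using B(1) uv_cell unfolding uv by auto
  have "c = (p + i, q + j)" using ij(1) inj_cell by (auto dest: injD)
  moreover have "(a, b) \<in> s k" if "p \<le> a" "a < p + (d - 1)" "q \<le> b" "b < q + (d - 1)" for a b
  proof -
    have ab: "a - p < d - 1" "b - q < d - 1" using that by linarith+
    have "cbox (u (a - p), v (b - q)) (u (Suc (a - p)), v (Suc (b - q))) \<in> B" using uv ab by blast
    then have "cell k (a, b) \<in> B" using uv_cell[OF ab] that by simp
    then show ?thesis using B(3) unfolding s_def by blast
  qed
  ultimately have "is_block (d - 1) (s k) (p, q) c" using ij(2,3) unfolding is_block_def by auto
  then show "\<exists>b. is_block (d - 1) (s k) b c" by blast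
qed

text \<open>On the index scale of level \<open>k\<close> a cell of lower level is at least two units
  wide. It is never confused with a unit cell, so removing subdivided cells affects only the current
  level.\<close>

lemma old_rects_large: "(a1, a2, b1, b2) \<in> old_rects k \<Longrightarrow> Suc a1 < a2"
  "unit_rect c \<notin> old_rects k"
proof -
  have large: "(a1, a2, b1, b2) \<in> old_rects k \<Longrightarrow> Suc a1 < a2" for a1 a2 b1 b2 k
  proof (induction k arbitrary: a1 a2 b1 b2)
    case (Suc k)
    then obtain a1' a2' b1' b2' where R: "(a1', a2', b1', b2') \<in> old_rects k \<union> unit_rect ` (A k - s k)" "a1 = 2 * a1'" "a2 = 2 * a2'"
      unfolding old_rects.simps mem_double_rects by blast
    then have "a1' < a2'" using Suc.IH[of a1' a2' b1' b2'] by (auto simp: mem_unit_rects)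
    then show ?case using R by simp
  qed simp
  show "(a1, a2, b1, b2) \<in> old_rects k \<Longrightarrow> Suc a1 < a2" by (rule large)
  show "unit_rect c \<notin> old_rects k" using large[of "fst c" "Suc (fst c)" "snd c" "Suc (snd c)" k] by (cases c) auto
qed

lemma rects_Suc: "rects (Suc k) = double_rect ` (rects k - unit_rect ` s k) \<union> unit_rect ` A (Suc k)"
proof -
  have inj: "inj unit_rect" by (auto simp: inj_def)
  have "rects k - unit_rect ` s k = old_rects k \<union> unit_rect ` (A k - s k)"
    unfolding rects_def using old_rects_large(2)[of _ k] inj by (auto dest: injD)
  then show ?thesis unfolding rects_def[of "Suc k"] by simp
qed

lemma unit_in_rects: "c \<in> s k \<Longrightarrow> unit_rect c \<in> rects k"
  unfolding rects_def using level_cells(3) by blast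

lemma rects_bounded: "(a1, a2, b1, b2) \<in> rects k \<Longrightarrow> a1 < a2 \<and> a2 \<le> m * 2 ^ k \<and> b1 < b2 \<and> b2 \<le> n * 2 ^ k"
proof (induction k arbitrary: a1 a2 b1 b2)
  case 0
  then show ?case by (auto simp: rects_def)
next
  case (Suc k)
  from Suc.prems consider R where "R \<in> rects k" "(a1, a2, b1, b2) = double_rect R"
    | c where "c \<in> A (Suc k)" "(a1, a2, b1, b2) = unit_rect c" unfolding rects_Suc by blast
  then show ?case
  proof cases
    case 1
    obtain a1' a2' b1' b2' where R: "R = (a1', a2', b1', b2')" by (cases R)
    then show ?thesis using Suc.IH[of a1' a2' b1' b2'] 1 by auto
  next
    case 2
    obtain a b where c: "c = (a, b)" by (cases c)
    have "(a div 2, b div 2) \<in> s k" using 2 c by simp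
    then have "(a div 2, Suc (a div 2), b div 2, Suc (b div 2)) \<in> rects k" using unit_in_rects by fastforce
    then have "Suc (a div 2) \<le> m * 2 ^ k" "Suc (b div 2) \<le> n * 2 ^ k" using Suc.IH by blast+
    then have "Suc a \<le> 2 * (m * 2 ^ k)" "Suc b \<le> 2 * (n * 2 ^ k)" by linarith+
    then show ?thesis using 2 c by auto
  qed
qed

lemma rects_cover: "a < m * 2 ^ k \<Longrightarrow> b < n * 2 ^ k \<Longrightarrow> \<exists>R\<in>rects k. in_rect (a, b) R"
proof (induction k arbitrary: a b)
  case 0
  then have "unit_rect (a, b) \<in> rects 0" by (simp add: rects_def mem_unit_rects)
  moreover have "in_rect (a, b) (unit_rect (a, b))" by simp
  ultimately show ?case by blast
next
  case (Suc k)
  have "a div 2 < m * 2 ^ k" "b div 2 < n * 2 ^ k" using Suc.prems by auto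
  then obtain R where R: "R \<in> rects k" "in_rect (a div 2, b div 2) R" using Suc.IH by blast
  show ?case
  proof (cases "R \<in> unit_rect ` s k")
    case True
    then have "(a, b) \<in> A (Suc k)" using R(2) by (auto simp: in_unit_rect simp del: unit_rect.simps in_rect.simps)
    moreover have "in_rect (a, b) (unit_rect (a, b))" by simp
    ultimately show ?thesis unfolding rects_Suc by blast
  next
    case False
    then have "double_rect R \<in> rects (Suc k)" using R unfolding rects_Suc by blast
    then show ?thesis using R(2) in_double_rect by blast
  qed
qed

text \<open>In the mixed case the halved index cell is covered by an old rectangle and by a
  subdivided unit cell. By induction they coincide, but subdivided cells have been removed.\<close>

lemma rects_unique: "R \<in> rects k \<Longrightarrow> R' \<in> rects k \<Longrightarrow> in_rect (a, b) R \<Longrightarrow> in_rect (a, b) R' \<Longrightarrow> R = R'"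
proof (induction k arbitrary: a b R R')
  case 0
  then show ?case by (auto simp: rects_def)
next
  case (Suc k)
  have mixed: False if "P \<in> rects k - unit_rect ` s k" "in_rect (a, b) (double_rect P)" "c \<in> A (Suc k)" "in_rect (a, b) (unit_rect c)" for P c
  proof -
    have c: "c = (a, b)" "(a div 2, b div 2) \<in> s k" using that(3,4) by (auto simp: in_unit_rect simp del: unit_rect.simps in_rect.simps)
    then have "P = unit_rect (a div 2, b div 2)"
      using that(1,2) unit_in_rects[OF c(2)]
      by (intro Suc.IH[of _ _ "a div 2" "b div 2"])
        (simp_all add: in_unit_rect in_double_rect del: unit_rect.simps in_rect.simps double_rect.simps)
    then show False using that(1) c(2) by blast
  qed
  from Suc.prems(1) show ?case
    unfolding rects_Suc
  proof
    assume "R \<in> double_rect ` (rects k - unit_rect ` s k)"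
    then obtain P where P: "R = double_rect P" "P \<in> rects k - unit_rect ` s k" by blast
    from Suc.prems(2) show ?case
      unfolding rects_Suc
    proof
      assume "R' \<in> double_rect ` (rects k - unit_rect ` s k)"
      then obtain P' where P': "R' = double_rect P'" "P' \<in> rects k - unit_rect ` s k" by blast
      then have "P = P'"
        using P Suc.prems(3,4) by (intro Suc.IH[of _ _ "a div 2" "b div 2"]) (simp_all add: in_double_rect)
      then show ?case using P P' by simp
    next
      assume "R' \<in> unit_rect ` A (Suc k)"
      then obtain c where "R' = unit_rect c" "c \<in> A (Suc k)" by blast
      then show ?case using mixed[OF P(2), of c] P(1) Suc.prems(3,4) by simp
    qed
  next
    assume "R \<in> unit_rect ` A (Suc k)"
    then obtain c where c: "R = unit_rect c" "c \<in> A (Suc k)" by blast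
    from Suc.prems(2) show ?case
      unfolding rects_Suc
    proof
      assume "R' \<in> double_rect ` (rects k - unit_rect ` s k)"
      then obtain P where "R' = double_rect P" "P \<in> rects k - unit_rect ` s k" by blast
      then show ?case using mixed[of P c] c Suc.prems(3,4) by simp
    next
      assume "R' \<in> unit_rect ` A (Suc k)"
      then obtain c' where "R' = unit_rect c'" by blast
      then show ?case using c(1) Suc.prems(3,4) in_unit_rect by metis
    qed
  qed
qed

sublocale T: tiling "X k" "Y k" "m * 2 ^ k" "n * 2 ^ k" "rects k" for k
proof
  show "strict_mono (X k)" "strict_mono (Y k)" by (rule mono_XY)+
  show "\<exists>i. z < X k i" "\<exists>i. z < Y k i" for z unfolding X_def Y_def using unbounded by (auto intro: dyadic_unbounded)
  show "0 < m * 2 ^ k" "0 < n * 2 ^ k" using mn by simp_all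
  show "a1 < a2 \<and> a2 \<le> m * 2 ^ k \<and> b1 < b2 \<and> b2 \<le> n * 2 ^ k" if "(a1, a2, b1, b2) \<in> rects k" for a1 a2 b1 b2
    using rects_bounded[OF that] .
  show "\<exists>a1 a2 b1 b2. (a1, a2, b1, b2) \<in> rects k \<and> a1 \<le> a \<and> a < a2 \<and> b1 \<le> b \<and> b < b2"
    if "a < m * 2 ^ k" "b < n * 2 ^ k" for a b
    using rects_cover[OF that] by (metis in_rect.simps prod_cases4)
  show "(a1, a2, b1, b2) = (a1', a2', b1', b2')"
    if "(a1, a2, b1, b2) \<in> rects k" "a1 \<le> a" "a < a2" "b1 \<le> b" "b < b2"
      "(a1', a2', b1', b2') \<in> rects k" "a1' \<le> a" "a < a2'" "b1' \<le> b" "b < b2'" for a b a1 a2 b1 b2 a1' a2' b1' b2'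
    by (rule rects_unique[OF that(1,6), of a b]) (use that in auto)
qed

fun rect_cell :: "nat \<Rightarrow> index_rect \<Rightarrow> (real \<times> real) set" where
  "rect_cell k (a1, a2, b1, b2) = cbox (X k a1, Y k b1) (X k a2, Y k b2)"

lemma rect_cell_double: "rect_cell (Suc k) (double_rect R) = rect_cell k R"
  by (cases R) (simp add: double_XY)

lemma rect_cell_unit: "rect_cell k (unit_rect c) = cell k c"
  by (cases c) (simp add: cell_def)

lemma old_rects_cells: "rect_cell k ` old_rects k = (\<Union>l<k. level_cells M0 S l - S l)"
proof (induction k)
  case (Suc k)
  have "rect_cell (Suc k) ` old_rects (Suc k) = rect_cell k ` (old_rects k \<union> unit_rect ` (A k - s k))"
    by (simp add: image_image rect_cell_double)
  also have "\<dots> = rect_cell k ` old_rects k \<union> cell k ` (A k - s k)"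
    by (simp add: image_Un image_image rect_cell_unit)
  also have "cell k ` (A k - s k) = level_cells M0 S k - S k"
    unfolding level_cells(1) level_cells(2)[of k] by (rule image_set_diff[OF inj_cell])
  finally show ?case using Suc.IH by (auto simp: lessThan_Suc)
qed simp

lemma hierarchical_mesh: "hierarchical_mesh M0 S k = T.mesh k"
proof -
  have "T.mesh k = rect_cell k ` rects k"
    unfolding T.mesh_def by force
  also have "\<dots> = (\<Union>l<k. level_cells M0 S l - S l) \<union> level_cells M0 S k"
    unfolding rects_def image_Un old_rects_cells level_cells(1) by (simp add: image_image rect_cell_unit)
  finally show ?thesis unfolding hierarchical_mesh_def by simp
qed

lemma unit_in_rects': "(i, j) \<in> s k \<Longrightarrow> (i, Suc i, j, Suc j) \<in> rects k"
  using unit_in_rects[of "(i, j)" k] by simp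

lemma cell_edges:
  assumes "(i, j) \<in> s k" shows "T.H k i j" "T.H k i (Suc j)" "T.V k i j" "T.V k (Suc i) j"
  using unit_in_rects'[OF assms] unfolding T.H_def T.V_def by (metis le_refl lessI)+

lemma refine_H: "T.H (Suc k) = refine_h (T.H k) (s k)"
proof -
  have H: "T.H k = h_line (rects k)" for k by (simp add: fun_eq_iff T.H_def h_line_def)
  have "h_line (rects (Suc k)) = refine_h (h_line (rects k)) (s k)"
    unfolding rects_Suc A_Suc using unit_in_rects by (intro refine_h_line) blast
  then show ?thesis unfolding H .
qed

text \<open>This is the horizontal statement for the transposed rectangles.\<close>

lemma refine_V: "T.V (Suc k) = refine_v (T.V k) (s k)"
proof (intro ext)
  fix a b
  have V: "T.V k a b = h_line (flip_rect ` rects k) b a" for k a b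
    unfolding T.V_def h_line_def by force
  have "flip_rect ` rects (Suc k) =
      double_rect ` (flip_rect ` rects k - unit_rect ` (s k)\<inverse>) \<union> unit_rect ` {(b, a). (b div 2, a div 2) \<in> (s k)\<inverse>}"
  proof -
    have unit: "flip_rect ` unit_rect ` Z = unit_rect ` (Z\<inverse>)" for Z by (force simp: image_iff)
    have "flip_rect ` double_rect ` Z = double_rect ` flip_rect ` Z" for Z by (force simp: image_iff)
    moreover have "{(a, b). (a div 2, b div 2) \<in> s k}\<inverse> = {(b, a). (b div 2, a div 2) \<in> (s k)\<inverse>}" by auto
    moreover have "inj flip_rect" by (auto simp: inj_def)
    ultimately show ?thesis unfolding rects_Suc A_Suc by (simp add: image_Un unit image_set_diff)
  qed
  moreover have "unit_rect ` (s k)\<inverse> \<subseteq> flip_rect ` rects k"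
  proof
    fix R assume "R \<in> unit_rect ` (s k)\<inverse>"
    then obtain i j where "R = flip_rect (unit_rect (i, j))" "(i, j) \<in> s k" by auto
    then show "R \<in> flip_rect ` rects k" using unit_in_rects by blast
  qed
  ultimately have "h_line (flip_rect ` rects (Suc k)) = refine_h (h_line (flip_rect ` rects k)) ((s k)\<inverse>)"
    by (simp only: refine_h_line)
  then have "T.V (Suc k) a b = refine_h (\<lambda>b a. T.V k a b) ((s k)\<inverse>) b a" unfolding V by simp
  then show "T.V (Suc k) a b = refine_v (T.V k) (s k) a b" by (simp add: refine_h_def refine_v_def)
qed

lemma level_0: "T.H 0 = tensor_h m n" "T.V 0 = tensor_v m n"
proof -
  have D: "rects 0 = {(i, Suc i, j, Suc j) | i j. i < m \<and> j < n}" by (force simp: rects_def)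
  show "T.H 0 = tensor_h m n"
  proof (intro ext)
    fix a b
    have "T.H 0 a b \<longleftrightarrow> (\<exists>j<n. a < m \<and> (b = j \<or> b = Suc j))"
      unfolding T.H_def unfolding D by (auto simp: le_less_Suc_eq)
    also have "\<dots> \<longleftrightarrow> a < m \<and> b \<le> n" using mn by (cases b) (auto simp: Suc_le_eq)
    finally show "T.H 0 a b = tensor_h m n a b" by (simp add: tensor_h_def)
  qed
  show "T.V 0 = tensor_v m n"
  proof (intro ext)
    fix a b
    have "T.V 0 a b \<longleftrightarrow> (\<exists>i<m. b < n \<and> (a = i \<or> a = Suc i))"
      unfolding T.V_def unfolding D by (auto simp: le_less_Suc_eq)
    also have "\<dots> \<longleftrightarrow> a \<le> m \<and> b < n" using mn by (cases a) (auto simp: Suc_le_eq)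
    finally show "T.V 0 a b = tensor_v m n a b" by (simp add: tensor_v_def)
  qed
qed

lemma s_0_inner: "(i, j) \<in> s 0 \<Longrightarrow> 0 < i \<and> Suc i < m \<and> 0 < j \<and> Suc j < n"
proof -
  assume s: "(i, j) \<in> s 0"
  then have "interior_cell (T.mesh 0) (cell 0 (i, j))" using interior hierarchical_mesh by (simp add: s_def)
  then show ?thesis using T.unit_interior_cell[OF unit_in_rects'[OF s]] by (simp add: cell_def)
qed

text \<open>At level 0 the outermost ring of cells is excluded, and later subdivided cells lie in
  earlier ones.\<close>

lemma s_inner: "(i, j) \<in> s k \<Longrightarrow> 2 ^ k \<le> i \<and> i < (m - 1) * 2 ^ k \<and> 2 ^ k \<le> j \<and> j < (n - 1) * 2 ^ k"
proof (induction k arbitrary: i j)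
  case 0
  then show ?case using s_0_inner[of i j] by auto
next
  case (Suc k)
  have "(i div 2, j div 2) \<in> s k" using Suc.prems level_cells(3)[of "Suc k"] by auto
  from Suc.IH[OF this] show ?case by auto
qed

text \<open>The frame consists of the lines of the initial mesh next to its boundary, rescaled to
  level \<open>k\<close>. Old cross-nodes lie in it by induction; a new one needs a subdivided cell
  to its upper right, which lies inside the frame. For \<open>m = 1\<close> or \<open>n = 1\<close>
  the frame is empty.\<close>

lemma frame: "framed_tiling (X k) (Y k) (m * 2 ^ k) (n * 2 ^ k) (rects k) (2 ^ k) ((m - 1) * 2 ^ k) (2 ^ k) ((n - 1) * 2 ^ k)"
proof (induction k)
  case 0
  show ?case
    by unfold_locales (auto simp: level_0 cross_nodes_def tensor_h_def tensor_v_def)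
next
  case (Suc k)
  interpret F: framed_tiling "X k" "Y k" "m * 2 ^ k" "n * 2 ^ k" "rects k" "2 ^ k" "(m - 1) * 2 ^ k" "2 ^ k" "(n - 1) * 2 ^ k"
    by (rule Suc.IH)
  have even: "(2 * a, 2 * b) \<in> cross_nodes (T.H (Suc k)) (T.V (Suc k)) \<longleftrightarrow> (a, b) \<in> cross_nodes (T.H k) (T.V k)" for a b
  proof -
    have "(2 * a - Suc 0) div 2 = a - 1" "(2 * b - Suc 0) div 2 = b - 1" by presburger+
    then show ?thesis by (simp add: cross_nodes_def refine_H refine_V refine_h_def refine_v_def)
  qed
  show ?case
  proof unfold_locales
    show "cross_nodes (T.H (Suc k)) (T.V (Suc k)) \<subseteq> {2 ^ Suc k..(m - 1) * 2 ^ Suc k} \<times> {2 ^ Suc k..(n - 1) * 2 ^ Suc k}"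
    proof clarify
      fix a b assume c: "(a, b) \<in> cross_nodes (T.H (Suc k)) (T.V (Suc k))"
      show "a \<in> {2 ^ Suc k..(m - 1) * 2 ^ Suc k} \<and> b \<in> {2 ^ Suc k..(n - 1) * 2 ^ Suc k}"
      proof (cases "even a \<and> even b")
        case True
        then obtain a' b' where ab: "a = 2 * a'" "b = 2 * b'" by (auto elim!: evenE)
        then have "(a', b') \<in> cross_nodes (T.H k) (T.V k)" using c even by simp
        then have "(a', b') \<in> {2 ^ k..(m - 1) * 2 ^ k} \<times> {2 ^ k..(n - 1) * 2 ^ k}" using F.cross_in by blast
        then show ?thesis using ab by simp
      next
        case False
        then have "(a div 2, b div 2) \<in> s k"
          using c by (auto simp: cross_nodes_def refine_H refine_V refine_h_def refine_v_def)
        from s_inner[OF this] show ?thesis by auto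
      qed
    qed
    assume "2 ^ Suc k \<le> (m - 1) * 2 ^ Suc k" "2 ^ Suc k \<le> (n - 1) * 2 ^ Suc k"
    then have c: "{2 ^ k, (m - 1) * 2 ^ k} \<times> {2 ^ k, (n - 1) * 2 ^ k} \<subseteq> cross_nodes (T.H k) (T.V k)"
      by (intro F.frame_corners) auto
    have "(2 ^ k, 2 ^ k) \<in> cross_nodes (T.H k) (T.V k)" "(2 ^ k, (n - 1) * 2 ^ k) \<in> cross_nodes (T.H k) (T.V k)"
      "((m - 1) * 2 ^ k, 2 ^ k) \<in> cross_nodes (T.H k) (T.V k)" "((m - 1) * 2 ^ k, (n - 1) * 2 ^ k) \<in> cross_nodes (T.H k) (T.V k)"
      using c by blast+
    from this[folded even] show "{2 ^ Suc k, (m - 1) * 2 ^ Suc k} \<times> {2 ^ Suc k, (n - 1) * 2 ^ Suc k} \<subseteq> cross_nodes (T.H (Suc k)) (T.V (Suc k))"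
      by (simp add: mult.left_commute)
  next
    fix i assume i: "2 ^ Suc k \<le> i" "i < (m - 1) * 2 ^ Suc k" "2 ^ Suc k \<le> (n - 1) * 2 ^ Suc k"
    then have "T.H k (i div 2) (2 ^ k) \<and> T.H k (i div 2) ((n - 1) * 2 ^ k)" by (intro F.frame_h) auto
    then show "T.H (Suc k) i (2 ^ Suc k) \<and> T.H (Suc k) i ((n - 1) * 2 ^ Suc k)"
      by (simp add: refine_H refine_h_def)
  next
    fix j assume j: "2 ^ Suc k \<le> j" "j < (n - 1) * 2 ^ Suc k" "2 ^ Suc k \<le> (m - 1) * 2 ^ Suc k"
    then have "T.V k (2 ^ k) (j div 2) \<and> T.V k ((m - 1) * 2 ^ k) (j div 2)" by (intro F.frame_v) auto
    then show "T.V (Suc k) (2 ^ Suc k) j \<and> T.V (Suc k) ((m - 1) * 2 ^ Suc k) j"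
      by (simp add: refine_V refine_v_def)
  qed
qed

lemma bounded_HV: "bounded_edges (max (m * 2 ^ k) (n * 2 ^ k)) (T.H k) (T.V k)"
  using T.H_bounded T.V_bounded unfolding bounded_edges_def by (auto simp: le_max_iff_disj less_max_iff_disj)

lemma refinement_level: "refinement d (T.H k) (T.V k) (X k) (Y k) (X (Suc k)) (Y (Suc k)) (s k)"
  by unfold_locales (use d covered mono_XY double_XY cell_edges in auto)

lemma dual_bipoly_level: "dual_bipoly C d (T.H k) (T.V k) (X k) (Y k) (s k)"
proof (induction k)
  case 0
  show ?case
  proof (cases "s 0 = {}")
    case True
    then show ?thesis unfolding True dual_bipoly_def bipoly_on_cells_def row_match_def by simp
  next
    case False
    then obtain c p q where "is_block (d - 1) (s 0) (p, q) c" using covered[of 0] unfolding covered_by_blocks_def by fast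
    then have block: "{p..<p + (d - 1)} \<times> {q..<q + (d - 1)} \<subseteq> s 0" by (simp add: is_block_def)
    \<comment> \<open>The first and last cell of a block are both interior, so \<open>0 < p\<close>
      and \<open>p + (d - 1) < m\<close>. This leaves enough lines for the interpolation on the
      tensor product mesh.\<close>
    have "(p, q) \<in> s 0" "(p + (d - 2), q + (d - 2)) \<in> s 0" using d by (auto intro!: subsetD[OF block])
    from s_0_inner[OF this(1)] s_0_inner[OF this(2)] have "d < m" "d < n" by linarith+
    then show ?thesis unfolding level_0 using d mono_XY s_0_inner by (intro dual_bipoly_tensor) auto
  qed
next
  case (Suc k)
  have "(a div 2, b div 2) \<in> s k" if "(a, b) \<in> s (Suc k)" for a b using that level_cells(3)[of "Suc k"] by auto
  then show ?case
    unfolding refine_H refine_V by (intro refinement.dual_bipoly_refine[OF refinement_level Suc.IH])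
qed

lemma dim_level_eq:
  "fun_space.dim (coeff_space d (T.H k) (T.V k) (X k) (Y k) UNIV UNIV UNIV) =
   fun_space.dim (coeff_space (d - 2) (T.H k) (T.V k) (X k) (Y k) (cross_nodes (T.H k) (T.V k)) UNIV UNIV)"
proof (induction k)
  case 0
  show ?case unfolding level_0 using d mn mono_XY by (intro tensor_dim_eq)
next
  case (Suc k)
  have "dual_refinement C d (T.H k) (T.V k) (X k) (Y k) (X (Suc k)) (Y (Suc k)) (s k) (max (m * 2 ^ k) (n * 2 ^ k))" for C
    using refinement_level bounded_HV dual_bipoly_level
    by (simp add: dual_refinement_def bounded_refinement_def dual_refinement_axioms_def bounded_refinement_axioms_def)
  from dim_refine_eq[OF this this Suc.IH] show ?case unfolding refine_H refine_V .
qed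

theorem dim_eq:
  "fun_space.dim (mesh_splines d (hierarchical_mesh M0 S k)) = fun_space.dim (cvr_splines (d - 2) (hierarchical_mesh M0 S k))"
  unfolding hierarchical_mesh T.mesh_splines_dim framed_tiling.cvr_splines_dim[OF frame] by (rule dim_level_eq)

end

section \<open>From sets of cells to index data\<close>

lemma strict_mono_extend:
  fixes u :: "nat \<Rightarrow> real"
  assumes "strict_mono_on {0..m} u"
  obtains v where "strict_mono v" "\<And>z. \<exists>i. z < v i" "\<And>i. i \<le> m \<Longrightarrow> v i = u i"
proof
  define v where "v i = (if i \<le> m then u i else u m + real (i - m))" for i
  show "v i = u i" if "i \<le> m" for i using that by (simp add: v_def)
  show "strict_mono v"
    unfolding strict_mono_Suc_iff
  proof
    fix i
    consider "Suc i \<le> m" | "i = m" | "m < i" by linarith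
    then show "v i < v (Suc i)"
    proof cases
      case 1
      then show ?thesis using strict_mono_onD[OF assms, of i "Suc i"] by (simp add: v_def)
    qed (simp_all add: v_def Suc_diff_le)
  qed
  show "\<exists>i. z < v i" for z
  proof -
    obtain i :: nat where "z - u m < real i" using reals_Archimedean2 by blast
    then have "z < v (m + Suc i)" by (simp add: v_def)
    then show ?thesis by blast
  qed
qed

lemma level_cells_cong: "(\<And>k. k < N \<Longrightarrow> S k = S' k) \<Longrightarrow> l \<le> N \<Longrightarrow> level_cells M0 S l = level_cells M0 S' l"
  by (cases l) auto

lemma hierarchical_mesh_cong:
  assumes "\<And>k. k < N \<Longrightarrow> S k = S' k" "l \<le> N"
  shows "hierarchical_mesh M0 S l = hierarchical_mesh M0 S' l"
proof -
  have "level_cells M0 S i - S i = level_cells M0 S' i - S' i" if "i < l" for i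
    using level_cells_cong[of N S S' i M0] assms that by simp
  moreover have "level_cells M0 S l = level_cells M0 S' l" using level_cells_cong[of N S S' l M0] assms by simp
  ultimately show ?thesis unfolding hierarchical_mesh_def by simp
qed

theorem theorem5p1:
  fixes d N :: nat and M0 :: mesh and S :: "nat \<Rightarrow> mesh"
  assumes "d \<ge> 2"
    and "tensor_product_mesh M0"
    and "\<forall>k<N. union_of_blocks (d - 1) (level_cells M0 S k) (S k)"
    and "\<forall>k<N. \<forall>K\<in>S k. interior_cell (hierarchical_mesh M0 S k) K"
  shows "fun_space.dim (mesh_splines d (hierarchical_mesh M0 S N)) =
         fun_space.dim (cvr_splines (d - 2) (hierarchical_mesh M0 S N))"
proof -
  obtain m n and u v :: "nat \<Rightarrow> real" where mn: "1 \<le> m" "1 \<le> n" and uv: "strict_mono_on {0..m} u" "strict_mono_on {0..n} v"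
    and M0: "M0 = {cbox (u i, v j) (u (Suc i), v (Suc j)) | i j. i < m \<and> j < n}"
    using assms(2) unfolding tensor_product_mesh_def tensor_grid_def by blast
  obtain x where x: "strict_mono x" "\<And>z. \<exists>i. z < x i" "\<And>i. i \<le> m \<Longrightarrow> x i = u i"
    using strict_mono_extend[OF uv(1)] by blast
  obtain y where y: "strict_mono y" "\<And>z. \<exists>j. z < y j" "\<And>j. j \<le> n \<Longrightarrow> y j = v j"
    using strict_mono_extend[OF uv(2)] by blast
  \<comment> \<open>Emptying the levels from \<open>N\<close> on makes the block condition hold at
    every level and does not change the mesh after \<open>N\<close> steps.\<close>
  define S' where "S' k = (if k < N then S k else {})" for k
  have SS': "S k = S' k" if "k < N" for k using that by (simp add: S'_def)
  interpret hierarchy d m n x y S'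
    by unfold_locales (use assms(1) mn x y in auto)
  have M0': "M0 = cell 0 ` A 0"
  proof -
    have "cell 0 ` A 0 = {cell 0 (i, j) | i j. i < m \<and> j < n}" by auto
    also have "\<dots> = M0"
    proof -
      have "cell 0 (i, j) = cbox (u i, v j) (u (Suc i), v (Suc j))" if "i < m" "j < n" for i j
        using that x(3) y(3) by (simp add: cell_def X_def Y_def)
      then show ?thesis unfolding M0 by metis
    qed
    finally show ?thesis by simp
  qed
  interpret hierarchical_splines d m n x y S'
  proof unfold_locales
    fix k
    show "union_of_blocks (d - 1) (level_cells (cell 0 ` A 0) S' k) (S' k)"
    proof (cases "k < N")
      case True
      then have "union_of_blocks (d - 1) (level_cells M0 S k) (S k)" using assms(3) by blast
      moreover have "level_cells M0 S k = level_cells M0 S' k" using True SS' by (intro level_cells_cong[of N]) auto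
      ultimately show ?thesis using SS'[OF True] unfolding M0'[symmetric] by simp
    next
      case False
      then show ?thesis unfolding union_of_blocks_def S'_def by (intro exI[of _ "{}"]) simp
    qed
  next
    fix K assume K: "K \<in> S' 0"
    then have "0 < N" by (auto simp: S'_def split: if_splits)
    then have "K \<in> S 0" using K by (simp add: S'_def)
    then have "interior_cell (hierarchical_mesh M0 S 0) K" using assms(4) \<open>0 < N\<close> by blast
    then show "interior_cell (hierarchical_mesh (cell 0 ` A 0) S' 0) K"
      unfolding M0'[symmetric] by (simp add: hierarchical_mesh_def)
  qed
  have "hierarchical_mesh M0 S N = hierarchical_mesh (cell 0 ` A 0) S' N"
    using hierarchical_mesh_cong[of N S S' N M0] SS' M0' by simp
  then show ?thesis using dim_eq[of N] by simp
qed


end
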